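(* Let $p>1$ and consider the Cauchy problem in $\mathbb{R}^{1+1}$ $$-\partial_t^2\phi+\partial_x^2\phi=|\phi|^{p-1}\phi,\qquad \phi(0,x)=\phi_0(x),\qquad \partial_t\phi(0,x)=\phi_1(x),$$ with finite energy data, that is, $$\mathcal{E}_0[\phi]=\int_{\mathbb{R}}\Big(|\partial_x\phi_0|^2+|\phi_1|^2+\frac{2}{p+1}|\phi_0|^{p+1}\Big)dx<+\infty .$$ Then the solution $\phi$ exists globally in time and satisfies $$\lim_{t\to\infty}\|\phi(t)\|_{L_x^{p+1}(\mathbb{R})}=0,\qquad \lim_{t\to\infty}\|\phi(t)\|_{L_x^{\infty}(\mathbb{R})}=0.$$
   Context: Functions are real-valued. For data $(\phi_0,\phi_1)$ with $\mathcal{E}_0[\phi]<\infty$, a solution is understood in the energy space: $\phi$ is a continuous function of $(t,x)$ with $\phi\in C_t L_x^{p+1}(\mathbb{R})$, $\partial_x\phi,\partial_t\phi\in C_tL_x^2(\mathbb{R})$, solving the equation in the sense of distributions and attaining the initial data at $t=0$; global in time means that it is defined for all $t\in\mathbb{R}$. *)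

theory Defs
  imports "HOL-Analysis.Analysis" "HOL-Probability.Essential_Supremum"
begin

section \<open>Test functions\<close>

definition partial_deriv :: "'a::euclidean_space \<Rightarrow> ('a \<Rightarrow> real) \<Rightarrow> 'a \<Rightarrow> real" where
  "partial_deriv b f z = frechet_derivative f (at z) b"

primrec Ck :: "nat \<Rightarrow> ('a::euclidean_space \<Rightarrow> real) \<Rightarrow> bool" where
  "Ck 0 f \<longleftrightarrow> continuous_on UNIV f"
| "Ck (Suc k) f \<longleftrightarrow> (\<forall>z. f differentiable (at z)) \<and> (\<forall>b\<in>Basis. Ck k (partial_deriv b f))"

definition test_function :: "('a::euclidean_space \<Rightarrow> real) \<Rightarrow> bool" where
  "test_function \<psi> \<longleftrightarrow> (\<forall>k. Ck k \<psi>) \<and> compact (closure {z. \<psi> z \<noteq> 0})"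

section \<open>Lebesgue spaces on the real line\<close>

definition in_Lq :: "real \<Rightarrow> (real \<Rightarrow> real) \<Rightarrow> bool" where
  "in_Lq q f \<longleftrightarrow> f \<in> borel_measurable lebesgue \<and> integrable lebesgue (\<lambda>x. \<bar>f x\<bar> powr q)"

definition Lq_norm :: "real \<Rightarrow> (real \<Rightarrow> real) \<Rightarrow> real" where
  "Lq_norm q f = (\<integral>x. \<bar>f x\<bar> powr q \<partial>lebesgue) powr (1 / q)"

definition Linf_norm :: "(real \<Rightarrow> real) \<Rightarrow> ereal" where
  "Linf_norm f = esssup lebesgue (\<lambda>x. ereal \<bar>f x\<bar>)"

definition Ct_Lq :: "real \<Rightarrow> (real \<Rightarrow> real \<Rightarrow> real) \<Rightarrow> bool" where
  "Ct_Lq q u \<longleftrightarrow> (\<forall>t. in_Lq q (u t)) \<and>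
     (\<forall>t0. ((\<lambda>t. Lq_norm q (\<lambda>x. u t x - u t0 x)) \<longlongrightarrow> 0) (at t0))"

section \<open>Weak derivatives and the energy of the data\<close>

definition weak_deriv :: "(real \<Rightarrow> real) \<Rightarrow> (real \<Rightarrow> real) \<Rightarrow> bool" where
  "weak_deriv f g \<longleftrightarrow>
     (\<forall>K. compact K \<longrightarrow> f absolutely_integrable_on K \<and> g absolutely_integrable_on K) \<and>
     (\<forall>\<psi>. test_function \<psi> \<longrightarrow>
        (\<integral>x. f x * deriv \<psi> x \<partial>lebesgue) = - (\<integral>x. g x * \<psi> x \<partial>lebesgue))"

text \<open>The argument \<open>d\<phi>0\<close> is the weak derivative of \<open>\<phi>0\<close>.\<close>

definition energy0 :: "real \<Rightarrow> (real \<Rightarrow> real) \<Rightarrow> (real \<Rightarrow> real) \<Rightarrow> (real \<Rightarrow> real) \<Rightarrow> ennreal" where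
  "energy0 p \<phi>0 d\<phi>0 \<phi>1 =
     (\<integral>\<^sup>+x. ennreal (\<bar>d\<phi>0 x\<bar>\<^sup>2 + \<bar>\<phi>1 x\<bar>\<^sup>2 + 2 / (p + 1) * \<bar>\<phi>0 x\<bar> powr (p + 1)) \<partial>lebesgue)"

definition finite_energy_data :: "real \<Rightarrow> (real \<Rightarrow> real) \<Rightarrow> (real \<Rightarrow> real) \<Rightarrow> bool" where
  "finite_energy_data p \<phi>0 \<phi>1 \<longleftrightarrow>
     \<phi>0 \<in> borel_measurable lebesgue \<and> \<phi>1 \<in> borel_measurable lebesgue \<and>
     (\<exists>d\<phi>0. weak_deriv \<phi>0 d\<phi>0 \<and> energy0 p \<phi>0 d\<phi>0 \<phi>1 < \<infinity>)"

section \<open>Energy solutions\<close>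

text \<open>Space-time functions are curried, time first; on test functions \<open>(1, 0)\<close> is the time
  direction and \<open>(0, 1)\<close> the space direction.

  Space-time pairings are iterated integrals. A function in \<open>C\<^sub>t L\<^sup>2\<close> is a continuous curve of
  equivalence classes, so a choice of representatives at each time need not be jointly measurable.
  Against a test function the inner integral is continuous and compactly supported in time, hence
  the iterated integral is always well defined and independent of the representatives.\<close>

definition pairing :: "(real \<Rightarrow> real \<Rightarrow> real) \<Rightarrow> (real \<times> real \<Rightarrow> real) \<Rightarrow> real" where
  "pairing u \<psi> = (\<integral>t. (\<integral>x. u t x * \<psi> (t, x) \<partial>lebesgue) \<partial>lebesgue)"

definition weak_partial ::
    "real \<times> real \<Rightarrow> (real \<Rightarrow> real \<Rightarrow> real) \<Rightarrow> (real \<Rightarrow> real \<Rightarrow> real) \<Rightarrow> bool" where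
  "weak_partial b u v \<longleftrightarrow>
     (\<forall>\<psi>. test_function \<psi> \<longrightarrow> pairing u (partial_deriv b \<psi>) = - pairing v \<psi>)"

definition nlw_distributional :: "real \<Rightarrow> (real \<Rightarrow> real \<Rightarrow> real) \<Rightarrow> bool" where
  "nlw_distributional p \<phi> \<longleftrightarrow>
     (\<forall>\<psi>. test_function \<psi> \<longrightarrow>
        pairing \<phi> (\<lambda>z. - partial_deriv (1, 0) (partial_deriv (1, 0) \<psi>) z
                        + partial_deriv (0, 1) (partial_deriv (0, 1) \<psi>) z)
        = pairing (\<lambda>t x. \<bar>\<phi> t x\<bar> powr (p - 1) * \<phi> t x) \<psi>)"

text \<open>The initial data are functions up to null sets. Among the weak time derivatives of \<open>\<phi>\<close>, the
  one in \<open>C\<^sub>t L\<^sup>2\<close> is determined, up to null sets, at every time, so its value at time \<open>0\<close>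
  makes sense.\<close>

definition global_energy_solution ::
    "real \<Rightarrow> (real \<Rightarrow> real) \<Rightarrow> (real \<Rightarrow> real) \<Rightarrow> (real \<Rightarrow> real \<Rightarrow> real) \<Rightarrow> bool" where
  "global_energy_solution p \<phi>0 \<phi>1 \<phi> \<longleftrightarrow>
     continuous_on UNIV (\<lambda>(t, x). \<phi> t x) \<and>
     Ct_Lq (p + 1) \<phi> \<and>
     (\<exists>\<phi>x. weak_partial (0, 1) \<phi> \<phi>x \<and> Ct_Lq 2 \<phi>x) \<and>
     (\<exists>\<phi>t. weak_partial (1, 0) \<phi> \<phi>t \<and> Ct_Lq 2 \<phi>t \<and> (AE x in lebesgue. \<phi>t 0 x = \<phi>1 x)) \<and>
     (AE x in lebesgue. \<phi> 0 x = \<phi>0 x) \<and>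
     nlw_distributional p \<phi>"

end

theory Submission
  imports Defs "HOL-Computational_Algebra.Polynomial"
begin

text \<open>
  In the coordinates \<open>u = t - x\<close>, \<open>v = t + x\<close> the equation reads \<open>\<Phi>\<^sub>u\<^sub>v = - f \<Phi> / 4\<close> with \<open>f = V'\<close>, and
  \<open>\<Phi>\<^sub>v\<^sup>2\<close> and \<open>\<Phi>\<^sub>u\<^sup>2\<close> obey exact flux identities in which \<open>V \<Phi> / 2\<close> is the flux density. Weighting these with
  \<open>v\<^sup>2 / (u + v)\<^sup>2\<close> and \<open>u\<^sup>2 / (u + v)\<^sup>2\<close> and using \<open>y f y = (p + 1) V y\<close> with \<open>p + 1 > 2\<close> shows that
  \<open>u v (u + v)\<^sup>-\<^sup>3 V \<Phi>\<close> is integrable over \<open>u, v \<ge> 1\<close>. Well inside the light cone at time \<open>T\<close> the weight is of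
  order \<open>1 / T\<close>, so for large \<open>T\<close> some characteristic line of length comparable to \<open>T\<close> carries
  little flux. Across such a line no energy is exchanged up to a small error, hence the energy that
  still moves towards the origin is small and with it the potential energy. The supremum decays
  because a function of finite energy is Hoelder continuous of exponent one half, so that a large
  value forces a large potential energy.

  Existence is a fixed point argument for the Duhamel formula. For uniqueness, the equation is tested
  against products \<open>\<eta> u * \<zeta> v\<close>; by the lemma of du Bois-Reymond every energy solution has the
  form \<open>\<alpha> u + \<beta> v\<close> plus its Duhamel integral, and the data determine \<open>\<alpha>\<close> and \<open>\<beta>\<close>.
\<close>

section \<open>Oriented integrals\<close>

text \<open>The obstacle is regularity: finite energy makes \<open>\<Phi>\<^sub>u\<close> and
  \<open>\<Phi>\<^sub>v\<close> merely square integrable. Still, the equation makes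
  \<open>\<Phi>\<^sub>v\<close> continuously differentiable in \<open>u\<close>, and
  \<open>\<Phi>\<close> is absolutely continuous in \<open>v\<close>. Each flux identity is split
  into two terms, one integrated along each direction, and so holds exactly for rough data.

  The two weighted identities supply the squared terms of
  \<open>(v \<Phi>\<^sub>v - u \<Phi>\<^sub>u)\<^sup>2\<close>, the square of the derivative along
  the Lorentz boost \<open>x \<partial>\<^sub>t + t \<partial>\<^sub>x\<close>. Each carries the
  potential with the wrong sign; the mixed term, rewritten by the equation, outweighs this.

  Integrability of the weighted potential alone does not make the flux at a given time small. What
  is used is a tail: the weighted mass at distances comparable to \<open>T\<close> tends to zero,
  and averaging over a range of lines of width of order \<open>T\<close> cancels the factor
  \<open>1 / T\<close> of the weight. The layer near the light cone, where the weight degenerates,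
  is made thin instead.\<close>

definition oint :: "real \<Rightarrow> real \<Rightarrow> (real \<Rightarrow> real) \<Rightarrow> real" where
  "oint a b g = (b - a) * integral {0..1} (\<lambda>s. g (a + s * (b - a)))"

lemma oint_antiderivative:
  assumes "\<And>x. (G has_real_derivative g x) (at x)"
  shows "oint a b g = G b - G a"
proof -
  have "((\<lambda>s. (b - a) * g (a + s * (b - a))) has_integral
          (G (a + 1 * (b - a)) - G (a + 0 * (b - a)))) {0..1}"
  proof (rule fundamental_theorem_of_calculus)
    fix s :: real
    have "((\<lambda>s. G (a + s * (b - a))) has_real_derivative g (a + s * (b - a)) * (b - a)) (at s)"
      by (rule DERIV_chain2[OF assms]) (auto intro!: derivative_eq_intros)
    then show "((\<lambda>s. G (a + s * (b - a))) has_vector_derivative (b - a) * g (a + s * (b - a))) (at s within {0..1})"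
      by (simp add: has_real_derivative_iff_has_vector_derivative[symmetric] mult.commute has_field_derivative_at_within)
  qed auto
  then have "integral {0..1} (\<lambda>s. (b - a) * g (a + s * (b - a))) = G (a + 1 * (b - a)) - G (a + 0 * (b - a))"
    by (rule integral_unique)
  then show ?thesis
    unfolding oint_def Henstock_Kurzweil_Integration.integral_mult_right by simp
qed

text \<open>An antiderivative on the whole line reduces the algebra of \<open>oint\<close> to
  telescoping increments, with no case distinction on the order of the endpoints.\<close>

lemma continuous_antiderivative:
  assumes "continuous_on UNIV (g :: real \<Rightarrow> real)"
  obtains G where "\<And>x. (G has_real_derivative g x) (at x)"
proof -
  have "\<exists>F. \<forall>x :: real. -\<infinity> < ereal x \<longrightarrow> ereal x < \<infinity> \<longrightarrow> (F has_vector_derivative g x) (at x)"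
    by (rule einterval_antiderivative) (use assms in \<open>auto simp: continuous_on_eq_continuous_at\<close>)
  then show ?thesis
    using that by (auto simp: has_real_derivative_iff_has_vector_derivative)
qed

lemma oint_same [simp]: "oint a a g = 0"
  by (simp add: oint_def)

lemma oint_swap: "continuous_on UNIV g \<Longrightarrow> oint b a g = - oint a b g"
  by (metis continuous_antiderivative oint_antiderivative minus_diff_eq)

lemma oint_combine: "continuous_on UNIV g \<Longrightarrow> oint a b g + oint b c g = oint a c g"
proof -
  assume "continuous_on UNIV g"
  then obtain G where "\<And>x. (G has_real_derivative g x) (at x)"
    using continuous_antiderivative by blast
  from oint_antiderivative[OF this] show ?thesis by simp
qed

lemma oint_diff:
  assumes "continuous_on UNIV g" "continuous_on UNIV h"
  shows "oint a b (\<lambda>s. g s - h s) = oint a b g - oint a b h"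
proof -
  obtain G where G: "\<And>x. (G has_real_derivative g x) (at x)"
    using continuous_antiderivative[OF assms(1)] by blast
  obtain H where H: "\<And>x. (H has_real_derivative h x) (at x)"
    using continuous_antiderivative[OF assms(2)] by blast
  have "((\<lambda>x. G x - H x) has_real_derivative g x - h x) (at x)" for x
    by (intro derivative_intros G H)
  from oint_antiderivative[OF this] show ?thesis
    by (simp add: oint_antiderivative[OF G] oint_antiderivative[OF H])
qed

lemma oint_minus: "oint a b (\<lambda>s. - g s) = - oint a b g"
  by (simp add: oint_def)

lemma oint_cmult: "oint a b (\<lambda>s. c * g s) = c * oint a b g"
  by (simp add: oint_def)

lemma oint_deriv:
  assumes "continuous_on UNIV g"
  shows "((\<lambda>x. oint a x g) has_real_derivative g x) (at x)"
proof -
  obtain G where G: "\<And>x. (G has_real_derivative g x) (at x)"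
    using continuous_antiderivative[OF assms] by blast
  show ?thesis
    by (simp add: oint_antiderivative[OF G]) (auto intro!: derivative_eq_intros G)
qed

lemma oint_affine:
  assumes "continuous_on UNIV g"
  shows "c * oint a b (\<lambda>s. g (d + c * s)) = oint (d + c * a) (d + c * b) g"
proof -
  obtain G where G: "\<And>x. (G has_real_derivative g x) (at x)"
    using continuous_antiderivative[OF assms] by blast
  have "((\<lambda>s. G (d + c * s)) has_real_derivative c * g (d + c * x)) (at x)" for x
    by (rule DERIV_cong[OF DERIV_chain2[OF G]]) (auto intro!: derivative_eq_intros)
  from oint_antiderivative[OF this] show ?thesis
    by (simp add: oint_antiderivative[OF G] oint_cmult)
qed

text \<open>The outer absolute value on the right allows \<open>b < a\<close>, where the oriented
  integral of the nonnegative majorant is not positive.\<close>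

lemma oint_bound:
  assumes "continuous_on UNIV g" "continuous_on UNIV k"
    and "\<And>s. s \<in> closed_segment a b \<Longrightarrow> \<bar>g s\<bar> \<le> k s"
  shows "\<bar>oint a b g\<bar> \<le> \<bar>oint a b k\<bar>"
proof -
  have seg: "a + s * (b - a) \<in> closed_segment a b" if "s \<in> {0..1}" for s
    using that by (auto simp: in_segment algebra_simps intro!: exI[of _ s])
  have "\<bar>integral {0..1} (\<lambda>s. g (a + s * (b - a)))\<bar> \<le> integral {0..1} (\<lambda>s. k (a + s * (b - a)))"
    unfolding real_norm_def[symmetric]
  proof (rule integral_norm_bound_integral)
    show "(\<lambda>s. g (a + s * (b - a))) integrable_on {0..1}"
      by (intro integrable_continuous_real continuous_on_compose2[OF assms(1)] continuous_intros) auto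
    show "(\<lambda>s. k (a + s * (b - a))) integrable_on {0..1}"
      by (intro integrable_continuous_real continuous_on_compose2[OF assms(2)] continuous_intros) auto
  qed (simp add: assms(3) seg)
  then show ?thesis
    unfolding oint_def abs_mult by (intro mult_left_mono) auto
qed

lemma oint_const: "oint a b (\<lambda>_. c) = c * (b - a)"
  by (simp add: oint_def)

text \<open>This is what the definition of \<open>oint\<close> over the unit interval is for: with
  the endpoints moved into the integrand, joint continuity is that of a parameter integral over a
  fixed compact interval. Duhamel integrals, whose limits depend on the point, rely on it.\<close>

lemma continuous_oint:
  fixes \<alpha> \<beta> :: "'a::topological_space \<Rightarrow> real"
  assumes "continuous_on UNIV \<alpha>" "continuous_on UNIV \<beta>" "continuous_on UNIV (\<lambda>(z, s). h z s)"
  shows "continuous_on UNIV (\<lambda>z. oint (\<alpha> z) (\<beta> z) (h z))"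
proof -
  have a: "continuous_on (UNIV \<times> cbox 0 1) (\<lambda>y. \<alpha> (fst y))"
    by (rule continuous_on_compose2[OF assms(1) continuous_on_fst[OF continuous_on_id]]) simp
  have b: "continuous_on (UNIV \<times> cbox 0 1) (\<lambda>y. \<beta> (fst y))"
    by (rule continuous_on_compose2[OF assms(2) continuous_on_fst[OF continuous_on_id]]) simp
  have "continuous_on (UNIV \<times> cbox 0 1) (\<lambda>y. (fst y, \<alpha> (fst y) + snd y * (\<beta> (fst y) - \<alpha> (fst y))))"
    by (intro continuous_intros a b)
  from continuous_on_compose2[OF assms(3) this subset_UNIV]
  have "continuous_on (UNIV \<times> cbox 0 1) (\<lambda>(z, s). h z (\<alpha> z + s * (\<beta> z - \<alpha> z)))"
    by (simp only: case_prod_unfold fst_conv snd_conv)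
  from integral_continuous_on_param[OF this]
  have "continuous_on UNIV (\<lambda>z. integral {0..1} (\<lambda>s. h z (\<alpha> z + s * (\<beta> z - \<alpha> z))))"
    by (simp only: cbox_interval)
  then show ?thesis
    unfolding oint_def by (intro continuous_intros assms(1,2))
qed

text \<open>The bridge between the two integrals in use: \<open>oint\<close> for continuous
  integrands with moving endpoints, the Lebesgue integral for square integrable ones.\<close>

lemma oint_eq_LBINT:
  assumes "continuous_on UNIV g" "a \<le> b"
  shows "(LBINT x:{a..b}. g x) = oint a b g"
proof -
  obtain G where G: "\<And>x. (G has_real_derivative g x) (at x)"
    using continuous_antiderivative[OF assms(1)] by blast
  have "set_integrable lborel {a..b} g"
    using assms(1) by (intro borel_integrable_atLeastAtMost') (auto intro: continuous_on_subset)
  then have "(LBINT x:{a..b}. g x) = integral {a..b} g"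
    by (rule set_borel_integral_eq_integral)
  also have "\<dots> = G b - G a"
    using G assms(2) by (intro integral_unique fundamental_theorem_of_calculus)
      (auto simp: has_real_derivative_iff_has_vector_derivative[symmetric] has_field_derivative_at_within)
  finally show ?thesis by (simp add: oint_antiderivative[OF G])
qed

section \<open>Square integrable functions and absolute continuity\<close>

lemma power_abs_add_le:
  fixes x y :: real
  shows "\<bar>x + y\<bar> ^ q \<le> 2 ^ q * (\<bar>x\<bar> ^ q + \<bar>y\<bar> ^ q)"
proof -
  have "\<bar>x + y\<bar> ^ q \<le> (2 * max \<bar>x\<bar> \<bar>y\<bar>) ^ q"
    by (intro power_mono) auto
  also have "\<dots> = 2 ^ q * (max \<bar>x\<bar> \<bar>y\<bar>) ^ q"
    by (simp add: power_mult_distrib)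
  also have "(max \<bar>x\<bar> \<bar>y\<bar>) ^ q \<le> \<bar>x\<bar> ^ q + \<bar>y\<bar> ^ q"
    by (simp add: max_def)
  finally show ?thesis by simp
qed

lemma integrable_power_abs_add:
  fixes f g :: "real \<Rightarrow> real"
  assumes "f \<in> borel_measurable borel" "g \<in> borel_measurable borel"
    and "integrable lborel (\<lambda>x. \<bar>f x\<bar> ^ q)" "integrable lborel (\<lambda>x. \<bar>g x\<bar> ^ q)"
  shows "integrable lborel (\<lambda>x. \<bar>f x + g x\<bar> ^ q)"
    and "(\<integral>x. \<bar>f x + g x\<bar> ^ q \<partial>lborel) \<le> 2 ^ q * ((\<integral>x. \<bar>f x\<bar> ^ q \<partial>lborel) + (\<integral>x. \<bar>g x\<bar> ^ q \<partial>lborel))"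
proof -
  have i: "integrable lborel (\<lambda>x. 2 ^ q * (\<bar>f x\<bar> ^ q + \<bar>g x\<bar> ^ q))"
    using assms by auto
  show 1: "integrable lborel (\<lambda>x. \<bar>f x + g x\<bar> ^ q)"
    by (rule Bochner_Integration.integrable_bound[OF i]) (use assms power_abs_add_le in auto)
  have "(\<integral>x. \<bar>f x + g x\<bar> ^ q \<partial>lborel) \<le> (\<integral>x. 2 ^ q * (\<bar>f x\<bar> ^ q + \<bar>g x\<bar> ^ q) \<partial>lborel)"
    by (intro integral_mono 1 i power_abs_add_le)
  then show "(\<integral>x. \<bar>f x + g x\<bar> ^ q \<partial>lborel) \<le> 2 ^ q * ((\<integral>x. \<bar>f x\<bar> ^ q \<partial>lborel) + (\<integral>x. \<bar>g x\<bar> ^ q \<partial>lborel))"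
    using assms by simp
qed

text \<open>Truncation in size and in range costs little by dominated convergence. A measurable
  function is an almost everywhere limit of continuous ones, and dominated convergence applies again
  once these are clipped. The case \<open>q = 1\<close> serves the chain rule, \<open>q = 2\<close>
  the continuity of translations.\<close>

lemma continuous_compact_support_dense:
  fixes f :: "real \<Rightarrow> real"
  assumes [measurable]: "f \<in> borel_measurable borel" and int: "integrable lborel (\<lambda>x. \<bar>f x\<bar> ^ q)"
    and q: "q > 0" and e: "e > 0"
  obtains g R where "continuous_on UNIV g" "\<And>x. R < \<bar>x\<bar> \<Longrightarrow> g x = 0"
    "integrable lborel (\<lambda>x. \<bar>f x - g x\<bar> ^ q)" "(\<integral>x. \<bar>f x - g x\<bar> ^ q \<partial>lborel) < e"
proof -
  define F where "F n x = (if \<bar>x\<bar> \<le> real n \<and> \<bar>f x\<bar> \<le> real n then f x else 0)" for n x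
  have [measurable]: "F n \<in> borel_measurable borel" for n
    unfolding F_def by measurable
  have F_le: "\<bar>f x - F n x\<bar> ^ q \<le> \<bar>f x\<bar> ^ q" for n x
    using q by (auto simp: F_def)
  have intF: "integrable lborel (\<lambda>x. \<bar>f x - F n x\<bar> ^ q)" for n
    by (rule Bochner_Integration.integrable_bound[OF int]) (use F_le in auto)
  have "(\<lambda>n. \<integral>x. \<bar>f x - F n x\<bar> ^ q \<partial>lborel) \<longlonglongrightarrow> (\<integral>x. 0 \<partial>(lborel :: real measure))"
  proof (rule integral_dominated_convergence[where w = "\<lambda>x. \<bar>f x\<bar> ^ q"])
    show "AE x in lborel. (\<lambda>n. \<bar>f x - F n x\<bar> ^ q) \<longlonglongrightarrow> 0"
    proof (rule AE_I2)
      fix x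
      obtain N :: nat where N: "max \<bar>x\<bar> \<bar>f x\<bar> \<le> real N" using real_arch_simple by blast
      have "\<forall>\<^sub>F n in sequentially. \<bar>f x - F n x\<bar> ^ q = 0"
        using eventually_ge_at_top[of N] by eventually_elim (use N q in \<open>auto simp: F_def\<close>)
      then show "(\<lambda>n. \<bar>f x - F n x\<bar> ^ q) \<longlonglongrightarrow> 0"
        by (rule tendsto_eventually)
    qed
  qed (use int F_le in auto)
  then have "(\<lambda>n. \<integral>x. \<bar>f x - F n x\<bar> ^ q \<partial>lborel) \<longlonglongrightarrow> 0" by simp
  then have "\<forall>\<^sub>F n in sequentially. (\<integral>x. \<bar>f x - F n x\<bar> ^ q \<partial>lborel) < e / (2 * 2 ^ q)"
    by (rule order_tendstoD) (use e in auto)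
  \<comment> \<open>The denominator anticipates the factor \<open>2 ^ q\<close> that is lost when
    the two errors are added by \<open>integrable_power_abs_add\<close>.\<close>
  then obtain n where n: "(\<integral>x. \<bar>f x - F n x\<bar> ^ q \<partial>lborel) < e / (2 * 2 ^ q)"
    by (auto simp: eventually_sequentially)
  have "F n \<in> borel_measurable lebesgue" using measurable_completion[of "F n" lborel borel] by simp
  then have "F n measurable_on UNIV"
    by (rule lebesgue_measurable_imp_measurable_on_real) simp
  then obtain N G where N: "negligible N" and G: "\<And>k. continuous_on UNIV (G k)"
    and lim: "\<And>x. x \<notin> N \<Longrightarrow> (\<lambda>k. G k x) \<longlonglongrightarrow> F n x"
    unfolding measurable_on_def by auto
  define c where "c = real n"
  have c0: "c \<ge> 0" by (simp add: c_def)
  \<comment> \<open>Clipping at \<open>c\<close> and the tent factor give all \<open>K k\<close> one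
    bound and one support, as dominated convergence requires. They do not alter the limit, because
    \<open>F n\<close> has modulus at most \<open>c\<close> and vanishes wherever the tent factor is
    below 1.\<close>
  define K where "K k x = max (- c) (min c (G k x)) * max 0 (min 1 (c + 1 - \<bar>x\<bar>))" for k x
  have contK: "continuous_on UNIV (K k)" for k
    unfolding K_def by (intro continuous_intros G)
  then have [measurable]: "K k \<in> borel_measurable borel" for k
    by (rule borel_measurable_continuous_onI)
  have Ksupp: "K k x = 0" if "c + 1 < \<bar>x\<bar>" for k x
    using that by (simp add: K_def max_def)
  have Kb: "\<bar>K k x\<bar> \<le> c" for k x
  proof -
    have "\<bar>max (- c) (min c (G k x))\<bar> * \<bar>max 0 (min 1 (c + 1 - \<bar>x\<bar>))\<bar> \<le> c * 1"
      by (intro mult_mono) (use c0 in auto)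
    then show ?thesis by (simp add: K_def abs_mult)
  qed
  have Fb: "\<bar>F n x\<bar> \<le> c" for x
    by (simp add: F_def c_def)
  have intc: "integrable lborel (\<lambda>x. (2 * c) ^ q * indicator {- (c+1)..c+1} x :: real)"
    by (auto simp: integrable_indicator_iff emeasure_lborel_Icc_eq)
  have dom: "\<bar>F n x - K k x\<bar> ^ q \<le> (2 * c) ^ q * indicator {- (c+1)..c+1} x" for x k
  proof (cases "\<bar>x\<bar> \<le> c + 1")
    case True
    have "\<bar>F n x - K k x\<bar> \<le> 2 * c" using Fb[of x] Kb[of k x] by linarith
    then have "\<bar>F n x - K k x\<bar> ^ q \<le> (2 * c) ^ q" by (intro power_mono) auto
    then show ?thesis using True by (auto simp: indicator_def)
  next
    case False
    then have "F n x = 0" "K k x = 0" using Ksupp[of x k] by (auto simp: F_def c_def)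
    then have "\<bar>F n x - K k x\<bar> ^ q = 0" using q by simp
    moreover have "(2 * c) ^ q * indicator {- (c+1)..c+1} x \<ge> 0" using c0 by (simp add: indicator_def)
    ultimately show ?thesis by linarith
  qed
  have intK: "integrable lborel (\<lambda>x. \<bar>F n x - K k x\<bar> ^ q)" for k
    by (rule Bochner_Integration.integrable_bound[OF intc]) (use dom c0 in \<open>auto simp: indicator_def\<close>)
  have "(\<lambda>k. \<integral>x. \<bar>F n x - K k x\<bar> ^ q \<partial>lborel) \<longlonglongrightarrow> (\<integral>x. 0 \<partial>(lborel :: real measure))"
  proof (rule integral_dominated_convergence[OF _ _ intc])
    have "AE x in lebesgue. x \<notin> N"
      using N by (intro AE_not_in) (simp add: negligible_iff_null_sets)
    then have "AE x in lborel. x \<notin> N" by (simp add: AE_completion_iff)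
    then show "AE x in lborel. (\<lambda>k. \<bar>F n x - K k x\<bar> ^ q) \<longlonglongrightarrow> 0"
    proof eventually_elim
      case (elim x)
      have "(\<lambda>k. K k x) \<longlonglongrightarrow> max (- c) (min c (F n x)) * max 0 (min 1 (c + 1 - \<bar>x\<bar>))"
        unfolding K_def by (intro tendsto_intros lim elim)
      also have "max (- c) (min c (F n x)) * max 0 (min 1 (c + 1 - \<bar>x\<bar>)) = F n x"
        using c0 by (auto simp: F_def c_def)
      finally have "(\<lambda>k. \<bar>F n x - K k x\<bar> ^ q) \<longlonglongrightarrow> \<bar>F n x - F n x\<bar> ^ q"
        by (intro tendsto_intros)
      moreover have "\<bar>F n x - F n x\<bar> ^ q = 0" using q by simp
      ultimately show ?case by metis
    qed
  qed (use dom in auto)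
  then have "(\<lambda>k. \<integral>x. \<bar>F n x - K k x\<bar> ^ q \<partial>lborel) \<longlonglongrightarrow> 0" by simp
  then have "\<forall>\<^sub>F k in sequentially. (\<integral>x. \<bar>F n x - K k x\<bar> ^ q \<partial>lborel) < e / (2 * 2 ^ q)"
    by (rule order_tendstoD) (use e in auto)
  then obtain k where k: "(\<integral>x. \<bar>F n x - K k x\<bar> ^ q \<partial>lborel) < e / (2 * 2 ^ q)"
    by (auto simp: eventually_sequentially)
  note A = integrable_power_abs_add[OF _ _ intF[of n] intK[of k]]
  show ?thesis
  proof (rule that[OF contK Ksupp])
    show "integrable lborel (\<lambda>x. \<bar>f x - K k x\<bar> ^ q)" using A(1) by simp
    have "2 ^ q * ((\<integral>x. \<bar>f x - F n x\<bar> ^ q \<partial>lborel) + (\<integral>x. \<bar>F n x - K k x\<bar> ^ q \<partial>lborel))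
        < 2 ^ q * (e / (2 * 2 ^ q) + e / (2 * 2 ^ q))"
      using n k by (intro mult_strict_left_mono add_strict_mono) auto
    also have "\<dots> = e" by simp
    finally show "(\<integral>x. \<bar>f x - K k x\<bar> ^ q \<partial>lborel) < e" using A(2) by simp
  qed
qed

text \<open>The standard density argument: \<open>f\<close> is exchanged for a uniformly continuous
  \<open>g\<close>, once before and once after the shift. It enters the continuity in time of the
  derivatives, whose profiles are translated as time passes.\<close>

lemma L2_translation_continuous:
  fixes f :: "real \<Rightarrow> real"
  assumes [measurable]: "f \<in> borel_measurable borel" and int: "integrable lborel (\<lambda>x. \<bar>f x\<bar> ^ 2)"
  shows "((\<lambda>h. \<integral>x. \<bar>f (x + h) - f x\<bar> ^ 2 \<partial>lborel) \<longlongrightarrow> 0) (at 0)"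
proof (rule tendstoI)
  fix e :: real assume e: "e > 0"
  obtain g R where g: "continuous_on UNIV g" and supp: "\<And>x. R < \<bar>x\<bar> \<Longrightarrow> g x = 0"
    and ig: "integrable lborel (\<lambda>x. \<bar>f x - g x\<bar> ^ 2)" and le: "(\<integral>x. \<bar>f x - g x\<bar> ^ 2 \<partial>lborel) < e / 64"
    using continuous_compact_support_dense[OF assms, of "e/64"] e by auto
  have [measurable]: "g \<in> borel_measurable borel" using g by (rule borel_measurable_continuous_onI)
  define S where "S = \<bar>R\<bar> + 1"
  have "compact {-S-1..S+1}" by simp
  then have "uniformly_continuous_on {-S-1..S+1} g"
    by (intro compact_uniformly_continuous continuous_on_subset[OF g]) auto
  \<comment> \<open>The middle term is supported in an interval of length \<open>2 * S + 2\<close>,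
    so it contributes at most \<open>d\<^sup>2 * (2 * S + 2) = e / 32\<close>. With the factors 4
    from the two splittings the three errors add up to \<open>52 / 64 * e\<close>.\<close>
  moreover define d where "d = sqrt (e / (32 * (2 * S + 2)))"
  moreover have "d > 0" using e by (auto simp: d_def S_def intro!: divide_pos_pos)
  ultimately obtain \<delta> where \<delta>: "\<delta> > 0" "\<And>x y. x \<in> {-S-1..S+1} \<Longrightarrow> y \<in> {-S-1..S+1} \<Longrightarrow> dist x y < \<delta> \<Longrightarrow> dist (g x) (g y) < d"
    unfolding uniformly_continuous_on_def by metis
  have main: "(\<integral>x. \<bar>f (x + h) - f x\<bar> ^ 2 \<partial>lborel) < e" if h: "\<bar>h\<bar> < min \<delta> 1" for h
  proof -
    let ?a = "\<lambda>x. f (x + h) - g (x + h)" and ?b = "\<lambda>x. g (x + h) - g x" and ?c = "\<lambda>x. g x - f x"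
    have ia: "integrable lborel (\<lambda>x. \<bar>?a x\<bar> ^ 2)" and va: "(\<integral>x. \<bar>?a x\<bar> ^ 2 \<partial>lborel) < e / 64"
      using ig le lborel_integrable_real_affine[OF ig, of 1 h] lborel_integral_real_affine[of 1 "\<lambda>x. \<bar>f x - g x\<bar> ^ 2" h]
      by (auto simp: add.commute)
    have ic: "integrable lborel (\<lambda>x. \<bar>?c x\<bar> ^ 2)" and vc: "(\<integral>x. \<bar>?c x\<bar> ^ 2 \<partial>lborel) < e / 64"
      using ig le by (simp_all add: abs_minus_commute)
    have pb: "\<bar>?b x\<bar> ^ 2 \<le> d ^ 2 * indicator {-S-1..S+1} x" for x
    proof (cases "\<bar>x\<bar> \<le> S")
      case True
      have "\<bar>?b x\<bar> \<le> d" using \<delta>(2)[of "x + h" x] True h by (force simp: dist_real_def)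
      then have "\<bar>?b x\<bar> ^ 2 \<le> d ^ 2" by (intro power_mono) auto
      then show ?thesis using True by (auto simp: indicator_def)
    next
      case False
      then have "R < \<bar>x\<bar>" "R < \<bar>x + h\<bar>" using h by (auto simp: S_def)
      then show ?thesis using supp by (simp add: indicator_def)
    qed
    have id: "integrable lborel (\<lambda>x. d ^ 2 * indicator {-S-1..S+1} x :: real)"
      by (auto simp: integrable_indicator_iff emeasure_lborel_Icc_eq)
    have ib: "integrable lborel (\<lambda>x. \<bar>?b x\<bar> ^ 2)"
      by (rule Bochner_Integration.integrable_bound[OF id]) (use pb in auto)
    have "(\<integral>x. \<bar>?b x\<bar> ^ 2 \<partial>lborel) \<le> (\<integral>x. d ^ 2 * indicator {-S-1..S+1} x \<partial>lborel)"
      by (rule integral_mono[OF ib id pb])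
    also have "\<dots> = d ^ 2 * (2 * S + 2)"
      by (simp add: S_def)
    also have "\<dots> = e / 32"
    proof -
      have "d ^ 2 = e / (32 * (2 * S + 2))" using e by (simp add: d_def S_def)
      moreover have "2 * S + 2 > 0" by (simp add: S_def)
      ultimately show ?thesis by (simp add: field_simps)
    qed
    finally have vb: "(\<integral>x. \<bar>?b x\<bar> ^ 2 \<partial>lborel) \<le> e / 32" .
    note bc = integrable_power_abs_add[OF _ _ ib ic]
    note abc = integrable_power_abs_add[OF _ _ ia bc(1)]
    have "(\<integral>x. \<bar>f (x + h) - f x\<bar> ^ 2 \<partial>lborel) = (\<integral>x. \<bar>?a x + (?b x + ?c x)\<bar> ^ 2 \<partial>lborel)"
      by (intro Bochner_Integration.integral_cong) auto
    also have "\<dots> \<le> 4 * (e / 64 + 4 * (e / 32 + e / 64))"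
      using abc(2) bc(2) va vb vc by simp
    also have "\<dots> < e" using e by simp
    finally show ?thesis .
  qed
  have "min \<delta> 1 > 0" using \<delta> by simp
  then show "\<forall>\<^sub>F h in at 0. dist (\<integral>x. \<bar>f (x + h) - f x\<bar> ^ 2 \<partial>lborel) 0 < e"
    unfolding eventually_at using main
    by (intro exI[of _ "min \<delta> 1"]) (auto simp: dist_real_def)
qed

text \<open>Product and chain rule for an absolutely continuous \<open>G\<close> whose density
  \<open>g\<close> is merely integrable. Approximating \<open>g\<close> in mean by continuous
  \<open>h n\<close> makes the primitives \<open>H n\<close> converge uniformly, so the fundamental
  theorem for \<open>A * W (H n)\<close> passes to the limit. The factor \<open>A\<close> is kept
  because the energy identities carry weights.\<close>

lemma AC_chain_rule:
  fixes g G A A' W W' :: "real \<Rightarrow> real"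
  assumes ab: "a \<le> b" and g: "set_integrable lborel {a..b} g"
    and G: "\<And>x. x \<in> {a..b} \<Longrightarrow> G x = G a + (LBINT y:{a..x}. g y)"
    and A: "\<And>x. x \<in> {a..b} \<Longrightarrow> (A has_real_derivative A' x) (at x within {a..b})"
    and A': "continuous_on {a..b} A'"
    and W: "\<And>y. (W has_real_derivative W' y) (at y)" and W': "continuous_on UNIV W'"
  shows "set_integrable lborel {a..b} (\<lambda>x. A' x * W (G x) + A x * W' (G x) * g x)" (is ?th1)
    and "(LBINT x:{a..b}. A' x * W (G x) + A x * W' (G x) * g x) = A b * W (G b) - A a * W (G a)" (is ?th2)
proof -
  define f where "f x = indicator {a..b} x * g x" for x
  have fi: "integrable lborel f"
    using g by (simp add: set_integrable_def f_def[abs_def])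
  then have [measurable]: "f \<in> borel_measurable borel" by auto
  have "\<exists>h. continuous_on UNIV h \<and> integrable lborel (\<lambda>x. \<bar>f x - h x\<bar> ^ 1) \<and> (\<integral>x. \<bar>f x - h x\<bar> ^ 1 \<partial>lborel) < inverse (Suc n)" for n
    by (rule continuous_compact_support_dense[of f 1 "inverse (Suc n)"]) (use fi in auto)
  then obtain h where h: "\<And>n. continuous_on UNIV (h n)" and hi: "\<And>n. integrable lborel (\<lambda>x. \<bar>f x - h n x\<bar>)"
    and hl: "\<And>n. (\<integral>x. \<bar>f x - h n x\<bar> \<partial>lborel) < inverse (Suc n)"
    by (simp del: of_nat_Suc) metis
  have [measurable]: "h n \<in> borel_measurable borel" for n using h by (rule borel_measurable_continuous_onI)
  define H where "H n x = G a + oint a x (h n)" for n x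
  have gi: "set_integrable lborel {a..x} g" if "x \<in> {a..b}" for x
    using g by (rule set_integrable_subset) (use that in auto)
  have hint: "set_integrable lborel {a..x} (h n)" for n x
    by (intro borel_integrable_atLeastAtMost' continuous_on_subset[OF h]) auto
  have L1: "\<bar>LBINT y:{a..x}. c y * (h n y - g y)\<bar> \<le> C * inverse (Suc n)"
    if x: "x \<in> {a..b}" and c: "\<And>y. y \<in> {a..b} \<Longrightarrow> \<bar>c y\<bar> \<le> C" and C: "C \<ge> 0" for x n c C
  proof -
    have "norm (LBINT y:{a..x}. c y * (h n y - g y)) \<le> (\<integral>y. norm (indicator {a..x} y *\<^sub>R (c y * (h n y - g y))) \<partial>lborel)"
      unfolding set_lebesgue_integral_def by (rule integral_norm_bound)
    also have "\<dots> \<le> (\<integral>y. C * \<bar>f y - h n y\<bar> \<partial>lborel)"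
    proof (rule integral_mono_AE')
      show "integrable lborel (\<lambda>y. C * \<bar>f y - h n y\<bar>)" using hi by simp
      show "AE y in lborel. norm (indicator {a..x} y *\<^sub>R (c y * (h n y - g y))) \<le> C * \<bar>f y - h n y\<bar>"
        using c C x by (intro AE_I2) (auto simp: indicator_def f_def abs_mult abs_minus_commute intro!: mult_mono)
    qed (use C in auto)
    also have "\<dots> \<le> C * inverse (Suc n)"
      using hl[of n] C by (simp add: mult_left_mono del: of_nat_Suc)
    finally show ?thesis by simp
  qed
  have HG: "\<bar>H n x - G x\<bar> \<le> inverse (Suc n)" if x: "x \<in> {a..b}" for n x
  proof -
    have "H n x - G x = (LBINT y:{a..x}. h n y) - (LBINT y:{a..x}. g y)"
      using x by (simp add: H_def G[OF x] oint_eq_LBINT[OF h])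
    also have "\<dots> = (LBINT y:{a..x}. h n y - g y)"
      using hint gi[OF x] by simp
    finally show ?thesis using L1[OF x, of "\<lambda>_. 1" 1 n] by simp
  qed
  have Hd: "(H n has_real_derivative h n x) (at x)" for n x
    unfolding H_def using oint_deriv[OF h[of n], of a x] by (auto intro!: derivative_eq_intros)
  have Hc: "continuous_on S (H n)" for n S
    using Hd by (meson DERIV_continuous_on has_field_derivative_at_within)
  have u: "uniform_limit {a..b} H G sequentially"
  proof (rule uniform_limitI)
    fix e :: real assume "e > 0"
    then obtain N where "inverse (Suc N) < e" using reals_Archimedean by blast
    then have "\<forall>n\<ge>N. \<forall>x\<in>{a..b}. dist (H n x) (G x) < e"
      using HG by (smt (verit, best) dist_real_def le_imp_inverse_le of_nat_0_less_iff of_nat_le_iff Suc_le_mono zero_less_Suc)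
    then show "\<forall>\<^sub>F n in sequentially. \<forall>x\<in>{a..b}. dist (H n x) (G x) < e"
      by (auto simp: eventually_sequentially)
  qed
  have Gc: "continuous_on {a..b} G"
    by (rule uniform_limit_theorem[OF _ u]) (auto simp: Hc)
  then have "bounded (G ` {a..b})"
    by (intro compact_imp_bounded compact_continuous_image) auto
  then obtain B where B: "\<And>x. x \<in> {a..b} \<Longrightarrow> \<bar>G x\<bar> \<le> B" unfolding bounded_iff by (metis image_eqI real_norm_def)
  \<comment> \<open>One unit of slack around the range of \<open>G\<close> confines all
    \<open>H n\<close> to one compact interval, on which \<open>W\<close> and \<open>W'\<close> have
    common bounds.\<close>
  have HB: "H n x \<in> {-(B+1)..B+1}" "G x \<in> {-(B+1)..B+1}" if "x \<in> {a..b}" for n x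
  proof -
    have "inverse (real (Suc n)) \<le> 1" by (simp add: field_simps)
    then show "H n x \<in> {-(B+1)..B+1}" "G x \<in> {-(B+1)..B+1}"
      using HG[OF that, of n] B[OF that] by (auto simp del: of_nat_Suc)
  qed
  have Wc: "continuous_on S W" for S
    using W by (meson DERIV_continuous_on has_field_derivative_at_within)
  have Ac: "continuous_on {a..b} A"
    using A by (rule DERIV_continuous_on)
  have bdd: "\<exists>C\<ge>0. \<forall>x\<in>K. \<bar>k x\<bar> \<le> C" if "continuous_on K k" "compact K" for K and k :: "real \<Rightarrow> real"
  proof -
    have "bounded (k ` K)" using that by (intro compact_imp_bounded compact_continuous_image)
    then show ?thesis unfolding bounded_iff by (metis abs_ge_zero image_eqI order_trans real_norm_def linear)
  qed
  obtain C1 where C1: "C1 \<ge> 0" "\<And>x. x \<in> {-(B+1)..B+1} \<Longrightarrow> \<bar>W x\<bar> \<le> C1"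
    using bdd[OF Wc compact_Icc] by metis
  obtain C2 where C2: "C2 \<ge> 0" "\<And>x. x \<in> {-(B+1)..B+1} \<Longrightarrow> \<bar>W' x\<bar> \<le> C2"
    using bdd[OF continuous_on_subset[OF W'] compact_Icc] by (metis subset_UNIV)
  obtain C3 where C3: "C3 \<ge> 0" "\<And>x. x \<in> {a..b} \<Longrightarrow> \<bar>A x\<bar> \<le> C3"
    using bdd[OF Ac compact_Icc] by metis
  obtain C4 where C4: "C4 \<ge> 0" "\<And>x. x \<in> {a..b} \<Longrightarrow> \<bar>A' x\<bar> \<le> C4"
    using bdd[OF A' compact_Icc] by metis
  define X where "X K x = A' x * W (K x) + A x * W' (K x) * g x" for K x
  have dom: "\<bar>indicator {a..b} x * X K x\<bar> \<le> indicator {a..b} x * (C4 * C1) + C3 * C2 * \<bar>f x\<bar>"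
    if "\<And>x. x \<in> {a..b} \<Longrightarrow> K x \<in> {-(B+1)..B+1}" for K x
  proof (cases "x \<in> {a..b}")
    case True
    have "\<bar>A' x * W (K x)\<bar> \<le> C4 * C1" "\<bar>A x * W' (K x) * g x\<bar> \<le> C3 * C2 * \<bar>g x\<bar>"
      unfolding abs_mult using C1 C2 C3 C4 that True by (auto intro!: mult_mono)
    then show ?thesis using True by (simp add: X_def f_def)
  next
    case False
    then show ?thesis using C2 C3 by simp
  qed
  have domi: "integrable lborel (\<lambda>x. indicator {a..b} x * (C4 * C1) + C3 * C2 * \<bar>f x\<bar>)"
    using fi by (auto intro!: Bochner_Integration.integrable_add integrable_mult_left integrable_real_indicator simp: emeasure_lborel_Icc_eq)
  have meas: "(\<lambda>x. indicator {a..b} x * X K x) \<in> borel_measurable borel" if "continuous_on {a..b} K" for K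
  proof -
    have "continuous_on {a..b} (\<lambda>x. A' x * W (K x))" "continuous_on {a..b} (\<lambda>x. A x * W' (K x))"
      by (auto intro!: continuous_intros A' Ac that continuous_on_compose2[OF Wc[of UNIV]] continuous_on_compose2[OF W'])
    then have [measurable]: "(\<lambda>x. indicator {a..b} x *\<^sub>R (A' x * W (K x))) \<in> borel_measurable borel"
       "(\<lambda>x. indicator {a..b} x *\<^sub>R (A x * W' (K x))) \<in> borel_measurable borel"
      by - (rule borel_measurable_continuous_on_indicator; simp)+
    have "(\<lambda>x. indicator {a..b} x *\<^sub>R (A' x * W (K x)) + (indicator {a..b} x *\<^sub>R (A x * W' (K x))) * f x) \<in> borel_measurable borel"
      by measurable
    also have "(\<lambda>x. indicator {a..b} x *\<^sub>R (A' x * W (K x)) + (indicator {a..b} x *\<^sub>R (A x * W' (K x))) * f x) = (\<lambda>x. indicator {a..b} x * X K x)"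
      by (auto simp: X_def f_def indicator_def fun_eq_iff)
    finally show ?thesis .
  qed
  have Xi: "integrable lborel (\<lambda>x. indicator {a..b} x * X K x)"
    if "\<And>x. x \<in> {a..b} \<Longrightarrow> K x \<in> {-(B+1)..B+1}" "continuous_on {a..b} K" for K
    by (rule Bochner_Integration.integrable_bound[OF domi]) (use meas[OF that(2)] order_trans[OF dom[OF that(1)] abs_ge_self] in auto)
  have lim1: "(\<lambda>n. LBINT x:{a..b}. X (H n) x) \<longlonglongrightarrow> (LBINT x:{a..b}. X G x)"
    unfolding set_lebesgue_integral_def real_scaleR_def
  proof (rule integral_dominated_convergence[OF _ _ domi])
    show "AE x in lborel. (\<lambda>n. indicator {a..b} x * X (H n) x) \<longlonglongrightarrow> indicator {a..b} x * X G x"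
    proof (rule AE_I2)
      fix x
      show "(\<lambda>n. indicator {a..b} x * X (H n) x) \<longlonglongrightarrow> indicator {a..b} x * X G x"
      proof (cases "x \<in> {a..b}")
        case True
        have l: "(\<lambda>n. H n x) \<longlonglongrightarrow> G x" using u True by (rule tendsto_uniform_limitI)
        have "isCont W (G x)" "isCont W' (G x)"
          using Wc[of UNIV] W' by (auto simp: continuous_on_eq_continuous_at)
        then show ?thesis unfolding X_def
          by (intro tendsto_intros isCont_tendsto_compose[of _ W] isCont_tendsto_compose[of _ W'] l)
      qed simp
    qed
  qed (use meas Gc Hc dom HB in auto)
  \<comment> \<open>The density of \<open>H n\<close> is \<open>h n\<close>, not \<open>g\<close>.
    The error of exchanging them is a uniformly bounded function times \<open>h n - g\<close>, which
    vanishes in mean.\<close>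
  have lim2: "(\<lambda>n. LBINT x:{a..b}. A x * W' (H n x) * (h n x - g x)) \<longlonglongrightarrow> 0"
  proof (rule Lim_null_comparison)
    show "\<forall>\<^sub>F n in sequentially. norm (LBINT x:{a..b}. A x * W' (H n x) * (h n x - g x)) \<le> C3 * C2 * inverse (Suc n)"
    proof (rule always_eventually, rule allI)
      fix n
      show "norm (LBINT x:{a..b}. A x * W' (H n x) * (h n x - g x)) \<le> C3 * C2 * inverse (Suc n)"
        unfolding real_norm_def
        by (rule L1) (use ab C2 C3 HB in \<open>auto simp: abs_mult intro!: mult_mono\<close>)
    qed
    show "(\<lambda>n. C3 * C2 * inverse (real (Suc n))) \<longlonglongrightarrow> 0"
      using tendsto_mult_right_zero[OF LIMSEQ_inverse_real_of_nat] by blast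
  qed
  have id: "(LBINT x:{a..b}. X (H n) x) + (LBINT x:{a..b}. A x * W' (H n x) * (h n x - g x))
      = A b * W (H n b) - A a * W (H n a)" for n
  proof -
    have AWc: "continuous_on {a..b} (\<lambda>x. A x * W' (H n x))"
      by (intro continuous_intros Ac continuous_on_compose2[OF W' Hc]) auto
    have Yc: "continuous_on {a..b} (\<lambda>x. A' x * W (H n x) + A x * W' (H n x) * h n x)"
      by (intro continuous_intros A' AWc continuous_on_compose2[OF Wc Hc] continuous_on_subset[OF h]) auto
    have Yi: "set_integrable lborel {a..b} (\<lambda>x. A' x * W (H n x) + A x * W' (H n x) * h n x)"
      by (rule borel_integrable_atLeastAtMost'[OF Yc])
    have Xs: "set_integrable lborel {a..b} (X (H n))"
      using Xi[OF HB(1) Hc] by (simp add: set_integrable_def)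
    have "set_integrable lborel {a..b} (\<lambda>x. (A' x * W (H n x) + A x * W' (H n x) * h n x) - X (H n) x)"
      using Yi Xs by (rule set_integral_diff(1))
    then have Zs: "set_integrable lborel {a..b} (\<lambda>x. A x * W' (H n x) * (h n x - g x))"
      by (simp add: X_def algebra_simps)
    have "(LBINT x:{a..b}. X (H n) x) + (LBINT x:{a..b}. A x * W' (H n x) * (h n x - g x))
       = (LBINT x:{a..b}. X (H n) x + A x * W' (H n x) * (h n x - g x))"
      using set_integral_add(2)[OF Xs Zs] by simp
    also have "\<dots> = (LBINT x:{a..b}. A' x * W (H n x) + A x * W' (H n x) * h n x)"
      by (simp add: X_def algebra_simps)
    also have "\<dots> = integral {a..b} (\<lambda>x. A' x * W (H n x) + A x * W' (H n x) * h n x)"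
      by (rule set_borel_integral_eq_integral(2)[OF Yi])
    also have "\<dots> = A b * W (H n b) - A a * W (H n a)"
    proof (rule integral_unique, rule fundamental_theorem_of_calculus[OF ab])
      fix x assume x: "x \<in> {a..b}"
      have "((\<lambda>x. W (H n x)) has_real_derivative W' (H n x) * h n x) (at x within {a..b})"
        by (rule has_field_derivative_at_within[OF DERIV_chain2[OF W Hd]])
      from DERIV_mult[OF A[OF x] this]
      show "((\<lambda>x. A x * W (H n x)) has_vector_derivative A' x * W (H n x) + A x * W' (H n x) * h n x) (at x within {a..b})"
        by (simp add: has_real_derivative_iff_has_vector_derivative algebra_simps)
    qed
    finally show ?thesis .
  qed
  have "(\<lambda>n. H n x) \<longlonglongrightarrow> G x" if "x \<in> {a..b}" for x using u that by (rule tendsto_uniform_limitI)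
  then have "(\<lambda>n. A b * W (H n b) - A a * W (H n a)) \<longlonglongrightarrow> A b * W (G b) - A a * W (G a)"
    using ab Wc[of UNIV]
    by (intro tendsto_intros isCont_tendsto_compose[of _ W]) (auto simp: continuous_on_eq_continuous_at)
  moreover have "(\<lambda>n. A b * W (H n b) - A a * W (H n a)) \<longlonglongrightarrow> (LBINT x:{a..b}. X G x) + 0"
    unfolding id[symmetric] by (intro tendsto_add lim1 lim2)
  ultimately show ?th2
    unfolding X_def using LIMSEQ_unique by fastforce
  show ?th1
    using Xi[OF HB(2) Gc] by (simp add: set_integrable_def X_def)
qed

section \<open>Characteristic coordinates and energy identities\<close>

lemma LBINT_FTC:
  fixes F F' :: "real \<Rightarrow> real"
  assumes "a \<le> b" "\<And>x. x \<in> {a..b} \<Longrightarrow> (F has_real_derivative F' x) (at x within {a..b})"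
    and "continuous_on {a..b} F'"
  shows "(LBINT x:{a..b}. F' x) = F b - F a"
proof -
  have "set_integrable lborel {a..b} F'"
    by (rule borel_integrable_atLeastAtMost'[OF assms(3)])
  then have "(LBINT x:{a..b}. F' x) = integral {a..b} F'"
    by (rule set_borel_integral_eq_integral)
  also have "\<dots> = F b - F a"
    using assms by (intro integral_unique fundamental_theorem_of_calculus)
      (auto simp: has_real_derivative_iff_has_vector_derivative[symmetric])
  finally show ?thesis .
qed

lemma LBINT_nonneg: "(\<And>x. x \<in> S \<Longrightarrow> 0 \<le> g x) \<Longrightarrow> 0 \<le> (LBINT x:S. (g x :: real))"
  unfolding set_lebesgue_integral_def by (intro Bochner_Integration.integral_nonneg) (auto simp: indicator_def)

lemma set_integrable_continuous_mult:
  fixes g h :: "'a::euclidean_space \<Rightarrow> real"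
  assumes "set_integrable lborel S g" "continuous_on S h" "compact S"
  shows "set_integrable lborel S (\<lambda>x. h x * g x)"
proof -
  have "bounded (h ` S)" using assms by (intro compact_imp_bounded compact_continuous_image)
  then obtain C where C: "\<And>x. x \<in> S \<Longrightarrow> \<bar>h x\<bar> \<le> C"
    unfolding bounded_iff by (metis image_eqI real_norm_def)
  have S: "S \<in> sets borel" using assms(3) by (rule borel_compact)
  have m: "(\<lambda>x. indicator S x *\<^sub>R h x) \<in> borel_measurable borel"
    by (rule borel_measurable_continuous_on_indicator[OF S assms(2)])
  have i: "integrable lborel (\<lambda>x. indicator S x *\<^sub>R g x)"
    using assms(1) by (simp add: set_integrable_def)
  show ?thesis
    unfolding set_integrable_def
  proof (rule Bochner_Integration.integrable_bound)
    show "integrable lborel (\<lambda>x. C * (indicator S x *\<^sub>R g x))" using i by simp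
    have "(\<lambda>x. (indicator S x *\<^sub>R h x) * (indicator S x *\<^sub>R g x)) \<in> borel_measurable borel"
      using m i by (intro borel_measurable_times) auto
    also have "(\<lambda>x. (indicator S x *\<^sub>R h x) * (indicator S x *\<^sub>R g x)) = (\<lambda>x. indicator S x *\<^sub>R (h x * g x))"
      by (auto simp: indicator_def)
    finally show "(\<lambda>x. indicator S x *\<^sub>R (h x * g x)) \<in> borel_measurable lborel" by simp
    show "AE x in lborel. norm (indicator S x *\<^sub>R (h x * g x)) \<le> norm (C * (indicator S x *\<^sub>R g x))"
    proof (rule AE_I2)
      fix x
      show "norm (indicator S x *\<^sub>R (h x * g x)) \<le> norm (C * (indicator S x *\<^sub>R g x))"
        using C[of x] by (cases "x \<in> S") (auto simp: abs_mult intro!: mult_right_mono)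
    qed
  qed
qed

lemma set_integrable_from_square:
  fixes g :: "'a::euclidean_space \<Rightarrow> real"
  assumes "set_integrable lborel S (\<lambda>x. (g x)\<^sup>2)" "g \<in> borel_measurable borel" "compact S"
  shows "set_integrable lborel S g"
proof -
  have S: "S \<in> sets borel" using assms(3) by (rule borel_compact)
  have "set_integrable lborel S (\<lambda>x. 1 :: real)"
    unfolding set_integrable_def using assms(3)
    by (auto intro!: integrable_real_indicator emeasure_compact_finite S)
  from set_integral_add(1)[OF this assms(1)]
  have i: "set_integrable lborel S (\<lambda>x. 1 + (g x)\<^sup>2)" .
  show ?thesis
    unfolding set_integrable_def
  proof (rule Bochner_Integration.integrable_bound[OF i[unfolded set_integrable_def]])
    show "(\<lambda>x. indicator S x *\<^sub>R g x) \<in> borel_measurable lborel"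
      using assms(2) S by measurable
    have "\<bar>y\<bar> \<le> 1 + y\<^sup>2" for y :: real
    proof -
      have "0 \<le> (\<bar>y\<bar> - 1)\<^sup>2" by simp
      then have "2 * \<bar>y\<bar> \<le> 1 + y\<^sup>2" by (simp add: power2_diff)
      then show ?thesis by linarith
    qed
    then show "AE x in lborel. norm (indicator S x *\<^sub>R g x) \<le> norm (indicator S x *\<^sub>R (1 + (g x)\<^sup>2))"
      by (intro AE_I2) (auto simp: indicator_def)
  qed
qed

text \<open>Fubini in both orders over the part of a rectangle beyond the curve
  \<open>u = k v\<close>, which \<open>l\<close> describes as a graph over \<open>u\<close>.
  Constant \<open>k\<close> gives rectangles, and \<open>k v = 2 * t - v\<close> gives regions above
  a time slice.\<close>

lemma box_region_integral:
  fixes Y :: "real \<times> real \<Rightarrow> real"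
  assumes D: "D = {(u, v). u0 \<le> u \<and> u \<le> u1 \<and> v0 \<le> v \<and> v \<le> v1 \<and> k v \<le> u}"
    and i: "set_integrable lborel D Y"
    and k: "\<And>v. v \<in> {v0..v1} \<Longrightarrow> u0 \<le> k v"
    and kl: "\<And>u v. u \<in> {u0..u1} \<Longrightarrow> v \<in> {v0..v1} \<Longrightarrow> k v \<le> u \<longleftrightarrow> l u \<le> v"
    and l: "\<And>u. u \<in> {u0..u1} \<Longrightarrow> v0 \<le> l u"
  shows "(LBINT z:D. Y z) = (LBINT v:{v0..v1}. LBINT u:{k v..u1}. Y (u, v))"
    and "(LBINT z:D. Y z) = (LBINT u:{u0..u1}. LBINT v:{l u..v1}. Y (u, v))"
proof -
  let ?Z = "\<lambda>u v. indicator D (u, v) * Y (u, v)"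
  have i': "integrable (lborel \<Otimes>\<^sub>M lborel) (case_prod ?Z)"
    using i by (simp add: set_integrable_def lborel_prod case_prod_unfold)
  have e: "(LBINT z:D. Y z) = integral\<^sup>L (lborel \<Otimes>\<^sub>M lborel) (case_prod ?Z)"
    by (simp add: set_lebesgue_integral_def lborel_prod case_prod_unfold)
  have "(\<integral>v. (\<integral>u. ?Z u v \<partial>lborel) \<partial>lborel) = (LBINT v:{v0..v1}. LBINT u:{k v..u1}. Y (u, v))"
    unfolding set_lebesgue_integral_def
  proof (intro Bochner_Integration.integral_cong refl)
    fix v
    have "?Z u v = indicator {v0..v1} v * (indicator {k v..u1} u * Y (u, v))" for u
      using k[of v] by (auto simp: D indicator_def)
    then show "(\<integral>u. ?Z u v \<partial>lborel) = indicator {v0..v1} v *\<^sub>R (\<integral>u. indicator {k v..u1} u *\<^sub>R Y (u, v) \<partial>lborel)"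
      by (simp only: real_scaleR_def integral_mult_right_zero)
  qed
  then show "(LBINT z:D. Y z) = (LBINT v:{v0..v1}. LBINT u:{k v..u1}. Y (u, v))"
    unfolding e using lborel_pair.integral_snd[OF i'] by (simp add: case_prod_unfold)
  have "(\<integral>u. (\<integral>v. ?Z u v \<partial>lborel) \<partial>lborel) = (LBINT u:{u0..u1}. LBINT v:{l u..v1}. Y (u, v))"
    unfolding set_lebesgue_integral_def
  proof (intro Bochner_Integration.integral_cong refl)
    fix u
    have "?Z u v = indicator {u0..u1} u * (indicator {l u..v1} v * Y (u, v))" for v
      using l[of u] kl[of u v] by (auto simp: D indicator_def)
    then show "(\<integral>v. ?Z u v \<partial>lborel) = indicator {u0..u1} u *\<^sub>R (\<integral>v. indicator {l u..v1} v *\<^sub>R Y (u, v) \<partial>lborel)"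
      by (simp only: real_scaleR_def integral_mult_right_zero)
  qed
  then show "(LBINT z:D. Y z) = (LBINT u:{u0..u1}. LBINT v:{l u..v1}. Y (u, v))"
    unfolding e using lborel_pair.integral_fst[OF i'] by (simp add: case_prod_unfold)
qed

lemma LBINT_combine:
  fixes g :: "real \<Rightarrow> real"
  assumes "a \<le> b" "b \<le> c" "set_integrable lborel {a..c} g"
  shows "(LBINT x:{a..b}. g x) + (LBINT x:{b..c}. g x) = (LBINT x:{a..c}. g x)"
proof -
  have i: "set_integrable lborel {a..b} g" "set_integrable lborel {b..c} g"
    using assms by (auto intro: set_integrable_subset)
  have "(LBINT x:{a..c}. g x) = (LBINT x:{a..b} \<union> {b..c}. g x)"
    using assms by (simp add: ivl_disj_un)
  also have "\<dots> = (LBINT x:{a..b}. g x) + (LBINT x:{b..c}. g x)"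
  proof (rule set_integral_Un_AE)
    show "AE x in lborel. \<not> (x \<in> {a..b} \<and> x \<in> {b..c})"
      using AE_lborel_singleton[of b] by eventually_elim auto
  qed (use i in auto)
  finally show ?thesis by simp
qed

text \<open>\<open>Pd f \<Phi> p\<close> is the derivative \<open>\<Phi>\<^sub>v\<close> of a solution of \<open>\<Phi>\<^sub>u\<^sub>v = - f \<Phi> / 4\<close> whose value on the
  line \<open>u = 0\<close> is \<open>p\<close>. It is an honest function, jointly measurable and differentiable in \<open>u\<close>, so
  that only the square integrable profile \<open>p\<close> lacks regularity. The other derivative is obtained by
  exchanging the two coordinates.\<close>

definition Pd :: "(real \<Rightarrow> real) \<Rightarrow> (real \<Rightarrow> real \<Rightarrow> real) \<Rightarrow> (real \<Rightarrow> real) \<Rightarrow> real \<Rightarrow> real \<Rightarrow> real" where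
  "Pd f \<Phi> p u v = p v - oint 0 u (\<lambda>s. f (\<Phi> s v)) / 4"

text \<open>Only the increments of \<open>\<Phi>\<close> along the two coordinate directions are
  prescribed, in keeping with the regularity of the data. The assumptions are symmetric under
  exchanging \<open>u\<close> with \<open>v\<close> and \<open>p\<close> with \<open>q\<close>, so
  each statement about \<open>P\<close> yields one about \<open>Q\<close>. \<open>f\<close> and
  \<open>V\<close> stay general in order to cover the truncated equation as well.\<close>

locale charsol =
  fixes f V :: "real \<Rightarrow> real" and \<Phi> :: "real \<Rightarrow> real \<Rightarrow> real" and p q :: "real \<Rightarrow> real"
  assumes f_cont: "continuous_on UNIV f"
    and V_deriv: "\<And>y. (V has_real_derivative f y) (at y)"
    and V_nonneg: "\<And>y. 0 \<le> V y"
    and Phi_cont: "continuous_on UNIV (\<lambda>(u, v). \<Phi> u v)"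
    and p_meas [measurable]: "p \<in> borel_measurable borel"
    and q_meas [measurable]: "q \<in> borel_measurable borel"
    and p_sq: "\<And>a b. set_integrable lborel {a..b} (\<lambda>x. (p x)\<^sup>2)"
    and q_sq: "\<And>a b. set_integrable lborel {a..b} (\<lambda>x. (q x)\<^sup>2)"
    and Phi_v: "\<And>u v1 v2. v1 \<le> v2 \<Longrightarrow> \<Phi> u v2 - \<Phi> u v1 = (LBINT y:{v1..v2}. Pd f \<Phi> p u y)"
    and Phi_u: "\<And>v u1 u2. u1 \<le> u2 \<Longrightarrow> \<Phi> u2 v - \<Phi> u1 v = (LBINT y:{u1..u2}. Pd f (\<lambda>u v. \<Phi> v u) q v y)"
begin

abbreviation P where "P \<equiv> Pd f \<Phi> p"
abbreviation Q where "Q \<equiv> \<lambda>u v. Pd f (\<lambda>u v. \<Phi> v u) q v u"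

lemma Phi_cont': "continuous_on S a \<Longrightarrow> continuous_on S b \<Longrightarrow> continuous_on S (\<lambda>z. \<Phi> (a z) (b z))"
  using continuous_on_compose2[OF Phi_cont, of S "\<lambda>z. (a z, b z)"] by (simp add: continuous_on_Pair)

lemma f_Phi_cont: "continuous_on S a \<Longrightarrow> continuous_on S b \<Longrightarrow> continuous_on S (\<lambda>z. f (\<Phi> (a z) (b z)))"
  using continuous_on_compose2[OF f_cont _ subset_UNIV, of S "\<lambda>z. \<Phi> (a z) (b z)"] Phi_cont'[of S a b]
  by blast

lemma V_cont: "continuous_on S V"
  by (rule DERIV_continuous_on[OF has_field_derivative_at_within[OF V_deriv]])

lemma V_Phi_cont: "continuous_on S a \<Longrightarrow> continuous_on S b \<Longrightarrow> continuous_on S (\<lambda>z. V (\<Phi> (a z) (b z)))"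
  using continuous_on_compose2[OF V_cont[of UNIV] _ subset_UNIV, of S "\<lambda>z. \<Phi> (a z) (b z)"] Phi_cont'[of S a b]
  by blast

lemma P_corr_cont:
  fixes a b :: "'z::topological_space \<Rightarrow> real"
  assumes "continuous_on UNIV a" "continuous_on UNIV b"
  shows "continuous_on UNIV (\<lambda>z. oint 0 (a z) (\<lambda>s. f (\<Phi> s (b z))))"
proof -
  have "continuous_on UNIV (\<lambda>y::'z \<times> real. b (fst y))"
    by (rule continuous_on_compose2[OF assms(2) continuous_on_fst[OF continuous_on_id]]) simp
  then have "continuous_on UNIV (\<lambda>y::'z \<times> real. f (\<Phi> (snd y) (b (fst y))))"
    by (intro f_Phi_cont continuous_intros)
  then show ?thesis
    by (intro continuous_oint assms continuous_on_const) (simp add: case_prod_unfold)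
qed

lemma P_deriv: "((\<lambda>u. P u v) has_real_derivative - f (\<Phi> u v) / 4) (at u within S)"
proof -
  have "((\<lambda>x. oint 0 x (\<lambda>s. f (\<Phi> s v))) has_real_derivative f (\<Phi> u v)) (at u within S)"
    by (rule has_field_derivative_at_within, rule oint_deriv) (intro f_Phi_cont continuous_intros)
  then show ?thesis
    unfolding Pd_def by (auto intro!: derivative_eq_intros)
qed

lemma P_cont: "continuous_on S (\<lambda>u. P u v)"
  using P_deriv by (rule DERIV_continuous_on)

lemma P_meas: "(\<lambda>z. P (fst z) (snd z)) \<in> borel_measurable borel"
proof -
  have [measurable]: "(\<lambda>z::real \<times> real. oint 0 (fst z) (\<lambda>s. f (\<Phi> s (snd z)))) \<in> borel_measurable borel"
    by (intro borel_measurable_continuous_onI P_corr_cont continuous_intros)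
  have [measurable]: "(\<lambda>z::real \<times> real. p (snd z)) \<in> borel_measurable borel"
    by (rule measurable_compose[OF _ p_meas]) (intro borel_measurable_continuous_onI continuous_intros)
  show ?thesis unfolding Pd_def by measurable
qed

lemma P_meas': "k \<in> borel_measurable borel \<Longrightarrow> m \<in> borel_measurable borel \<Longrightarrow> (\<lambda>v::real. P (k v) (m v)) \<in> borel_measurable borel"
  using measurable_compose[OF borel_measurable_Pair P_meas, of k borel m] by simp

text \<open>The term subtracted from \<open>p\<close> is continuous along any curve
  \<open>u = k v\<close>, so after expanding the square only \<open>p\<close> and its square have to
  be integrable. Time slices are the curves of interest.\<close>

lemma P_sq_line:
  assumes "continuous_on UNIV k"
  shows "set_integrable lborel {a..b} (\<lambda>v. (P (k v) v)\<^sup>2)"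
proof -
  let ?c = "\<lambda>v. oint 0 (k v) (\<lambda>s. f (\<Phi> s v))"
  have c: "continuous_on UNIV ?c" by (intro P_corr_cont assms continuous_intros)
  have p1: "set_integrable lborel {a..b} p"
    by (rule set_integrable_from_square[OF p_sq p_meas]) simp
  have "set_integrable lborel {a..b} (\<lambda>v. (p v)\<^sup>2 - (?c v / 2) * p v + (?c v / 4)\<^sup>2)"
    by (intro set_integral_add set_integral_diff p_sq set_integrable_continuous_mult[OF p1]
        borel_integrable_atLeastAtMost') (auto intro!: continuous_intros continuous_on_subset[OF c])
  then show ?thesis
    by (simp add: Pd_def power2_diff field_simps)
qed

lemma P_line: "set_integrable lborel {a..b} (\<lambda>v. P u v)"
  by (rule set_integrable_from_square[OF P_sq_line]) (auto intro!: P_meas' continuous_intros)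

lemma P_sq_box: "set_integrable lborel ({a..b} \<times> {c..d}) (\<lambda>z. (P (fst z) (snd z))\<^sup>2)"
proof -
  let ?B = "{a..b} \<times> {c..d}"
  let ?c = "\<lambda>z. oint 0 (fst z) (\<lambda>s. f (\<Phi> s (snd z)))"
  have cB: "compact ?B" by (intro compact_Times compact_Icc)
  have c: "continuous_on UNIV ?c" by (intro P_corr_cont continuous_intros)
  have m: "(\<lambda>z::real \<times> real. p (snd z)) \<in> borel_measurable borel"
    by (rule measurable_compose[OF _ p_meas]) (intro borel_measurable_continuous_onI continuous_intros)
  have p2: "set_integrable lborel ?B (\<lambda>z. (p (snd z))\<^sup>2)"
    unfolding set_integrable_def
  proof -
    have "integrable (lborel \<Otimes>\<^sub>M lborel) (\<lambda>z. indicator {a..b} (fst z) * (indicator {c..d} (snd z) * (p (snd z))\<^sup>2))"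
    proof (rule lborel_pair.Fubini_integrable)
      show "integrable lborel (\<lambda>x. \<integral>y. norm (indicator {a..b} (fst (x, y)) * (indicator {c..d} (snd (x, y)) * (p (snd (x, y)))\<^sup>2)) \<partial>lborel)"
        by (simp add: abs_mult integrable_mult_left integrable_real_indicator emeasure_lborel_Icc_eq)
      show "AE x in lborel. integrable lborel (\<lambda>y. indicator {a..b} (fst (x, y)) * (indicator {c..d} (snd (x, y)) * (p (snd (x, y)))\<^sup>2))"
        using p_sq[of c d] by (simp add: set_integrable_def)
    qed measurable
    then show "integrable lborel (\<lambda>z. indicator ?B z *\<^sub>R (p (snd z))\<^sup>2)"
      by (simp add: lborel_prod indicator_times mult.assoc)
  qed
  have p1: "set_integrable lborel ?B (\<lambda>z. p (snd z))"
    by (rule set_integrable_from_square[OF p2 m cB])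
  have "set_integrable lborel ?B (\<lambda>z. (p (snd z))\<^sup>2 - (?c z / 2) * p (snd z) + (?c z / 4)\<^sup>2)"
    by (intro set_integral_add set_integral_diff p2 set_integrable_continuous_mult[OF p1] cB
        borel_integrable_compact[unfolded set_integrable_def[symmetric]])
      (auto intro!: continuous_intros continuous_on_subset[OF c] simp: set_integrable_def borel_integrable_compact cB)
  then show ?thesis
    by (simp add: Pd_def power2_diff field_simps)
qed

lemma P_box: "set_integrable lborel ({a..b} \<times> {c..d}) (\<lambda>z. P (fst z) (snd z))"
  by (rule set_integrable_from_square[OF P_sq_box P_meas]) (intro compact_Times compact_Icc)

text \<open>Integrated form of \<open>(A P\<^sup>2)\<^sub>u = A\<^sub>u P\<^sup>2 - A f(\<Phi>) P /
  2\<close> and \<open>(A V(\<Phi>))\<^sub>v = A\<^sub>v V(\<Phi>) + A f(\<Phi>) P\<close>: adding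
  half of the second to the first removes the terms that contain \<open>f\<close>. By Fubini over
  the same region the first is integrated along \<open>u\<close> and the second along
  \<open>v\<close>, so that \<open>P\<close> is never differentiated in \<open>v\<close>.\<close>

lemma energy_identity:
  fixes A Au Av :: "real \<Rightarrow> real \<Rightarrow> real"
  assumes u01: "u0 \<le> u1" and v01: "v0 \<le> v1"
    and kI: "\<And>v. v \<in> {v0..v1} \<Longrightarrow> k v \<in> {u0..u1}"
    and lI: "\<And>u. u \<in> {u0..u1} \<Longrightarrow> l u \<in> {v0..v1}"
    and kl: "\<And>u v. u \<in> {u0..u1} \<Longrightarrow> v \<in> {v0..v1} \<Longrightarrow> k v \<le> u \<longleftrightarrow> l u \<le> v"
    and k: "continuous_on UNIV k"
    and dAu: "\<And>u v. u \<in> {u0..u1} \<Longrightarrow> v \<in> {v0..v1} \<Longrightarrow> ((\<lambda>u. A u v) has_real_derivative Au u v) (at u)"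
    and dAv: "\<And>u v. u \<in> {u0..u1} \<Longrightarrow> v \<in> {v0..v1} \<Longrightarrow> ((\<lambda>v. A u v) has_real_derivative Av u v) (at v)"
    and cA: "continuous_on ({u0..u1} \<times> {v0..v1}) (\<lambda>z. A (fst z) (snd z))"
    and cAu: "continuous_on ({u0..u1} \<times> {v0..v1}) (\<lambda>z. Au (fst z) (snd z))"
    and cAv: "continuous_on ({u0..u1} \<times> {v0..v1}) (\<lambda>z. Av (fst z) (snd z))"
    and D: "D = {(u, v). u0 \<le> u \<and> u \<le> u1 \<and> v0 \<le> v \<and> v \<le> v1 \<and> k v \<le> u}"
  shows "set_integrable lborel D (\<lambda>z. Au (fst z) (snd z) * (P (fst z) (snd z))\<^sup>2 + Av (fst z) (snd z) * V (\<Phi> (fst z) (snd z)) / 2)"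
    and "(LBINT v:{v0..v1}. A u1 v * (P u1 v)\<^sup>2 - A (k v) v * (P (k v) v)\<^sup>2)
       + (LBINT u:{u0..u1}. A u v1 * V (\<Phi> u v1) - A u (l u) * V (\<Phi> u (l u))) / 2
       = (LBINT z:D. Au (fst z) (snd z) * (P (fst z) (snd z))\<^sup>2 + Av (fst z) (snd z) * V (\<Phi> (fst z) (snd z)) / 2)"
proof -
  let ?B = "{u0..u1} \<times> {v0..v1}"
  have cB: "compact ?B" by (intro compact_Times compact_Icc)
  define Y1 where "Y1 z = Au (fst z) (snd z) * (P (fst z) (snd z))\<^sup>2 - ((A (fst z) (snd z) * f (\<Phi> (fst z) (snd z))) * P (fst z) (snd z)) / 2" for z
  define Y2 where "Y2 z = Av (fst z) (snd z) * V (\<Phi> (fst z) (snd z)) + (A (fst z) (snd z) * f (\<Phi> (fst z) (snd z))) * P (fst z) (snd z)" for z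
  have i1: "set_integrable lborel ?B (\<lambda>z. Au (fst z) (snd z) * (P (fst z) (snd z))\<^sup>2)"
    by (rule set_integrable_continuous_mult[OF P_sq_box cAu cB])
  have i2: "set_integrable lborel ?B (\<lambda>z. (A (fst z) (snd z) * f (\<Phi> (fst z) (snd z))) * P (fst z) (snd z))"
    by (rule set_integrable_continuous_mult[OF P_box _ cB]) (intro continuous_intros cA f_Phi_cont)
  have i3: "set_integrable lborel ?B (\<lambda>z. Av (fst z) (snd z) * V (\<Phi> (fst z) (snd z)))"
    unfolding set_integrable_def by (intro borel_integrable_compact cB continuous_intros cAv V_Phi_cont)
  have "continuous_on UNIV (\<lambda>z::real \<times> real. k (snd z))"
    by (rule continuous_on_compose2[OF k continuous_on_snd[OF continuous_on_id]]) simp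
  then have "closed {z::real \<times> real. k (snd z) \<le> fst z}"
    by (intro closed_Collect_le continuous_intros)
  moreover have "D = ?B \<inter> {z. k (snd z) \<le> fst z}" by (auto simp: D)
  ultimately have "closed D" using cB by (simp add: closed_Int compact_imp_closed)
  then have Db: "D \<in> sets lborel" by simp
  have DB: "D \<subseteq> ?B" by (auto simp: D)
  have I1: "set_integrable lborel D Y1"
    unfolding Y1_def by (rule set_integrable_subset[OF _ Db DB]) (intro set_integral_diff set_integrable_divide i1 i2)
  have I2: "set_integrable lborel D Y2"
    unfolding Y2_def by (rule set_integrable_subset[OF _ Db DB]) (intro set_integral_add i3 i2)
  have Y12: "Y1 z + Y2 z / 2 = Au (fst z) (snd z) * (P (fst z) (snd z))\<^sup>2 + Av (fst z) (snd z) * V (\<Phi> (fst z) (snd z)) / 2" for z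
    by (simp add: Y1_def Y2_def field_simps)
  have I2': "set_integrable lborel D (\<lambda>z. Y2 z / 2)" using I2 by simp
  note I12 = set_integral_add[OF I1 I2', unfolded Y12]
  then show "set_integrable lborel D (\<lambda>z. Au (fst z) (snd z) * (P (fst z) (snd z))\<^sup>2 + Av (fst z) (snd z) * V (\<Phi> (fst z) (snd z)) / 2)"
    by simp
  \<comment> \<open>Classical, since \<open>P\<close> is differentiable in \<open>u\<close> for each
    fixed \<open>v\<close>, however rough \<open>p\<close> may be.\<close>
  have e1: "(LBINT u:{k v..u1}. Y1 (u, v)) = A u1 v * (P u1 v)\<^sup>2 - A (k v) v * (P (k v) v)\<^sup>2" if v: "v \<in> {v0..v1}" for v
  proof (rule LBINT_FTC)
    show "k v \<le> u1" using kI[OF v] by simp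
    have sub: "u \<in> {u0..u1}" if "u \<in> {k v..u1}" for u using kI[OF v] that by auto
    show "((\<lambda>u. A u v * (P u v)\<^sup>2) has_real_derivative Y1 (u, v)) (at u within {k v..u1})" if "u \<in> {k v..u1}" for u
      using has_field_derivative_at_within[OF dAu[OF sub[OF that] v]]
      by (auto intro!: derivative_eq_intros P_deriv simp: Y1_def field_simps power2_eq_square)
    have c: "continuous_on {k v..u1} (\<lambda>u. g (fst (u, v)) (snd (u, v)))" if "continuous_on ?B (\<lambda>z. g (fst z) (snd z))" for g :: "real \<Rightarrow> real \<Rightarrow> real"
      by (rule continuous_on_compose2[OF that]) (use v sub in \<open>auto intro!: continuous_intros\<close>)
    show "continuous_on {k v..u1} (\<lambda>u. Y1 (u, v))"
      unfolding Y1_def using c[OF cA] c[OF cAu] by (intro continuous_intros f_Phi_cont) (auto intro!: continuous_intros P_cont)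
  qed
  \<comment> \<open>In \<open>v\<close> the function \<open>\<Phi>\<close> is only absolutely
    continuous with density \<open>P\<close>, which calls for \<open>AC_chain_rule\<close>.\<close>
  have e2: "(LBINT v:{l u..v1}. Y2 (u, v)) = A u v1 * V (\<Phi> u v1) - A u (l u) * V (\<Phi> u (l u))" if u: "u \<in> {u0..u1}" for u
  proof -
    have sub: "v \<in> {v0..v1}" if "v \<in> {l u..v1}" for v using lI[OF u] that by auto
    have "(LBINT v:{l u..v1}. Av u v * V (\<Phi> u v) + A u v * f (\<Phi> u v) * P u v) = A u v1 * V (\<Phi> u v1) - A u (l u) * V (\<Phi> u (l u))"
    proof (rule AC_chain_rule(2))
      show "l u \<le> v1" using lI[OF u] by simp
      show "set_integrable lborel {l u..v1} (P u)" using P_line[of _ _ u] .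
      show "\<Phi> u x = \<Phi> u (l u) + (LBINT y:{l u..x}. P u y)" if "x \<in> {l u..v1}" for x
        using Phi_v[of "l u" x u] that by simp
      show "(A u has_real_derivative Av u x) (at x within {l u..v1})" if "x \<in> {l u..v1}" for x
        using has_field_derivative_at_within[OF dAv[OF u sub[OF that]]] .
      have "continuous_on {l u..v1} (\<lambda>v. Av (fst (u, v)) (snd (u, v)))"
        by (rule continuous_on_compose2[OF cAv]) (use u sub in \<open>auto intro!: continuous_intros\<close>)
      then show "continuous_on {l u..v1} (Av u)" by simp
    qed (use V_deriv f_cont in auto)
    then show ?thesis by (simp add: Y2_def mult.assoc)
  qed
  have "(LBINT v:{v0..v1}. A u1 v * (P u1 v)\<^sup>2 - A (k v) v * (P (k v) v)\<^sup>2) = (LBINT v:{v0..v1}. LBINT u:{k v..u1}. Y1 (u, v))"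
    by (rule set_lebesgue_integral_cong) (simp_all add: e1)
  also have "\<dots> = (LBINT z:D. Y1 z)"
    by (rule box_region_integral(1)[OF D I1 _ kl, symmetric]) (use kI lI in auto)
  finally have E1: "(LBINT v:{v0..v1}. A u1 v * (P u1 v)\<^sup>2 - A (k v) v * (P (k v) v)\<^sup>2) = (LBINT z:D. Y1 z)" .
  have "(LBINT u:{u0..u1}. A u v1 * V (\<Phi> u v1) - A u (l u) * V (\<Phi> u (l u))) = (LBINT u:{u0..u1}. LBINT v:{l u..v1}. Y2 (u, v))"
    by (rule set_lebesgue_integral_cong) (simp_all add: e2)
  also have "\<dots> = (LBINT z:D. Y2 z)"
    by (rule box_region_integral(2)[OF D I2 _ kl, symmetric]) (use kI lI in auto)
  finally have E2: "(LBINT u:{u0..u1}. A u v1 * V (\<Phi> u v1) - A u (l u) * V (\<Phi> u (l u))) = (LBINT z:D. Y2 z)" .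
  show "(LBINT v:{v0..v1}. A u1 v * (P u1 v)\<^sup>2 - A (k v) v * (P (k v) v)\<^sup>2)
       + (LBINT u:{u0..u1}. A u v1 * V (\<Phi> u v1) - A u (l u) * V (\<Phi> u (l u))) / 2
       = (LBINT z:D. Au (fst z) (snd z) * (P (fst z) (snd z))\<^sup>2 + Av (fst z) (snd z) * V (\<Phi> (fst z) (snd z)) / 2)"
    unfolding I12(2) E1 E2 by simp
qed

text \<open>The density on the time slice \<open>(u + v) / 2 = t\<close>, parametrised by \<open>v\<close>, of the part of the energy
  that is transported along the lines \<open>v = const\<close>.\<close>

definition eP :: "real \<Rightarrow> real \<Rightarrow> real" where
  "eP t v = (P (2 * t - v) v)\<^sup>2 + V (\<Phi> (2 * t - v) v) / 2"

lemma eP_nonneg: "0 \<le> eP t v"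
  by (simp add: eP_def V_nonneg)

lemma V_line: "set_integrable lborel {a..b} (\<lambda>u. V (\<Phi> u v))"
  by (intro borel_integrable_atLeastAtMost' V_Phi_cont continuous_intros)

lemma eP_int: "set_integrable lborel {a..b} (eP t)"
  unfolding eP_def
  by (intro set_integral_add P_sq_line set_integrable_divide borel_integrable_atLeastAtMost' V_Phi_cont continuous_intros)

text \<open>The identity with weight 1 on the triangle with apex \<open>(u1, v1)\<close> above the
  slice of time \<open>t\<close>: what enters through the slice leaves through the two
  characteristic sides. The flux estimates that follow compare such triangles.\<close>

lemma triangle:
  assumes "2 * t \<le> u1 + v1"
  shows "(LBINT v:{2*t-u1..v1}. (P u1 v)\<^sup>2) + (LBINT u:{2*t-v1..u1}. V (\<Phi> u v1)) / 2 = (LBINT v:{2*t-u1..v1}. eP t v)"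
proof -
  let ?I = "{2*t-u1..v1}" and ?J = "{2*t-v1..u1}"
  define D where "D = {(u, v). 2*t-v1 \<le> u \<and> u \<le> u1 \<and> 2*t-u1 \<le> v \<and> v \<le> v1 \<and> 2*t-v \<le> u}"
  have "(LBINT v:?I. 1 * (P u1 v)\<^sup>2 - 1 * (P (2*t-v) v)\<^sup>2)
      + (LBINT u:?J. 1 * V (\<Phi> u v1) - 1 * V (\<Phi> u (2*t-u))) / 2
      = (LBINT z:D. 0 * (P (fst z) (snd z))\<^sup>2 + 0 * V (\<Phi> (fst z) (snd z)) / 2)"
    by (rule energy_identity(2)[where A = "\<lambda>_ _. 1" and Au = "\<lambda>_ _. 0" and Av = "\<lambda>_ _. 0" and k = "\<lambda>v. 2*t-v" and l = "\<lambda>u. 2*t-u"])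
      (use assms in \<open>auto intro!: continuous_intros simp: D_def\<close>)
  then have 1: "(LBINT v:?I. (P u1 v)\<^sup>2 - (P (2*t-v) v)\<^sup>2) + (LBINT u:?J. V (\<Phi> u v1) - V (\<Phi> u (2*t-u))) / 2 = 0"
    by simp
  have 2: "(LBINT v:?I. (P u1 v)\<^sup>2 - (P (2*t-v) v)\<^sup>2) = (LBINT v:?I. (P u1 v)\<^sup>2) - (LBINT v:?I. (P (2*t-v) v)\<^sup>2)"
    by (intro set_integral_diff P_sq_line continuous_intros)
  have 3: "(LBINT u:?J. V (\<Phi> u v1) - V (\<Phi> u (2*t-u))) = (LBINT u:?J. V (\<Phi> u v1)) - (LBINT u:?J. V (\<Phi> u (2*t-u)))"
    by (intro set_integral_diff borel_integrable_atLeastAtMost' V_Phi_cont continuous_intros)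
  have g: "continuous_on UNIV (\<lambda>u. V (\<Phi> u (2*t-u)))" and g': "continuous_on UNIV (\<lambda>v. V (\<Phi> (2*t-v) v))"
    by (intro V_Phi_cont continuous_intros)+
  have "(LBINT u:?J. V (\<Phi> u (2*t-u))) = oint (2*t-v1) u1 (\<lambda>u. V (\<Phi> u (2*t-u)))"
    using assms by (intro oint_eq_LBINT g) auto
  also have "\<dots> = - oint u1 (2*t-v1) (\<lambda>u. V (\<Phi> u (2*t-u)))"
    by (rule oint_swap[OF g])
  also have "\<dots> = oint (2*t-u1) v1 (\<lambda>v. V (\<Phi> (2*t-v) v))"
    using oint_affine[OF g, of "-1" "2*t-u1" v1 "2*t"] by simp
  also have "\<dots> = (LBINT v:?I. V (\<Phi> (2*t-v) v))"
    using assms by (intro oint_eq_LBINT[symmetric] g') auto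
  finally have 4: "(LBINT u:?J. V (\<Phi> u (2*t-u))) = (LBINT v:?I. V (\<Phi> (2*t-v) v))" .
  have 5: "(LBINT v:?I. eP t v) = (LBINT v:?I. (P (2*t-v) v)\<^sup>2) + (LBINT v:?I. V (\<Phi> (2*t-v) v) / 2)"
    unfolding eP_def
    by (intro set_integral_add P_sq_line set_integrable_divide borel_integrable_atLeastAtMost' V_Phi_cont continuous_intros)
  show ?thesis using 1 unfolding 2 3 4 5 by (simp add: diff_divide_distrib)
qed

lemma flux_P:
  assumes "2 * t \<le> u1 + v1"
  shows "(LBINT v:{2*t-u1..v1}. (P u1 v)\<^sup>2) \<le> (LBINT v:{2*t-u1..v1}. eP t v)"
  using triangle[OF assms] LBINT_nonneg[of "{2*t-v1..u1}" "\<lambda>u. V (\<Phi> u v1)"] V_nonneg by simp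

lemma flux_V:
  assumes "2 * t \<le> u1 + v1"
  shows "(LBINT u:{2*t-v1..u1}. V (\<Phi> u v1)) \<le> 2 * (LBINT v:{2*t-u1..v1}. eP t v)"
  using triangle[OF assms] LBINT_nonneg[of "{2*t-u1..v1}" "\<lambda>v. (P u1 v)\<^sup>2"] by simp

text \<open>Two triangles with the same apex: the characteristic sides of the larger one contain
  those of the smaller one, and both fluxes are nonnegative.\<close>

lemma trapezoid:
  assumes "t \<le> T" "2 * T \<le> u1 + v1"
  shows "(LBINT v:{2*T-u1..v1}. eP T v) \<le> (LBINT v:{2*t-u1..v1}. eP t v)"
proof -
  have P2: "set_integrable lborel {a..b} (\<lambda>v. (P u1 v)\<^sup>2)" for a b by (intro P_sq_line continuous_intros)
  have "(LBINT v:{2*t-u1..2*T-u1}. (P u1 v)\<^sup>2) + (LBINT v:{2*T-u1..v1}. (P u1 v)\<^sup>2) = (LBINT v:{2*t-u1..v1}. (P u1 v)\<^sup>2)"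
    using assms by (intro LBINT_combine P2) auto
  moreover have "(LBINT u:{2*t-v1..2*T-v1}. V (\<Phi> u v1)) + (LBINT u:{2*T-v1..u1}. V (\<Phi> u v1)) = (LBINT u:{2*t-v1..u1}. V (\<Phi> u v1))"
    using assms by (intro LBINT_combine V_line) auto
  moreover have "0 \<le> (LBINT v:{2*t-u1..2*T-u1}. (P u1 v)\<^sup>2)" "0 \<le> (LBINT u:{2*t-v1..2*T-v1}. V (\<Phi> u v1))"
    by (auto intro!: LBINT_nonneg V_nonneg)
  ultimately show ?thesis using triangle[of t u1 v1] triangle[of T u1 v1] assms by simp
qed

text \<open>A balance on the strip between \<open>v = v0\<close> and \<open>v = v1\<close>. The
  energy measured by \<open>eP\<close> stays on its line \<open>v = const\<close> except for an
  exchange through the potential. The flux through \<open>v1\<close> has a favourable sign, so only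
  the flux through \<open>v0\<close> can add to the energy in the strip.\<close>

lemma lag:
  assumes "t \<le> T" "v0 \<le> v1"
  shows "(LBINT v:{v0..v1}. eP T v) \<le> (LBINT v:{v0..v1}. eP t v) + (LBINT u:{2*t-v0..2*T-v0}. V (\<Phi> u v0)) / 2"
proof -
  \<comment> \<open>With this \<open>u1\<close> the point \<open>(u1, v0)\<close> lies on the slice
    of time \<open>T\<close>. Removing from the triangle at \<open>(u1, v1)\<close> above time
    \<open>t\<close> the one at \<open>(u1, v0)\<close> above \<open>t\<close> and the one at
    \<open>(u1, v1)\<close> above \<open>T\<close> leaves the strip.\<close>
  define u1 where "u1 = 2*T - v0"
  have P2: "set_integrable lborel {a..b} (\<lambda>v. (P u1 v)\<^sup>2)" for a b by (intro P_sq_line continuous_intros)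
  have "(LBINT v:{2*t-u1..v0}. (P u1 v)\<^sup>2) + (LBINT v:{v0..v1}. (P u1 v)\<^sup>2) = (LBINT v:{2*t-u1..v1}. (P u1 v)\<^sup>2)"
    using assms by (intro LBINT_combine P2) (auto simp: u1_def)
  moreover have "(LBINT v:{2*t-u1..v0}. eP t v) + (LBINT v:{v0..v1}. eP t v) = (LBINT v:{2*t-u1..v1}. eP t v)"
    using assms by (intro LBINT_combine eP_int) (auto simp: u1_def)
  moreover have "(LBINT u:{2*t-v1..2*T-v1}. V (\<Phi> u v1)) + (LBINT u:{2*T-v1..u1}. V (\<Phi> u v1)) = (LBINT u:{2*t-v1..u1}. V (\<Phi> u v1))"
    using assms by (intro LBINT_combine V_line) (auto simp: u1_def)
  moreover have "0 \<le> (LBINT u:{2*t-v1..2*T-v1}. V (\<Phi> u v1))"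
    by (auto intro!: LBINT_nonneg V_nonneg)
  moreover have "2*T - u1 = v0" by (simp add: u1_def)
  ultimately show ?thesis using triangle[of t u1 v1] triangle[of T u1 v1] triangle[of t u1 v0] assms
    by (simp add: u1_def)
qed

end

section \<open>Symmetries, and energy bounds at all times\<close>

lemma LBINT_reflect:
  fixes g :: "real \<Rightarrow> real"
  shows "(LBINT x:{a..b}. g (- x)) = (LBINT x:{- b..- a}. g x)"
proof -
  have "(LBINT x:{- b..- a}. g x) = (\<integral>x. indicator {- b..- a} (0 + (-1) * x) *\<^sub>R g (0 + (-1) * x) \<partial>lborel)"
    unfolding set_lebesgue_integral_def by (subst lborel_integral_real_affine[where c = "-1" and t = 0]) auto
  also have "(\<lambda>x. indicator {- b..- a} (0 + (-1) * x) *\<^sub>R g (0 + (-1) * x)) = (\<lambda>x. indicator {a..b} x *\<^sub>R g (- x))"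
    by (auto simp: indicator_def)
  finally show ?thesis by (simp add: set_lebesgue_integral_def)
qed

lemma set_integrable_reflect:
  assumes "set_integrable lborel {- b..- a} (g :: real \<Rightarrow> real)"
  shows "set_integrable lborel {a..b} (\<lambda>x. g (- x))"
proof -
  have "integrable lborel (\<lambda>x. indicator {- b..- a} (0 + (-1) * x) *\<^sub>R g (0 + (-1) * x))"
    using assms unfolding set_integrable_def by (intro lborel_integrable_real_affine) auto
  also have "(\<lambda>x. indicator {- b..- a} (0 + (-1) * x) *\<^sub>R g (0 + (-1) * x)) = (\<lambda>x. indicator {a..b} x *\<^sub>R g (- x))"
    by (auto simp: indicator_def)
  finally show ?thesis by (simp add: set_integrable_def)
qed

lemma LBINT_abs_le:
  fixes g h :: "'a::euclidean_space \<Rightarrow> real"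
  assumes "set_integrable lborel S g" "set_integrable lborel S h" "\<And>x. x \<in> S \<Longrightarrow> \<bar>g x\<bar> \<le> h x"
  shows "\<bar>LBINT x:S. g x\<bar> \<le> (LBINT x:S. h x)"
proof -
  have "(LBINT x:S. g x) \<le> (LBINT x:S. h x)"
    by (rule set_integral_mono[OF assms(1,2)]) (use assms(3) in force)
  moreover have "(LBINT x:S. - h x) \<le> (LBINT x:S. g x)"
    by (rule set_integral_mono[OF _ assms(1)]) (use assms(2,3) in \<open>force simp: set_integrable_def\<close>)+
  ultimately show ?thesis using set_integral_uminus[OF assms(2)] by linarith
qed

lemma integrable_if_bounded_on_intervals:
  fixes g :: "real \<Rightarrow> real"
  assumes [measurable]: "g \<in> borel_measurable borel" and nn: "\<And>x. 0 \<le> g x"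
    and i: "\<And>n::nat. set_integrable lborel {- real n..real n} g"
    and b: "\<And>n::nat. (LBINT x:{- real n..real n}. g x) \<le> C"
  shows "integrable lborel g" and "integral\<^sup>L lborel g \<le> C"
proof -
  let ?I = "\<lambda>n::nat. \<integral>x. indicator {- real n..real n} x * g x \<partial>lborel"
  have ii: "integrable lborel (\<lambda>x. indicator {- real n..real n} x * g x)" for n
    using i[of n] by (simp add: set_integrable_def)
  have "incseq ?I"
    by (intro incseq_SucI integral_mono ii) (use nn in \<open>auto simp: indicator_def\<close>)
  moreover have bb: "?I n \<le> C" for n
    using b[of n] by (simp add: set_lebesgue_integral_def)
  ultimately obtain L where L: "?I \<longlonglongrightarrow> L" "\<And>n. ?I n \<le> L"
    using incseq_convergent[of ?I C] by blast
  have lim: "(\<lambda>n. indicator {- real n..real n} x * g x) \<longlonglongrightarrow> g x" for x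
  proof -
    obtain N :: nat where N: "\<bar>x\<bar> \<le> real N" using real_arch_simple by blast
    have "\<forall>\<^sub>F n in sequentially. indicator {- real n..real n} x * g x = g x"
      using eventually_ge_at_top[of N] by eventually_elim (use N in \<open>auto simp: indicator_def\<close>)
    then show ?thesis by (rule tendsto_eventually)
  qed
  have m: "AE x in lborel. mono (\<lambda>n. indicator {- real n..real n} x * g x)"
  proof (rule AE_I2)
    fix x show "mono (\<lambda>n::nat. indicator {- real n..real n} x * g x)"
      unfolding mono_def by (auto simp: indicator_def nn)
  qed
  note mc = integrable_monotone_convergence[OF ii m AE_I2[OF lim] L(1)]
  show "integrable lborel g" by (rule mc) auto
  have "integral\<^sup>L lborel g = L" by (rule integral_monotone_convergence[OF ii m AE_I2[OF lim] L(1)]) auto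
  also have "L \<le> C" using L(1) bb by (intro LIMSEQ_le_const2) auto
  finally show "integral\<^sup>L lborel g \<le> C" .
qed

lemma LBINT_le_integral:
  fixes g :: "real \<Rightarrow> real"
  assumes "integrable lborel g" "\<And>x. 0 \<le> g x" "S \<in> sets borel"
  shows "(LBINT x:S. g x) \<le> integral\<^sup>L lborel g"
  unfolding set_lebesgue_integral_def
proof (rule integral_mono)
  show "integrable lborel (\<lambda>x. indicator S x *\<^sub>R g x)"
    by (rule integrable_mult_indicator) (use assms in auto)
qed (use assms in \<open>auto simp: indicator_def\<close>)

lemma inverse_square_integral:
  fixes U :: real
  assumes "1 \<le> U"
  shows "(LBINT u:{1..U}. (inverse u)\<^sup>2) \<le> 1"
proof -
  have "(LBINT u:{1..U}. (inverse u)\<^sup>2) = - inverse U - (- inverse 1)"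
    by (rule LBINT_FTC[where F = "\<lambda>u. - inverse u"]) (use assms in \<open>auto intro!: derivative_eq_intros continuous_intros simp: power2_eq_square\<close>)
  also have "\<dots> \<le> 1" using assms by simp
  finally show ?thesis .
qed

context charsol
begin

text \<open>The spatial reflection \<open>x \<mapsto> - x\<close>, which exchanges \<open>P\<close>
  and \<open>Q\<close>.\<close>

lemma swap: "charsol f V (\<lambda>u v. \<Phi> v u) q p"
proof
  show "continuous_on UNIV (\<lambda>(u, v). \<Phi> v u)"
    unfolding case_prod_unfold by (intro Phi_cont' continuous_intros)
qed (use f_cont V_deriv V_nonneg p_sq q_sq Phi_v Phi_u in auto)

lemma P_reverse: "Pd f (\<lambda>u v. \<Phi> (- u) (- v)) (\<lambda>v. - p (- v)) u v = - P (- u) (- v)"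
  using oint_affine[of "\<lambda>s. f (\<Phi> s (- v))" "-1" 0 u 0] f_Phi_cont[of UNIV "\<lambda>s. s" "\<lambda>_. - v"]
  by (simp add: Pd_def continuous_on_id field_simps)

text \<open>The reflection \<open>(t, x) \<mapsto> (- t, - x)\<close>. It keeps the roles of
  \<open>P\<close> and \<open>Q\<close> and turns estimates forward in time into estimates backward
  in time.\<close>

lemma reverse: "charsol f V (\<lambda>u v. \<Phi> (- u) (- v)) (\<lambda>v. - p (- v)) (\<lambda>u. - q (- u))"
proof
  show "continuous_on UNIV (\<lambda>(u, v). \<Phi> (- u) (- v))"
    unfolding case_prod_unfold by (intro Phi_cont' continuous_intros)
  show "set_integrable lborel {a..b} (\<lambda>x. (- p (- x))\<^sup>2)" "set_integrable lborel {a..b} (\<lambda>x. (- q (- x))\<^sup>2)" for a b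
    using set_integrable_reflect[OF p_sq] set_integrable_reflect[OF q_sq] by simp_all
  show "\<Phi> (- u) (- v2) - \<Phi> (- u) (- v1) = (LBINT y:{v1..v2}. Pd f (\<lambda>u v. \<Phi> (- u) (- v)) (\<lambda>v. - p (- v)) u y)"
    if "v1 \<le> v2" for u v1 v2
    using Phi_v[of "- v2" "- v1" "- u"] that
    by (simp add: P_reverse LBINT_reflect[where g = "\<lambda>y. - P (- u) y"] set_integral_uminus P_line)
  interpret sw: charsol f V "\<lambda>u v. \<Phi> v u" q p by (rule swap)
  show "\<Phi> (- u2) (- v) - \<Phi> (- u1) (- v) = (LBINT y:{u1..u2}. Pd f (\<lambda>u v. \<Phi> (- v) (- u)) (\<lambda>u. - q (- u)) v y)"
    if "u1 \<le> u2" for v u1 u2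
    using Phi_u[of "- u2" "- u1" "- v"] that
    by (simp add: sw.P_reverse LBINT_reflect[where g = "\<lambda>y. - Q y (- v)"] set_integral_uminus sw.P_line)
qed (use f_cont V_deriv V_nonneg in auto)

lemma eP_meas [measurable]: "eP t \<in> borel_measurable borel"
proof -
  have [measurable]: "(\<lambda>v. P (2 * t - v) v) \<in> borel_measurable borel"
    by (intro P_meas') (auto intro!: borel_measurable_continuous_onI continuous_intros)
  have [measurable]: "(\<lambda>v. V (\<Phi> (2 * t - v) v)) \<in> borel_measurable borel"
    by (intro borel_measurable_continuous_onI V_Phi_cont continuous_intros)
  show ?thesis unfolding eP_def[abs_def] by measurable
qed

text \<open>The integral of \<open>eP\<close> is half the sum of energy and momentum, hence
  controlled separately from its counterpart for \<open>Q\<close>. The slice is exhausted by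
  \<open>[-n, n]\<close>, the upper base of the trapezoid with apex \<open>(2 * T + n, n)\<close>,
  so that no flux at infinity has to be estimated.\<close>

lemma energy_decreasing:
  assumes "integrable lborel (eP t)" "t \<le> T"
  shows "integrable lborel (eP T)" and "integral\<^sup>L lborel (eP T) \<le> integral\<^sup>L lborel (eP t)"
proof -
  have b: "(LBINT x:{- real n..real n}. eP T x) \<le> integral\<^sup>L lborel (eP t)" for n
  proof -
    have "(LBINT x:{- real n..real n}. eP T x) = (LBINT x:{2 * T - (2 * T + real n)..real n}. eP T x)"
      by simp
    also have "\<dots> \<le> (LBINT x:{2 * t - (2 * T + real n)..real n}. eP t x)"
      by (rule trapezoid) (use assms in auto)
    also have "\<dots> \<le> integral\<^sup>L lborel (eP t)"
      by (rule LBINT_le_integral) (use assms eP_nonneg in auto)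
    finally show ?thesis .
  qed
  show "integrable lborel (eP T)" "integral\<^sup>L lborel (eP T) \<le> integral\<^sup>L lborel (eP t)"
    by (rule integrable_if_bounded_on_intervals[OF eP_meas eP_nonneg eP_int b])+
qed

end

locale finite_energy = charsol +
  assumes eP0: "integrable lborel (eP 0)"
    and eQ0: "integrable lborel (charsol.eP f V (\<lambda>u v. \<Phi> v u) q 0)"
begin

lemma swap': "finite_energy f V (\<lambda>u v. \<Phi> v u) q p"
  using swap eP0 eQ0 by (simp add: finite_energy_def finite_energy_axioms_def)

lemma reverse_eP: "charsol.eP f V (\<lambda>u v. \<Phi> (- u) (- v)) (\<lambda>v. - p (- v)) T v = eP (- T) (- v)"
  by (simp add: charsol.eP_def[OF reverse] P_reverse eP_def)

lemma energy_bound: "integrable lborel (eP T)" "integral\<^sup>L lborel (eP T) \<le> integral\<^sup>L lborel (eP 0)"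
proof -
  have "integrable lborel (eP T) \<and> integral\<^sup>L lborel (eP T) \<le> integral\<^sup>L lborel (eP 0)"
  proof (cases "0 \<le> T")
    case True
    then show ?thesis using energy_decreasing[OF eP0] by simp
  next
    \<comment> \<open>Negative times are reached by reflecting and using the forward estimate from
      time 0.\<close>
    case False
    interpret rv: charsol f V "\<lambda>u v. \<Phi> (- u) (- v)" "\<lambda>v. - p (- v)" "\<lambda>u. - q (- u)" by (rule reverse)
    have refl: "integrable lborel (\<lambda>v. g (- v))" if "integrable lborel g" for g :: "real \<Rightarrow> real"
      using lborel_integrable_real_affine[OF that, of "-1" 0] by simp
    have refl': "(\<integral>v. g (- v) \<partial>lborel) = integral\<^sup>L lborel g" for g :: "real \<Rightarrow> real"
      using lborel_integral_real_affine[of "-1" g 0] by simp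
    have e: "rv.eP s = (\<lambda>v. eP (- s) (- v))" for s by (rule ext) (rule reverse_eP)
    have "integrable lborel (rv.eP 0)" unfolding e using refl[OF eP0] by simp
    from rv.energy_decreasing[OF this, of "- T"] False
    have *: "integrable lborel (\<lambda>v. eP T (- v))" "(\<integral>v. eP T (- v) \<partial>lborel) \<le> (\<integral>v. eP 0 (- v) \<partial>lborel)"
      unfolding e by simp_all
    then show ?thesis using refl[OF *(1)] refl'[of "eP T"] refl'[of "eP 0"] by simp
  qed
  then show "integrable lborel (eP T)" "integral\<^sup>L lborel (eP T) \<le> integral\<^sup>L lborel (eP 0)" by auto
qed

definition EP where "EP = integral\<^sup>L lborel (eP 0)"
definition EQ where "EQ = integral\<^sup>L lborel (charsol.eP f V (\<lambda>u v. \<Phi> v u) q 0)"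

lemma EP_nonneg: "0 \<le> EP" "0 \<le> EQ"
  unfolding EP_def EQ_def by (auto intro!: Bochner_Integration.integral_nonneg eP_nonneg charsol.eP_nonneg[OF swap])

lemma flux_P_le:
  assumes "2 * t - u1 \<le> a"
  shows "(LBINT v:{a..b}. (P u1 v)\<^sup>2) \<le> EP"
proof (cases "a \<le> b")
  case True
  have i: "set_integrable lborel {x..y} (\<lambda>v. (P u1 v)\<^sup>2)" for x y by (intro P_sq_line continuous_intros)
  have "(LBINT v:{a..b}. (P u1 v)\<^sup>2) \<le> (LBINT v:{2*t-u1..b}. (P u1 v)\<^sup>2)"
    using LBINT_combine[OF assms True i] LBINT_nonneg[of "{2*t-u1..a}" "\<lambda>v. (P u1 v)\<^sup>2"] by simp
  also have "\<dots> \<le> (LBINT v:{2*t-u1..b}. eP t v)"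
    by (rule flux_P) (use assms True in auto)
  also have "\<dots> \<le> integral\<^sup>L lborel (eP t)"
    by (rule LBINT_le_integral) (use energy_bound eP_nonneg in auto)
  also have "\<dots> \<le> EP" unfolding EP_def by (rule energy_bound)
  finally show ?thesis .
qed (simp add: EP_nonneg set_lebesgue_integral_def)

lemma flux_V_le:
  assumes "2 * t - v1 \<le> a"
  shows "(LBINT u:{a..b}. V (\<Phi> u v1)) \<le> 2 * EP"
proof (cases "a \<le> b")
  case True
  have "(LBINT u:{a..b}. V (\<Phi> u v1)) \<le> (LBINT u:{2*t-v1..b}. V (\<Phi> u v1))"
    using LBINT_combine[OF assms True V_line[of _ _ v1]] LBINT_nonneg[of "{2*t-v1..a}" "\<lambda>u. V (\<Phi> u v1)"] V_nonneg by simp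
  also have "\<dots> \<le> 2 * (LBINT v:{2*t-b..v1}. eP t v)"
    by (rule flux_V) (use assms True in auto)
  also have "(LBINT v:{2*t-b..v1}. eP t v) \<le> integral\<^sup>L lborel (eP t)"
    by (rule LBINT_le_integral) (use energy_bound eP_nonneg in auto)
  also have "\<dots> \<le> EP" unfolding EP_def by (rule energy_bound)
  finally show ?thesis by simp
qed (simp add: EP_nonneg set_lebesgue_integral_def)

end

section \<open>A weighted space-time estimate\<close>

lemma set_integrable_prod_swap:
  fixes g :: "real \<times> real \<Rightarrow> real"
  assumes "set_integrable lborel (S \<times> T) g"
  shows "set_integrable lborel (T \<times> S) (\<lambda>z. g (snd z, fst z))"
    and "(LBINT z:T \<times> S. g (snd z, fst z)) = (LBINT z:S \<times> T. g z)"
proof -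
  have i: "integrable (lborel \<Otimes>\<^sub>M lborel) (\<lambda>z. indicator (S \<times> T) z *\<^sub>R g z)"
    using assms by (simp add: set_integrable_def lborel_prod)
  have e: "(\<lambda>(x, y). indicator (S \<times> T) (y, x) *\<^sub>R g (y, x)) = (\<lambda>z. indicator (T \<times> S) z *\<^sub>R g (snd z, fst z))"
    by (auto simp: fun_eq_iff indicator_def)
  show "set_integrable lborel (T \<times> S) (\<lambda>z. g (snd z, fst z))"
    using lborel_pair.integrable_product_swap[OF i] unfolding e by (simp add: set_integrable_def lborel_prod)
  show "(LBINT z:T \<times> S. g (snd z, fst z)) = (LBINT z:S \<times> T. g z)"
    using lborel_pair.integral_product_swap[OF borel_measurable_integrable[OF i]] unfolding e
    by (simp add: set_lebesgue_integral_def lborel_prod)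
qed

lemma set_integrable_mult_squares:
  fixes g h :: "'a::euclidean_space \<Rightarrow> real"
  assumes "set_integrable lborel S (\<lambda>x. (g x)\<^sup>2)" "set_integrable lborel S (\<lambda>x. (h x)\<^sup>2)"
    and "g \<in> borel_measurable borel" "h \<in> borel_measurable borel" "S \<in> sets borel"
  shows "set_integrable lborel S (\<lambda>x. g x * h x)"
  unfolding set_integrable_def
proof (rule Bochner_Integration.integrable_bound[OF set_integral_add(1)[OF assms(1,2), unfolded set_integrable_def]])
  show "(\<lambda>x. indicator S x *\<^sub>R (g x * h x)) \<in> borel_measurable lborel"
    using assms by measurable
  have "\<bar>a * b\<bar> \<le> a\<^sup>2 + b\<^sup>2" for a b :: real
  proof -
    have "2 * \<bar>a\<bar> * \<bar>b\<bar> \<le> a\<^sup>2 + b\<^sup>2" using sum_squares_bound[of "\<bar>a\<bar>" "\<bar>b\<bar>"] by simp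
    moreover have "0 \<le> \<bar>a\<bar> * \<bar>b\<bar>" by simp
    ultimately show ?thesis unfolding abs_mult by linarith
  qed
  then show "AE x in lborel. norm (indicator S x *\<^sub>R (g x * h x)) \<le> norm (indicator S x *\<^sub>R ((g x)\<^sup>2 + (h x)\<^sup>2))"
    by (intro AE_I2) (auto simp: indicator_def)
qed

definition iv :: "real \<Rightarrow> real \<Rightarrow> real" where "iv u v = inverse (u + v)"

text \<open>Half of the \<open>v\<close>-derivative of \<open>(v / (u + v))\<^sup>2\<close> and, by
  symmetry, half of the \<open>u\<close>-derivative of \<open>(u / (u + v))\<^sup>2\<close>. Both
  one-sided identities therefore carry the same weight in front of the potential.\<close>

definition wt :: "real \<Rightarrow> real \<Rightarrow> real" where "wt u v = u * v * iv u v ^ 3"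

lemma iv_sym: "iv u v = iv v u"
  by (simp add: iv_def add.commute)

lemma iv_deriv_u: "u + v \<noteq> 0 \<Longrightarrow> ((\<lambda>u. iv u v) has_real_derivative - (iv u v)\<^sup>2) (at u within S)"
  unfolding iv_def by (auto intro!: derivative_eq_intros simp: power2_eq_square)

lemma iv_deriv_v: "u + v \<noteq> 0 \<Longrightarrow> ((\<lambda>v. iv u v) has_real_derivative - (iv u v)\<^sup>2) (at v within S)"
  unfolding iv_def by (auto intro!: derivative_eq_intros simp: power2_eq_square)

lemma iv_cont:
  assumes "continuous_on S a" "continuous_on S b" "\<And>z. z \<in> S \<Longrightarrow> 1 \<le> a z" "\<And>z. z \<in> S \<Longrightarrow> 1 \<le> b z"
  shows "continuous_on S (\<lambda>z. iv (a z) (b z))"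
  unfolding iv_def using assms(3,4) by (intro continuous_intros assms(1,2)) force

lemma iv_bounds:
  assumes "1 \<le> u" "1 \<le> v"
  shows "0 < iv u v" "u * iv u v \<le> 1" "v * iv u v \<le> 1" "iv u v \<le> inverse u" "iv u v \<le> inverse v"
  using assms by (auto simp: iv_def field_simps)

context charsol
begin

lemma Q_meas: "(\<lambda>z. Q (fst z) (snd z)) \<in> borel_measurable borel"
proof -
  have "(\<lambda>z::real \<times> real. (snd z, fst z)) \<in> borel_measurable borel"
    by (intro borel_measurable_continuous_onI continuous_intros)
  from measurable_compose[OF this charsol.P_meas[OF swap]] show ?thesis by simp
qed

lemma Q_sq_box: "set_integrable lborel ({a..b} \<times> {c..d}) (\<lambda>z. (Q (fst z) (snd z))\<^sup>2)"
  using set_integrable_prod_swap(1)[OF charsol.P_sq_box[OF swap]] by simp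

lemma Q_deriv: "((\<lambda>v. Q u v) has_real_derivative - f (\<Phi> u v) / 4) (at v within S)"
  by (rule charsol.P_deriv[OF swap])

end

context finite_energy
begin

lemma flux_int_le:
  fixes A :: "real \<Rightarrow> real"
  assumes "continuous_on {a..b} A" "\<And>x. x \<in> {a..b} \<Longrightarrow> \<bar>A x\<bar> \<le> 1" "2 * t - u \<le> a"
  shows "\<bar>LBINT v:{a..b}. A v * (P u v)\<^sup>2\<bar> \<le> EP"
proof -
  have i: "set_integrable lborel {a..b} (\<lambda>v. (P u v)\<^sup>2)" by (intro P_sq_line continuous_intros)
  have "\<bar>LBINT v:{a..b}. A v * (P u v)\<^sup>2\<bar> \<le> (LBINT v:{a..b}. (P u v)\<^sup>2)"
    by (rule LBINT_abs_le[OF set_integrable_continuous_mult[OF i assms(1)] i])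
      (use assms(2) in \<open>auto simp: abs_mult intro!: mult_left_le_one_le\<close>)
  also have "\<dots> \<le> EP" by (rule flux_P_le[OF assms(3)])
  finally show ?thesis .
qed

lemma pot_int_le:
  fixes A :: "real \<Rightarrow> real"
  assumes "continuous_on {a..b} A" "\<And>x. x \<in> {a..b} \<Longrightarrow> \<bar>A x\<bar> \<le> 1" "2 * t - v \<le> a"
  shows "\<bar>LBINT u:{a..b}. A u * V (\<Phi> u v)\<bar> \<le> 2 * EP"
proof -
  have "\<bar>LBINT u:{a..b}. A u * V (\<Phi> u v)\<bar> \<le> (LBINT u:{a..b}. V (\<Phi> u v))"
    by (rule LBINT_abs_le[OF set_integrable_continuous_mult[OF V_line assms(1)] V_line])
      (use assms(2) V_nonneg in \<open>auto simp: abs_mult intro!: mult_left_le_one_le\<close>)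
  also have "\<dots> \<le> 2 * EP" by (rule flux_V_le[OF assms(3)])
  finally show ?thesis .
qed

text \<open>The weight \<open>- (v / (u + v))\<^sup>2\<close> is bounded by 1, so the sides of the
  square contribute at most \<open>EP + EP + (2 * EP + 2 * EP) / 2\<close>, independently of
  \<open>U\<close>. The two interior terms have opposite signs, so by itself the estimate bounds
  neither. The square starts at 1 to stay away from \<open>u + v = 0\<close>.\<close>

lemma weighted_one_side:
  assumes U: "1 \<le> U"
  shows "set_integrable lborel ({1..U} \<times> {1..U}) (\<lambda>z. 2 * (snd z)\<^sup>2 * iv (fst z) (snd z) ^ 3 * (P (fst z) (snd z))\<^sup>2 - wt (fst z) (snd z) * V (\<Phi> (fst z) (snd z)))"
    and "\<bar>LBINT z:{1..U} \<times> {1..U}. 2 * (snd z)\<^sup>2 * iv (fst z) (snd z) ^ 3 * (P (fst z) (snd z))\<^sup>2 - wt (fst z) (snd z) * V (\<Phi> (fst z) (snd z))\<bar> \<le> 4 * EP"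
proof -
  let ?A = "\<lambda>u v. - (v * iv u v)\<^sup>2"
  let ?Au = "\<lambda>u v. 2 * v\<^sup>2 * iv u v ^ 3"
  let ?Av = "\<lambda>u v. - 2 * wt u v"
  let ?I = "{1..U}"
  have c: "continuous_on (?I \<times> ?I) (\<lambda>z. iv (fst z) (snd z))"
    by (rule iv_cont) (auto intro!: continuous_intros)
  have D: "?I \<times> ?I = {(u, v). 1 \<le> u \<and> u \<le> U \<and> 1 \<le> v \<and> v \<le> U \<and> 1 \<le> u}" by auto
  have dv: "((\<lambda>v. ?A u v) has_real_derivative ?Av u v) (at v)" if "u \<in> ?I" "v \<in> ?I" for u v
  proof -
    have nz: "u + v \<noteq> 0" using that by auto
    have "((\<lambda>v. ?A u v) has_real_derivative - (2 * (v * iv u v) * (v * (- (iv u v)\<^sup>2) + iv u v))) (at v)"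
      using iv_deriv_v[OF nz] by (auto intro!: derivative_eq_intros)
    moreover have "iv u v = (u + v) * (iv u v)\<^sup>2"
      using nz by (simp add: iv_def power2_eq_square)
    then have "v * (- (iv u v)\<^sup>2) + iv u v = u * (iv u v)\<^sup>2" by (simp add: algebra_simps)
    ultimately show ?thesis by (simp add: wt_def power2_eq_square power3_eq_cube mult_ac)
  qed
  have du: "((\<lambda>u. ?A u v) has_real_derivative ?Au u v) (at u)" if "u \<in> ?I" "v \<in> ?I" for u v
  proof -
    have nz: "u + v \<noteq> 0" using that by auto
    show ?thesis using iv_deriv_u[OF nz]
      by (auto intro!: derivative_eq_intros simp: power2_eq_square power3_eq_cube mult_ac)
  qed
  have cA: "continuous_on (?I \<times> ?I) (\<lambda>z. ?A (fst z) (snd z))"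
    by (intro continuous_intros c)
  have cAu: "continuous_on (?I \<times> ?I) (\<lambda>z. ?Au (fst z) (snd z))"
    by (intro continuous_intros c)
  have cAv: "continuous_on (?I \<times> ?I) (\<lambda>z. ?Av (fst z) (snd z))"
    unfolding wt_def by (intro continuous_intros c)
  have one: "1 \<in> ?I" using U by simp
  have kl: "(1 \<le> u) = (1 \<le> v)" if "u \<in> ?I" "v \<in> ?I" for u v using that by simp
  note hyp = energy_identity[where A = ?A and Au = ?Au and Av = ?Av and k = "\<lambda>_. 1" and l = "\<lambda>_. 1",
      OF U U one one kl continuous_on_const du dv cA cAu cAv D, simplified]
  then show "set_integrable lborel ({1..U} \<times> {1..U}) (\<lambda>z. 2 * (snd z)\<^sup>2 * iv (fst z) (snd z) ^ 3 * (P (fst z) (snd z))\<^sup>2 - wt (fst z) (snd z) * V (\<Phi> (fst z) (snd z)))"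
    by simp
  have cv: "continuous_on ?I (\<lambda>v. ?A u v)" if "1 \<le> u" for u
    using that by (intro continuous_intros iv_cont) auto
  have cu: "continuous_on ?I (\<lambda>u. ?A u v)" if "1 \<le> v" for v
    using that by (intro continuous_intros iv_cont) auto
  have Ab: "\<bar>?A u v\<bar> \<le> 1" if "1 \<le> u" "1 \<le> v" for u v
  proof -
    have "0 \<le> v * iv u v" "v * iv u v \<le> 1" using iv_bounds[OF that] that by auto
    then show ?thesis by (simp add: power_le_one)
  qed
  have i2: "set_integrable lborel ?I (\<lambda>v. (P u v)\<^sup>2)" for u by (intro P_sq_line continuous_intros)
  have s1: "(LBINT v:?I. ?A U v * (P U v)\<^sup>2 - ?A 1 v * (P 1 v)\<^sup>2) = (LBINT v:?I. ?A U v * (P U v)\<^sup>2) - (LBINT v:?I. ?A 1 v * (P 1 v)\<^sup>2)"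
    using U by (intro set_integral_diff set_integrable_continuous_mult[OF i2] cv compact_Icc) auto
  have s2: "(LBINT u:?I. ?A u U * V (\<Phi> u U) - ?A u 1 * V (\<Phi> u 1)) = (LBINT u:?I. ?A u U * V (\<Phi> u U)) - (LBINT u:?I. ?A u 1 * V (\<Phi> u 1))"
    using U by (intro set_integral_diff set_integrable_continuous_mult[OF V_line] cu compact_Icc) auto
  define x1 where "x1 = (LBINT v:?I. ?A U v * (P U v)\<^sup>2)"
  define x2 where "x2 = (LBINT v:?I. ?A 1 v * (P 1 v)\<^sup>2)"
  define x3 where "x3 = (LBINT u:?I. ?A u U * V (\<Phi> u U))"
  define x4 where "x4 = (LBINT u:?I. ?A u 1 * V (\<Phi> u 1))"
  have U1: "1 \<le> (1 :: real)" by simp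
  have "\<bar>x1\<bar> \<le> EP"
    unfolding x1_def by (rule flux_int_le[where t = 0, OF cv[OF U] Ab[OF U]]) (use U in auto)
  moreover have "\<bar>x2\<bar> \<le> EP"
    unfolding x2_def by (rule flux_int_le[where t = 0, OF cv[OF U1] Ab[OF U1]]) (use U in auto)
  moreover have "\<bar>x3\<bar> \<le> 2 * EP"
    unfolding x3_def by (rule pot_int_le[where t = 0, OF cu[OF U] Ab[OF _ U]]) (use U in auto)
  moreover have "\<bar>x4\<bar> \<le> 2 * EP"
    unfolding x4_def by (rule pot_int_le[where t = 0, OF cu[OF U1] Ab[OF _ U1]]) (use U in auto)
  moreover have eq: "(LBINT z:{1..U} \<times> {1..U}. 2 * (snd z)\<^sup>2 * iv (fst z) (snd z) ^ 3 * (P (fst z) (snd z))\<^sup>2 - wt (fst z) (snd z) * V (\<Phi> (fst z) (snd z)))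
    = (x1 - x2) + (x3 - x4) / 2"
    unfolding x1_def x2_def x3_def x4_def s1[symmetric] s2[symmetric] using hyp(2) by simp
  ultimately show "\<bar>LBINT z:{1..U} \<times> {1..U}. 2 * (snd z)\<^sup>2 * iv (fst z) (snd z) ^ 3 * (P (fst z) (snd z))\<^sup>2 - wt (fst z) (snd z) * V (\<Phi> (fst z) (snd z))\<bar> \<le> 4 * EP"
    unfolding eq by argo
qed

lemma weighted_other_side:
  assumes U: "1 \<le> U"
  shows "set_integrable lborel ({1..U} \<times> {1..U}) (\<lambda>z. 2 * (fst z)\<^sup>2 * iv (fst z) (snd z) ^ 3 * (Q (fst z) (snd z))\<^sup>2 - wt (fst z) (snd z) * V (\<Phi> (fst z) (snd z)))"
    and "\<bar>LBINT z:{1..U} \<times> {1..U}. 2 * (fst z)\<^sup>2 * iv (fst z) (snd z) ^ 3 * (Q (fst z) (snd z))\<^sup>2 - wt (fst z) (snd z) * V (\<Phi> (fst z) (snd z))\<bar> \<le> 4 * EQ"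
proof -
  interpret sw: finite_energy f V "\<lambda>u v. \<Phi> v u" q p by (rule swap')
  have e: "sw.EP = EQ" by (simp add: sw.EP_def EQ_def)
  have w: "wt (snd z) (fst z) = wt (fst z) (snd z)" "iv (snd z) (fst z) = iv (fst z) (snd z)" for z :: "real \<times> real"
    by (simp_all add: wt_def iv_sym mult.commute)
  note a = sw.weighted_one_side[OF U] and b = set_integrable_prod_swap[OF sw.weighted_one_side(1)[OF U]]
  show "set_integrable lborel ({1..U} \<times> {1..U}) (\<lambda>z. 2 * (fst z)\<^sup>2 * iv (fst z) (snd z) ^ 3 * (Q (fst z) (snd z))\<^sup>2 - wt (fst z) (snd z) * V (\<Phi> (fst z) (snd z)))"
    using b(1) by (simp add: w)
  show "\<bar>LBINT z:{1..U} \<times> {1..U}. 2 * (fst z)\<^sup>2 * iv (fst z) (snd z) ^ 3 * (Q (fst z) (snd z))\<^sup>2 - wt (fst z) (snd z) * V (\<Phi> (fst z) (snd z))\<bar> \<le> 4 * EQ"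
    using a(2) b(2) by (simp add: w e)
qed

text \<open>The mixed term is \<open>\<Phi>\<^sub>u \<Phi>\<^sub>v = (\<Phi> \<Phi>\<^sub>v)\<^sub>u + \<Phi> f \<Phi> / 4\<close>; integrating the first summand by parts
  twice leaves boundary terms and derivatives of the weight, which the bound on \<open>\<Phi>\<close> controls.\<close>

lemma mixed_bound:
  assumes U: "1 \<le> U" and M: "\<And>u v. \<bar>\<Phi> u v\<bar> \<le> M"
  shows "set_integrable lborel ({1..U} \<times> {1..U}) (\<lambda>z. wt (fst z) (snd z) * (P (fst z) (snd z) * Q (fst z) (snd z)))"
    and "\<bar>LBINT z:{1..U} \<times> {1..U}. wt (fst z) (snd z) * (P (fst z) (snd z) * Q (fst z) (snd z))
          - wt (fst z) (snd z) * (\<Phi> (fst z) (snd z) * f (\<Phi> (fst z) (snd z))) / 4\<bar> \<le> 2 * M * (1 + EP) + 14 * M\<^sup>2"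
proof -
  let ?I = "{1..U}" let ?D = "?I \<times> ?I"
  \<comment> \<open>\<open>wu\<close> is the derivative of \<open>wt\<close> in \<open>u\<close>,
    and \<open>wuv\<close> that of \<open>wu\<close> in \<open>v\<close>.\<close>
  define wu where "wu u v = v * iv u v ^ 3 - 3 * u * v * iv u v ^ 4" for u v
  define wuv where "wuv u v = iv u v ^ 3 - 3 * v * iv u v ^ 4 - 3 * u * iv u v ^ 4 + 12 * u * v * iv u v ^ 5" for u v
  interpret sw: finite_energy f V "\<lambda>u v. \<Phi> v u" q p by (rule swap')
  have M0: "0 \<le> M" using M[of 0 0] by linarith
  have cD: "compact ?D" by (intro compact_Times compact_Icc)
  have D: "?D = {(u, v). 1 \<le> u \<and> u \<le> U \<and> 1 \<le> v \<and> v \<le> U \<and> 1 \<le> u}" by auto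
  have one: "1 \<le> (1 :: real)" by simp
  have kl: "(1 \<le> u) = (1 \<le> v)" if "u \<in> ?I" "v \<in> ?I" for u v using that by simp
  have c: "continuous_on ?D (\<lambda>z. iv (fst z) (snd z))"
    by (rule iv_cont) (auto intro!: continuous_intros)
  have cwt: "continuous_on ?D (\<lambda>z. wt (fst z) (snd z))" and cwu: "continuous_on ?D (\<lambda>z. wu (fst z) (snd z))"
    and cwuv: "continuous_on ?D (\<lambda>z. wuv (fst z) (snd z))"
    unfolding wt_def wu_def wuv_def by (intro continuous_intros c)+
  have cu: "continuous_on ?I (\<lambda>u. iv u v)" if "1 \<le> v" for v
    using that by (intro iv_cont continuous_intros) auto
  have cv: "continuous_on ?I (\<lambda>v. iv u v)" if "1 \<le> u" for u
    using that by (intro iv_cont continuous_intros) auto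
  have cPhi: "continuous_on S (\<lambda>z. \<Phi> (fst z) (snd z))" and cf: "continuous_on S (\<lambda>z. f (\<Phi> (fst z) (snd z)))" for S
    by (intro Phi_cont' f_Phi_cont continuous_intros)+
  have iPQ: "set_integrable lborel ?D (\<lambda>z. P (fst z) (snd z) * Q (fst z) (snd z))"
    by (rule set_integrable_mult_squares[OF P_sq_box Q_sq_box P_meas Q_meas]) (use cD in \<open>auto simp: borel_compact\<close>)
  show iwPQ: "set_integrable lborel ?D (\<lambda>z. wt (fst z) (snd z) * (P (fst z) (snd z) * Q (fst z) (snd z)))"
    by (rule set_integrable_continuous_mult[OF iPQ cwt cD])
  have icont: "set_integrable lborel ?D g" if "continuous_on ?D g" for g :: "real \<times> real \<Rightarrow> real"
    unfolding set_integrable_def by (rule borel_integrable_compact[OF cD that])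
  have iwf: "set_integrable lborel ?D (\<lambda>z. wt (fst z) (snd z) * (\<Phi> (fst z) (snd z) * f (\<Phi> (fst z) (snd z))) / 4)"
    by (intro icont continuous_intros cwt cPhi cf) simp
  have iwuP: "set_integrable lborel ?D (\<lambda>z. wu (fst z) (snd z) * \<Phi> (fst z) (snd z) * P (fst z) (snd z))"
    by (rule set_integrable_continuous_mult[OF P_box _ cD]) (intro continuous_intros cwu cPhi)
  have iwuv: "set_integrable lborel ?D (\<lambda>z. wuv (fst z) (snd z) * ((\<Phi> (fst z) (snd z))\<^sup>2 / 2))"
    by (intro icont continuous_intros cwuv cPhi) simp
  \<comment> \<open>Integrating \<open>(wt P \<Phi>)\<^sub>u = K + R\<close> over \<open>u\<close>
    and \<open>(wu \<Phi>\<^sup>2 / 2)\<^sub>v = L + K\<close> over \<open>v\<close> expresses the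
    integral of \<open>R\<close> by boundary terms and the integral of \<open>L\<close>.\<close>
  define R where "R z = wt (fst z) (snd z) * (P (fst z) (snd z) * Q (fst z) (snd z)) - wt (fst z) (snd z) * (\<Phi> (fst z) (snd z) * f (\<Phi> (fst z) (snd z))) / 4" for z
  define K where "K z = wu (fst z) (snd z) * \<Phi> (fst z) (snd z) * P (fst z) (snd z)" for z
  define L where "L z = wuv (fst z) (snd z) * ((\<Phi> (fst z) (snd z))\<^sup>2 / 2)" for z
  have iR: "set_integrable lborel ?D R" unfolding R_def by (rule set_integral_diff(1)[OF iwPQ iwf])
  have iK: "set_integrable lborel ?D K" unfolding K_def by (rule iwuP)
  have iL: "set_integrable lborel ?D L" unfolding L_def by (rule iwuv)
  have ivb: "0 < iv u v" "u * iv u v \<le> 1" "v * iv u v \<le> 1" "iv u v \<le> inverse u" "iv u v \<le> inverse v" "0 \<le> u * iv u v" "0 \<le> v * iv u v"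
    if "1 \<le> u" "1 \<le> v" for u v
    using iv_bounds[OF that] that by auto
  \<comment> \<open>The factors \<open>u * iv u v\<close> and \<open>v * iv u v\<close> are at most
    1, so each derivative of the weight gains a power of \<open>iv\<close>. The three resulting
    bounds are just integrable enough: \<open>inverse v\<close> against the square integrable
    \<open>P\<close>, then an inverse square on a line and an inverse cube on the quadrant.\<close>
  have wtb: "\<bar>wt u v\<bar> \<le> inverse v" if "1 \<le> u" "1 \<le> v" for u v
  proof -
    have "wt u v = (u * iv u v) * (v * iv u v) * iv u v"
      by (simp add: wt_def power3_eq_cube)
    also have "\<bar>\<dots>\<bar> \<le> 1 * 1 * inverse v"
      unfolding abs_mult using ivb[OF that] that by (intro mult_mono) auto
    finally show ?thesis by simp
  qed
  have wub: "\<bar>wu u v\<bar> \<le> 4 * (inverse u)\<^sup>2" if "1 \<le> u" "1 \<le> v" for u v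
  proof -
    have "wu u v = (v * iv u v - 3 * ((u * iv u v) * (v * iv u v))) * (iv u v)\<^sup>2"
      by (simp add: wu_def power2_eq_square power3_eq_cube power4_eq_xxxx algebra_simps)
    also have "\<bar>\<dots>\<bar> \<le> 4 * (inverse u)\<^sup>2"
    proof -
      have "(u * iv u v) * (v * iv u v) \<le> 1 * 1" using ivb[OF that] by (intro mult_mono) auto
      moreover have "0 \<le> (u * iv u v) * (v * iv u v)" using ivb[OF that] by simp
      ultimately have 1: "\<bar>v * iv u v - 3 * ((u * iv u v) * (v * iv u v))\<bar> \<le> 4"
        using ivb[OF that] by linarith
      have 2: "\<bar>(iv u v)\<^sup>2\<bar> \<le> (inverse u)\<^sup>2" using ivb[OF that] by (simp add: power_mono)
      show ?thesis unfolding abs_mult using 1 2 by (intro mult_mono) auto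
    qed
    finally show ?thesis .
  qed
  have wuvb: "\<bar>wuv u v\<bar> \<le> 20 * iv u v ^ 3" if "1 \<le> u" "1 \<le> v" for u v
  proof -
    have "wuv u v = (1 - 3 * (v * iv u v) - 3 * (u * iv u v) + 12 * ((u * iv u v) * (v * iv u v))) * iv u v ^ 3"
      by (simp add: wuv_def eval_nat_numeral algebra_simps)
    also have "\<bar>\<dots>\<bar> \<le> 20 * iv u v ^ 3"
    proof -
      have "(u * iv u v) * (v * iv u v) \<le> 1 * 1" using ivb[OF that] by (intro mult_mono) auto
      moreover have "0 \<le> (u * iv u v) * (v * iv u v)" using ivb[OF that] by simp
      ultimately have 1: "\<bar>1 - 3 * (v * iv u v) - 3 * (u * iv u v) + 12 * ((u * iv u v) * (v * iv u v))\<bar> \<le> 20"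
        using ivb[OF that] by linarith
      show ?thesis unfolding abs_mult using 1 ivb(1)[OF that] by (intro mult_mono) auto
    qed
    finally show ?thesis .
  qed
  \<comment> \<open>\<open>wt * P\<close> is differentiable in \<open>u\<close> and plays the part
    of \<open>A\<close> in \<open>AC_chain_rule\<close>, while the absolutely continuous
    \<open>\<Phi>\<close> plays that of \<open>G\<close>.\<close>
  have e1: "(LBINT u:?I. K (u, v) + R (u, v)) = wt U v * P U v * \<Phi> U v - wt 1 v * P 1 v * \<Phi> 1 v" if v: "v \<in> ?I" for v
  proof -
    have v1: "1 \<le> v" using v by simp
    have "(LBINT u:?I. (wu u v * P u v + wt u v * (- f (\<Phi> u v) / 4)) * \<Phi> u v + (wt u v * P u v) * 1 * Q u v)
        = (wt U v * P U v) * \<Phi> U v - (wt 1 v * P 1 v) * \<Phi> 1 v"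
    proof (rule AC_chain_rule(2)[OF U, where W = "\<lambda>y. y" and W' = "\<lambda>_. 1"])
      show "set_integrable lborel ?I (\<lambda>u. Q u v)" by (rule sw.P_line)
      show "\<Phi> x v = \<Phi> 1 v + (LBINT y:{1..x}. Q y v)" if "x \<in> ?I" for x
        using Phi_u[of 1 x v] that by simp
      show "((\<lambda>u. wt u v * P u v) has_real_derivative wu x v * P x v + wt x v * (- f (\<Phi> x v) / 4)) (at x within ?I)" if x: "x \<in> ?I" for x
      proof -
        have nz: "x + v \<noteq> 0" using x v by auto
        have "((\<lambda>u. wt u v) has_real_derivative wu x v) (at x within ?I)"
          unfolding wt_def wu_def using iv_deriv_u[OF nz]
          by (auto intro!: derivative_eq_intros simp: eval_nat_numeral algebra_simps)
        from DERIV_mult[OF this P_deriv] show ?thesis by (simp add: algebra_simps)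
      qed
      show "continuous_on ?I (\<lambda>u. wu u v * P u v + wt u v * (- f (\<Phi> u v) / 4))"
        unfolding wu_def wt_def by (intro continuous_intros cu[OF v1] P_cont f_Phi_cont) simp
    qed (auto intro!: continuous_intros)
    then show ?thesis by (simp add: K_def R_def algebra_simps)
  qed
  have e2: "(LBINT v:?I. L (u, v) + K (u, v)) = wu u U * ((\<Phi> u U)\<^sup>2 / 2) - wu u 1 * ((\<Phi> u 1)\<^sup>2 / 2)" if u: "u \<in> ?I" for u
  proof -
    have u1: "1 \<le> u" using u by simp
    have "(LBINT v:?I. wuv u v * ((\<Phi> u v)\<^sup>2 / 2) + wu u v * \<Phi> u v * P u v) = wu u U * ((\<Phi> u U)\<^sup>2 / 2) - wu u 1 * ((\<Phi> u 1)\<^sup>2 / 2)"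
    proof (rule AC_chain_rule(2)[OF U, where W = "\<lambda>y. y\<^sup>2 / 2" and W' = "\<lambda>y. y" and G = "\<lambda>v. \<Phi> u v"])
      show "set_integrable lborel ?I (\<lambda>v. P u v)" by (rule P_line)
      show "\<Phi> u x = \<Phi> u 1 + (LBINT y:{1..x}. P u y)" if "x \<in> ?I" for x
        using Phi_v[of 1 x u] that by simp
      show "((\<lambda>v. wu u v) has_real_derivative wuv u x) (at x within ?I)" if x: "x \<in> ?I" for x
      proof -
        have nz: "u + x \<noteq> 0" using x u by auto
        show ?thesis
          unfolding wu_def wuv_def using iv_deriv_v[OF nz]
          by (auto intro!: derivative_eq_intros simp: eval_nat_numeral algebra_simps)
      qed
      show "continuous_on ?I (\<lambda>v. wuv u v)"
        unfolding wuv_def by (intro continuous_intros cv[OF u1])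
    qed (auto intro!: continuous_intros derivative_eq_intros)
    then show ?thesis by (simp add: K_def L_def)
  qed
  have E1: "(LBINT z:?D. K z) + (LBINT z:?D. R z) = (LBINT v:?I. wt U v * P U v * \<Phi> U v - wt 1 v * P 1 v * \<Phi> 1 v)"
  proof -
    have i: "set_integrable lborel ?D (\<lambda>z. K z + R z)" by (rule set_integral_add(1)[OF iK iR])
    have "(LBINT z:?D. K z) + (LBINT z:?D. R z) = (LBINT z:?D. K z + R z)"
      using set_integral_add(2)[OF iK iR] by simp
    also have "\<dots> = (LBINT v:?I. LBINT u:?I. K (u, v) + R (u, v))"
      by (rule box_region_integral(1)[OF D i one kl one])
    also have "\<dots> = (LBINT v:?I. wt U v * P U v * \<Phi> U v - wt 1 v * P 1 v * \<Phi> 1 v)"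
      by (rule set_lebesgue_integral_cong) (use e1 in auto)
    finally show ?thesis .
  qed
  have E2: "(LBINT z:?D. L z) + (LBINT z:?D. K z) = (LBINT u:?I. wu u U * ((\<Phi> u U)\<^sup>2 / 2) - wu u 1 * ((\<Phi> u 1)\<^sup>2 / 2))"
  proof -
    have i: "set_integrable lborel ?D (\<lambda>z. L z + K z)" by (rule set_integral_add(1)[OF iL iK])
    have "(LBINT z:?D. L z) + (LBINT z:?D. K z) = (LBINT z:?D. L z + K z)"
      using set_integral_add(2)[OF iL iK] by simp
    also have "\<dots> = (LBINT u:?I. LBINT v:?I. L (u, v) + K (u, v))"
      by (rule box_region_integral(2)[OF D i one kl one])
    also have "\<dots> = (LBINT u:?I. wu u U * ((\<Phi> u U)\<^sup>2 / 2) - wu u 1 * ((\<Phi> u 1)\<^sup>2 / 2))"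
      by (rule set_lebesgue_integral_cong) (use e2 in auto)
    finally show ?thesis .
  qed
  have iinv: "set_integrable lborel ?I (\<lambda>x. (inverse x)\<^sup>2)"
    by (intro borel_integrable_atLeastAtMost' continuous_intros) auto
  have b1: "\<bar>LBINT v:?I. wt c v * P c v * \<Phi> c v\<bar> \<le> M * (1 + EP)" and b1i: "set_integrable lborel ?I (\<lambda>v. wt c v * P c v * \<Phi> c v)" if c1: "1 \<le> c" for c
  proof -
    have "set_integrable lborel ?I (\<lambda>v. (wt c v * \<Phi> c v) * P c v)"
      by (rule set_integrable_continuous_mult[OF P_line]) (auto simp: wt_def intro!: continuous_intros cv c1 Phi_cont')
    then show i: "set_integrable lborel ?I (\<lambda>v. wt c v * P c v * \<Phi> c v)" by (simp add: mult_ac)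
    have iP2: "set_integrable lborel ?I (\<lambda>v. (P c v)\<^sup>2)" by (intro P_sq_line continuous_intros)
    have s: "set_integrable lborel ?I (\<lambda>v. M * ((inverse v)\<^sup>2 + (P c v)\<^sup>2))"
      using set_integral_add(1)[OF iinv iP2] by simp
    have "\<bar>LBINT v:?I. wt c v * P c v * \<Phi> c v\<bar> \<le> (LBINT v:?I. M * ((inverse v)\<^sup>2 + (P c v)\<^sup>2))"
    proof (rule LBINT_abs_le[OF i s])
      fix v assume v: "v \<in> ?I"
      have "\<bar>wt c v * P c v * \<Phi> c v\<bar> \<le> inverse v * \<bar>P c v\<bar> * M"
        unfolding abs_mult using wtb[OF c1, of v] v M M0 by (intro mult_mono) auto
      moreover have "inverse v * \<bar>P c v\<bar> \<le> (inverse v)\<^sup>2 + (P c v)\<^sup>2"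
      proof -
        have "2 * (inverse v * \<bar>P c v\<bar>) \<le> (inverse v)\<^sup>2 + (P c v)\<^sup>2"
          using sum_squares_bound[of "inverse v" "\<bar>P c v\<bar>"] by (simp add: mult.assoc)
        moreover have "0 \<le> inverse v * \<bar>P c v\<bar>" using v by simp
        ultimately show ?thesis by linarith
      qed
      then have "inverse v * \<bar>P c v\<bar> * M \<le> ((inverse v)\<^sup>2 + (P c v)\<^sup>2) * M" using M0 by (rule mult_right_mono)
      ultimately show "\<bar>wt c v * P c v * \<Phi> c v\<bar> \<le> M * ((inverse v)\<^sup>2 + (P c v)\<^sup>2)" by (simp add: mult.commute)
    qed
    also have "\<dots> = M * ((LBINT v:?I. (inverse v)\<^sup>2) + (LBINT v:?I. (P c v)\<^sup>2))"
      using set_integral_add(2)[OF iinv iP2] by simp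
    also have "\<dots> \<le> M * (1 + EP)"
      using inverse_square_integral[OF U] flux_P_le[of 0 c 1 U] c1 M0 by (intro mult_left_mono add_mono) auto
    finally show "\<bar>LBINT v:?I. wt c v * P c v * \<Phi> c v\<bar> \<le> M * (1 + EP)" .
  qed
  have b2: "\<bar>LBINT u:?I. wu u c * ((\<Phi> u c)\<^sup>2 / 2)\<bar> \<le> 2 * M\<^sup>2" and b2i: "set_integrable lborel ?I (\<lambda>u. wu u c * ((\<Phi> u c)\<^sup>2 / 2))" if c1: "1 \<le> c" for c
  proof -
    show i: "set_integrable lborel ?I (\<lambda>u. wu u c * ((\<Phi> u c)\<^sup>2 / 2))"
      unfolding wu_def by (intro borel_integrable_atLeastAtMost' continuous_intros cu[OF c1] Phi_cont') simp
    have s: "set_integrable lborel ?I (\<lambda>u. (2 * M\<^sup>2) * (inverse u)\<^sup>2)" using iinv by simp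
    have "\<bar>LBINT u:?I. wu u c * ((\<Phi> u c)\<^sup>2 / 2)\<bar> \<le> (LBINT u:?I. (2 * M\<^sup>2) * (inverse u)\<^sup>2)"
    proof (rule LBINT_abs_le[OF i s])
      fix u assume u: "u \<in> ?I"
      have "(\<Phi> u c)\<^sup>2 \<le> M\<^sup>2" using M[of u c] M0 by (metis abs_le_square_iff abs_of_nonneg)
      then have "\<bar>wu u c * ((\<Phi> u c)\<^sup>2 / 2)\<bar> \<le> (4 * (inverse u)\<^sup>2) * (M\<^sup>2 / 2)"
        unfolding abs_mult using wub[of u c] u c1 by (intro mult_mono) auto
      then show "\<bar>wu u c * ((\<Phi> u c)\<^sup>2 / 2)\<bar> \<le> (2 * M\<^sup>2) * (inverse u)\<^sup>2" by simp
    qed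
    also have "\<dots> \<le> 2 * M\<^sup>2 * 1"
      unfolding set_integral_mult_right using inverse_square_integral[OF U] by (intro mult_left_mono) auto
    finally show "\<bar>LBINT u:?I. wu u c * ((\<Phi> u c)\<^sup>2 / 2)\<bar> \<le> 2 * M\<^sup>2" by simp
  qed
  have b3: "\<bar>LBINT z:?D. L z\<bar> \<le> 10 * M\<^sup>2"
  proof -
    have ic: "set_integrable lborel ?D (\<lambda>z. iv (fst z) (snd z) ^ 3)" by (intro icont continuous_intros c)
    have s: "set_integrable lborel ?D (\<lambda>z. (10 * M\<^sup>2) * iv (fst z) (snd z) ^ 3)" using ic by simp
    have "\<bar>LBINT z:?D. L z\<bar> \<le> (LBINT z:?D. (10 * M\<^sup>2) * iv (fst z) (snd z) ^ 3)"
    proof (rule LBINT_abs_le[OF iL s])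
      fix z assume z: "z \<in> ?D"
      have "(\<Phi> (fst z) (snd z))\<^sup>2 \<le> M\<^sup>2" using M[of "fst z" "snd z"] M0 by (metis abs_le_square_iff abs_of_nonneg)
      then have "\<bar>L z\<bar> \<le> (20 * iv (fst z) (snd z) ^ 3) * (M\<^sup>2 / 2)"
        unfolding L_def abs_mult using wuvb[of "fst z" "snd z"] ivb(1)[of "fst z" "snd z"] z
        by (intro mult_mono) (auto simp: less_imp_le)
      then show "\<bar>L z\<bar> \<le> (10 * M\<^sup>2) * iv (fst z) (snd z) ^ 3" by simp
    qed
    also have "(LBINT z:?D. (10 * M\<^sup>2) * iv (fst z) (snd z) ^ 3) = (10 * M\<^sup>2) * (LBINT z:?D. iv (fst z) (snd z) ^ 3)"
      by simp
    also have "(LBINT z:?D. iv (fst z) (snd z) ^ 3) = (LBINT u:?I. LBINT v:?I. iv u v ^ 3)"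
      using box_region_integral(2)[OF D ic one kl one] by simp
    also have "\<dots> \<le> (LBINT u:?I. (inverse u)\<^sup>2)"
    proof -
      have e: "(LBINT v:?I. iv u v ^ 3) = (iv u 1)\<^sup>2 / 2 - (iv u U)\<^sup>2 / 2" if u: "u \<in> ?I" for u
      proof -
        have "(LBINT v:?I. iv u v ^ 3) = - (iv u U)\<^sup>2 / 2 - (- (iv u 1)\<^sup>2 / 2)"
        proof (rule LBINT_FTC[OF U])
          show "((\<lambda>v. - (iv u v)\<^sup>2 / 2) has_real_derivative iv u v ^ 3) (at v within ?I)" if v: "v \<in> ?I" for v
          proof -
            have nz: "u + v \<noteq> 0" using u v by auto
            show ?thesis using iv_deriv_v[OF nz]
              by (auto intro!: derivative_eq_intros simp: eval_nat_numeral algebra_simps)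
          qed
          show "continuous_on ?I (\<lambda>v. iv u v ^ 3)" using u by (intro continuous_intros cv) auto
        qed
        then show ?thesis by simp
      qed
      have i: "set_integrable lborel ?I (\<lambda>u. (iv u 1)\<^sup>2 / 2 - (iv u U)\<^sup>2 / 2)"
        using U by (intro borel_integrable_atLeastAtMost' continuous_intros cu) auto
      have "(LBINT u:?I. LBINT v:?I. iv u v ^ 3) = (LBINT u:?I. (iv u 1)\<^sup>2 / 2 - (iv u U)\<^sup>2 / 2)"
        by (rule set_lebesgue_integral_cong) (use e in auto)
      also have "\<dots> \<le> (LBINT u:?I. (inverse u)\<^sup>2)"
      proof (rule set_integral_mono[OF i iinv])
        fix u assume u: "u \<in> ?I"
        have "(iv u 1)\<^sup>2 \<le> (inverse u)\<^sup>2" using ivb[of u 1] u by (intro power_mono) auto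
        moreover have "0 \<le> (iv u U)\<^sup>2" "0 \<le> (iv u 1)\<^sup>2" by simp_all
        ultimately show "(iv u 1)\<^sup>2 / 2 - (iv u U)\<^sup>2 / 2 \<le> (inverse u)\<^sup>2" by linarith
      qed
      finally show ?thesis .
    qed
    also have "\<dots> \<le> 1" by (rule inverse_square_integral[OF U])
    finally show ?thesis by (simp add: mult_left_mono)
  qed
  have E1': "(LBINT z:?D. K z) + (LBINT z:?D. R z) = (LBINT v:?I. wt U v * P U v * \<Phi> U v) - (LBINT v:?I. wt 1 v * P 1 v * \<Phi> 1 v)"
    unfolding E1 by (rule set_integral_diff(2)[OF b1i[OF U] b1i[OF one]])
  have E2': "(LBINT z:?D. L z) + (LBINT z:?D. K z) = (LBINT u:?I. wu u U * ((\<Phi> u U)\<^sup>2 / 2)) - (LBINT u:?I. wu u 1 * ((\<Phi> u 1)\<^sup>2 / 2))"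
    unfolding E2 by (rule set_integral_diff(2)[OF b2i[OF U] b2i[OF one]])
  \<comment> \<open>The first integration contributes two sides with \<open>M * (1 + EP)\<close>
    each; the coefficient of \<open>M\<^sup>2\<close> is \<open>14 = 2 + 2 + 10\<close>, from the
    two sides of the second integration and from \<open>L\<close>.\<close>
  have "\<bar>LBINT z:?D. R z\<bar> \<le> 2 * (M * (1 + EP)) + 14 * M\<^sup>2"
    using E1' E2' b1[OF U] b1[OF one] b2[OF U] b2[OF one] b3 by linarith
  then show "\<bar>LBINT z:?D. wt (fst z) (snd z) * (P (fst z) (snd z) * Q (fst z) (snd z))
          - wt (fst z) (snd z) * (\<Phi> (fst z) (snd z) * f (\<Phi> (fst z) (snd z))) / 4\<bar> \<le> 2 * M * (1 + EP) + 14 * M\<^sup>2"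
    by (simp add: R_def mult.assoc)
qed

text \<open>Twice the square of \<open>v \<Phi>\<^sub>v - u \<Phi>\<^sub>u\<close>, weighted by \<open>(u + v)\<^sup>-\<^sup>3\<close>, has nonnegative integral. Its
  three terms are given by the three preceding estimates, and the potential enters with the total
  factor \<open>\<kappa> - 2\<close>.\<close>

lemma weighted_potential_bound:
  assumes U: "1 \<le> U" and M: "\<And>u v. \<bar>\<Phi> u v\<bar> \<le> M"
    and hom: "\<And>y. y * f y = \<kappa> * V y"
  shows "(\<kappa> - 2) * (LBINT z:{1..U} \<times> {1..U}. wt (fst z) (snd z) * V (\<Phi> (fst z) (snd z)))
     \<le> 4 * EP + 4 * EQ + 4 * (2 * M * (1 + EP) + 14 * M\<^sup>2)"
proof -
  let ?I = "{1..U}" let ?D = "?I \<times> ?I"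
  have cD: "compact ?D" by (intro compact_Times compact_Icc)
  have c: "continuous_on ?D (\<lambda>z. iv (fst z) (snd z))"
    by (rule iv_cont) (auto intro!: continuous_intros)
  define wV where "wV z = wt (fst z) (snd z) * V (\<Phi> (fst z) (snd z))" for z
  define wPQ where "wPQ z = wt (fst z) (snd z) * (P (fst z) (snd z) * Q (fst z) (snd z))" for z
  define X1 where "X1 z = 2 * (snd z)\<^sup>2 * iv (fst z) (snd z) ^ 3 * (P (fst z) (snd z))\<^sup>2 - wV z" for z
  define X2 where "X2 z = 2 * (fst z)\<^sup>2 * iv (fst z) (snd z) ^ 3 * (Q (fst z) (snd z))\<^sup>2 - wV z" for z
  have iV: "set_integrable lborel ?D wV"
    unfolding set_integrable_def wV_def wt_def
    by (intro borel_integrable_compact cD continuous_intros c V_Phi_cont)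
  have iPQ: "set_integrable lborel ?D wPQ" unfolding wPQ_def by (rule mixed_bound(1)[OF U M])
  have i1: "set_integrable lborel ?D X1" and b1: "\<bar>LBINT z:?D. X1 z\<bar> \<le> 4 * EP"
    unfolding X1_def wV_def by (rule weighted_one_side[OF U])+
  have i2: "set_integrable lborel ?D X2" and b2: "\<bar>LBINT z:?D. X2 z\<bar> \<le> 4 * EQ"
    unfolding X2_def wV_def by (rule weighted_other_side[OF U])+
  have iV': "set_integrable lborel ?D (\<lambda>z. \<kappa> / 4 * wV z)" using iV by simp
  have "(LBINT z:?D. wPQ z - \<kappa> / 4 * wV z) = (LBINT z:?D. wPQ z) - \<kappa> / 4 * (LBINT z:?D. wV z)"
    using set_integral_diff(2)[OF iPQ iV'] by simp
  moreover have "\<bar>LBINT z:?D. wPQ z - \<kappa> / 4 * wV z\<bar> \<le> 2 * M * (1 + EP) + 14 * M\<^sup>2"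
    using mixed_bound(2)[OF U M] by (simp add: wPQ_def wV_def hom mult_ac)
  ultimately have b3: "\<bar>(LBINT z:?D. wPQ z) - \<kappa> / 4 * (LBINT z:?D. wV z)\<bar> \<le> 2 * M * (1 + EP) + 14 * M\<^sup>2"
    by simp
  have i4: "set_integrable lborel ?D (\<lambda>z. 4 * wPQ z)" "set_integrable lborel ?D (\<lambda>z. 2 * wV z)" using iPQ iV by simp_all
  have "(LBINT z:?D. 4 * wPQ z - 2 * wV z) \<le> (LBINT z:?D. X1 z + X2 z)"
  proof (rule set_integral_mono[OF set_integral_diff(1)[OF i4] set_integral_add(1)[OF i1 i2]])
    fix z assume z: "z \<in> ?D"
    let ?u = "fst z" let ?v = "snd z"
    have "0 \<le> 2 * iv ?u ?v ^ 3 * (?v * P ?u ?v - ?u * Q ?u ?v)\<^sup>2"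
      using iv_bounds(1)[of ?u ?v] z by auto
    then show "4 * wPQ z - 2 * wV z \<le> X1 z + X2 z"
      by (simp add: X1_def X2_def wPQ_def wt_def power2_eq_square algebra_simps)
  qed
  then have "4 * (LBINT z:?D. wPQ z) - 2 * (LBINT z:?D. wV z) \<le> (LBINT z:?D. X1 z) + (LBINT z:?D. X2 z)"
    using set_integral_diff(2)[OF i4] set_integral_add(2)[OF i1 i2] by simp
  then show ?thesis
    unfolding wV_def[symmetric] left_diff_distrib using b1 b2 b3 by argo
qed

end

section \<open>Decay of the potential energy\<close>

lemma set_integrable_of_integrable:
  fixes g :: "'a::euclidean_space \<Rightarrow> real"
  assumes "integrable lborel g" "S \<in> sets borel"
  shows "set_integrable lborel S g"
  unfolding set_integrable_def by (rule integrable_mult_indicator) (use assms in auto)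

lemma tail_tendsto_0:
  fixes g :: "real \<Rightarrow> real"
  assumes "integrable lborel g"
  shows "((\<lambda>a. LBINT x:{a..}. g x) \<longlongrightarrow> 0) at_top" and "((\<lambda>a. LBINT x:{..- a}. g x) \<longlongrightarrow> 0) at_top"
proof -
  have m: "set_borel_measurable lborel S g" if "S \<in> sets borel" for S
    using assms that by (auto simp: set_borel_measurable_def)
  have 0: "((\<lambda>a. indicator (S a) x *\<^sub>R g x) \<longlongrightarrow> 0) at_top" if "\<And>a. \<bar>x\<bar> < a \<Longrightarrow> x \<notin> S a" for S x
  proof (rule tendsto_eventually)
    show "\<forall>\<^sub>F a in at_top. indicator (S a) x *\<^sub>R g x = 0"
      using eventually_gt_at_top[of "\<bar>x\<bar>"] by eventually_elim (simp add: that)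
  qed
  have "((\<lambda>a. LBINT x:S a. g x) \<longlongrightarrow> (\<integral>x. 0 \<partial>(lborel :: real measure))) at_top"
    if "\<And>a. S a \<in> sets borel" "\<And>a x. \<bar>x\<bar> < a \<Longrightarrow> x \<notin> S a" for S :: "real \<Rightarrow> real set"
    unfolding set_lebesgue_integral_def
  proof (rule integral_dominated_convergence_at_top[where f = "\<lambda>_. 0" and s = "\<lambda>a x. indicator (S a) x *\<^sub>R g x" and w = "\<lambda>x. \<bar>g x\<bar>"])
    show "\<forall>\<^sub>F a in at_top. AE x in lborel. norm (indicator (S a) x *\<^sub>R g x) \<le> \<bar>g x\<bar>"
      by (intro always_eventually allI AE_I2) (auto simp: indicator_def)
  qed (use assms that 0 m[unfolded set_borel_measurable_def] in auto)
  from this[of "\<lambda>a. {a..}"] this[of "\<lambda>a. {..- a}"]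
  show "((\<lambda>a. LBINT x:{a..}. g x) \<longlongrightarrow> 0) at_top" "((\<lambda>a. LBINT x:{..- a}. g x) \<longlongrightarrow> 0) at_top"
    by force+
qed

lemma LBINT_mono_set:
  fixes g :: "'a::euclidean_space \<Rightarrow> real"
  assumes "set_integrable lborel T g" "\<And>x. 0 \<le> g x" "S \<in> sets borel" "S \<subseteq> T"
  shows "(LBINT x:S. g x) \<le> (LBINT x:T. g x)"
proof -
  have "set_integrable lborel S g" using assms by (intro set_integrable_subset[OF assms(1)]) auto
  then show ?thesis
    using assms unfolding set_lebesgue_integral_def set_integrable_def
    by (intro integral_mono) (auto simp: indicator_def)
qed

context finite_energy
begin

lemma wt_nonneg: "1 \<le> u \<Longrightarrow> 1 \<le> v \<Longrightarrow> 0 \<le> wt u v"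
  using iv_bounds(1)[of u v] by (simp add: wt_def)

lemma wV_int:
  assumes "1 \<le> a" "1 \<le> c"
  shows "set_integrable lborel ({a..b} \<times> {c..d}) (\<lambda>z. wt (fst z) (snd z) * V (\<Phi> (fst z) (snd z)))"
  unfolding set_integrable_def wt_def using assms
  by (intro borel_integrable_compact compact_Times compact_Icc continuous_intros iv_cont V_Phi_cont) auto

text \<open>The flux of the potential through a line \<open>v = const\<close> is averaged over that line's position, which
  turns it into a space-time integral. The weight is at least of order \<open>\<delta> / T\<close> on the part with
  \<open>u \<ge> \<delta> * T\<close>; the remaining part is bounded by the energy of the data.\<close>

lemma averaged_lag:
  assumes \<delta>: "0 < \<delta>" "\<delta> \<le> 1" and T: "2 \<le> \<delta> * T" and X: "T \<le> X"
  shows "(LBINT v:{T..X}. eP T v) \<le> (LBINT v:{T/2..}. eP 0 v) + 2 * (LBINT u:{..- (\<delta> * T)}. charsol.eP f V (\<lambda>u v. \<Phi> v u) q 0 u)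
    + 4 * \<delta> * EQ + 54 / \<delta> * ((LBINT z:{1..2*T} \<times> {1..2*T}. wt (fst z) (snd z) * V (\<Phi> (fst z) (snd z)))
       - (LBINT z:{1..\<delta>*T/2} \<times> {1..\<delta>*T/2}. wt (fst z) (snd z) * V (\<Phi> (fst z) (snd z))))"
proof -
  interpret sw: finite_energy f V "\<lambda>u v. \<Phi> v u" q p by (rule swap')
  let ?eQ = "sw.eP"
  have "\<delta> * T \<le> 1 * T"
  proof -
    have "0 < \<delta> * T" using T by simp
    then have "0 < T" using \<delta>(1) by (simp add: zero_less_mult_iff)
    then show ?thesis using \<delta>(2) by (intro mult_right_mono) auto
  qed
  then have T2: "2 \<le> T" using T by simp
  define S where "S = (LBINT v:{T..X}. eP T v)"
  define a1 where "a1 = (LBINT v:{T/2..}. eP 0 v)"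
  define lQ where "lQ = (LBINT u:{..- (\<delta> * T)}. ?eQ 0 u)"
  let ?h = "\<lambda>v u. V (\<Phi> u v)"
  have hc: "continuous_on UNIV (?h v)" for v by (intro V_Phi_cont continuous_intros)
  have hn: "0 \<le> ?h v u" for u v by (rule V_nonneg)
  \<comment> \<open>The line \<open>v = const\<close> from the data at \<open>u = - v\<close> up to
    \<open>u = 2 * T\<close> is cut at the light cone \<open>u = 0\<close> and at
    \<open>u = \<delta> * T\<close>: outside the cone, near it, and well inside, where alone the
    weight \<open>wt\<close> is of use.\<close>
  define g1 where "g1 v = oint (- v) 0 (?h v)" for v
  define g2 where "g2 v = oint 0 (\<delta> * T) (?h v)" for v
  define g3 where "g3 v = oint (\<delta> * T) (2 * T) (?h v)" for v
  have "continuous_on UNIV (\<lambda>z::real \<times> real. V (\<Phi> (snd z) (fst z)))" by (intro V_Phi_cont continuous_intros)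
  then have hc2: "continuous_on UNIV (\<lambda>(v, u). ?h v u)" by (simp add: case_prod_unfold)
  have g1c: "continuous_on UNIV g1" and g2c: "continuous_on UNIV g2" and g3c: "continuous_on UNIV g3"
    unfolding g1_def g2_def g3_def by (intro continuous_oint hc2 continuous_intros)+
  have gi: "set_integrable lborel {a..b} g" if "continuous_on UNIV g" for g :: "real \<Rightarrow> real" and a b
    by (intro borel_integrable_atLeastAtMost' continuous_on_subset[OF that]) auto
  \<comment> \<open>Since \<open>v \<ge> T/2\<close>, the energy that is already beyond the line at
    time 0 belongs to the tail \<open>a1\<close> of the data.\<close>
  have step: "S \<le> a1 + (g1 v + g2 v + g3 v) / 2" if v: "v \<in> {T/2..T}" for v
  proof -
    have "S \<le> (LBINT x:{v..X}. eP T x)"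
      unfolding S_def by (rule LBINT_mono_set[OF eP_int]) (use v eP_nonneg in auto)
    also have "\<dots> \<le> (LBINT x:{v..X}. eP 0 x) + (LBINT u:{2*0-v..2*T-v}. V (\<Phi> u v)) / 2"
      by (rule lag) (use v X T2 in auto)
    also have "(LBINT x:{v..X}. eP 0 x) \<le> a1"
      unfolding a1_def using eP_nonneg v
      by (intro LBINT_mono_set set_integrable_of_integrable eP0) auto
    also have "(LBINT u:{2*0-v..2*T-v}. V (\<Phi> u v)) \<le> (LBINT u:{-v..2*T}. V (\<Phi> u v))"
      by (rule LBINT_mono_set[OF V_line hn]) (use v T2 in auto)
    also have "\<dots> = oint (-v) (2*T) (?h v)"
      by (rule oint_eq_LBINT[OF hc]) (use v T2 in auto)
    also have "\<dots> = g1 v + g2 v + g3 v"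
      unfolding g1_def g2_def g3_def by (simp add: oint_combine[OF hc])
    finally show ?thesis by simp
  qed
  have "S * (T / 2) = (LBINT v:{T/2..T}. S)"
    using T2 by (simp add: set_integral_const)
  also have "\<dots> \<le> (LBINT v:{T/2..T}. a1 + (g1 v + g2 v + g3 v) / 2)"
    by (rule set_integral_mono[OF gi gi]) (auto intro!: continuous_intros g1c g2c g3c step)
  also have "\<dots> = (LBINT v:{T/2..T}. a1) + ((LBINT v:{T/2..T}. g1 v) + (LBINT v:{T/2..T}. g2 v) + (LBINT v:{T/2..T}. g3 v)) / 2"
    using gi[OF continuous_on_const[of UNIV a1]] gi[OF g1c] gi[OF g2c] gi[OF g3c] by simp
  also have "(LBINT v:{T/2..T}. a1) = a1 * (T / 2)"
    using T2 by (simp add: set_integral_const)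
  finally have main: "S * (T / 2) \<le> a1 * (T / 2) + ((LBINT v:{T/2..T}. g1 v) + (LBINT v:{T/2..T}. g2 v) + (LBINT v:{T/2..T}. g3 v)) / 2" .
  have Vbox: "set_integrable lborel ({a..b} \<times> {c..d}) (\<lambda>z. V (\<Phi> (fst z) (snd z)))" for a b c d
    unfolding set_integrable_def by (intro borel_integrable_compact compact_Times compact_Icc V_Phi_cont continuous_intros)
  \<comment> \<open>With the order of integration exchanged, the flux runs along lines
    \<open>u = const\<close> and is bounded by the other half of the energy on the slice of time 0.
    For \<open>u < - (\<delta> * T)\<close> only the tail \<open>lQ\<close> is met; the remaining
    lines fill a width \<open>\<delta> * T\<close> and cost at most \<open>2 * EQ\<close>
    each.\<close>
  have b1: "(LBINT v:{T/2..T}. g1 v) \<le> 2 * T * lQ + 2 * \<delta> * T * EQ"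
  proof -
    define D where "D = {(u, v). - T \<le> u \<and> u \<le> 0 \<and> T/2 \<le> v \<and> v \<le> T \<and> - v \<le> u}"
    have Db: "D \<in> sets lborel"
    proof -
      have "D = ({-T..0} \<times> {T/2..T}) \<inter> {z. - snd z \<le> fst z}" by (auto simp: D_def)
      moreover have "closed {z::real\<times>real. - snd z \<le> fst z}" by (intro closed_Collect_le continuous_intros)
      ultimately have "closed D" by (auto intro!: closed_Int closed_Times)
      then show ?thesis by simp
    qed
    have DV: "set_integrable lborel D (\<lambda>z. V (\<Phi> (fst z) (snd z)))"
      by (rule set_integrable_subset[OF Vbox[of "- T" 0 "T/2" T] Db]) (auto simp: D_def)
    have "(LBINT v:{T/2..T}. g1 v) = (LBINT v:{T/2..T}. LBINT u:{-v..0}. V (\<Phi> u v))"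
      by (rule set_lebesgue_integral_cong) (use T2 in \<open>auto simp: g1_def oint_eq_LBINT[OF hc]\<close>)
    also have "\<dots> = (LBINT z:D. V (\<Phi> (fst z) (snd z)))"
      using T2 by (subst box_region_integral(1)[where k = "\<lambda>v. - v" and l = "\<lambda>u. max (T/2) (- u)" and ?u0.0 = "- T" and ?u1.0 = 0 and ?v0.0 = "T/2" and ?v1.0 = T, OF D_def DV]) auto
    also have "\<dots> = (LBINT u:{-T..0}. LBINT v:{max (T/2) (-u)..T}. V (\<Phi> u v))"
      using T2 by (subst box_region_integral(2)[where k = "\<lambda>v. - v" and l = "\<lambda>u. max (T/2) (- u)" and ?u0.0 = "- T" and ?u1.0 = 0 and ?v0.0 = "T/2" and ?v1.0 = T, OF D_def DV]) auto
    also have "\<dots> = (LBINT u:{-T..0}. oint (max (T/2) (-u)) T (\<lambda>v. V (\<Phi> u v)))"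
      by (rule set_lebesgue_integral_cong) (use T2 in \<open>auto simp: oint_eq_LBINT V_Phi_cont continuous_on_id\<close>)
    also have "\<dots> \<le> (LBINT u:{-T..0}. 2 * lQ + 2 * EQ * indicator {-(\<delta>*T)..0} u)"
    proof (rule set_integral_mono)
      have "continuous_on UNIV (\<lambda>(u, v). V (\<Phi> u v))" unfolding case_prod_unfold by (intro V_Phi_cont continuous_intros)
      then show "set_integrable lborel {-T..0} (\<lambda>u. oint (max (T/2) (-u)) T (\<lambda>v. V (\<Phi> u v)))"
        by (intro gi continuous_oint continuous_intros)
      show "set_integrable lborel {-T..0} (\<lambda>u. 2 * lQ + 2 * EQ * indicator {-(\<delta>*T)..0} u)"
      proof (intro set_integral_add(1))
        show "set_integrable lborel {-T..0} (\<lambda>u. 2 * lQ)" by (intro gi continuous_intros)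
        show "set_integrable lborel {-T..0} (\<lambda>u. 2 * EQ * indicator {-(\<delta>*T)..0} u)"
          by (intro set_integrable_of_integrable integrable_mult_right) (auto simp: integrable_indicator_iff emeasure_lborel_Icc_eq)
      qed
      fix u assume u: "u \<in> {-T..0}"
      have "oint (max (T/2) (-u)) T (\<lambda>v. V (\<Phi> u v)) = (LBINT v:{max (T/2) (-u)..T}. V (\<Phi> u v))"
        by (rule oint_eq_LBINT[symmetric]) (use u T2 in \<open>auto intro!: V_Phi_cont continuous_intros\<close>)
      also have "\<dots> \<le> (LBINT v:{2*0-u..T}. V (\<Phi> u v))"
        by (rule LBINT_mono_set[OF sw.V_line]) (use u V_nonneg in auto)
      also have "\<dots> \<le> 2 * (LBINT y:{2*0-T..u}. ?eQ 0 y)"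
        by (rule sw.flux_V) (use u in auto)
      finally have le: "oint (max (T/2) (-u)) T (\<lambda>v. V (\<Phi> u v)) \<le> 2 * (LBINT y:{2*0-T..u}. ?eQ 0 y)" .
      have lQ0: "0 \<le> lQ" unfolding lQ_def by (intro LBINT_nonneg sw.eP_nonneg)
      show "oint (max (T/2) (-u)) T (\<lambda>v. V (\<Phi> u v)) \<le> 2 * lQ + 2 * EQ * indicator {-(\<delta>*T)..0} u"
      proof (cases "u < - (\<delta> * T)")
        case True
        have "(LBINT y:{2*0-T..u}. ?eQ 0 y) \<le> lQ"
          unfolding lQ_def using sw.eP_nonneg True
          by (intro LBINT_mono_set set_integrable_of_integrable eQ0) auto
        then show ?thesis using le EP_nonneg by (simp add: indicator_def)
      next
        case False
        have "(LBINT y:{2*0-T..u}. ?eQ 0 y) \<le> EQ"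
          unfolding EQ_def by (rule LBINT_le_integral) (use eQ0 sw.eP_nonneg in auto)
        then show ?thesis using le lQ0 False u by (simp add: indicator_def)
      qed
    qed
    also have "\<dots> = 2 * T * lQ + 2 * \<delta> * T * EQ"
    proof -
      have "indicator {-T..0} u *\<^sub>R (2 * lQ + 2 * EQ * indicator {-(\<delta>*T)..0} u) = 2 * lQ * indicator {-T..0} u + 2 * EQ * indicator {-(\<delta>*T)..0} u" for u
        using \<open>\<delta> * T \<le> 1 * T\<close> by (auto simp: indicator_def)
      then have "(LBINT u:{-T..0}. 2 * lQ + 2 * EQ * indicator {-(\<delta>*T)..0} u)
         = (\<integral>u. 2 * lQ * indicator {-T..0} u + 2 * EQ * indicator {-(\<delta>*T)..0} u \<partial>lborel)"
        unfolding set_lebesgue_integral_def by simp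
      also have "\<dots> = 2 * lQ * T + 2 * EQ * (\<delta> * T)"
        using T2 T by (subst Bochner_Integration.integral_add) (auto simp: emeasure_lborel_Icc_eq)
      finally show ?thesis by (simp add: mult_ac)
    qed
    finally show ?thesis .
  qed
  have one: "(a \<le> x) = (c \<le> y)" if "x \<in> {a..b}" "y \<in> {c..d}" for a b c d x y :: real using that by simp
  have dbl: "(LBINT v:{c..d}. oint a b (?h v)) = (LBINT z:{a..b} \<times> {c..d}. V (\<Phi> (fst z) (snd z)))"
    "(LBINT z:{a..b} \<times> {c..d}. V (\<Phi> (fst z) (snd z))) = (LBINT u:{a..b}. LBINT v:{c..d}. V (\<Phi> u v))"
    if "a \<le> b" for a b c d
  proof -
    have D: "{a..b} \<times> {c..d} = {(u, v). a \<le> u \<and> u \<le> b \<and> c \<le> v \<and> v \<le> d \<and> a \<le> u}" by auto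
    have "(LBINT v:{c..d}. oint a b (?h v)) = (LBINT v:{c..d}. LBINT u:{a..b}. V (\<Phi> u v))"
      using that by (simp add: oint_eq_LBINT[OF hc])
    then show "(LBINT v:{c..d}. oint a b (?h v)) = (LBINT z:{a..b} \<times> {c..d}. V (\<Phi> (fst z) (snd z)))"
      using box_region_integral(1)[OF D Vbox, of "\<lambda>_. c"] by simp
    show "(LBINT z:{a..b} \<times> {c..d}. V (\<Phi> (fst z) (snd z))) = (LBINT u:{a..b}. LBINT v:{c..d}. V (\<Phi> u v))"
      using box_region_integral(2)[OF D Vbox, of "\<lambda>_. c"] by simp
  qed
  \<comment> \<open>Near the cone no smallness of the flux is available; only the width
    \<open>\<delta> * T\<close> of the layer is small compared with \<open>T\<close>.\<close>
  have b2: "(LBINT v:{T/2..T}. g2 v) \<le> 2 * \<delta> * T * EQ"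
  proof -
    have "(LBINT v:{T/2..T}. g2 v) = (LBINT u:{0..\<delta>*T}. LBINT v:{T/2..T}. V (\<Phi> u v))"
      unfolding g2_def using T by (simp add: dbl)
    also have "\<dots> = (LBINT u:{0..\<delta>*T}. oint (T/2) T (\<lambda>v. V (\<Phi> u v)))"
      by (rule set_lebesgue_integral_cong) (use T2 in \<open>auto simp: oint_eq_LBINT V_Phi_cont continuous_on_id\<close>)
    also have "\<dots> \<le> (LBINT u:{0..\<delta>*T}. 2 * EQ)"
    proof (rule set_integral_mono)
      have "continuous_on UNIV (\<lambda>(u, v). V (\<Phi> u v))" unfolding case_prod_unfold by (intro V_Phi_cont continuous_intros)
      then show "set_integrable lborel {0..\<delta>*T} (\<lambda>u. oint (T/2) T (\<lambda>v. V (\<Phi> u v)))"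
        by (intro gi continuous_oint continuous_intros)
      fix u assume u: "u \<in> {0..\<delta>*T}"
      have "oint (T/2) T (\<lambda>v. V (\<Phi> u v)) = (LBINT v:{T/2..T}. V (\<Phi> u v))"
        by (rule oint_eq_LBINT[symmetric]) (use u T2 in \<open>auto intro!: V_Phi_cont continuous_intros\<close>)
      also have "\<dots> \<le> 2 * sw.EP" by (rule sw.flux_V_le[where t = 0]) (use u T2 in auto)
      finally show "oint (T/2) T (\<lambda>v. V (\<Phi> u v)) \<le> 2 * EQ" by (simp add: sw.EP_def EQ_def)
    qed (intro gi continuous_intros)
    also have "\<dots> = 2 * \<delta> * T * EQ"
      using T by (simp add: set_integral_const)
    finally show ?thesis .
  qed
  let ?wV = "\<lambda>z. wt (fst z) (snd z) * V (\<Phi> (fst z) (snd z))"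
  let ?A = "{\<delta>*T..2*T} \<times> {T/2..T}" let ?B = "{1..2*T} \<times> {1..2*T}" let ?C = "{1..\<delta>*T/2} \<times> {1..\<delta>*T/2}"
  \<comment> \<open>On \<open>?A\<close> one has \<open>u * v \<ge> \<delta> * T\<^sup>2 / 2\<close>
    and \<open>u + v \<le> 3 * T\<close>, hence \<open>wt \<ge> \<delta> / (54 * T)\<close>. The
    square \<open>?C\<close> is disjoint from \<open>?A\<close>; subtracting it leaves the weighted
    mass between the scales \<open>\<delta> * T / 2\<close> and \<open>2 * T\<close>, which is a
    tail as soon as the full integral converges.\<close>
  have b3: "(LBINT v:{T/2..T}. g3 v) \<le> 54 * T / \<delta> * ((LBINT z:?B. ?wV z) - (LBINT z:?C. ?wV z))"
  proof -
    have T1: "1 \<le> v" if "T \<le> v * 2" for v using that T2 by linarith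
    have AB: "?A \<union> ?C \<subseteq> ?B" using T T2 \<open>\<delta> * T \<le> 1 * T\<close> by (auto dest: T1)
    have AC: "?A \<inter> ?C = {}" using T by auto
    have bs: "?A \<in> sets borel" "?C \<in> sets borel" "?B \<in> sets borel"
      by (auto intro!: borel_closed closed_Times)
    have iB: "set_integrable lborel ?B ?wV" by (rule wV_int) auto
    have iA: "set_integrable lborel ?A ?wV" and iC: "set_integrable lborel ?C ?wV"
      by (rule set_integrable_subset[OF iB]; use AB bs in auto)+
    have "(LBINT v:{T/2..T}. g3 v) = (LBINT z:?A. V (\<Phi> (fst z) (snd z)))"
      unfolding g3_def using \<open>\<delta> * T \<le> 1 * T\<close> T2 by (simp add: dbl)
    also have "\<dots> \<le> (LBINT z:?A. 54 * T / \<delta> * ?wV z)"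
    proof (rule set_integral_mono[OF Vbox])
      show "set_integrable lborel ?A (\<lambda>z. 54 * T / \<delta> * ?wV z)" using iA by simp
      fix z assume z: "z \<in> ?A"
      let ?u = "fst z" let ?v = "snd z"
      have uv: "\<delta> * T \<le> ?u" "?u \<le> 2 * T" "T / 2 \<le> ?v" "?v \<le> T" using z by auto
      have s: "0 < ?u + ?v" "?u + ?v \<le> 3 * T" using uv T T2 by auto
      have "\<delta> * T * (T / 2) \<le> ?u * ?v" using uv T T2 \<delta> by (intro mult_mono) auto
      then have n: "27 * T ^ 3 \<le> 54 * T / \<delta> * (?u * ?v)"
        using \<delta> T2 by (simp add: field_simps power3_eq_cube mult_left_mono)
      have "(?u + ?v) ^ 3 \<le> (3 * T) ^ 3" using s by (intro power_mono) auto
      also have "\<dots> = 27 * T ^ 3" by (simp add: power_mult_distrib)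
      also note n
      finally have "1 \<le> 54 * T / \<delta> * (?u * ?v) / (?u + ?v) ^ 3" using s by (subst le_divide_eq) simp
      also have "\<dots> = 54 * T / \<delta> * wt ?u ?v" by (simp add: wt_def iv_def divide_inverse power_inverse mult.assoc)
      finally have "1 * V (\<Phi> ?u ?v) \<le> 54 * T / \<delta> * wt ?u ?v * V (\<Phi> ?u ?v)"
        by (rule mult_right_mono[OF _ V_nonneg])
      then show "V (\<Phi> ?u ?v) \<le> 54 * T / \<delta> * ?wV z" by (simp add: mult.assoc)
    qed
    also have "\<dots> = 54 * T / \<delta> * (LBINT z:?A. ?wV z)" by simp
    also have "\<dots> \<le> 54 * T / \<delta> * ((LBINT z:?B. ?wV z) - (LBINT z:?C. ?wV z))"
    proof (rule mult_left_mono)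
      have "(LBINT z:?A. ?wV z) + (LBINT z:?C. ?wV z) = (LBINT z:?A \<union> ?C. ?wV z)"
        by (rule set_integral_Un[symmetric, OF AC iA iC])
      also have "\<dots> \<le> (LBINT z:?B. ?wV z)"
        unfolding set_lebesgue_integral_def
      proof (rule integral_mono)
        show "integrable lborel (\<lambda>z. indicator (?A \<union> ?C) z *\<^sub>R ?wV z)"
          using set_integrable_subset[OF iB _ AB] bs by (simp add: set_integrable_def)
        show "integrable lborel (\<lambda>z. indicator ?B z *\<^sub>R ?wV z)" using iB by (simp add: set_integrable_def)
        fix z
        show "indicator (?A \<union> ?C) z *\<^sub>R ?wV z \<le> indicator ?B z *\<^sub>R ?wV z"
        proof (cases "z \<in> ?B")
          case True
          then have "0 \<le> ?wV z" using wt_nonneg[of "fst z" "snd z"] V_nonneg by auto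
          then show ?thesis using True by (simp add: indicator_def)
        next
          case False
          then have "z \<notin> ?A \<union> ?C" using AB by blast
          then show ?thesis using False by simp
        qed
      qed
      finally show "(LBINT z:?A. ?wV z) \<le> (LBINT z:?B. ?wV z) - (LBINT z:?C. ?wV z)" by simp
      show "0 \<le> 54 * T / \<delta>" using \<delta> T2 by simp
    qed
    finally show ?thesis .
  qed
  define K where "K = (LBINT z:?B. ?wV z) - (LBINT z:?C. ?wV z)"
  have "S * (T / 2) \<le> (a1 + 2 * lQ + 4 * \<delta> * EQ + 54 / \<delta> * K) * (T / 2)"
    using main b1 b2 b3 unfolding K_def[symmetric] by (simp add: field_simps)
  then have "S \<le> a1 + 2 * lQ + 4 * \<delta> * EQ + 54 / \<delta> * K"
    using T2 by (simp add: mult_le_cancel_right)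
  then show ?thesis by (simp add: S_def a1_def lQ_def K_def)
qed

text \<open>The order of choices matters: \<open>\<delta>\<close> is fixed first, so that the layer
  near the cone costs at most \<open>\<epsilon> / 2\<close>, and only then does \<open>T\<close>
  grow. The increasing function \<open>k\<close> is bounded by
  \<open>weighted_potential_bound\<close> and so converges; its increment between
  \<open>\<delta> * T / 2\<close> and \<open>2 * T\<close> vanishes in the limit even after the
  factor \<open>54 / \<delta>\<close>.\<close>

lemma half_decay:
  assumes M: "\<And>u v. \<bar>\<Phi> u v\<bar> \<le> M" and hom: "\<And>y. y * f y = \<kappa> * V y" and \<kappa>: "\<kappa> > 2" and \<epsilon>: "\<epsilon> > 0"
  shows "\<forall>\<^sub>F T in at_top. \<forall>X\<ge>T. (LBINT v:{T..X}. eP T v) \<le> \<epsilon>"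
proof -
  interpret sw: finite_energy f V "\<lambda>u v. \<Phi> v u" q p by (rule swap')
  let ?wV = "\<lambda>z. wt (fst z) (snd z) * V (\<Phi> (fst z) (snd z))"
  define k where "k U = (LBINT z:{1..U} \<times> {1..U}. ?wV z)" for U
  define C where "C = (4 * EP + 4 * EQ + 4 * (2 * M * (1 + EP) + 14 * M\<^sup>2)) / (\<kappa> - 2)"
  have kC: "k U \<le> C" if "1 \<le> U" for U
    using weighted_potential_bound[OF that M hom] \<kappa> by (simp add: k_def C_def field_simps)
  have kmono: "k U \<le> k W" if "U \<le> W" for U W
  proof -
    have "(\<integral>z. indicator ({1..U} \<times> {1..U}) z *\<^sub>R ?wV z \<partial>lborel) \<le> (\<integral>z. indicator ({1..W} \<times> {1..W}) z *\<^sub>R ?wV z \<partial>lborel)"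
    proof (rule integral_mono)
      fix z
      show "indicator ({1..U} \<times> {1..U}) z *\<^sub>R ?wV z \<le> indicator ({1..W} \<times> {1..W}) z *\<^sub>R ?wV z"
        using that wt_nonneg[of "fst z" "snd z"] V_nonneg by (auto simp: indicator_def)
    qed (use wV_int[of 1 1] in \<open>simp_all add: set_integrable_def\<close>)
    then show ?thesis by (simp add: k_def set_lebesgue_integral_def)
  qed
  define s where "s = Sup (range k)"
  have bdd: "bdd_above (range k)"
  proof (rule bdd_aboveI)
    fix y assume "y \<in> range k"
    then obtain U where "y = k U" by auto
    also have "k U \<le> k (max 1 U)" by (rule kmono) simp
    also have "\<dots> \<le> C" by (rule kC) simp
    finally show "y \<le> C" .
  qed
  have kl: "(k \<longlongrightarrow> s) at_top"
  proof (rule increasing_tendsto)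
    show "\<forall>\<^sub>F U in at_top. k U \<le> s"
      unfolding s_def by (intro always_eventually allI cSup_upper bdd) auto
    fix y assume "y < s"
    then obtain U where U: "y < k U"
      unfolding s_def using less_cSup_iff[OF _ bdd] by auto
    show "\<forall>\<^sub>F U in at_top. y < k U"
      using eventually_ge_at_top[of U] by eventually_elim (use U kmono in \<open>meson less_le_trans\<close>)
  qed
  define \<delta> where "\<delta> = min 1 (\<epsilon> / (8 * (EQ + 1)))"
  have EQ0: "0 \<le> EQ" by (rule EP_nonneg)
  have \<delta>: "0 < \<delta>" "\<delta> \<le> 1" using \<epsilon> EQ0 by (auto simp: \<delta>_def)
  have "4 * \<delta> * EQ \<le> 4 * (\<epsilon> / (8 * (EQ + 1))) * (EQ + 1)"
    using EQ0 \<epsilon> by (intro mult_mono) (auto simp: \<delta>_def)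
  also have "\<dots> = \<epsilon> / 2" using EQ0 by (simp add: field_simps)
  finally have d: "4 * \<delta> * EQ \<le> \<epsilon> / 2" .
  have fT: "filterlim (\<lambda>T. \<delta> * T) at_top at_top"
    using \<delta> by (intro filterlim_tendsto_pos_mult_at_top[OF tendsto_const] filterlim_ident) auto
  have f2: "filterlim (\<lambda>T. \<delta> * T / 2) at_top at_top" "filterlim (\<lambda>T::real. 2 * T) at_top at_top" "filterlim (\<lambda>T::real. T / 2) at_top at_top"
    using filterlim_tendsto_pos_mult_at_top[OF tendsto_const[of "\<delta> / 2"] _ filterlim_ident] \<delta>
      filterlim_tendsto_pos_mult_at_top[OF tendsto_const[of "2::real"] _ filterlim_ident]
      filterlim_tendsto_pos_mult_at_top[OF tendsto_const[of "1/2::real"] _ filterlim_ident]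
    by (simp_all add: mult.commute)
  have "((\<lambda>T. (LBINT v:{T/2..}. eP 0 v) + 2 * (LBINT u:{..- (\<delta> * T)}. sw.eP 0 u) + 4 * \<delta> * EQ
      + 54 / \<delta> * (k (2 * T) - k (\<delta> * T / 2))) \<longlongrightarrow> 0 + 2 * 0 + 4 * \<delta> * EQ + 54 / \<delta> * (s - s)) at_top"
    by (intro tendsto_intros filterlim_compose[OF tail_tendsto_0(1)[OF eP0] f2(3)]
        filterlim_compose[OF tail_tendsto_0(2)[OF eQ0] fT] filterlim_compose[OF kl f2(1)] filterlim_compose[OF kl f2(2)])
  moreover have "0 + 2 * 0 + 4 * \<delta> * EQ + 54 / \<delta> * (s - s) < \<epsilon>" using d \<epsilon> by simp
  ultimately have "\<forall>\<^sub>F T in at_top. (LBINT v:{T/2..}. eP 0 v) + 2 * (LBINT u:{..- (\<delta> * T)}. sw.eP 0 u) + 4 * \<delta> * EQ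
      + 54 / \<delta> * (k (2 * T) - k (\<delta> * T / 2)) < \<epsilon>"
    by (rule order_tendstoD)
  moreover have "\<forall>\<^sub>F T in at_top. 2 \<le> \<delta> * T"
    using fT by (simp add: filterlim_at_top)
  ultimately show ?thesis
  proof eventually_elim
    case (elim T)
    show ?case
      using averaged_lag[OF \<delta> elim(2)] elim(1) unfolding k_def by force
  qed
qed

lemma space_line_shift:
  assumes "0 \<le> X"
  shows "(LBINT x:{0..X}. V (\<Phi> (T - x) (T + x))) \<le> 2 * (LBINT v:{T..T + X}. eP T v)"
proof -
  have c1: "continuous_on UNIV (\<lambda>x. V (\<Phi> (T - x) (T + x)))" and c2: "continuous_on UNIV (\<lambda>v. V (\<Phi> (2 * T - v) v))"
    by (intro V_Phi_cont continuous_intros)+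
  have "(LBINT x:{0..X}. V (\<Phi> (T - x) (T + x))) = oint 0 X (\<lambda>x. V (\<Phi> (T - x) (T + x)))"
    by (rule oint_eq_LBINT[OF c1 assms])
  also have "\<dots> = oint T (T + X) (\<lambda>v. V (\<Phi> (2 * T - v) v))"
    using oint_affine[OF c2, of 1 0 X T] by simp
  also have "\<dots> = (LBINT v:{T..T + X}. V (\<Phi> (2 * T - v) v))"
    by (rule oint_eq_LBINT[OF c2, symmetric]) (use assms in simp)
  also have "\<dots> \<le> (LBINT v:{T..T + X}. 2 * eP T v)"
  proof (rule set_integral_mono)
    show "set_integrable lborel {T..T + X} (\<lambda>v. V (\<Phi> (2 * T - v) v))"
      by (intro borel_integrable_atLeastAtMost' continuous_on_subset[OF c2]) auto
    show "set_integrable lborel {T..T + X} (\<lambda>v. 2 * eP T v)" using eP_int by simp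
  qed (simp add: eP_def)
  finally show ?thesis by simp
qed

text \<open>The bounds on \<open>eP\<close> control the half \<open>x \<ge> 0\<close> of the slice,
  where \<open>v \<ge> T\<close>; the bounds with exchanged coordinates control
  \<open>x \<le> 0\<close>. Each half contributes \<open>2 * C\<close> because
  \<open>V \<Phi> \<le> 2 * eP\<close>.\<close>

lemma potential_line:
  assumes "\<And>X. 0 \<le> X \<Longrightarrow> (LBINT v:{T..T + X}. eP T v) \<le> C"
    and "\<And>X. 0 \<le> X \<Longrightarrow> (LBINT u:{T..T + X}. charsol.eP f V (\<lambda>u v. \<Phi> v u) q T u) \<le> C"
  shows "integrable lborel (\<lambda>x. V (\<Phi> (T - x) (T + x)))" and "(\<integral>x. V (\<Phi> (T - x) (T + x)) \<partial>lborel) \<le> 4 * C"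
proof -
  interpret sw: finite_energy f V "\<lambda>u v. \<Phi> v u" q p by (rule swap')
  let ?h = "\<lambda>x. V (\<Phi> (T - x) (T + x))"
  have c: "continuous_on UNIV ?h" by (intro V_Phi_cont continuous_intros)
  have i: "set_integrable lborel {a..b} ?h" for a b
    by (intro borel_integrable_atLeastAtMost' continuous_on_subset[OF c]) auto
  have b: "(LBINT x:{- real n..real n}. ?h x) \<le> 4 * C" for n
  proof -
    have "(LBINT x:{- real n..real n}. ?h x) = (LBINT x:{- real n..0}. ?h x) + (LBINT x:{0..real n}. ?h x)"
      by (rule LBINT_combine[symmetric, OF _ _ i]) auto
    also have "(LBINT x:{- real n..0}. ?h x) = (LBINT x:{0..real n}. ?h (- x))"
      using LBINT_reflect[of 0 "real n" ?h] by simp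
    also have "\<dots> = (LBINT x:{0..real n}. V (\<Phi> (T + x) (T - x)))" by simp
    also have "\<dots> \<le> 2 * (LBINT u:{T..T + real n}. sw.eP T u)" by (rule sw.space_line_shift) simp
    also have "(LBINT x:{0..real n}. ?h x) \<le> 2 * (LBINT v:{T..T + real n}. eP T v)" by (rule space_line_shift) simp
    finally show ?thesis using assms[of "real n"] by simp
  qed
  have m: "?h \<in> borel_measurable borel" using c by (rule borel_measurable_continuous_onI)
  show "integrable lborel ?h" "integral\<^sup>L lborel ?h \<le> 4 * C"
    by (rule integrable_if_bounded_on_intervals[OF m V_nonneg i b])+
qed

lemma potential_integrable: "integrable lborel (\<lambda>x. V (\<Phi> (T - x) (T + x)))"
    and potential_energy_bound: "(\<integral>x. V (\<Phi> (T - x) (T + x)) \<partial>lborel) \<le> 4 * (EP + EQ)"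
proof -
  interpret sw: finite_energy f V "\<lambda>u v. \<Phi> v u" q p by (rule swap')
  have "(LBINT v:{T..T + X}. eP T v) \<le> EP + EQ" for X
  proof -
    have "(LBINT v:{T..T + X}. eP T v) \<le> integral\<^sup>L lborel (eP T)"
      by (rule LBINT_le_integral) (use energy_bound eP_nonneg in auto)
    then show ?thesis using energy_bound(2)[of T] EP_nonneg by (simp add: EP_def)
  qed
  moreover have "(LBINT v:{T..T + X}. sw.eP T v) \<le> EP + EQ" for X
  proof -
    have "(LBINT v:{T..T + X}. sw.eP T v) \<le> integral\<^sup>L lborel (sw.eP T)"
      by (rule LBINT_le_integral) (use sw.energy_bound sw.eP_nonneg in auto)
    then show ?thesis using sw.energy_bound(2)[of T] EP_nonneg by (simp add: EQ_def)
  qed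
  ultimately show "integrable lborel (\<lambda>x. V (\<Phi> (T - x) (T + x)))" "(\<integral>x. V (\<Phi> (T - x) (T + x)) \<partial>lborel) \<le> 4 * (EP + EQ)"
    using potential_line by blast+
qed

lemma potential_decay:
  assumes M: "\<And>u v. \<bar>\<Phi> u v\<bar> \<le> M" and hom: "\<And>y. y * f y = \<kappa> * V y" and \<kappa>: "\<kappa> > 2"
  shows "((\<lambda>T. \<integral>x. V (\<Phi> (T - x) (T + x)) \<partial>lborel) \<longlongrightarrow> 0) at_top"
proof (rule tendstoI)
  interpret sw: finite_energy f V "\<lambda>u v. \<Phi> v u" q p by (rule swap')
  fix e :: real assume e: "e > 0"
  have "\<forall>\<^sub>F T in at_top. \<forall>X\<ge>T. (LBINT v:{T..X}. eP T v) \<le> e / 8"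
    by (rule half_decay[OF M hom \<kappa>]) (use e in auto)
  moreover have "\<forall>\<^sub>F T in at_top. \<forall>X\<ge>T. (LBINT v:{T..X}. sw.eP T v) \<le> e / 8"
    by (rule sw.half_decay[OF M hom \<kappa>]) (use e in auto)
  ultimately show "\<forall>\<^sub>F T in at_top. dist (\<integral>x. V (\<Phi> (T - x) (T + x)) \<partial>lborel) 0 < e"
  proof eventually_elim
    case (elim T)
    have "(\<integral>x. V (\<Phi> (T - x) (T + x)) \<partial>lborel) \<le> 4 * (e / 8)"
      by (rule potential_line) (use elim in auto)
    moreover have "0 \<le> (\<integral>x. V (\<Phi> (T - x) (T + x)) \<partial>lborel)"
      by (intro Bochner_Integration.integral_nonneg V_nonneg)
    ultimately show ?case using e by (simp add: dist_real_def)
  qed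
qed

end

section \<open>The Duhamel integral and mild solutions\<close>

text \<open>The integral of \<open>h\<close> over the characteristic triangle with apex
  \<open>(u, v)\<close> and base on \<open>u + v = 0\<close>, the line of the data. Below that line
  both orientations flip, so one formula serves both directions of time.\<close>

definition duh :: "(real \<Rightarrow> real \<Rightarrow> real) \<Rightarrow> real \<Rightarrow> real \<Rightarrow> real" where
  "duh h u v = oint (- u) v (\<lambda>v'. oint (- v') u (\<lambda>u'. h u' v'))"

lemma continuous_on_curried:
  assumes "continuous_on UNIV (\<lambda>(u, v). h u v)" "continuous_on S a" "continuous_on S b"
  shows "continuous_on S (\<lambda>z. h (a z) (b z))"
  using continuous_on_compose2[OF assms(1) continuous_on_Pair[OF assms(2,3)]] by simp

lemma continuous_swap_args:
  assumes "continuous_on UNIV (\<lambda>(u::real, v::real). h u v)"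
  shows "continuous_on UNIV (\<lambda>(u, v). h v u)"
  unfolding case_prod_unfold by (intro continuous_on_curried[OF assms] continuous_intros)

lemma continuous_inner_oint:
  fixes h :: "real \<Rightarrow> real \<Rightarrow> real" and a b c :: "'a::topological_space \<Rightarrow> real"
  assumes h: "continuous_on UNIV (\<lambda>(u, v). h u v)"
    and "continuous_on UNIV a" "continuous_on UNIV b" "continuous_on UNIV c"
  shows "continuous_on UNIV (\<lambda>z. oint (a z) (b z) (\<lambda>u'. h u' (c z)))"
proof -
  have "continuous_on UNIV (\<lambda>y::'a \<times> real. c (fst y))"
    by (rule continuous_on_compose2[OF assms(4) continuous_on_fst[OF continuous_on_id]]) simp
  then have "continuous_on UNIV (\<lambda>y::'a \<times> real. h (snd y) (c (fst y)))"
    by (intro continuous_on_curried[OF h] continuous_intros)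
  then show ?thesis
    by (intro continuous_oint assms) (simp add: case_prod_unfold)
qed

lemma duh_cont:
  assumes h: "continuous_on UNIV (\<lambda>(u, v). h u v)"
  shows "continuous_on UNIV (\<lambda>(u, v). duh h u v)"
proof -
  have "continuous_on UNIV (\<lambda>y::(real \<times> real) \<times> real. oint (- snd y) (fst (fst y)) (\<lambda>u'. h u' (snd y)))"
    by (intro continuous_inner_oint[OF h] continuous_intros)
  then have "continuous_on UNIV (\<lambda>z::real \<times> real. oint (- fst z) (snd z) (\<lambda>v'. oint (- v') (fst z) (\<lambda>u'. h u' v')))"
    by (intro continuous_oint continuous_intros) (simp add: case_prod_unfold)
  then show ?thesis unfolding duh_def case_prod_unfold .
qed

lemma duh_inner_cont:
  assumes h: "continuous_on UNIV (\<lambda>(u, v). h u v)"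
  shows "continuous_on UNIV (\<lambda>v'. oint (- v') u (\<lambda>u'. h u' v'))"
  by (intro continuous_inner_oint[OF h] continuous_intros)

lemma slice_cont:
  assumes h: "continuous_on UNIV (\<lambda>(u, v). h u v)"
  shows "continuous_on UNIV (\<lambda>u::real. h u (v::real))" "continuous_on UNIV (\<lambda>v::real. h (u::real) v)"
  by (intro continuous_on_curried[OF h] continuous_intros)+

lemma duh_diff_v:
  assumes h: "continuous_on UNIV (\<lambda>(u, v). h u v)"
  shows "duh h u v2 - duh h u v1 = oint v1 v2 (\<lambda>v'. oint (- v') u (\<lambda>u'. h u' v'))"
  using oint_combine[OF duh_inner_cont[OF h], of "- u" v1 u v2] by (simp add: duh_def)

lemma duh_diag [simp]: "duh h (- x) x = 0" "duh h x (- x) = 0"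
  by (simp_all add: duh_def)

lemma duh_minus:
  assumes h: "continuous_on UNIV (\<lambda>(u, v). h u v)" and k: "continuous_on UNIV (\<lambda>(u, v). k u v)"
  shows "duh h u v - duh k u v = duh (\<lambda>a b. h a b - k a b) u v"
  unfolding duh_def
  by (simp add: oint_diff slice_cont[OF h] slice_cont[OF k] duh_inner_cont[OF h] duh_inner_cont[OF k])

lemma abs_sinh_le_cosh: "\<bar>sinh x\<bar> \<le> cosh (x :: real)"
  using sinh_less_cosh_real[of x] sinh_less_cosh_real[of "- x"] by (simp add: abs_if)

text \<open>The weight \<open>cosh (l (a + b))\<close> makes the Duhamel operator a contraction on bounded squares once \<open>l\<close>
  is large, so that no step-by-step continuation in time is needed.\<close>

lemma duh_bound:
  assumes h: "continuous_on UNIV (\<lambda>(u, v). h u v)" and uv: "\<bar>u\<bar> \<le> R" "\<bar>v\<bar> \<le> R" and l: "l > 0" and K: "K \<ge> 0"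
    and b: "\<And>a b. \<bar>a\<bar> \<le> R \<Longrightarrow> \<bar>b\<bar> \<le> R \<Longrightarrow> \<bar>h a b\<bar> \<le> K * cosh (l * (a + b))"
  shows "\<bar>duh h u v\<bar> \<le> K / l\<^sup>2 * cosh (l * (u + v))"
proof -
  have seg: "\<bar>s\<bar> \<le> R" if "s \<in> closed_segment a b" "\<bar>a\<bar> \<le> R" "\<bar>b\<bar> \<le> R" for s a b :: real
    using that by (auto simp: closed_segment_eq_real_ivl split: if_splits)
  have inner: "\<bar>oint (- v') u (\<lambda>u'. h u' v')\<bar> \<le> K / l * cosh (l * (u + v'))" if v': "\<bar>v'\<bar> \<le> R" for v'
  proof -
    have "\<bar>oint (- v') u (\<lambda>u'. h u' v')\<bar> \<le> \<bar>oint (- v') u (\<lambda>u'. K * cosh (l * (u' + v')))\<bar>"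
      by (rule oint_bound[OF slice_cont(1)[OF h]]) (use v' uv in \<open>auto intro!: continuous_intros b dest: seg\<close>)
    \<comment> \<open>\<open>sinh\<close> vanishes at the data line, so each of the two integrations
      reproduces the weight and gains a factor \<open>1 / l\<close>.\<close>
    also have "oint (- v') u (\<lambda>u'. K * cosh (l * (u' + v'))) = K / l * sinh (l * (u + v')) - K / l * sinh (l * (- v' + v'))"
      by (rule oint_antiderivative) (use l in \<open>auto intro!: derivative_eq_intros\<close>)
    also have "\<bar>\<dots>\<bar> \<le> K / l * cosh (l * (u + v'))"
      using abs_sinh_le_cosh[of "l * (u + v')"] K l by (simp add: abs_mult mult_left_mono divide_right_mono)
    finally show ?thesis .
  qed
  have "\<bar>duh h u v\<bar> \<le> \<bar>oint (- u) v (\<lambda>v'. K / l * cosh (l * (u + v')))\<bar>"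
    unfolding duh_def
  proof (rule oint_bound[OF duh_inner_cont[OF h]])
    show "continuous_on UNIV (\<lambda>v'. K / l * cosh (l * (u + v')))" by (intro continuous_intros) (use l in auto)
    show "\<bar>oint (- s) u (\<lambda>u'. h u' s)\<bar> \<le> K / l * cosh (l * (u + s))" if "s \<in> closed_segment (- u) v" for s
      using inner[OF seg[OF that]] uv by simp
  qed
  also have "oint (- u) v (\<lambda>v'. K / l * cosh (l * (u + v'))) = K / l\<^sup>2 * sinh (l * (u + v)) - K / l\<^sup>2 * sinh (l * (u + (- u)))"
    by (rule oint_antiderivative) (use l in \<open>auto intro!: derivative_eq_intros simp: power2_eq_square\<close>)
  also have "\<bar>\<dots>\<bar> \<le> K / l\<^sup>2 * cosh (l * (u + v))"
    using abs_sinh_le_cosh[of "l * (u + v)"] K l by (simp add: abs_mult mult_left_mono divide_right_mono)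
  finally show ?thesis .
qed

text \<open>The triangle has area of order \<open>(u + v)\<^sup>2 = 4 * t\<^sup>2\<close>. That
  Duhamel terms are of second order at the data line drives both \<open>duh_sym\<close> and the
  comparison of initial velocities.\<close>

lemma duh_quadratic_bound:
  assumes h: "continuous_on UNIV (\<lambda>(u, v). h u v)" and uv: "\<bar>u\<bar> \<le> R" "\<bar>v\<bar> \<le> R"
    and b: "\<And>a b. \<bar>a\<bar> \<le> R \<Longrightarrow> \<bar>b\<bar> \<le> R \<Longrightarrow> \<bar>h a b\<bar> \<le> K"
  shows "\<bar>duh h u v\<bar> \<le> K * (u + v)\<^sup>2"
proof -
  have K: "0 \<le> K" using b[of 0 0] uv by fastforce
  have seg: "\<bar>s\<bar> \<le> R" if "s \<in> closed_segment a b" "\<bar>a\<bar> \<le> R" "\<bar>b\<bar> \<le> R" for s a b :: real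
    using that by (auto simp: closed_segment_eq_real_ivl split: if_splits)
  have inner: "\<bar>oint (- v') u (\<lambda>u'. h u' v')\<bar> \<le> K * \<bar>u + v\<bar>" if v': "v' \<in> closed_segment (- u) v" for v'
  proof -
    have v'R: "\<bar>v'\<bar> \<le> R" using seg[OF v'] uv by auto
    have "\<bar>oint (- v') u (\<lambda>u'. h u' v')\<bar> \<le> \<bar>oint (- v') u (\<lambda>u'. K)\<bar>"
      by (rule oint_bound[OF slice_cont(1)[OF h]]) (use v'R uv in \<open>auto intro!: continuous_intros b dest: seg\<close>)
    also have "\<dots> = K * \<bar>u + v'\<bar>" using K by (simp add: oint_const abs_mult)
    also have "\<dots> \<le> K * \<bar>u + v\<bar>"
      using v' K by (intro mult_left_mono) (auto simp: closed_segment_eq_real_ivl split: if_splits)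
    finally show ?thesis .
  qed
  have "\<bar>duh h u v\<bar> \<le> \<bar>oint (- u) v (\<lambda>v'. K * \<bar>u + v\<bar>)\<bar>"
    unfolding duh_def by (rule oint_bound[OF duh_inner_cont[OF h]]) (auto intro!: continuous_intros inner)
  also have "\<dots> = K * (u + v)\<^sup>2"
    using K by (simp add: oint_const abs_mult power2_eq_square add.commute)
  finally show ?thesis .
qed

lemma oint_swap_order:
  assumes h: "continuous_on UNIV (\<lambda>(u, v). h u v)"
  shows "oint v1 v2 (\<lambda>v. oint u1 u2 (\<lambda>u. h u v)) = oint u1 u2 (\<lambda>u. oint v1 v2 (\<lambda>v. h u v))"
proof -
  have "continuous_on (cbox (0, 0) (1, 1)) (\<lambda>z::real \<times> real. h (u1 + snd z * (u2 - u1)) (v1 + fst z * (v2 - v1)))"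
    by (intro continuous_on_curried[OF h] continuous_intros)
  then have c: "continuous_on (cbox (0, 0) (1, 1)) (\<lambda>(r::real, s::real). h (u1 + s * (u2 - u1)) (v1 + r * (v2 - v1)))"
    by (simp add: case_prod_unfold)
  have "integral {0..1} (\<lambda>r. integral {0..1} (\<lambda>s. h (u1 + s * (u2 - u1)) (v1 + r * (v2 - v1))))
      = integral {0..1} (\<lambda>s. integral {0..1} (\<lambda>r. h (u1 + s * (u2 - u1)) (v1 + r * (v2 - v1))))"
    using integral_swap_continuous[OF c] by simp
  then show ?thesis
    unfolding oint_def Henstock_Kurzweil_Integration.integral_mult_right by simp
qed

lemma compact_bounded_values:
  fixes k :: "'a::topological_space \<Rightarrow> real"
  assumes "continuous_on K k" "compact K"
  shows "\<exists>C\<ge>0. \<forall>x\<in>K. \<bar>k x\<bar> \<le> C"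
proof -
  have "bounded (k ` K)" using assms by (intro compact_imp_bounded compact_continuous_image)
  then show ?thesis unfolding bounded_iff by (metis abs_ge_zero image_eqI order_trans real_norm_def linear)
qed

lemma square_bounded_values:
  fixes h :: "real \<Rightarrow> real \<Rightarrow> real"
  assumes h: "continuous_on UNIV (\<lambda>(u, v). h u v)"
  obtains C :: real where "C \<ge> 0" "\<And>a b. \<bar>a\<bar> \<le> R \<Longrightarrow> \<bar>b\<bar> \<le> R \<Longrightarrow> \<bar>h a b\<bar> \<le> C"
proof -
  have "compact ({-R..R} \<times> {-R..R})" by (intro compact_Times compact_Icc)
  from compact_bounded_values[OF continuous_on_subset[OF h subset_UNIV] this] show ?thesis
    using that by (force simp: abs_le_iff)
qed

text \<open>Difference quotients are of the order of the increment, so the derivative vanishes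
  everywhere.\<close>

lemma quadratic_increment_const:
  fixes \<alpha> :: "real \<Rightarrow> real"
  assumes "\<And>R. \<exists>C. \<forall>x y. \<bar>x\<bar> \<le> R \<longrightarrow> \<bar>y\<bar> \<le> R \<longrightarrow> \<bar>\<alpha> x - \<alpha> y\<bar> \<le> C * (x - y)\<^sup>2"
  shows "\<alpha> x = \<alpha> y"
proof -
  have "(\<alpha> has_real_derivative 0) (at x)" for x
  proof -
    obtain C where C: "\<And>a b. \<bar>a\<bar> \<le> \<bar>x\<bar> + 1 \<Longrightarrow> \<bar>b\<bar> \<le> \<bar>x\<bar> + 1 \<Longrightarrow> \<bar>\<alpha> a - \<alpha> b\<bar> \<le> C * (a - b)\<^sup>2"
      using assms by metis
    have "((\<lambda>y. (\<alpha> y - \<alpha> x) / (y - x)) \<longlongrightarrow> 0) (at x)"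
    proof (rule Lim_null_comparison)
      have "\<forall>\<^sub>F y in at x. dist y x < 1" unfolding eventually_at by (intro exI[of _ 1]) simp
      then show "\<forall>\<^sub>F y in at x. norm ((\<alpha> y - \<alpha> x) / (y - x)) \<le> C * \<bar>y - x\<bar>"
      proof (rule eventually_mono)
        fix y assume d: "dist y x < 1"
        have "\<bar>\<alpha> y - \<alpha> x\<bar> \<le> C * (y - x)\<^sup>2" using d by (intro C) (auto simp: dist_real_def)
        also have "\<dots> = C * \<bar>y - x\<bar> * \<bar>y - x\<bar>" by (simp add: power2_eq_square)
        finally show "norm ((\<alpha> y - \<alpha> x) / (y - x)) \<le> C * \<bar>y - x\<bar>"
          by (cases "y = x") (auto simp: divide_le_eq abs_divide)
      qed
      show "((\<lambda>y. C * \<bar>y - x\<bar>) \<longlongrightarrow> 0) (at x)"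
        by (auto intro!: tendsto_eq_intros)
    qed
    then show ?thesis by (simp add: has_field_derivative_iff)
  qed
  then show ?thesis using DERIV_isconst_all by blast
qed

text \<open>Fubini on a triangle reduced to rectangles: both sides have the same mixed increments,
  so their difference is \<open>\<alpha> u - \<alpha> (- v)\<close>, as it vanishes for
  \<open>u + v = 0\<close>. The quadratic bound then makes \<open>\<alpha>\<close> constant.\<close>

lemma duh_sym:
  assumes h: "continuous_on UNIV (\<lambda>(u, v). h u v)"
  shows "duh h u v = duh (\<lambda>a b. h b a) v u"
proof -
  let ?k = "\<lambda>a b. h b a"
  have k: "continuous_on UNIV (\<lambda>(u, v). ?k u v)" by (rule continuous_swap_args[OF h])
  have incr: "duh h u2 v2 - duh h u1 v2 - duh h u2 v1 + duh h u1 v1 = oint v1 v2 (\<lambda>v. oint u1 u2 (\<lambda>u. h u v))"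
    if h: "continuous_on UNIV (\<lambda>(u, v). h u v)" for u1 u2 v1 v2 and h :: "real \<Rightarrow> real \<Rightarrow> real"
  proof -
    have a: "oint u1 u2 (\<lambda>u. h u v) = oint (- v) u2 (\<lambda>u. h u v) - oint (- v) u1 (\<lambda>u. h u v)" for v
      using oint_combine[OF slice_cont(1)[OF h], of "- v" u1 v u2] by simp
    have "oint v1 v2 (\<lambda>v. oint u1 u2 (\<lambda>u. h u v)) = oint v1 v2 (\<lambda>v. oint (- v) u2 (\<lambda>u. h u v) - oint (- v) u1 (\<lambda>u. h u v))"
      by (simp only: a)
    also have "\<dots> = (duh h u2 v2 - duh h u2 v1) - (duh h u1 v2 - duh h u1 v1)"
      unfolding duh_diff_v[OF h] by (rule oint_diff[OF duh_inner_cont[OF h] duh_inner_cont[OF h]])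
    finally have "oint v1 v2 (\<lambda>v. oint u1 u2 (\<lambda>u. h u v)) = (duh h u2 v2 - duh h u2 v1) - (duh h u1 v2 - duh h u1 v1)" .
    then show ?thesis by simp
  qed
  define D where "D u v = duh h u v - duh ?k v u" for u v
  have D: "D u2 v2 - D u1 v2 - D u2 v1 + D u1 v1 = 0" for u1 u2 v1 v2
    using incr[OF h, of u2 v2 u1 v1] incr[OF k, of v2 u2 v1 u1] oint_swap_order[OF h, of v1 v2 u1 u2]
    by (simp add: D_def)
  define \<alpha> where "\<alpha> x = D x 0" for x
  have D0: "D (- x) x = 0" for x by (simp add: D_def)
  have D00: "D 0 0 = 0" using D0[of 0] by simp
  have Dv: "D 0 v = - \<alpha> (- v)" for v using D[of 0 v "- v" 0] D0[of v] D00 by (simp add: \<alpha>_def)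
  have Da: "D u v = \<alpha> u - \<alpha> (- v)" for u v
    using D[of u v 0 0] D00 Dv[of v] unfolding \<alpha>_def by linarith
  have "\<alpha> u = \<alpha> (- v)"
  proof (rule quadratic_increment_const[where \<alpha> = \<alpha>])
    fix R :: real
    obtain C where C: "C \<ge> 0" "\<And>a b. \<bar>a\<bar> \<le> R \<Longrightarrow> \<bar>b\<bar> \<le> R \<Longrightarrow> \<bar>h a b\<bar> \<le> C"
      using square_bounded_values[OF h] by blast
    have "\<bar>\<alpha> x - \<alpha> y\<bar> \<le> (2 * C) * (x - y)\<^sup>2" if "\<bar>x\<bar> \<le> R" "\<bar>y\<bar> \<le> R" for x y
    proof -
      have "\<bar>duh h x (- y)\<bar> \<le> C * (x + - y)\<^sup>2"
        by (rule duh_quadratic_bound[OF h, where R = R]) (simp_all add: that C)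
      moreover have "\<bar>duh ?k (- y) x\<bar> \<le> C * (- y + x)\<^sup>2"
        by (rule duh_quadratic_bound[OF k, where R = R]) (simp_all add: that C)
      ultimately have "\<bar>duh h x (- y)\<bar> \<le> C * (x - y)\<^sup>2" "\<bar>duh ?k (- y) x\<bar> \<le> C * (x - y)\<^sup>2"
        by simp_all
      then show ?thesis using Da[of x "- y"] by (simp add: D_def)
    qed
    then show "\<exists>C. \<forall>x y. \<bar>x\<bar> \<le> R \<longrightarrow> \<bar>y\<bar> \<le> R \<longrightarrow> \<bar>\<alpha> x - \<alpha> y\<bar> \<le> C * (x - y)\<^sup>2" by blast
  qed
  then show ?thesis using Da[of u v] by (simp add: D_def)
qed

text \<open>Writing \<open>\<Phi>\<close> as \<open>F + G\<close> plus \<open>cosh\<close> times a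
  bounded function turns the weighted norm into the supremum norm, so Banach's theorem applies to
  bounded continuous functions on the whole plane. \<open>F\<close> and \<open>G\<close> may be
  unbounded, since the weight divides only the Duhamel term.\<close>

lemma mild_solution_exists:
  fixes f F G :: "real \<Rightarrow> real"
  assumes F: "continuous_on UNIV F" and G: "continuous_on UNIV G"
    and Lip: "\<And>x y. \<bar>f x - f y\<bar> \<le> L * \<bar>x - y\<bar>" and B: "\<And>x. \<bar>f x\<bar> \<le> B"
  obtains \<Phi> where "continuous_on UNIV (\<lambda>(u, v). \<Phi> u v)"
    "\<And>u v. \<Phi> u v = F v + G u - duh (\<lambda>a b. f (\<Phi> a b)) u v / 4"
proof -
  have L0: "0 \<le> L" using order_trans[OF abs_ge_zero Lip[of 0 1]] by simp
  have B0: "0 \<le> B" using order_trans[OF abs_ge_zero B] .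
  have fc: "continuous_on UNIV f"
  proof -
    have "L-lipschitz_on UNIV f" by (rule lipschitz_onI) (use Lip L0 in \<open>auto simp: dist_real_def\<close>)
    then show ?thesis by (rule lipschitz_on_continuous_on)
  qed
  \<comment> \<open>\<open>l\<^sup>2 \<ge> L\<close> absorbs the Lipschitz constant and leaves the
    coefficient \<open>1/4\<close> of the Duhamel term as contraction factor;
    \<open>l\<^sup>2 \<ge> 1\<close> keeps the iterates bounded by \<open>B\<close>.\<close>
  define l where "l = sqrt L + 1"
  have l: "l > 0" "L \<le> l\<^sup>2" "1 \<le> l\<^sup>2"
  proof -
    have "sqrt L \<ge> 0" using L0 by simp
    then show "l > 0" unfolding l_def by linarith
    have "l\<^sup>2 = L + (2 * sqrt L + 1)" using L0 by (simp add: l_def power2_sum)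
    then show "L \<le> l\<^sup>2" "1 \<le> l\<^sup>2" using L0 \<open>sqrt L \<ge> 0\<close> by simp_all
  qed
  define ch where "ch u v = cosh (l * (u + v))" for u v :: real
  have ch1: "1 \<le> ch u v" for u v by (simp add: ch_def cosh_real_ge_1)
  then have ch0: "0 < ch u v" for u v using less_le_trans[OF zero_less_one] by blast
  have chc: "continuous_on UNIV (\<lambda>(u, v). ch u v)" unfolding ch_def case_prod_unfold by (intro continuous_intros)
  define \<Psi> where "\<Psi> x u v = F v + G u + ch u v * x (u, v)" for x :: "real \<times> real \<Rightarrow> real" and u v
  have \<Psi>c: "continuous_on UNIV (\<lambda>(u, v). f (\<Psi> x u v))" if "continuous_on UNIV x" for x
  proof -
    have "continuous_on UNIV (\<lambda>z::real \<times> real. \<Psi> x (fst z) (snd z))"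
      unfolding \<Psi>_def
      by (intro continuous_intros continuous_on_curried[OF chc] continuous_on_compose2[OF F] continuous_on_compose2[OF G] continuous_on_compose2[OF that]) auto
    from continuous_on_compose2[OF fc this] show ?thesis by (simp add: case_prod_unfold)
  qed
  define N where "N x z = - duh (\<lambda>a b. f (\<Psi> x a b)) (fst z) (snd z) / (4 * ch (fst z) (snd z))" for x z
  have Nb: "N x \<in> bcontfun" if x: "continuous_on UNIV x" for x
  proof (rule bcontfun_normI)
    show "continuous_on UNIV (N x)"
      unfolding N_def using ch0
      by (intro continuous_intros continuous_on_curried[OF duh_cont[OF \<Psi>c[OF x]]] continuous_on_curried[OF chc]) (auto simp: less_imp_neq[THEN not_sym])
    fix z :: "real \<times> real"
    let ?u = "fst z" let ?v = "snd z"
    have "\<bar>duh (\<lambda>a b. f (\<Psi> x a b)) ?u ?v\<bar> \<le> B / l\<^sup>2 * cosh (l * (?u + ?v))"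
    proof (rule duh_bound[OF \<Psi>c[OF x], where R = "max \<bar>?u\<bar> \<bar>?v\<bar>"])
      fix a b :: real
      have "B * 1 \<le> B * cosh (l * (a + b))" using B0 by (intro mult_left_mono cosh_real_ge_1)
      then show "\<bar>f (\<Psi> x a b)\<bar> \<le> B * cosh (l * (a + b))" using B[of "\<Psi> x a b"] by simp
    qed (use l B0 in auto)
    also have "\<dots> \<le> B * ch ?u ?v"
    proof -
      have "B / l\<^sup>2 \<le> B" using l mult_left_mono[OF l(3) B0] by (simp add: divide_le_eq)
      then show ?thesis using ch0[of ?u ?v] unfolding ch_def by (intro mult_right_mono) auto
    qed
    finally show "norm (N x z) \<le> B"
    proof -
      assume d: "\<bar>duh (\<lambda>a b. f (\<Psi> x a b)) ?u ?v\<bar> \<le> B * ch ?u ?v"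
      have "0 \<le> B * ch ?u ?v" using B0 ch0[of ?u ?v] by simp
      then have "\<bar>duh (\<lambda>a b. f (\<Psi> x a b)) ?u ?v\<bar> \<le> B * (4 * ch ?u ?v)" using d by linarith
      then show ?thesis using ch0[of ?u ?v] by (simp add: N_def abs_divide abs_mult divide_le_eq)
    qed
  qed
  define T where "T x = Bcontfun (N (apply_bcontfun x))" for x :: "(real \<times> real) \<Rightarrow>\<^sub>C real"
  have xc: "continuous_on UNIV (apply_bcontfun x)" for x :: "(real \<times> real) \<Rightarrow>\<^sub>C real" by simp
  have Tap: "apply_bcontfun (T x) = N (apply_bcontfun x)" for x
    unfolding T_def by (rule Bcontfun_inverse[OF Nb[OF xc]])
  have contr: "dist (T x) (T y) \<le> 1/4 * dist x y" for x y
  proof (rule dist_bound)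
    fix z :: "real \<times> real"
    let ?u = "fst z" let ?v = "snd z"
    let ?X = "\<lambda>a b. f (\<Psi> (apply_bcontfun x) a b)" let ?Y = "\<lambda>a b. f (\<Psi> (apply_bcontfun y) a b)"
    have c: "continuous_on UNIV (\<lambda>(u, v). ?X u v - ?Y u v)"
      using continuous_on_diff[OF \<Psi>c[OF xc[of x]] \<Psi>c[OF xc[of y]]] by (simp add: case_prod_unfold)
    have "\<bar>duh ?X ?u ?v - duh ?Y ?u ?v\<bar> = \<bar>duh (\<lambda>a b. ?X a b - ?Y a b) ?u ?v\<bar>"
      by (subst duh_minus[OF \<Psi>c[OF xc] \<Psi>c[OF xc]]) simp
    also have "\<dots> \<le> (L * dist x y) / l\<^sup>2 * cosh (l * (?u + ?v))"
    proof (rule duh_bound[OF c, where R = "max \<bar>?u\<bar> \<bar>?v\<bar>"])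
      fix a b :: real
      have "\<bar>?X a b - ?Y a b\<bar> \<le> L * \<bar>ch a b * (x (a, b) - y (a, b))\<bar>"
        using Lip[of "\<Psi> (apply_bcontfun x) a b" "\<Psi> (apply_bcontfun y) a b"] by (simp add: \<Psi>_def algebra_simps)
      also have "\<dots> = L * (ch a b * dist (x (a, b)) (y (a, b)))"
        using ch0[of a b] by (simp add: abs_mult dist_real_def)
      also have "\<dots> \<le> L * (ch a b * dist x y)"
        using ch0[of a b] L0 by (intro mult_left_mono dist_bounded) auto
      finally show "\<bar>?X a b - ?Y a b\<bar> \<le> L * dist x y * cosh (l * (a + b))" by (simp add: ch_def mult_ac)
    qed (use l L0 in auto)
    also have "\<dots> \<le> dist x y * ch ?u ?v"
    proof -
      have "(L * dist x y) / l\<^sup>2 \<le> dist x y"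
        using l mult_right_mono[OF l(2), of "dist x y"] by (simp add: divide_le_eq mult.commute)
      then show ?thesis using ch0[of ?u ?v] unfolding ch_def by (intro mult_right_mono) auto
    qed
    finally have d: "\<bar>duh ?X ?u ?v - duh ?Y ?u ?v\<bar> \<le> dist x y * ch ?u ?v" .
    have "dist (T x z) (T y z) = \<bar>duh ?X ?u ?v - duh ?Y ?u ?v\<bar> / (4 * ch ?u ?v)"
      using ch0[of ?u ?v] by (simp add: Tap N_def dist_real_def diff_divide_distrib[symmetric] abs_divide abs_mult abs_minus_commute)
    also have "\<dots> \<le> 1/4 * dist x y"
      using d ch0[of ?u ?v] by (simp add: divide_le_eq mult_ac)
    finally show "dist (T x z) (T y z) \<le> 1/4 * dist x y" .
  qed
  obtain x where x: "T x = x"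
    using banach_fix_type[of "1/4" T] contr by auto
  have xN: "x z = N (apply_bcontfun x) z" for z using Tap[of x] x by simp
  show ?thesis
  proof (rule that[of "\<Psi> (apply_bcontfun x)"])
    have "continuous_on UNIV (\<lambda>z::real \<times> real. \<Psi> (apply_bcontfun x) (fst z) (snd z))"
      unfolding \<Psi>_def
      by (intro continuous_intros continuous_on_curried[OF chc] continuous_on_compose2[OF F] continuous_on_compose2[OF G] continuous_on_compose2[OF xc]) auto
    then show "continuous_on UNIV (\<lambda>(u, v). \<Psi> (apply_bcontfun x) u v)" by (simp add: case_prod_unfold)
    fix u v
    show "\<Psi> (apply_bcontfun x) u v = F v + G u - duh (\<lambda>a b. f (\<Psi> (apply_bcontfun x) a b)) u v / 4"
      using ch0[of u v] by (simp add: \<Psi>_def[of _ u v] xN[of "(u, v)"] N_def)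
  qed
qed

text \<open>A square centred at the origin contains the domain of dependence of each of its points,
  so a Lipschitz constant for bounded arguments suffices. The maximum \<open>m\<close> of the
  weighted difference over the square satisfies \<open>m \<le> m / 4\<close>.\<close>

lemma mild_solution_unique:
  fixes f :: "real \<Rightarrow> real" and A :: "real \<Rightarrow> real \<Rightarrow> real"
  assumes Lip: "\<And>R. \<exists>L. \<forall>x y. \<bar>x\<bar> \<le> R \<longrightarrow> \<bar>y\<bar> \<le> R \<longrightarrow> \<bar>f x - f y\<bar> \<le> L * \<bar>x - y\<bar>"
    and f: "continuous_on UNIV f"
    and c1: "continuous_on UNIV (\<lambda>(u, v). \<Phi>1 u v)" and c2: "continuous_on UNIV (\<lambda>(u, v). \<Phi>2 u v)"
    and e1: "\<And>u v. \<Phi>1 u v = A u v - duh (\<lambda>a b. f (\<Phi>1 a b)) u v / 4"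
    and e2: "\<And>u v. \<Phi>2 u v = A u v - duh (\<lambda>a b. f (\<Phi>2 a b)) u v / 4"
  shows "\<Phi>1 u v = \<Phi>2 u v"
proof -
  define R where "R = max \<bar>u\<bar> \<bar>v\<bar>"
  have fc: "continuous_on UNIV (\<lambda>(u, v). f (\<Phi> u v))" if "continuous_on UNIV (\<lambda>(u::real, v::real). \<Phi> u v)" for \<Phi>
    using continuous_on_compose2[OF f that] by (simp add: case_prod_unfold)
  obtain B1 where B1: "\<And>a b. \<bar>a\<bar> \<le> R \<Longrightarrow> \<bar>b\<bar> \<le> R \<Longrightarrow> \<bar>\<Phi>1 a b\<bar> \<le> B1" using square_bounded_values[OF c1] by blast
  obtain B2 where B2: "\<And>a b. \<bar>a\<bar> \<le> R \<Longrightarrow> \<bar>b\<bar> \<le> R \<Longrightarrow> \<bar>\<Phi>2 a b\<bar> \<le> B2" using square_bounded_values[OF c2] by blast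
  obtain L' where L': "\<And>x y. \<bar>x\<bar> \<le> max B1 B2 \<Longrightarrow> \<bar>y\<bar> \<le> max B1 B2 \<Longrightarrow> \<bar>f x - f y\<bar> \<le> L' * \<bar>x - y\<bar>"
    using Lip by metis
  define L where "L = max L' 0"
  have L0: "0 \<le> L" by (simp add: L_def)
  have L: "\<bar>f x - f y\<bar> \<le> L * \<bar>x - y\<bar>" if "\<bar>x\<bar> \<le> max B1 B2" "\<bar>y\<bar> \<le> max B1 B2" for x y
    using L'[OF that] mult_right_mono[of L' L "\<bar>x - y\<bar>"] by (simp add: L_def)
  define l where "l = sqrt L + 1"
  have l: "l > 0" "L \<le> l\<^sup>2"
  proof -
    have s: "sqrt L \<ge> 0" using L0 by simp
    then show "l > 0" unfolding l_def by linarith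
    have "l\<^sup>2 = L + (2 * sqrt L + 1)" using L0 by (simp add: l_def power2_sum)
    then show "L \<le> l\<^sup>2" using s by simp
  qed
  define ch where "ch u v = cosh (l * (u + v))" for u v :: real
  have ch0: "0 < ch u v" for u v using less_le_trans[OF zero_less_one cosh_real_ge_1] by (simp add: ch_def)
  let ?S = "{-R..R} \<times> {-R..R}"
  define d where "d z = \<bar>\<Phi>1 (fst z) (snd z) - \<Phi>2 (fst z) (snd z)\<bar> / ch (fst z) (snd z)" for z
  have "continuous_on ?S d"
    unfolding d_def ch_def
    by (intro continuous_intros continuous_on_curried[OF c1] continuous_on_curried[OF c2]) auto
  moreover have "compact ?S" by (intro compact_Times compact_Icc)
  moreover have "(0, 0) \<in> ?S" by (auto simp: R_def)
  ultimately obtain z where z: "z \<in> ?S" and zmax: "\<And>y. y \<in> ?S \<Longrightarrow> d y \<le> d z"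
    using continuous_attains_sup[of ?S d] by blast
  define m where "m = d z"
  have m0: "0 \<le> m" using ch0[of "fst z" "snd z"] by (simp add: m_def d_def)
  have db: "\<bar>\<Phi>1 a b - \<Phi>2 a b\<bar> \<le> m * ch a b" if "\<bar>a\<bar> \<le> R" "\<bar>b\<bar> \<le> R" for a b
  proof -
    have "d (a, b) \<le> m" unfolding m_def by (rule zmax) (use that in auto)
    then show ?thesis using ch0[of a b] by (simp add: d_def divide_le_eq)
  qed
  have c: "continuous_on UNIV (\<lambda>(u, v). f (\<Phi>1 u v) - f (\<Phi>2 u v))"
    using continuous_on_diff[OF fc[OF c1] fc[OF c2]] by (simp add: case_prod_unfold)
  have zR: "\<bar>fst z\<bar> \<le> R" "\<bar>snd z\<bar> \<le> R" using z by auto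
  have "\<bar>duh (\<lambda>a b. f (\<Phi>1 a b) - f (\<Phi>2 a b)) (fst z) (snd z)\<bar> \<le> (L * m) / l\<^sup>2 * cosh (l * (fst z + snd z))"
  proof (rule duh_bound[OF c zR])
    fix a b assume ab: "\<bar>a\<bar> \<le> R" "\<bar>b\<bar> \<le> R"
    have "\<bar>f (\<Phi>1 a b) - f (\<Phi>2 a b)\<bar> \<le> L * \<bar>\<Phi>1 a b - \<Phi>2 a b\<bar>"
      by (rule L) (use B1[OF ab] B2[OF ab] in auto)
    also have "\<dots> \<le> L * (m * ch a b)" by (rule mult_left_mono[OF db[OF ab] L0])
    finally show "\<bar>f (\<Phi>1 a b) - f (\<Phi>2 a b)\<bar> \<le> L * m * cosh (l * (a + b))" by (simp add: ch_def)
  qed (use l L0 m0 in auto)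
  also have "\<dots> \<le> m * ch (fst z) (snd z)"
  proof -
    have "(L * m) / l\<^sup>2 \<le> m" using l mult_right_mono[OF l(2) m0] by (simp add: divide_le_eq mult.commute)
    then show ?thesis using ch0[of "fst z" "snd z"] unfolding ch_def by (intro mult_right_mono) auto
  qed
  finally have D: "\<bar>duh (\<lambda>a b. f (\<Phi>1 a b) - f (\<Phi>2 a b)) (fst z) (snd z)\<bar> \<le> m * ch (fst z) (snd z)" .
  have "\<Phi>1 (fst z) (snd z) - \<Phi>2 (fst z) (snd z) = - duh (\<lambda>a b. f (\<Phi>1 a b) - f (\<Phi>2 a b)) (fst z) (snd z) / 4"
    unfolding duh_minus[OF fc[OF c1] fc[OF c2], symmetric]
    by (subst e1, subst e2) (simp add: diff_divide_distrib)
  then have "\<bar>\<Phi>1 (fst z) (snd z) - \<Phi>2 (fst z) (snd z)\<bar> \<le> m * ch (fst z) (snd z) / 4"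
    using D by simp
  then have "m \<le> m / 4"
    using ch0[of "fst z" "snd z"] by (simp add: m_def d_def divide_le_eq)
  then have "m = 0" using m0 by simp
  then show ?thesis using db[of u v] by (simp add: R_def)
qed

section \<open>Existence of characteristic solutions\<close>

text \<open>With \<open>m\<close> the mean of \<open>g\<close>, this is the nonnegativity of the
  integral of \<open>(g x - m)\<^sup>2\<close>.\<close>

lemma LBINT_Cauchy_Schwarz:
  fixes g :: "real \<Rightarrow> real"
  assumes ab: "a \<le> b" and g: "g \<in> borel_measurable borel" and g2: "set_integrable lborel {a..b} (\<lambda>x. (g x)\<^sup>2)"
  shows "(LBINT x:{a..b}. g x)\<^sup>2 \<le> (b - a) * (LBINT x:{a..b}. (g x)\<^sup>2)"
proof (cases "a = b")
  case True
  have "set_integrable lborel {b..b} g" by (rule set_integrable_from_square[OF _ g]) (use g2 True in auto)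
  then have "(LBINT x:{b..b}. g x) = 0" using LBINT_combine[of b b b g] by simp
  then show ?thesis using True by simp
next
  case False
  then have l: "b - a > 0" using ab by simp
  have g1: "set_integrable lborel {a..b} g" by (rule set_integrable_from_square[OF g2 g]) simp
  define m where "m = (LBINT x:{a..b}. g x) / (b - a)"
  have c: "set_integrable lborel {a..b} (\<lambda>x. m\<^sup>2)" by (intro borel_integrable_atLeastAtMost' continuous_intros)
  have s: "set_integrable lborel {a..b} (\<lambda>x. (g x)\<^sup>2 - 2 * m * g x)"
    using g1 g2 by (intro set_integral_diff) simp_all
  have "0 \<le> (LBINT x:{a..b}. (g x - m)\<^sup>2)" by (rule LBINT_nonneg) simp
  also have "(\<lambda>x. (g x - m)\<^sup>2) = (\<lambda>x. ((g x)\<^sup>2 - 2 * m * g x) + m\<^sup>2)" by (auto simp: power2_eq_square algebra_simps)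
  also have "(LBINT x:{a..b}. ((g x)\<^sup>2 - 2 * m * g x) + m\<^sup>2) = (LBINT x:{a..b}. (g x)\<^sup>2) - 2 * m * (LBINT x:{a..b}. g x) + m\<^sup>2 * (b - a)"
    using set_integral_add(2)[OF s c] set_integral_diff(2)[OF g2, of "\<lambda>x. 2 * m * g x"] g1 ab by (simp add: set_integral_const)
  also have "\<dots> = (LBINT x:{a..b}. (g x)\<^sup>2) - m\<^sup>2 * (b - a)"
  proof -
    have I: "(LBINT x:{a..b}. g x) = m * (b - a)" using l by (simp add: m_def)
    show ?thesis unfolding I by (simp add: power2_eq_square algebra_simps)
  qed
  finally have "m\<^sup>2 * (b - a) * (b - a) \<le> (LBINT x:{a..b}. (g x)\<^sup>2) * (b - a)"
    using l by (intro mult_right_mono) auto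
  moreover have "m\<^sup>2 * (b - a) * (b - a) = (LBINT x:{a..b}. g x)\<^sup>2"
    using l by (simp add: m_def power2_eq_square)
  ultimately show ?thesis by (simp add: mult.commute)
qed

lemma increments_continuous:
  fixes g G :: "real \<Rightarrow> real"
  assumes i: "\<And>a b. set_integrable lborel {a..b} g" and G: "\<And>a b. a \<le> b \<Longrightarrow> G b - G a = (LBINT x:{a..b}. g x)"
  shows "continuous_on UNIV G"
proof -
  have "isCont G x" for x
  proof -
    let ?a = "x - 1" let ?b = "x + 1"
    have "continuous_on {?a..?b} (\<lambda>y. integral {?a..y} g)"
      by (rule indefinite_integral_continuous_1) (rule set_borel_integral_eq_integral(1)[OF i])
    then have "continuous_on {?a..?b} (\<lambda>y. G ?a + integral {?a..y} g)" by (intro continuous_intros)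
    moreover have "G ?a + integral {?a..y} g = G y" if "y \<in> {?a..?b}" for y
      using G[of ?a y] set_borel_integral_eq_integral(2)[OF i, of ?a y] that by simp
    ultimately have "continuous_on {?a..?b} G" by (rule continuous_on_eq)
    then have "continuous_on {?a<..<?b} G" by (rule continuous_on_subset) auto
    then show ?thesis by (simp add: continuous_on_eq_continuous_at)
  qed
  then show ?thesis by (simp add: continuous_on_eq_continuous_at)
qed

lemma indefinite_integral_exists:
  fixes g :: "real \<Rightarrow> real"
  assumes i: "\<And>a b. set_integrable lborel {a..b} g"
  obtains G where "G 0 = 0" "\<And>a b. a \<le> b \<Longrightarrow> G b - G a = (LBINT x:{a..b}. g x)" "continuous_on UNIV G"
proof -
  have z: "(LBINT x:{c..c}. g x) = 0" for c
    using LBINT_combine[of c c c g, OF _ _ i] by simp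
  have e: "(LBINT x:{c..d}. g x) = 0" if "d < c" for c d
    using that by (simp add: set_lebesgue_integral_def)
  define G where "G x = (LBINT y:{0..x}. g y) - (LBINT y:{x..0}. g y)" for x
  have G: "G b - G a = (LBINT x:{a..b}. g x)" if ab: "a \<le> b" for a b
  proof -
    consider "0 \<le> a" | "a < 0" "0 \<le> b" | "b < 0" by linarith
    then show ?thesis
    proof cases
      case 1
      then have "(LBINT y:{a..0}. g y) = 0" "(LBINT y:{b..0}. g y) = 0"
        using ab z[of 0] e[of 0 a] e[of 0 b] by (cases "a = 0"; cases "b = 0"; simp)+
      then show ?thesis using LBINT_combine[OF 1 ab i] by (simp add: G_def)
    next
      case 2
      then have "(LBINT y:{b..0}. g y) = 0" "(LBINT y:{0..a}. g y) = 0"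
        using z[of 0] e[of 0 b] e[of a 0] by (cases "b = 0"; simp)+
      then show ?thesis using LBINT_combine[of a 0 b, OF _ _ i] 2 by (simp add: G_def)
    next
      case 3
      then have "(LBINT y:{0..a}. g y) = 0" "(LBINT y:{0..b}. g y) = 0" using ab e by auto
      then show ?thesis using LBINT_combine[of a b 0, OF ab _ i] 3 by (simp add: G_def)
    qed
  qed
  show ?thesis by (rule that[OF _ G increments_continuous[OF i G]]) (simp_all add: G_def)
qed

text \<open>\<open>Pd\<close> is normalised on the line \<open>u = 0\<close>, whereas the data live
  on \<open>u = - v\<close>; the integrals in \<open>p\<close> and \<open>q\<close> account for the
  passage between the two. Increments in \<open>v\<close> are immediate from the shape of
  \<open>duh\<close>, those in \<open>u\<close> rest on \<open>duh_sym\<close>.\<close>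

lemma mild_charsol:
  fixes f V F G pF qG :: "real \<Rightarrow> real"
  assumes f: "continuous_on UNIV f" and V: "\<And>y. (V has_real_derivative f y) (at y)" "\<And>y. 0 \<le> V y"
    and c: "continuous_on UNIV (\<lambda>(u, v). \<Phi> u v)"
    and m [measurable]: "pF \<in> borel_measurable borel" "qG \<in> borel_measurable borel"
    and sq: "\<And>a b. set_integrable lborel {a..b} (\<lambda>x. (pF x)\<^sup>2)" "\<And>a b. set_integrable lborel {a..b} (\<lambda>x. (qG x)\<^sup>2)"
    and F: "\<And>a b. a \<le> b \<Longrightarrow> F b - F a = (LBINT x:{a..b}. pF x)" and G: "\<And>a b. a \<le> b \<Longrightarrow> G b - G a = (LBINT x:{a..b}. qG x)"
    and eq: "\<And>u v. \<Phi> u v = F v + G u - duh (\<lambda>a b. f (\<Phi> a b)) u v / 4"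
  defines "p \<equiv> \<lambda>v. pF v - oint (- v) 0 (\<lambda>s. f (\<Phi> s v)) / 4" and "q \<equiv> \<lambda>u. qG u - oint (- u) 0 (\<lambda>s. f (\<Phi> u s)) / 4"
  shows "charsol f V \<Phi> p q"
    and "Pd f \<Phi> p u v = pF v - oint (- v) u (\<lambda>s. f (\<Phi> s v)) / 4"
    and "Pd f (\<lambda>u v. \<Phi> v u) q v u = qG u - oint (- u) v (\<lambda>s. f (\<Phi> u s)) / 4"
proof -
  have hc: "continuous_on UNIV (\<lambda>(u, v). f (\<Phi> u v))"
    using continuous_on_compose2[OF f c] by (simp add: case_prod_unfold)
  have hc': "continuous_on UNIV (\<lambda>(u, v). f (\<Phi> v u))" by (rule continuous_swap_args[OF hc])
  have P: "Pd f \<Phi> p u v = pF v - oint (- v) u (\<lambda>s. f (\<Phi> s v)) / 4" for u v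
    using oint_combine[OF slice_cont(1)[OF hc], of "- v" 0 v u] by (simp add: Pd_def p_def field_simps)
  have Q: "Pd f (\<lambda>u v. \<Phi> v u) q v u = qG u - oint (- u) v (\<lambda>s. f (\<Phi> u s)) / 4" for u v
    using oint_combine[OF slice_cont(2)[OF hc], of "- u" 0 u v] by (simp add: Pd_def q_def field_simps)
  show "Pd f \<Phi> p u v = pF v - oint (- v) u (\<lambda>s. f (\<Phi> s v)) / 4"
    "Pd f (\<lambda>u v. \<Phi> v u) q v u = qG u - oint (- u) v (\<lambda>s. f (\<Phi> u s)) / 4" by (rule P, rule Q)
  have diff: "set_integrable lborel {a..b} (\<lambda>x. (g x - k x / 4)\<^sup>2)"
    if "g \<in> borel_measurable borel" "set_integrable lborel {a..b} (\<lambda>x. (g x)\<^sup>2)" "continuous_on UNIV k" for g k :: "real \<Rightarrow> real" and a b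
  proof -
    have g1: "set_integrable lborel {a..b} g" by (rule set_integrable_from_square[OF that(2,1)]) simp
    have "set_integrable lborel {a..b} (\<lambda>x. (g x)\<^sup>2 - (k x / 2) * g x + (k x / 4)\<^sup>2)"
      by (intro set_integral_add set_integral_diff that(2) set_integrable_continuous_mult[OF g1] borel_integrable_atLeastAtMost')
        (auto intro!: continuous_intros continuous_on_subset[OF that(3)])
    then show ?thesis by (simp add: power2_diff field_simps)
  qed
  have k1: "continuous_on UNIV (\<lambda>v. oint (- v) 0 (\<lambda>s. f (\<Phi> s v)))" and k2: "continuous_on UNIV (\<lambda>u. oint (- u) 0 (\<lambda>s. f (\<Phi> u s)))"
    by (rule continuous_inner_oint[OF hc], intro continuous_intros, intro continuous_intros, intro continuous_intros)
      (rule continuous_inner_oint[OF hc'], intro continuous_intros, intro continuous_intros, intro continuous_intros)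
  have [measurable]: "(\<lambda>v. oint (- v) 0 (\<lambda>s. f (\<Phi> s v))) \<in> borel_measurable borel" "(\<lambda>u. oint (- u) 0 (\<lambda>s. f (\<Phi> u s))) \<in> borel_measurable borel"
    using k1 k2 by (auto intro: borel_measurable_continuous_onI)
  have incr: "A v2 - A v1 - (duh h u v2 - duh h u v1) / 4 = (LBINT y:{v1..v2}. g y - oint (- y) u (\<lambda>s. h s y) / 4)"
    if h: "continuous_on UNIV (\<lambda>(u, v). h u v)" and "v1 \<le> v2" and A: "A v2 - A v1 = (LBINT y:{v1..v2}. g y)"
      and gi: "set_integrable lborel {v1..v2} g" for A g :: "real \<Rightarrow> real" and h u v1 v2
  proof -
    have kc: "continuous_on UNIV (\<lambda>y. oint (- y) u (\<lambda>s. h s y) / 4)" by (intro continuous_intros duh_inner_cont[OF h]) simp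
    have ki: "set_integrable lborel {v1..v2} (\<lambda>y. oint (- y) u (\<lambda>s. h s y) / 4)"
      by (intro borel_integrable_atLeastAtMost' continuous_on_subset[OF kc]) auto
    have "(LBINT y:{v1..v2}. oint (- y) u (\<lambda>s. h s y) / 4) = oint v1 v2 (\<lambda>y. oint (- y) u (\<lambda>s. h s y)) / 4"
      by (simp add: oint_eq_LBINT[OF duh_inner_cont[OF h] that(2)])
    then show ?thesis
      unfolding set_integral_diff(2)[OF gi ki] A duh_diff_v[OF h] by simp
  qed
  have pi: "set_integrable lborel {a..b} pF" "set_integrable lborel {a..b} qG" for a b
    by (rule set_integrable_from_square[OF sq(1) m(1)], simp, rule set_integrable_from_square[OF sq(2) m(2)], simp)
  show "charsol f V \<Phi> p q"
  proof
    show "p \<in> borel_measurable borel" "q \<in> borel_measurable borel"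
      unfolding p_def q_def by measurable
    show "set_integrable lborel {a..b} (\<lambda>x. (p x)\<^sup>2)" "set_integrable lborel {a..b} (\<lambda>x. (q x)\<^sup>2)" for a b
      unfolding p_def q_def by (rule diff[OF m(1) sq(1) k1], rule diff[OF m(2) sq(2) k2])
    show "\<Phi> u v2 - \<Phi> u v1 = (LBINT y:{v1..v2}. Pd f \<Phi> p u y)" if "v1 \<le> v2" for u v1 v2
      unfolding P incr[OF hc that F[OF that] pi(1), symmetric] by (subst (1 2) eq) (simp add: diff_divide_distrib)
    show "\<Phi> u2 v - \<Phi> u1 v = (LBINT y:{u1..u2}. Pd f (\<lambda>u v. \<Phi> v u) q v y)" if "u1 \<le> u2" for v u1 u2
      unfolding Q incr[OF hc' that G[OF that] pi(2), symmetric]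
      by (subst (1 2) eq) (simp add: diff_divide_distrib duh_sym[OF hc, symmetric])
  qed (use f V c in auto)
qed

context finite_energy
begin

text \<open>The two points of a time slice are joined through the corner
  \<open>(T - x, T + y)\<close>. Each characteristic leg has length \<open>y - x\<close>, and by
  Cauchy-Schwarz the increment along it is at most the root of this length times the root of an
  energy flux.\<close>

lemma half_hoelder:
  assumes "x \<le> y"
  shows "\<bar>\<Phi> (T - x) (T + x) - \<Phi> (T - y) (T + y)\<bar> \<le> sqrt (y - x) * (sqrt EP + sqrt EQ)"
proof -
  interpret sw: finite_energy f V "\<lambda>u v. \<Phi> v u" q p by (rule swap')
  have [measurable]: "(\<lambda>v. P u v) \<in> borel_measurable borel" "(\<lambda>u. Q u v) \<in> borel_measurable borel" for u v
    by (intro P_meas' sw.P_meas'; simp)+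
  have 1: "\<bar>\<Phi> (T - x) (T + y) - \<Phi> (T - x) (T + x)\<bar> \<le> sqrt (y - x) * sqrt EP"
  proof -
    have "(\<Phi> (T - x) (T + y) - \<Phi> (T - x) (T + x))\<^sup>2 = (LBINT v:{T+x..T+y}. P (T - x) v)\<^sup>2"
      using assms by (simp add: Phi_v)
    also have "\<dots> \<le> (T + y - (T + x)) * (LBINT v:{T+x..T+y}. (P (T - x) v)\<^sup>2)"
      using assms by (intro LBINT_Cauchy_Schwarz P_sq_line continuous_intros) auto
    also have "\<dots> \<le> (y - x) * EP"
      using assms flux_P_le[of T "T - x" "T + x" "T + y"] by (auto intro!: mult_left_mono)
    finally show ?thesis by (simp add: real_le_rsqrt real_sqrt_mult[symmetric] flip: real_sqrt_abs)
  qed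
  have 2: "\<bar>\<Phi> (T - x) (T + y) - \<Phi> (T - y) (T + y)\<bar> \<le> sqrt (y - x) * sqrt EQ"
  proof -
    have "(\<Phi> (T - x) (T + y) - \<Phi> (T - y) (T + y))\<^sup>2 = (LBINT u:{T-y..T-x}. Q u (T + y))\<^sup>2"
      using assms by (simp add: Phi_u)
    also have "\<dots> \<le> (T - x - (T - y)) * (LBINT u:{T-y..T-x}. (Q u (T + y))\<^sup>2)"
      using assms by (intro LBINT_Cauchy_Schwarz sw.P_sq_line continuous_intros) auto
    also have "\<dots> \<le> (y - x) * EQ"
      using assms sw.flux_P_le[of T "T + y" "T - y" "T - x"] by (auto intro!: mult_left_mono simp: sw.EP_def EQ_def)
    finally show ?thesis by (simp add: real_le_rsqrt real_sqrt_mult[symmetric] flip: real_sqrt_abs)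
  qed
  show ?thesis using 1 2 by (simp add: distrib_left)
qed

text \<open>By \<open>half_hoelder\<close> a value of size \<open>\<eta>\<close> persists at half
  its size on an interval of length \<open>(\<eta> / (2 * H))\<^sup>2\<close>. The estimate serves
  twice: for the a priori bound on truncated solutions and for the decay of the supremum. The
  summand 1 keeps the denominator positive when the energy is zero.\<close>

lemma potential_lower_bound:
  assumes \<eta>: "\<eta> > 0" and low: "\<And>y. \<eta> / 2 \<le> \<bar>y\<bar> \<Longrightarrow> \<nu> \<le> V y" and x: "\<eta> \<le> \<bar>\<Phi> (T - x) (T + x)\<bar>"
  shows "(\<eta> / (2 * (sqrt EP + sqrt EQ + 1)))\<^sup>2 * \<nu> \<le> (\<integral>x. V (\<Phi> (T - x) (T + x)) \<partial>lborel)"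
proof -
  define H where "H = sqrt EP + sqrt EQ + 1"
  have H: "H > 0" "sqrt EP + sqrt EQ \<le> H" using EP_nonneg unfolding H_def by (auto intro!: add_nonneg_pos)
  define d where "d = (\<eta> / (2 * H))\<^sup>2"
  have d0: "0 \<le> d" by (simp add: d_def)
  have sd: "sqrt d = \<eta> / (2 * H)" using \<eta> H by (simp add: d_def)
  have b: "\<nu> \<le> V (\<Phi> (T - y) (T + y))" if y: "y \<in> {x..x+d}" for y
  proof (rule low)
    have "\<bar>\<Phi> (T - x) (T + x) - \<Phi> (T - y) (T + y)\<bar> \<le> sqrt (y - x) * (sqrt EP + sqrt EQ)"
      by (rule half_hoelder) (use y in auto)
    also have "\<dots> \<le> sqrt d * H" using y H EP_nonneg by (intro mult_mono) auto
    also have "\<dots> = \<eta> / 2" using H by (simp add: sd)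
    finally show "\<eta> / 2 \<le> \<bar>\<Phi> (T - y) (T + y)\<bar>" using x by linarith
  qed
  have "d * \<nu> = (LBINT y:{x..x+d}. \<nu>)" using d0 by (simp add: set_integral_const)
  also have "\<dots> \<le> (LBINT y:{x..x+d}. V (\<Phi> (T - y) (T + y)))"
    by (rule set_integral_mono) (auto intro!: borel_integrable_atLeastAtMost' V_Phi_cont continuous_intros b)
  also have "\<dots> \<le> (\<integral>x. V (\<Phi> (T - x) (T + x)) \<partial>lborel)"
    by (rule LBINT_le_integral[OF potential_integrable]) (auto intro: V_nonneg)
  finally show ?thesis by (simp add: d_def H_def)
qed

end

section \<open>The power nonlinearity, its potential and their truncations\<close>

definition nlin :: "real \<Rightarrow> real \<Rightarrow> real" where "nlin p y = \<bar>y\<bar> powr (p - 1) * y"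
definition npot :: "real \<Rightarrow> real \<Rightarrow> real" where "npot p y = \<bar>y\<bar> powr (p + 1) / (p + 1)"

text \<open>Away from 0 this is the power rule on each side; at 0 the difference quotient is
  \<open>\<bar>h\<bar> powr a\<close> itself.\<close>

lemma abs_powr_deriv:
  assumes a: "a > 0"
  shows "((\<lambda>y::real. \<bar>y\<bar> powr a * y) has_real_derivative (a + 1) * \<bar>y\<bar> powr a) (at y)"
proof -
  consider "y > 0" | "y < 0" | "y = 0" by linarith
  then show ?thesis
  proof cases
    case 1
    have "((\<lambda>y::real. y powr a * y) has_real_derivative (a + 1) * \<bar>y\<bar> powr a) (at y)"
      using 1 by (auto intro!: derivative_eq_intros simp: powr_diff field_simps)
    then show ?thesis
      by (rule has_field_derivative_transform_within_open[of _ _ _ "{0<..}"]) (use 1 in auto)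
  next
    case 2
    have "((\<lambda>y::real. (- y) powr a * y) has_real_derivative (a + 1) * \<bar>y\<bar> powr a) (at y)"
      using 2 by (auto intro!: derivative_eq_intros simp: powr_diff field_simps)
    then show ?thesis
      by (rule has_field_derivative_transform_within_open[of _ _ _ "{..<0}"]) (use 2 in auto)
  next
    case 3
    have "((\<lambda>h::real. \<bar>h\<bar> powr a) \<longlongrightarrow> 0) (at 0)"
      using a by (auto intro!: tendsto_eq_intros)
    then have "((\<lambda>h::real. (\<bar>h\<bar> powr a * h - \<bar>0\<bar> powr a * 0) / (h - 0)) \<longlongrightarrow> 0) (at 0)"
      by (rule Lim_transform_eventually) (auto simp: eventually_at_filter)
    then show ?thesis using 3 a by (simp add: has_field_derivative_iff)
  qed
qed

lemma nlin_deriv: "p > 1 \<Longrightarrow> (nlin p has_real_derivative p * \<bar>y\<bar> powr (p - 1)) (at y)"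
  using abs_powr_deriv[of "p - 1" y] by (simp add: nlin_def[abs_def])

lemma nlin_cont: "p > 1 \<Longrightarrow> continuous_on S (nlin p)"
  by (rule DERIV_continuous_on[OF has_field_derivative_at_within[OF nlin_deriv]])

lemma npot_eq: "p > 1 \<Longrightarrow> npot p y = nlin p y * y / (p + 1)"
proof -
  assume p: "p > 1"
  have "\<bar>y\<bar> powr (p + 1) = \<bar>y\<bar> powr ((p - 1) + 2)" by (simp add: add.commute)
  also have "\<dots> = \<bar>y\<bar> powr (p - 1) * \<bar>y\<bar> powr 2" by (rule powr_add)
  also have "\<bar>y\<bar> powr 2 = y * y" by (cases "y = 0") (simp_all add: power2_eq_square[symmetric])
  finally show ?thesis by (simp add: npot_def nlin_def)
qed

lemma npot_hom: "p > 1 \<Longrightarrow> y * nlin p y = (p + 1) * npot p y"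
  by (simp add: npot_eq)

lemma npot_nonneg: "p > 1 \<Longrightarrow> 0 \<le> npot p y"
  by (simp add: npot_def)

lemma npot_deriv: "p > 1 \<Longrightarrow> (npot p has_real_derivative nlin p y) (at y)"
proof -
  assume p: "p > 1"
  have "((\<lambda>y. nlin p y * y / (p + 1)) has_real_derivative nlin p y) (at y)"
  proof (rule DERIV_cong[OF DERIV_cdivide[OF DERIV_mult[OF nlin_deriv[OF p] DERIV_ident]]])
    show "(p * \<bar>y\<bar> powr (p - 1) * y + 1 * nlin p y) / (p + 1) = nlin p y"
      using p by (simp add: nlin_def field_simps)
  qed
  moreover have "npot p = (\<lambda>y. nlin p y * y / (p + 1))" using npot_eq[OF p] by auto
  ultimately show ?thesis by simp
qed

lemma npot_mono: "p > 1 \<Longrightarrow> 0 \<le> x \<Longrightarrow> x \<le> \<bar>y\<bar> \<Longrightarrow> npot p x \<le> npot p y"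
  unfolding npot_def by (intro divide_right_mono powr_mono2) auto

lemma nlin_lipschitz:
  assumes p: "p > 1" and "\<bar>x\<bar> \<le> R" "\<bar>y\<bar> \<le> R"
  shows "\<bar>nlin p x - nlin p y\<bar> \<le> (p * R powr (p - 1)) * \<bar>x - y\<bar>"
proof -
  have "norm (nlin p x - nlin p y) \<le> (p * R powr (p - 1)) * norm (x - y)"
  proof (rule field_differentiable_bound[of "{-R..R}"])
    fix z assume "z \<in> {-R..R}"
    then have "\<bar>z\<bar> powr (p - 1) \<le> R powr (p - 1)" using p by (intro powr_mono2) auto
    then show "norm (p * \<bar>z\<bar> powr (p - 1)) \<le> p * R powr (p - 1)" using p by (simp add: abs_mult)
    show "(nlin p has_field_derivative p * \<bar>z\<bar> powr (p - 1)) (at z within {-R..R})"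
      by (rule has_field_derivative_at_within[OF nlin_deriv[OF p]])
  qed (use assms in auto)
  then show ?thesis by simp
qed

text \<open>Truncating makes the nonlinearity globally Lipschitz. The energy bound for the truncated problem
  limits the supremum of the solution independently of a large truncation level \<open>M\<close>, at which point
  the truncation is never active.\<close>

definition trunc :: "real \<Rightarrow> real \<Rightarrow> real \<Rightarrow> real" where
  "trunc p M y = nlin p (max (- M) (min M y))"

lemma trunc_lipschitz:
  assumes "p > 1" "0 \<le> M"
  shows "\<bar>trunc p M x - trunc p M y\<bar> \<le> (p * M powr (p - 1)) * \<bar>x - y\<bar>"
proof -
  have "\<bar>trunc p M x - trunc p M y\<bar> \<le> (p * M powr (p - 1)) * \<bar>max (- M) (min M x) - max (- M) (min M y)\<bar>"
    unfolding trunc_def by (rule nlin_lipschitz) (use assms in auto)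
  also have "\<dots> \<le> (p * M powr (p - 1)) * \<bar>x - y\<bar>"
    using assms by (intro mult_left_mono) auto
  finally show ?thesis .
qed

lemma trunc_cont: "p > 1 \<Longrightarrow> continuous_on S (trunc p M)"
  unfolding trunc_def[abs_def] by (rule continuous_on_compose2[OF nlin_cont[of p UNIV]]) (auto intro!: continuous_intros)

lemma trunc_bound: "p > 1 \<Longrightarrow> 0 \<le> M \<Longrightarrow> \<bar>trunc p M x\<bar> \<le> (p * M powr (p - 1)) * M"
proof -
  assume p: "p > 1" and M: "0 \<le> M"
  have "\<bar>nlin p (max (- M) (min M x)) - nlin p 0\<bar> \<le> (p * M powr (p - 1)) * \<bar>max (- M) (min M x) - 0\<bar>"
    by (rule nlin_lipschitz) (use p M in auto)
  also have "\<dots> \<le> (p * M powr (p - 1)) * M"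
  proof (rule mult_left_mono)
    show "\<bar>max (- M) (min M x) - 0\<bar> \<le> M" using M by (simp only: diff_zero)
  qed (use p in simp)
  finally have "\<bar>nlin p (max (- M) (min M x)) - nlin p 0\<bar> \<le> (p * M powr (p - 1)) * M" .
  moreover have "nlin p 0 = 0" by (simp add: nlin_def)
  ultimately show ?thesis unfolding trunc_def by (simp only: diff_zero)
qed

lemma trunc_eq: "\<bar>y\<bar> \<le> M \<Longrightarrow> trunc p M y = nlin p y"
proof -
  assume "\<bar>y\<bar> \<le> M"
  then have "max (- M) (min M y) = y" by auto
  then show ?thesis by (simp add: trunc_def)
qed

definition tpot :: "real \<Rightarrow> real \<Rightarrow> real \<Rightarrow> real" where
  "tpot p M y = oint 0 y (trunc p M)"

lemma tpot_deriv: "p > 1 \<Longrightarrow> (tpot p M has_real_derivative trunc p M y) (at y)"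
  unfolding tpot_def[abs_def] by (rule oint_deriv[OF trunc_cont])

lemma tpot_even: "p > 1 \<Longrightarrow> 0 \<le> M \<Longrightarrow> tpot p M (- y) = tpot p M y"
proof -
  assume p: "p > 1" and M: "0 \<le> M"
  have o: "trunc p M (- s) = - trunc p M s" for s
  proof -
    have e: "max (- M) (min M (- s)) = - max (- M) (min M s)" using M by auto
    show ?thesis unfolding trunc_def e by (simp add: nlin_def)
  qed
  have "-1 * oint 0 y (\<lambda>s. trunc p M (0 + -1 * s)) = oint (0 + -1 * 0) (0 + -1 * y) (trunc p M)"
    by (rule oint_affine[OF trunc_cont[OF p]])
  then show ?thesis by (simp add: tpot_def o oint_minus)
qed

lemma npot_LBINT: "p > 1 \<Longrightarrow> 0 \<le> y \<Longrightarrow> (LBINT s:{0..y}. nlin p s) = npot p y"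
  using LBINT_FTC[of 0 y "npot p" "nlin p"] has_field_derivative_at_within[OF npot_deriv] nlin_cont
  by (simp add: npot_def)

text \<open>The truncated potential is even, grows with \<open>\<bar>y\<bar>\<close> and agrees with
  the full one up to the level \<open>M\<close>. The last bound, taken at \<open>m = 1\<close>, does
  not involve \<open>M\<close>, which makes the supremum estimate for truncated solutions
  uniform.\<close>

lemma tpot_bounds:
  assumes p: "p > 1" and M: "0 \<le> M"
  shows "0 \<le> tpot p M y" "tpot p M y \<le> npot p y" "0 \<le> m \<Longrightarrow> m \<le> M \<Longrightarrow> m \<le> \<bar>y\<bar> \<Longrightarrow> npot p m \<le> tpot p M y"
proof -
  have i: "set_integrable lborel {a..b} (trunc p M)" "set_integrable lborel {a..b} (nlin p)" for a b
    by (intro borel_integrable_atLeastAtMost' trunc_cont nlin_cont p)+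
  have nn: "0 \<le> trunc p M s" "trunc p M s \<le> nlin p s" if "0 \<le> s" for s
  proof -
    have "trunc p M s = nlin p (min M s)" using that M by (simp add: trunc_def)
    moreover have "nlin p (min M s) \<le> nlin p s"
      unfolding nlin_def using that M p by (intro mult_mono powr_mono2) auto
    moreover have "0 \<le> nlin p (min M s)" unfolding nlin_def using that M by simp
    ultimately show "0 \<le> trunc p M s" "trunc p M s \<le> nlin p s" by simp_all
  qed
  have e: "tpot p M \<bar>y\<bar> = (LBINT s:{0..\<bar>y\<bar>}. trunc p M s)"
    unfolding tpot_def by (rule oint_eq_LBINT[symmetric, OF trunc_cont[OF p]]) simp
  have ty: "tpot p M y = tpot p M \<bar>y\<bar>" using tpot_even[OF p M, of y] by (auto simp: abs_if)
  show "0 \<le> tpot p M y" unfolding ty e by (rule LBINT_nonneg) (use nn in auto)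
  have "tpot p M y \<le> (LBINT s:{0..\<bar>y\<bar>}. nlin p s)"
    unfolding ty e by (rule set_integral_mono[OF i]) (use nn in auto)
  then show "tpot p M y \<le> npot p y" using npot_LBINT[OF p, of "\<bar>y\<bar>"] by (simp add: npot_def)
  assume m: "0 \<le> m" "m \<le> M" "m \<le> \<bar>y\<bar>"
  have "npot p m = (LBINT s:{0..m}. nlin p s)" using npot_LBINT[OF p m(1)] by simp
  also have "\<dots> = (LBINT s:{0..m}. trunc p M s)"
    by (rule set_lebesgue_integral_cong) (use m trunc_eq[of _ M p] in auto)
  also have "\<dots> \<le> (LBINT s:{0..\<bar>y\<bar>}. trunc p M s)"
    using LBINT_combine[OF m(1,3) i(1)] LBINT_nonneg[of "{m..\<bar>y\<bar>}" "trunc p M"] nn m by simp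
  finally show "npot p m \<le> tpot p M y" unfolding ty e .
qed

text \<open>On the data line the Duhamel terms vanish, so \<open>P\<close> and \<open>Q\<close>
  reduce there to the profiles \<open>pF\<close> and \<open>qG\<close>, and both energies can be
  read off from the data.\<close>

lemma mild_finite_energy:
  fixes f V F G pF qG \<phi> :: "real \<Rightarrow> real"
  assumes f: "continuous_on UNIV f" and V: "\<And>y. (V has_real_derivative f y) (at y)" "\<And>y. 0 \<le> V y"
    and c: "continuous_on UNIV (\<lambda>(u, v). \<Phi> u v)"
    and m: "pF \<in> borel_measurable borel" "qG \<in> borel_measurable borel"
    and sq: "integrable lborel (\<lambda>x. (pF x)\<^sup>2)" "integrable lborel (\<lambda>x. (qG x)\<^sup>2)"
    and F: "\<And>a b. a \<le> b \<Longrightarrow> F b - F a = (LBINT x:{a..b}. pF x)" and G: "\<And>a b. a \<le> b \<Longrightarrow> G b - G a = (LBINT x:{a..b}. qG x)"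
    and eq: "\<And>u v. \<Phi> u v = F v + G u - duh (\<lambda>a b. f (\<Phi> a b)) u v / 4"
    and \<phi>: "\<And>x. F x + G (- x) = \<phi> x" and pot: "integrable lborel (\<lambda>x. V (\<phi> x))"
  obtains p q where "finite_energy f V \<Phi> p q"
    "finite_energy.EP f V \<Phi> p = (\<integral>x. (pF x)\<^sup>2 \<partial>lborel) + (\<integral>x. V (\<phi> x) \<partial>lborel) / 2"
    "finite_energy.EQ f V \<Phi> q = (\<integral>x. (qG x)\<^sup>2 \<partial>lborel) + (\<integral>x. V (\<phi> x) \<partial>lborel) / 2"
    "\<And>x. \<Phi> (- x) x = \<phi> x" "\<And>x. Pd f \<Phi> p (- x) x = pF x" "\<And>x. Pd f (\<lambda>u v. \<Phi> v u) q x (- x) = qG (- x)"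
proof -
  have sq': "set_integrable lborel {a..b} (\<lambda>x. (pF x)\<^sup>2)" "set_integrable lborel {a..b} (\<lambda>x. (qG x)\<^sup>2)" for a b
    using set_integrable_of_integrable[OF sq(1)] set_integrable_of_integrable[OF sq(2)] by auto
  note mc = mild_charsol[OF f V c m sq' F G eq]
  define p where "p v = pF v - oint (- v) 0 (\<lambda>s. f (\<Phi> s v)) / 4" for v
  define q where "q u = qG u - oint (- u) 0 (\<lambda>s. f (\<Phi> u s)) / 4" for u
  interpret charsol f V \<Phi> p q unfolding p_def[abs_def] q_def[abs_def] by (rule mc(1))
  interpret sw: charsol f V "\<lambda>u v. \<Phi> v u" q p by (rule swap)
  have P: "P (- x) x = pF x" for x
    using mc(2)[of "- x" x] by (simp add: p_def[abs_def])
  have Q: "Q x (- x) = qG x" for x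
    using mc(3)[of "- x" x] by (simp add: q_def[abs_def])
  have d: "\<Phi> (- x) x = \<phi> x" for x using eq[of "- x" x] \<phi> by simp
  have d': "\<Phi> x (- x) = \<phi> (- x)" for x using d[of "- x"] by simp
  have pot': "integrable lborel (\<lambda>x. V (\<phi> (- x)))"
    using lborel_integrable_real_affine[OF pot, of "-1" 0] by simp
  have pe: "(\<integral>x. V (\<phi> (- x)) \<partial>lborel) = (\<integral>x. V (\<phi> x) \<partial>lborel)"
    using lborel_integral_real_affine[of "-1" "\<lambda>x. V (\<phi> x)" 0] by simp
  have e1: "eP 0 = (\<lambda>v. (pF v)\<^sup>2 + V (\<phi> v) / 2)" by (rule ext) (simp add: eP_def P d)
  have e2: "sw.eP 0 = (\<lambda>u. (qG u)\<^sup>2 + V (\<phi> (- u)) / 2)" by (rule ext) (simp add: sw.eP_def Q d')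
  have fe: "finite_energy f V \<Phi> p q"
    by unfold_locales (use sq pot pot' in \<open>simp_all add: e1 e2\<close>)
  show ?thesis
  proof (rule that[OF fe])
    show "finite_energy.EP f V \<Phi> p = (\<integral>x. (pF x)\<^sup>2 \<partial>lborel) + (\<integral>x. V (\<phi> x) \<partial>lborel) / 2"
      using sq pot by (simp add: finite_energy.EP_def[OF fe] e1)
    show "finite_energy.EQ f V \<Phi> q = (\<integral>x. (qG x)\<^sup>2 \<partial>lborel) + (\<integral>x. V (\<phi> x) \<partial>lborel) / 2"
      using sq pot' pe by (simp add: finite_energy.EQ_def[OF fe] e2)
    show "Pd f (\<lambda>u v. \<Phi> v u) q x (- x) = qG (- x)" for x using Q[of "- x"] by simp
  qed (rule d, rule P)
qed

text \<open>The energies \<open>E1\<close> and \<open>E2\<close> are computed with the full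
  potential, which dominates every truncated one. So \<open>M\<close> can be chosen from the data
  before the truncated problem is solved, and a solution exceeding \<open>M\<close> somewhere would
  carry more potential energy than its energy permits.\<close>

lemma characteristic_solution_exists:
  fixes \<phi> D W :: "real \<Rightarrow> real"
  assumes p: "p > 1" and [measurable]: "D \<in> borel_measurable borel" "W \<in> borel_measurable borel"
    and D2: "integrable lborel (\<lambda>x. (D x)\<^sup>2)" and W2: "integrable lborel (\<lambda>x. (W x)\<^sup>2)"
    and \<phi>: "\<And>a b. a \<le> b \<Longrightarrow> \<phi> b - \<phi> a = (LBINT x:{a..b}. D x)"
    and pot: "integrable lborel (\<lambda>x. npot p (\<phi> x))"
  obtains \<Phi> pp qq M where "finite_energy (nlin p) (npot p) \<Phi> pp qq" "\<And>u v. \<bar>\<Phi> u v\<bar> \<le> M"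
    "\<And>x. \<Phi> (- x) x = \<phi> x" "\<And>x. Pd (nlin p) \<Phi> pp (- x) x = (D x + W x) / 2"
    "\<And>x. Pd (nlin p) (\<lambda>u v. \<Phi> v u) qq x (- x) = (W x - D x) / 2"
proof -
  have Di: "set_integrable lborel {a..b} D" and Wi: "set_integrable lborel {a..b} W" for a b
    by (rule set_integrable_from_square[OF set_integrable_of_integrable[OF D2]]; simp)
      (rule set_integrable_from_square[OF set_integrable_of_integrable[OF W2]]; simp)
  obtain w where w: "\<And>a b. a \<le> b \<Longrightarrow> w b - w a = (LBINT x:{a..b}. W x)" and wc: "continuous_on UNIV w"
    using indefinite_integral_exists[OF Wi] by metis
  have \<phi>c: "continuous_on UNIV \<phi>" by (rule increments_continuous[OF Di \<phi>])
  \<comment> \<open>d'Alembert's splitting: \<open>F\<close> and \<open>G\<close> are the two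
    travelling waves of the free equation with initial value \<open>\<phi>\<close> and initial
    velocity \<open>W\<close>.\<close>
  define F where "F v = (\<phi> v + w v) / 2" for v
  define G where "G u = (\<phi> (- u) - w (- u)) / 2" for u
  define pF where "pF v = (D v + W v) / 2" for v
  define qG where "qG u = (W (- u) - D (- u)) / 2" for u
  have Fc: "continuous_on UNIV F" unfolding F_def by (intro continuous_intros \<phi>c wc) simp
  have Gc: "continuous_on UNIV G" unfolding G_def
    by (intro continuous_intros continuous_on_compose2[OF \<phi>c] continuous_on_compose2[OF wc]) auto
  have FG: "F x + G (- x) = \<phi> x" for x by (simp add: F_def G_def field_simps)
  have m: "pF \<in> borel_measurable borel" "qG \<in> borel_measurable borel" unfolding pF_def qG_def by measurable
  have Fi: "F b - F a = (LBINT x:{a..b}. pF x)" if "a \<le> b" for a b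
  proof -
    have "(LBINT x:{a..b}. pF x) = ((LBINT x:{a..b}. D x) + (LBINT x:{a..b}. W x)) / 2"
      unfolding pF_def using Di Wi by simp
    then show ?thesis using \<phi>[OF that] w[OF that] by (simp add: F_def diff_divide_distrib add_divide_distrib)
  qed
  have Gi: "G b - G a = (LBINT x:{a..b}. qG x)" if "a \<le> b" for a b
  proof -
    have "(LBINT x:{a..b}. qG x) = ((LBINT x:{a..b}. W (- x)) - (LBINT x:{a..b}. D (- x))) / 2"
      unfolding qG_def using set_integrable_reflect[OF Di] set_integrable_reflect[OF Wi] by simp
    also have "\<dots> = ((LBINT x:{-b..-a}. W x) - (LBINT x:{-b..-a}. D x)) / 2"
      by (simp add: LBINT_reflect[where g = W] LBINT_reflect[where g = D])
    finally show ?thesis using \<phi>[of "- b" "- a"] w[of "- b" "- a"] that by (simp add: G_def diff_divide_distrib)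
  qed
  have sqi: "integrable lborel (\<lambda>x. ((a * D x + b * W x) / 2)\<^sup>2)" for a b
  proof (rule Bochner_Integration.integrable_bound)
    show "integrable lborel (\<lambda>x. a\<^sup>2 * (D x)\<^sup>2 + b\<^sup>2 * (W x)\<^sup>2)" using D2 W2 by simp
    show "AE x in lborel. norm (((a * D x + b * W x) / 2)\<^sup>2) \<le> norm (a\<^sup>2 * (D x)\<^sup>2 + b\<^sup>2 * (W x)\<^sup>2)"
    proof (rule AE_I2)
      fix x
      have "(a * D x + b * W x)\<^sup>2 \<le> 2 * ((a * D x)\<^sup>2 + (b * W x)\<^sup>2)"
        using sum_squares_bound[of "a * D x" "b * W x"] by (simp add: power2_sum)
      moreover have n: "0 \<le> (a * D x)\<^sup>2 + (b * W x)\<^sup>2" by simp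
      moreover have "X / 4 \<le> Y" if "X \<le> 2 * Y" "0 \<le> Y" for X Y :: real using that by simp
      ultimately have "(a * D x + b * W x)\<^sup>2 / 4 \<le> (a * D x)\<^sup>2 + (b * W x)\<^sup>2" by blast
      with n show "norm (((a * D x + b * W x) / 2)\<^sup>2) \<le> norm (a\<^sup>2 * (D x)\<^sup>2 + b\<^sup>2 * (W x)\<^sup>2)"
        unfolding power_mult_distrib[symmetric] real_norm_def by (simp add: power_divide)
    qed
  qed measurable
  have pF2: "integrable lborel (\<lambda>x. (pF x)\<^sup>2)" using sqi[of 1 1] by (simp add: pF_def)
  have "integrable lborel (\<lambda>x. ((W x - D x) / 2)\<^sup>2)" using sqi[of "-1" 1] by simp
  from lborel_integrable_real_affine[OF this, of "-1" 0]
  have qG2: "integrable lborel (\<lambda>x. (qG x)\<^sup>2)" by (simp add: qG_def)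
  define E1 where "E1 = (\<integral>x. (pF x)\<^sup>2 \<partial>lborel) + (\<integral>x. npot p (\<phi> x) \<partial>lborel) / 2"
  define E2 where "E2 = (\<integral>x. (qG x)\<^sup>2 \<partial>lborel) + (\<integral>x. npot p (\<phi> x) \<partial>lborel) / 2"
  have E0: "0 \<le> E1" "0 \<le> E2"
    unfolding E1_def E2_def using npot_nonneg[OF p] by (auto intro!: add_nonneg_nonneg Bochner_Integration.integral_nonneg)
  define H where "H = sqrt E1 + sqrt E2 + 1"
  have H0: "H > 0" unfolding H_def using E0 by (intro add_nonneg_pos) auto
  \<comment> \<open>Chosen so that \<open>K\<^sup>2 / (p + 1)\<close> exceeds the largest possible
    potential energy \<open>4 * (E1 + E2)\<close>. In \<open>M\<close> the summand
    \<open>2 * H * K\<close> forces large values on an interval of length at least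
    \<open>K\<^sup>2\<close>, and the summand 2 makes half of \<open>M\<close> at least 1, the level
    at which the truncated potential is bounded below.\<close>
  define K where "K = 4 * (E1 + E2) * (p + 1) + 1"
  have K1: "1 \<le> K" unfolding K_def using E0 p by simp
  define M where "M = 2 + 2 * H * K"
  have M2: "2 \<le> M" unfolding M_def using H0 K1 by simp
  have M0: "0 \<le> M" using M2 by simp
  obtain \<Phi> where c: "continuous_on UNIV (\<lambda>(u, v). \<Phi> u v)"
    and eqM: "\<And>u v. \<Phi> u v = F v + G u - duh (\<lambda>a b. trunc p M (\<Phi> a b)) u v / 4"
    by (rule mild_solution_exists[OF Fc Gc trunc_lipschitz[OF p M0] trunc_bound[OF p M0]], rule that)
  have tpm: "(\<lambda>x. tpot p M (\<phi> x)) \<in> borel_measurable borel"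
  proof (rule borel_measurable_continuous_onI)
    have "continuous_on UNIV (tpot p M)" by (rule DERIV_continuous_on[OF has_field_derivative_at_within[OF tpot_deriv[OF p]]])
    from continuous_on_compose2[OF this \<phi>c] show "continuous_on UNIV (\<lambda>x. tpot p M (\<phi> x))" by simp
  qed
  have tpi: "integrable lborel (\<lambda>x. tpot p M (\<phi> x))"
    by (rule Bochner_Integration.integrable_bound[OF pot]) (use tpm tpot_bounds[OF p M0] npot_nonneg[OF p] in auto)
  have tple: "(\<integral>x. tpot p M (\<phi> x) \<partial>lborel) \<le> (\<integral>x. npot p (\<phi> x) \<partial>lborel)"
    by (rule integral_mono[OF tpi pot tpot_bounds(2)[OF p M0]])
  obtain p1 q1 where fe: "finite_energy (trunc p M) (tpot p M) \<Phi> p1 q1"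
    and EPM: "finite_energy.EP (trunc p M) (tpot p M) \<Phi> p1 = (\<integral>x. (pF x)\<^sup>2 \<partial>lborel) + (\<integral>x. tpot p M (\<phi> x) \<partial>lborel) / 2"
    and EQM: "finite_energy.EQ (trunc p M) (tpot p M) \<Phi> q1 = (\<integral>x. (qG x)\<^sup>2 \<partial>lborel) + (\<integral>x. tpot p M (\<phi> x) \<partial>lborel) / 2"
    by (rule mild_finite_energy[OF trunc_cont[OF p] tpot_deriv[OF p] tpot_bounds(1)[OF p M0] c m pF2 qG2 Fi Gi eqM FG tpi])
      (assumption | rule that)+
  interpret M: finite_energy "trunc p M" "tpot p M" \<Phi> p1 q1 by (rule fe)
  have EM: "M.EP \<le> E1" "M.EQ \<le> E2" unfolding EPM EQM E1_def E2_def using tple by simp_all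
  have bd: "\<bar>\<Phi> u v\<bar> \<le> M" for u v
  proof (rule ccontr)
    assume "\<not> \<bar>\<Phi> u v\<bar> \<le> M"
    define T where "T = (u + v) / 2"
    define x where "x = (v - u) / 2"
    have uv: "u = T - x" "v = T + x" by (simp_all add: T_def x_def field_simps)
    have big: "M \<le> \<bar>\<Phi> (T - x) (T + x)\<bar>" using \<open>\<not> \<bar>\<Phi> u v\<bar> \<le> M\<close> unfolding uv by simp
    have "(M / (2 * (sqrt M.EP + sqrt M.EQ + 1)))\<^sup>2 * npot p 1 \<le> (\<integral>x. tpot p M (\<Phi> (T - x) (T + x)) \<partial>lborel)"
      by (rule M.potential_lower_bound[OF _ _ big]) (use M2 tpot_bounds(3)[OF p M0, of 1] in auto)
    also have "\<dots> \<le> 4 * (M.EP + M.EQ)" by (rule M.potential_energy_bound)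
    also have "\<dots> \<le> 4 * (E1 + E2)" using EM by simp
    finally have 1: "(M / (2 * (sqrt M.EP + sqrt M.EQ + 1)))\<^sup>2 / (p + 1) \<le> 4 * (E1 + E2)"
      by (simp add: npot_def)
    have "sqrt M.EP + sqrt M.EQ + 1 \<le> H" unfolding H_def using EM by (intro add_mono) auto
    moreover have "0 < sqrt M.EP + sqrt M.EQ + 1" using M.EP_nonneg by (intro add_nonneg_pos) auto
    ultimately have "M / (2 * H) \<le> M / (2 * (sqrt M.EP + sqrt M.EQ + 1))"
      using M0 by (intro divide_left_mono) auto
    moreover have "K \<le> M / (2 * H)" unfolding M_def using H0 by (simp add: field_simps)
    ultimately have "K \<le> M / (2 * (sqrt M.EP + sqrt M.EQ + 1))" by simp
    then have "K\<^sup>2 \<le> (M / (2 * (sqrt M.EP + sqrt M.EQ + 1)))\<^sup>2" using K1 by (intro power_mono) auto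
    moreover have "K \<le> K\<^sup>2" using K1 by (simp add: power2_eq_square)
    ultimately have "K / (p + 1) \<le> (M / (2 * (sqrt M.EP + sqrt M.EQ + 1)))\<^sup>2 / (p + 1)"
      using p by (intro divide_right_mono) linarith+
    with 1 have "K / (p + 1) \<le> 4 * (E1 + E2)" by linarith
    then have "K \<le> 4 * (E1 + E2) * (p + 1)" using p by (simp add: divide_le_eq)
    then show False by (simp add: K_def)
  qed
  have eq: "\<Phi> u v = F v + G u - duh (\<lambda>a b. nlin p (\<Phi> a b)) u v / 4" for u v
    using eqM[of u v] by (simp add: trunc_eq[OF bd])
  obtain pp qq where fe': "finite_energy (nlin p) (npot p) \<Phi> pp qq"
    and d: "\<And>x. \<Phi> (- x) x = \<phi> x" and Pp: "\<And>x. Pd (nlin p) \<Phi> pp (- x) x = pF x" and Qq: "\<And>x. Pd (nlin p) (\<lambda>u v. \<Phi> v u) qq x (- x) = qG (- x)"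
    by (rule mild_finite_energy[OF nlin_cont[OF p] npot_deriv[OF p] npot_nonneg[OF p] c m pF2 qG2 Fi Gi eq FG pot])
      (assumption | rule that)+
  show ?thesis
    by (rule that[OF fe' bd d]) (simp_all add: Pp Qq pF_def qG_def)
qed

section \<open>Test functions\<close>

lemma partial_deriv_eq: "(f has_derivative f') (at z) \<Longrightarrow> partial_deriv b f z = f' b"
  unfolding partial_deriv_def using frechet_derivative_at[of f f' z] by simp

lemma partial_deriv_works: "f differentiable (at z) \<Longrightarrow> (f has_derivative frechet_derivative f (at z)) (at z)"
  by (simp add: frechet_derivative_works)

lemma partial_deriv_add:
  assumes "f differentiable (at z)" "g differentiable (at z)"
  shows "partial_deriv b (\<lambda>z. f z + g z) z = partial_deriv b f z + partial_deriv b g z"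
  using partial_deriv_eq[OF has_derivative_add[OF assms[THEN partial_deriv_works]]] by (simp add: partial_deriv_def)

lemma partial_deriv_mult:
  assumes "f differentiable (at z)" "g differentiable (at z)"
  shows "partial_deriv b (\<lambda>z. f z * g z) z = f z * partial_deriv b g z + partial_deriv b f z * g z"
  using partial_deriv_eq[OF has_derivative_mult[OF assms[THEN partial_deriv_works]]] by (simp add: partial_deriv_def)

lemma real_partial_deriv: "(h has_real_derivative d) (at x) \<Longrightarrow> partial_deriv 1 h x = d"
  using partial_deriv_eq[of h "\<lambda>y. d * y" x 1] by (simp add: has_field_derivative_def)

lemma real_differentiable_deriv: "(h::real \<Rightarrow> real) differentiable (at x) \<Longrightarrow> (h has_real_derivative partial_deriv 1 h x) (at x)"
proof -
  assume "h differentiable (at x)"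
  then obtain d where d: "(h has_real_derivative d) (at x)" unfolding real_differentiable_def by blast
  then show ?thesis using real_partial_deriv[OF d] by simp
qed

lemma partial_deriv_affine:
  assumes "bounded_linear L" "(h::real \<Rightarrow> real) differentiable (at (L z + c))"
  shows "partial_deriv b (\<lambda>z. h (L z + c)) z = partial_deriv 1 h (L z + c) * L b"
    and "(\<lambda>z. h (L z + c)) differentiable (at z)"
proof -
  have "(h has_derivative (\<lambda>y. partial_deriv 1 h (L z + c) * y)) (at (L z + c))"
    using real_differentiable_deriv[OF assms(2)] by (simp add: has_field_derivative_def)
  moreover have "((\<lambda>z. L z + c) has_derivative L) (at z)"
    using bounded_linear_imp_has_derivative[OF assms(1)] by (auto intro!: derivative_eq_intros)
  ultimately have d: "((\<lambda>z. h (L z + c)) has_derivative (\<lambda>y. partial_deriv 1 h (L z + c) * L y)) (at z)"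
    using has_derivative_compose[of "\<lambda>z. L z + c" L z UNIV h] by simp
  show "partial_deriv b (\<lambda>z. h (L z + c)) z = partial_deriv 1 h (L z + c) * L b" by (rule partial_deriv_eq[OF d])
  show "(\<lambda>z. h (L z + c)) differentiable (at z)" using d by (rule differentiableI)
qed

lemma Ck_continuous: "Ck k f \<Longrightarrow> continuous_on UNIV f"
  by (cases k) (auto intro!: differentiable_imp_continuous_on simp: differentiable_on_def)

lemma Ck_mono: "Ck (Suc k) f \<Longrightarrow> Ck k f"
proof (induction k arbitrary: f)
  case 0
  then show ?case using Ck_continuous[of "Suc 0" f] by simp
next
  case (Suc k)
  then have "\<forall>z. f differentiable (at z)" "\<forall>b\<in>Basis. Ck (Suc k) (partial_deriv b f)"
    unfolding Ck.simps(2)[of "Suc k"] by blast+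
  then show ?case unfolding Ck.simps(2)[of k f] using Suc.IH by blast
qed

lemma Ck_const: "Ck k (\<lambda>_. c)"
proof (induction k arbitrary: c)
  case (Suc k)
  have "partial_deriv b (\<lambda>_. c) = (\<lambda>_. 0)" for b :: 'a
    by (auto simp: partial_deriv_def)
  then show ?case using Suc by simp
qed simp

lemma Ck_add: "Ck k f \<Longrightarrow> Ck k g \<Longrightarrow> Ck k (\<lambda>z. f z + g z)"
proof (induction k arbitrary: f g)
  case 0
  then show ?case by (auto intro: continuous_on_add)
next
  case (Suc k)
  have "partial_deriv b (\<lambda>z. f z + g z) = (\<lambda>z. partial_deriv b f z + partial_deriv b g z)" for b
    using Suc.prems by (auto intro!: partial_deriv_add)
  then show ?case using Suc by (auto intro: differentiable_add)
qed

lemma Ck_mult: "Ck k f \<Longrightarrow> Ck k g \<Longrightarrow> Ck k (\<lambda>z. f z * g z)"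
proof (induction k arbitrary: f g)
  case 0
  then show ?case by (auto intro: continuous_on_mult)
next
  case (Suc k)
  have e: "partial_deriv b (\<lambda>z. f z * g z) = (\<lambda>z. f z * partial_deriv b g z + partial_deriv b f z * g z)" for b
    using Suc.prems by (auto intro!: partial_deriv_mult)
  have "Ck k f" "Ck k g" using Suc.prems by (auto intro: Ck_mono)
  then have "Ck k (\<lambda>z. f z * partial_deriv b g z + partial_deriv b f z * g z)" if "b \<in> Basis" for b
    using Suc that by (intro Ck_add Suc.IH) auto
  then show ?case using Suc.prems e by (auto intro: differentiable_mult)
qed

lemma Ck_affine:
  assumes L: "bounded_linear L"
  shows "Ck k (h :: real \<Rightarrow> real) \<Longrightarrow> Ck k (\<lambda>z. h (L z + c))"
proof (induction k arbitrary: h)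
  case 0
  have "continuous_on UNIV (\<lambda>z. L z + c)"
    using L by (intro continuous_intros) (rule linear_continuous_on)
  with 0 show ?case by (auto intro: continuous_on_compose2)
next
  case (Suc k)
  have "partial_deriv b (\<lambda>z. h (L z + c)) = (\<lambda>z. partial_deriv 1 h (L z + c) * L b)" for b
    using Suc.prems partial_deriv_affine(1)[OF L] by auto
  then show ?case using Suc partial_deriv_affine(2)[OF L] by (auto intro!: Ck_mult Ck_const)
qed

lemma test_function_iff: "test_function \<psi> \<longleftrightarrow> (\<forall>k. Ck k \<psi>) \<and> bounded {z. \<psi> z \<noteq> 0}"
  by (simp add: test_function_def)

lemma test_function_support:
  fixes \<psi> :: "'a::euclidean_space \<Rightarrow> real"
  assumes "test_function \<psi>"
  obtains R where "R > 0" "\<And>z. R < norm z \<Longrightarrow> \<psi> z = 0"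
proof -
  obtain R where "R > 0" "\<And>z. \<psi> z \<noteq> 0 \<Longrightarrow> norm z \<le> R"
    using assms bounded_pos[of "{z. \<psi> z \<noteq> 0}"] by (auto simp: test_function_iff)
  then show ?thesis using that[of R] by (meson not_less)
qed

lemma test_function_differentiable: "test_function \<psi> \<Longrightarrow> \<psi> differentiable (at z)"
  unfolding test_function_iff using Ck.simps(2)[of 0 \<psi>] by blast

lemma test_function_continuous: "test_function \<psi> \<Longrightarrow> continuous_on UNIV \<psi>"
  unfolding test_function_iff using Ck_continuous[of 0 \<psi>] by blast

lemma partial_deriv_zero_outside:
  fixes \<psi> :: "'a::euclidean_space \<Rightarrow> real"
  assumes "\<And>z. R < norm z \<Longrightarrow> \<psi> z = 0" "R < norm z"
  shows "partial_deriv b \<psi> z = 0"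
proof -
  have "open {z::'a. R < norm z}" by (intro open_Collect_less continuous_intros)
  then have "(\<psi> has_derivative (\<lambda>_. 0)) (at z)"
    by (rule has_derivative_transform_within_open[OF has_derivative_const[of 0]]) (use assms in auto)
  then show ?thesis by (rule partial_deriv_eq)
qed

lemma test_function_partial_deriv:
  assumes "test_function \<psi>" "b \<in> Basis"
  shows "test_function (partial_deriv b \<psi>)"
proof -
  have "Ck k (partial_deriv b \<psi>)" for k
    using assms Ck.simps(2)[of k \<psi>] unfolding test_function_iff by blast
  moreover obtain R where R: "R > 0" "\<And>z. R < norm z \<Longrightarrow> \<psi> z = 0"
    using test_function_support[OF assms(1)] by blast
  have "norm z \<le> R" if "partial_deriv b \<psi> z \<noteq> 0" for z
    using partial_deriv_zero_outside[OF R(2), where z = z and b = b] that by (meson not_less)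
  then have "bounded {z. partial_deriv b \<psi> z \<noteq> 0}" unfolding bounded_iff by auto
  ultimately show ?thesis by (simp add: test_function_iff)
qed

lemma test_function_deriv:
  fixes \<eta> :: "real \<Rightarrow> real"
  assumes "test_function \<eta>"
  shows "(\<eta> has_real_derivative deriv \<eta> x) (at x)" "test_function (deriv \<eta>)" "partial_deriv 1 \<eta> = deriv \<eta>"
proof -
  have d: "(\<eta> has_real_derivative partial_deriv 1 \<eta> x) (at x)" for x
    by (rule real_differentiable_deriv[OF test_function_differentiable[OF assms]])
  have e: "partial_deriv 1 \<eta> = deriv \<eta>" by (rule ext) (rule DERIV_imp_deriv[OF d, symmetric])
  then show "partial_deriv 1 \<eta> = deriv \<eta>" .
  show "(\<eta> has_real_derivative deriv \<eta> x) (at x)" using d[of x] e by simp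
  show "test_function (deriv \<eta>)" using test_function_partial_deriv[OF assms, of 1] e by simp
qed

lemma test_function_lincomb:
  assumes "test_function f" "test_function g"
  shows "test_function (\<lambda>z. c * f z + d * g z)"
proof -
  have "bounded ({z. f z \<noteq> 0} \<union> {z. g z \<noteq> 0})" using assms by (simp add: test_function_iff)
  then have "bounded {z. c * f z + d * g z \<noteq> 0}" by (rule bounded_subset) auto
  then show ?thesis using assms unfolding test_function_iff by (auto intro!: Ck_add Ck_mult Ck_const)
qed

text \<open>Functions of this form are closed under differentiation, which gives smoothness at once.\<close>

definition pexp :: "real poly \<Rightarrow> real \<Rightarrow> real" where
  "pexp r x = (if x \<le> 0 then 0 else poly r (inverse x) * exp (- inverse x))"

lemma poly_exp_tendsto_0: "((\<lambda>y. poly r y * exp (- y)) \<longlongrightarrow> 0) (at_top :: real filter)"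
proof -
  have "((\<lambda>y. \<Sum>i\<le>degree r. coeff r i * (y ^ i / exp y)) \<longlongrightarrow> (\<Sum>i\<le>degree r. coeff r i * 0)) (at_top :: real filter)"
    by (intro tendsto_sum tendsto_mult tendsto_const tendsto_power_div_exp_0)
  then show ?thesis by (simp add: poly_altdef sum_distrib_right exp_minus divide_inverse mult.assoc)
qed

lemma pexp_deriv: "(pexp r has_real_derivative pexp ((r - pderiv r) * [:0, 0, 1:]) x) (at x)"
proof -
  consider "x > 0" | "x < 0" | "x = 0" by linarith
  then show ?thesis
  proof cases
    case 1
    have "((\<lambda>x. poly r (inverse x)) has_real_derivative poly (pderiv r) (inverse x) * (- (inverse x * inverse x))) (at x)"
      by (rule DERIV_chain2[OF poly_DERIV]) (use 1 in \<open>auto intro!: derivative_eq_intros\<close>)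
    moreover have "((\<lambda>x. exp (- inverse x)) has_real_derivative exp (- inverse x) * (inverse x * inverse x)) (at x)"
      using 1 by (auto intro!: derivative_eq_intros)
    ultimately have "((\<lambda>x. poly r (inverse x) * exp (- inverse x)) has_real_derivative pexp ((r - pderiv r) * [:0, 0, 1:]) x) (at x)"
      by (rule DERIV_cong[OF DERIV_mult]) (use 1 in \<open>simp add: pexp_def algebra_simps\<close>)
    then show ?thesis
      by (rule has_field_derivative_transform_within_open[of _ _ _ "{0<..}"]) (use 1 in \<open>auto simp: pexp_def\<close>)
  next
    case 2
    have "((\<lambda>x. 0) has_real_derivative pexp ((r - pderiv r) * [:0, 0, 1:]) x) (at x)"
      using 2 by (simp add: pexp_def)
    then show ?thesis
      by (rule has_field_derivative_transform_within_open[of _ _ _ "{..<0}"]) (use 2 in \<open>auto simp: pexp_def\<close>)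
  next
    case 3
    \<comment> \<open>With \<open>y = inverse x\<close> the difference quotient at 0 is
      \<open>y\<close> times \<open>poly r y * exp (- y)\<close>; this accounts for the factor
      \<open>[:0, 1:]\<close>.\<close>
    have "((\<lambda>x. poly ([:0, 1:] * r) (inverse x) * exp (- inverse x)) \<longlongrightarrow> 0) (at_right 0)"
      by (rule filterlim_compose[OF poly_exp_tendsto_0 filterlim_inverse_at_top_right])
    moreover have "\<forall>\<^sub>F h in at_right 0. poly ([:0, 1:] * r) (inverse h) * exp (- inverse h) = pexp r h / h"
      unfolding eventually_at_filter by (intro always_eventually) (auto simp: pexp_def field_simps)
    ultimately have r: "((\<lambda>h. pexp r h / h) \<longlongrightarrow> 0) (at_right 0)" by (rule Lim_transform_eventually)
    have "\<forall>\<^sub>F h in at_left 0. 0 = pexp r h / h"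
      unfolding eventually_at_filter by (intro always_eventually) (auto simp: pexp_def)
    then have "((\<lambda>h. pexp r h / h) \<longlongrightarrow> 0) (at_left 0)" by (rule Lim_transform_eventually[OF tendsto_const])
    with r have "((\<lambda>h. pexp r h / h) \<longlongrightarrow> 0) (at 0)" by (simp add: filterlim_at_split)
    then show ?thesis using 3 by (simp add: has_field_derivative_iff pexp_def)
  qed
qed

lemma pexp_smooth: "Ck k (pexp r)"
proof (induction k arbitrary: r)
  case 0
  then show ?case using DERIV_continuous_on[OF has_field_derivative_at_within[OF pexp_deriv]] by auto
next
  case (Suc k)
  have "partial_deriv 1 (pexp r) = pexp ((r - pderiv r) * [:0, 0, 1:])"
    using real_partial_deriv[OF pexp_deriv] by auto
  moreover have "pexp r differentiable (at z)" for z using pexp_deriv real_differentiable_def by blast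
  ultimately show ?case using Suc by (simp del: mult_pCons_right)
qed

text \<open>A smooth function supported in \<open>[a, b]\<close>; the factor \<open>Suc n\<close>
  steepens both flanks, so that the values inside tend to 1. The arguments are written as a multiple
  of \<open>x\<close> plus a constant to fit \<open>Ck_affine\<close>.\<close>

definition bump :: "real \<Rightarrow> real \<Rightarrow> nat \<Rightarrow> real \<Rightarrow> real" where
  "bump a b n x = pexp 1 (real (Suc n) * x + - real (Suc n) * a) * pexp 1 (- real (Suc n) * x + real (Suc n) * b)"

lemma pexp1_bounds: "0 \<le> pexp 1 x" "pexp 1 x \<le> 1"
  by (auto simp: pexp_def)

lemma bump_bounds: "0 \<le> bump a b n x" "bump a b n x \<le> 1"
  unfolding bump_def using pexp1_bounds by (auto intro: mult_le_one)

lemma bump_zero: "x \<notin> {a<..<b} \<Longrightarrow> bump a b n x = 0"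
proof -
  assume x: "x \<notin> {a<..<b}"
  have e: "real (Suc n) * x + - real (Suc n) * a = real (Suc n) * (x - a)" "- real (Suc n) * x + real (Suc n) * b = real (Suc n) * (b - x)"
    by (simp_all add: algebra_simps)
  have "real (Suc n) * (x - a) \<le> 0 \<or> real (Suc n) * (b - x) \<le> 0" using x by (auto simp: mult_le_0_iff)
  then show ?thesis unfolding bump_def e by (auto simp: pexp_def)
qed

lemma bump_test: "test_function (bump a b n)"
proof -
  have L: "bounded_linear (\<lambda>x::real. c * x)" for c by (rule bounded_linear_mult_right)
  have "Ck k (bump a b n)" for k
    unfolding bump_def[abs_def] by (intro Ck_mult Ck_affine[OF L] pexp_smooth)
  moreover have "bounded {x. bump a b n x \<noteq> 0}"
  proof (rule bounded_subset[OF bounded_closed_interval])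
    show "{x. bump a b n x \<noteq> 0} \<subseteq> {a..b}"
    proof
      fix x assume "x \<in> {x. bump a b n x \<noteq> 0}"
      then show "x \<in> {a..b}" using bump_zero[of x a b n] by (cases "x \<in> {a<..<b}") auto
    qed
  qed
  ultimately show ?thesis by (simp add: test_function_iff)
qed

lemma bump_tendsto: "(\<lambda>n. bump a b n x) \<longlonglongrightarrow> indicator {a<..<b} x"
proof (cases "x \<in> {a<..<b}")
  case True
  have "(\<lambda>n. pexp 1 (real (Suc n) * d)) \<longlonglongrightarrow> 1" if "d > 0" for d
  proof -
    have "(\<lambda>n. exp (- (inverse (real (Suc n)) * inverse d))) \<longlonglongrightarrow> exp (- (0 * inverse d))"
      by (intro tendsto_intros LIMSEQ_inverse_real_of_nat)
    moreover have "exp (- (inverse (real (Suc n)) * inverse d)) = pexp 1 (real (Suc n) * d)" for n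
      using that by (simp add: pexp_def mult_le_0_iff del: of_nat_Suc)
    ultimately show ?thesis by simp
  qed
  from tendsto_mult[OF this[of "x - a"] this[of "b - x"]] True
  have "(\<lambda>n. pexp 1 (real (Suc n) * (x - a)) * pexp 1 (real (Suc n) * (b - x))) \<longlonglongrightarrow> 1" by simp
  then show ?thesis using True by (simp add: bump_def algebra_simps)
next
  case False
  then show ?thesis by (simp add: bump_zero)
qed

section \<open>The lemma of du Bois-Reymond and its consequences\<close>

lemma integral_lborel_interval:
  fixes g :: "real \<Rightarrow> real"
  assumes "\<And>x. x \<notin> {a..b} \<Longrightarrow> g x = 0"
  shows "(\<integral>x. g x \<partial>lborel) = (LBINT x:{a..b}. g x)"
  unfolding set_lebesgue_integral_def
  by (rule Bochner_Integration.integral_cong) (use assms in \<open>auto simp: indicator_def\<close>)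

text \<open>Vanishing mean is exactly what makes the primitive return to zero to the right of the
  support.\<close>

lemma test_function_primitive:
  fixes \<rho> :: "real \<Rightarrow> real"
  assumes \<rho>: "test_function \<rho>" and z: "(\<integral>x. \<rho> x \<partial>lborel) = 0"
  obtains \<eta> where "test_function \<eta>" "deriv \<eta> = \<rho>"
proof -
  obtain R where R: "R > 0" "\<And>x. R < norm x \<Longrightarrow> \<rho> x = 0" using test_function_support[OF \<rho>] by blast
  have c: "continuous_on UNIV \<rho>" by (rule test_function_continuous[OF \<rho>])
  then have [measurable]: "\<rho> \<in> borel_measurable borel" by (rule borel_measurable_continuous_onI)
  define \<eta> where "\<eta> x = oint (- R) x \<rho>" for x
  have d: "(\<eta> has_real_derivative \<rho> x) (at x)" for x
    unfolding \<eta>_def[abs_def] by (rule oint_deriv[OF c])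
  have e: "partial_deriv 1 \<eta> = \<rho>" using real_partial_deriv[OF d] by auto
  have df: "\<eta> differentiable (at x)" for x using d real_differentiable_def by blast
  have "Ck k \<eta>" for k
  proof (cases k)
    case 0
    then show ?thesis using DERIV_continuous_on[OF has_field_derivative_at_within[OF d]] by simp
  next
    case (Suc m)
    then show ?thesis using \<rho> e df by (simp add: test_function_iff)
  qed
  moreover have "\<bar>x\<bar> \<le> R" if nz: "\<eta> x \<noteq> 0" for x
  proof (rule ccontr)
    assume "\<not> \<bar>x\<bar> \<le> R"
    then consider "x < - R" | "R < x" by linarith
    then show False
    proof cases
      case 1
      have "oint x (- R) \<rho> = (LBINT s:{x..- R}. \<rho> s)" using 1 by (intro oint_eq_LBINT[symmetric] c) auto
      \<comment> \<open>The support bound is strict and says nothing about the endpoint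
        \<open>- R\<close>, which is discarded as a null set.\<close>
      also have "\<dots> = (LBINT s:{x..- R}. 0)"
      proof -
        have "\<rho> s = 0" if "s \<in> {x..- R}" "s \<noteq> - R" for s using R that by auto
        then show ?thesis
          by (intro set_lebesgue_integral_cong_AE) (auto intro!: eventually_mono[OF AE_lborel_singleton[of "- R"]] borel_measurable_continuous_onI c)
      qed
      finally show False using nz oint_swap[OF c, of x "- R"] by (simp add: \<eta>_def)
    next
      case 2
      have "\<eta> x = (LBINT s:{- R..x}. \<rho> s)" unfolding \<eta>_def using 2 R by (intro oint_eq_LBINT[symmetric] c) auto
      also have "\<dots> = (LBINT s:{- R - 1..x}. \<rho> s)"
        unfolding set_lebesgue_integral_def
      proof (rule integral_cong_AE)
        show "AE s in lborel. indicator {- R..x} s *\<^sub>R \<rho> s = indicator {- R - 1..x} s *\<^sub>R \<rho> s"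
          by (intro AE_I2) (use R in \<open>auto simp: indicator_def\<close>)
      qed measurable
      also have "\<dots> = (\<integral>s. \<rho> s \<partial>lborel)"
        by (rule integral_lborel_interval[symmetric]) (use R 2 in auto)
      finally show False using nz z by simp
    qed
  qed
  then have "bounded {x. \<eta> x \<noteq> 0}" unfolding bounded_iff by auto
  ultimately have "test_function \<eta>" by (simp add: test_function_iff)
  moreover have "deriv \<eta> = \<rho>" using DERIV_imp_deriv[OF d] by auto
  ultimately show ?thesis by (rule that)
qed

lemma bump_integral_tendsto:
  fixes h :: "real \<Rightarrow> real"
  assumes i: "set_integrable lborel {a..b} h" and [measurable]: "h \<in> borel_measurable borel"
  shows "(\<lambda>n. \<integral>x. h x * bump a b n x \<partial>lborel) \<longlonglongrightarrow> (LBINT x:{a..b}. h x)"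
    and "integrable lborel (\<lambda>x. h x * bump a b n x)"
proof -
  have m [measurable]: "bump a b n \<in> borel_measurable borel" for n
    by (intro borel_measurable_continuous_onI test_function_continuous bump_test)
  have w: "integrable lborel (\<lambda>x. \<bar>indicator {a..b} x * h x\<bar>)"
    using i unfolding set_integrable_def by simp
  have dom: "norm (h x * bump a b n x) \<le> \<bar>indicator {a..b} x * h x\<bar>" for n x
    using bump_bounds[of a b n x] bump_zero[of x a b n]
    by (cases "x \<in> {a<..<b}") (auto simp: abs_mult intro: mult_left_le)
  show "integrable lborel (\<lambda>x. h x * bump a b n x)"
    by (rule Bochner_Integration.integrable_bound[OF w]) (use dom in auto)
  have "(\<lambda>n. \<integral>x. h x * bump a b n x \<partial>lborel) \<longlonglongrightarrow> (\<integral>x. h x * indicator {a<..<b} x \<partial>lborel)"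
    by (rule integral_dominated_convergence[OF _ _ w]) (auto intro!: tendsto_intros bump_tendsto simp: dom[unfolded real_norm_def])
  also have "(\<integral>x. h x * indicator {a<..<b} x \<partial>lborel) = (LBINT x:{a..b}. h x)"
    unfolding set_lebesgue_integral_def
  proof (rule integral_cong_AE)
    show "AE x in lborel. h x * indicator {a<..<b} x = indicator {a..b} x *\<^sub>R h x"
      using AE_lborel_singleton[of a] AE_lborel_singleton[of b] by eventually_elim (auto simp: indicator_def)
  qed auto
  finally show "(\<lambda>n. \<integral>x. h x * bump a b n x \<partial>lborel) \<longlonglongrightarrow> (LBINT x:{a..b}. h x)" .
qed

text \<open>Two bumps, each scaled by the integral of the other, have a difference of integral zero,
  hence a test function as primitive. Letting them steepen to indicators compares the average of
  \<open>h\<close> over \<open>[a, b]\<close> with that over \<open>[0, 1]\<close>.\<close>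

lemma du_Bois_Reymond:
  fixes h :: "real \<Rightarrow> real"
  assumes i: "\<And>a b. set_integrable lborel {a..b} h" and m [measurable]: "h \<in> borel_measurable borel"
    and z: "\<And>\<eta>. test_function \<eta> \<Longrightarrow> (\<integral>x. h x * deriv \<eta> x \<partial>lborel) = 0"
  obtains c where "\<And>a b. a \<le> b \<Longrightarrow> (LBINT x:{a..b}. h x) = c * (b - a)"
proof -
  define c where "c = (LBINT x:{0..1}. h x)"
  have "(LBINT x:{a..b}. h x) = c * (b - a)" if ab: "a \<le> b" for a b
  proof -
    have i1: "set_integrable lborel {a..b} (\<lambda>_. 1 :: real)" for a b :: real by (intro borel_integrable_atLeastAtMost' continuous_intros)
    have m1: "(\<lambda>_. 1) \<in> borel_measurable borel" by simp
    define k where "k a b n = (\<integral>x. bump a b n x \<partial>lborel)" for a b n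
    have kl: "k a b \<longlonglongrightarrow> (b - a)" if "a \<le> b" for a b
      using bump_integral_tendsto(1)[OF i1 m1, of a b] that by (simp add: k_def[abs_def] set_integral_const)
    have ki: "integrable lborel (bump a b n)" for a b n
      using bump_integral_tendsto(2)[OF i1 m1, of a b n] by simp
    have "k 0 1 n * (\<integral>x. h x * bump a b n x \<partial>lborel) = k a b n * (\<integral>x. h x * bump 0 1 n x \<partial>lborel)" for n
    proof -
      let ?\<rho> = "\<lambda>x. k 0 1 n * bump a b n x + (- k a b n) * bump 0 1 n x"
      have "(\<integral>x. ?\<rho> x \<partial>lborel) = k 0 1 n * k a b n + (- k a b n) * k 0 1 n"
        unfolding k_def using ki by (simp add: Bochner_Integration.integral_diff)
      then have "(\<integral>x. ?\<rho> x \<partial>lborel) = 0" by simp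
      then obtain \<eta> where "test_function \<eta>" "deriv \<eta> = ?\<rho>"
        using test_function_primitive[OF test_function_lincomb[OF bump_test bump_test]] by blast
      then have "(\<integral>x. h x * ?\<rho> x \<partial>lborel) = 0" using z by metis
      moreover have "(\<integral>x. h x * ?\<rho> x \<partial>lborel) = (\<integral>x. k 0 1 n * (h x * bump a b n x) - k a b n * (h x * bump 0 1 n x) \<partial>lborel)"
        by (rule Bochner_Integration.integral_cong) (auto simp: algebra_simps)
      moreover have "\<dots> = k 0 1 n * (\<integral>x. h x * bump a b n x \<partial>lborel) - k a b n * (\<integral>x. h x * bump 0 1 n x \<partial>lborel)"
        using bump_integral_tendsto(2)[OF i m, of a b n] bump_integral_tendsto(2)[OF i m, of 0 1 n]
        by (simp add: Bochner_Integration.integral_diff)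
      ultimately show ?thesis by simp
    qed
    moreover have "(\<lambda>n. k 0 1 n * (\<integral>x. h x * bump a b n x \<partial>lborel)) \<longlonglongrightarrow> (1 - 0) * (LBINT x:{a..b}. h x)"
      by (intro tendsto_mult kl bump_integral_tendsto i m) simp
    moreover have "(\<lambda>n. k a b n * (\<integral>x. h x * bump 0 1 n x \<partial>lborel)) \<longlonglongrightarrow> (b - a) * c"
      unfolding c_def by (intro tendsto_mult kl bump_integral_tendsto i m ab)
    ultimately have "(1 - 0) * (LBINT x:{a..b}. h x) = (b - a) * c" using LIMSEQ_unique by simp
    then show ?thesis by (simp add: mult.commute)
  qed
  then show ?thesis by (rule that)
qed

text \<open>The averages over all intervals agree, and continuity recovers the value at a point by
  differentiating the integral.\<close>

lemma du_Bois_Reymond_continuous: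
  fixes h :: "real \<Rightarrow> real"
  assumes c: "continuous_on UNIV h" and z: "\<And>\<eta>. test_function \<eta> \<Longrightarrow> (\<integral>x. h x * deriv \<eta> x \<partial>lborel) = 0"
  shows "h x = h y"
proof -
  have i: "set_integrable lborel {a..b} h" for a b
    by (intro borel_integrable_atLeastAtMost' continuous_on_subset[OF c]) auto
  obtain k where k: "\<And>a b. a \<le> b \<Longrightarrow> (LBINT x:{a..b}. h x) = k * (b - a)"
    using du_Bois_Reymond[OF i borel_measurable_continuous_onI[OF c] z] by blast
  have "h x = k" for x
  proof -
    let ?a = "x - 1"
    have "((\<lambda>t. oint ?a t h) has_real_derivative h x) (at x)" by (rule oint_deriv[OF c])
    moreover have "((\<lambda>t. k * (t - ?a)) has_real_derivative k) (at x)" by (auto intro!: derivative_eq_intros)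
    then have "((\<lambda>t. oint ?a t h) has_real_derivative k) (at x)"
      by (rule has_field_derivative_transform_within_open[of _ _ _ "{?a<..}"]) (auto simp: k[symmetric] oint_eq_LBINT[OF c])
    ultimately show ?thesis by (rule DERIV_unique)
  qed
  then show ?thesis by simp
qed

text \<open>Lebesgue's differentiation theorem: outside a null set \<open>h\<close> is the limit of
  its averages over shrinking intervals.\<close>

lemma AE_zero_if_interval_integrals_zero:
  fixes h :: "real \<Rightarrow> real"
  assumes i: "\<And>a b. set_integrable lborel {a..b} h" and z: "\<And>a b. a \<le> b \<Longrightarrow> (LBINT x:{a..b}. h x) = 0"
  shows "AE x in lborel. h x = 0"
proof -
  have "h integrable_on cbox a b" for a b using set_borel_integral_eq_integral(1)[OF i] by simp
  then obtain N where N: "negligible N"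
    and d: "\<And>x e. x \<notin> N \<Longrightarrow> 0 < e \<Longrightarrow> \<exists>d>0. \<forall>t. 0 < t \<and> t < d \<longrightarrow> norm (integral (cbox x (x + t *\<^sub>R One)) h /\<^sub>R t ^ DIM(real) - h x) < e"
    using integrable_ccontinuous_explicit[of h] by metis
  have "h x = 0" if xN: "x \<notin> N" for x
  proof (rule ccontr)
    assume "h x \<noteq> 0"
    then obtain d where d0: "d > 0" "\<And>t. 0 < t \<Longrightarrow> t < d \<Longrightarrow> norm (integral (cbox x (x + t *\<^sub>R One)) h /\<^sub>R t ^ DIM(real) - h x) < \<bar>h x\<bar>"
      using d[OF xN, of "\<bar>h x\<bar>"] by auto
    have "integral {x..x + d / 2} h = 0"
      using z[of x "x + d / 2"] set_borel_integral_eq_integral(2)[OF i, of x "x + d / 2"] d0 by simp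
    then show False using d0(2)[of "d / 2"] d0(1) by simp
  qed
  moreover have "AE x in lebesgue. x \<notin> N"
    using N by (intro AE_not_in) (simp add: negligible_iff_null_sets)
  then have "AE x in lborel. x \<notin> N" by (simp add: AE_completion_iff)
  ultimately show ?thesis by (auto elim: eventually_mono)
qed

lemma integration_by_parts_test:
  fixes g G \<eta> :: "real \<Rightarrow> real"
  assumes i: "\<And>a b. set_integrable lborel {a..b} g" and G: "\<And>a b. a \<le> b \<Longrightarrow> G b - G a = (LBINT x:{a..b}. g x)"
    and \<eta>: "\<And>x. (\<eta> has_real_derivative \<eta>' x) (at x)" "continuous_on UNIV \<eta>'" and R: "\<And>x. R < \<bar>x\<bar> \<Longrightarrow> \<eta> x = 0"
  shows "(\<integral>x. G x * \<eta>' x \<partial>lborel) = - (\<integral>x. g x * \<eta> x \<partial>lborel)"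
proof -
  have \<eta>'0: "\<eta>' x = 0" if "R < \<bar>x\<bar>" for x
  proof -
    have "open {x. R < \<bar>x::real\<bar>}" by (intro open_Collect_less continuous_intros)
    then have "(\<eta> has_real_derivative 0) (at x)"
      by (rule has_field_derivative_transform_within_open[OF DERIV_const[of 0]]) (use R that in auto)
    then show ?thesis using \<eta>(1)[of x] DERIV_unique by blast
  qed
  define S where "S = \<bar>R\<bar> + 1"
  have S: "- S \<le> S" "S > R" "\<And>x. x \<notin> {-S..S} \<Longrightarrow> R < \<bar>x\<bar>" by (auto simp: S_def)
  have \<eta>c: "continuous_on T \<eta>" for T by (rule DERIV_continuous_on[OF has_field_derivative_at_within[OF \<eta>(1)]])
  have Gc: "continuous_on UNIV G" by (rule increments_continuous[OF i G])
  have "(LBINT x:{-S..S}. \<eta>' x * G x + \<eta> x * 1 * g x) = \<eta> S * G S - \<eta> (-S) * G (-S)"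
  proof (rule AC_chain_rule(2)[OF S(1) i, where W = "\<lambda>y. y"])
    show "G x = G (-S) + (LBINT y:{-S..x}. g y)" if "x \<in> {-S..S}" for x using G[of "-S" x] that by simp
    show "(\<eta> has_real_derivative \<eta>' x) (at x within {-S..S})" for x by (rule has_field_derivative_at_within[OF \<eta>(1)])
  qed (auto intro!: continuous_intros continuous_on_subset[OF \<eta>(2)])
  also have "\<dots> = 0" using R[of S] R[of "-S"] by (simp add: S_def)
  finally have 0: "(LBINT x:{-S..S}. \<eta>' x * G x + \<eta> x * g x) = 0" by simp
  have i1: "set_integrable lborel {-S..S} (\<lambda>x. \<eta>' x * G x)"
    by (intro borel_integrable_atLeastAtMost' continuous_intros continuous_on_subset[OF \<eta>(2)] continuous_on_subset[OF Gc]) auto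
  have i2: "set_integrable lborel {-S..S} (\<lambda>x. \<eta> x * g x)"
    by (rule set_integrable_continuous_mult[OF i \<eta>c]) simp
  have "(LBINT x:{-S..S}. \<eta>' x * G x) + (LBINT x:{-S..S}. \<eta> x * g x) = 0"
    using set_integral_add(2)[OF i1 i2] 0 by simp
  moreover have "(\<integral>x. G x * \<eta>' x \<partial>lborel) = (LBINT x:{-S..S}. G x * \<eta>' x)"
    by (rule integral_lborel_interval) (use S(3) \<eta>'0 in auto)
  moreover have "(\<integral>x. g x * \<eta> x \<partial>lborel) = (LBINT x:{-S..S}. g x * \<eta> x)"
    by (rule integral_lborel_interval) (use S(3) R in auto)
  ultimately show ?thesis by (simp add: mult.commute)
qed

section \<open>Weak formulations in characteristic coordinates\<close>

text \<open>The data are Lebesgue measurable and matter only up to null sets. They are replaced by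
  Borel representatives \<open>D\<close> and \<open>W\<close> and an absolutely continuous
  representative of \<open>\<phi>0\<close>, namely a primitive of \<open>D\<close> plus the constant
  that the lemma of du Bois-Reymond provides.\<close>

lemma finite_energy_data_AC:
  assumes p: "p > 1" and data: "finite_energy_data p \<phi>0 \<phi>1"
  obtains \<phi> D W where "D \<in> borel_measurable borel" "W \<in> borel_measurable borel"
    "integrable lborel (\<lambda>x. (D x)\<^sup>2)" "integrable lborel (\<lambda>x. (W x)\<^sup>2)"
    "\<And>a b. a \<le> b \<Longrightarrow> \<phi> b - \<phi> a = (LBINT x:{a..b}. D x)" "integrable lborel (\<lambda>x. npot p (\<phi> x))"
    "AE x in lebesgue. \<phi> x = \<phi>0 x" "AE x in lebesgue. W x = \<phi>1 x"
proof -
  obtain d where m0: "\<phi>0 \<in> borel_measurable lebesgue" "\<phi>1 \<in> borel_measurable lebesgue" and wd: "weak_deriv \<phi>0 d"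
    and en: "energy0 p \<phi>0 d \<phi>1 < \<infinity>"
    using data unfolding finite_energy_data_def by blast
  have ai: "set_integrable lebesgue {a..b} \<phi>0" "set_integrable lebesgue {a..b} d" for a b
    using wd unfolding weak_deriv_def by auto
  \<comment> \<open>The weak derivative is only given as integrable on compact sets; its
    measurability on the line is recovered by a limit of restrictions.\<close>
  have dm: "d \<in> borel_measurable lebesgue"
  proof (rule borel_measurable_LIMSEQ_real)
    show "(\<lambda>x. indicator {- real n..real n} x *\<^sub>R d x) \<in> borel_measurable lebesgue" for n
      using ai(2) unfolding set_integrable_def by (rule borel_measurable_integrable)
    fix x
    obtain N :: nat where N: "\<bar>x\<bar> \<le> real N" using real_arch_simple by blast
    have "\<forall>\<^sub>F n in sequentially. indicator {- real n..real n} x *\<^sub>R d x = d x"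
      using eventually_ge_at_top[of N] by eventually_elim (use N in \<open>auto simp: indicator_def\<close>)
    then show "(\<lambda>n. indicator {- real n..real n} x *\<^sub>R d x) \<longlonglongrightarrow> d x" by (rule tendsto_eventually)
  qed
  obtain f0 where f0m: "f0 \<in> borel_measurable lborel" and f0: "AE x in lborel. \<phi>0 x = f0 x"
    using completion_ex_borel_measurable_real[OF m0(1)] by blast
  obtain D where Dm: "D \<in> borel_measurable lborel" and D: "AE x in lborel. d x = D x"
    using completion_ex_borel_measurable_real[OF dm] by blast
  obtain W where Wm: "W \<in> borel_measurable lborel" and W: "AE x in lborel. \<phi>1 x = W x"
    using completion_ex_borel_measurable_real[OF m0(2)] by blast
  have [measurable]: "f0 \<in> borel_measurable borel" "D \<in> borel_measurable borel" "W \<in> borel_measurable borel"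
    using f0m Dm Wm by simp_all
  have [measurable]: "f0 \<in> borel_measurable lebesgue" "D \<in> borel_measurable lebesgue" "W \<in> borel_measurable lebesgue"
    using f0m Dm Wm by (auto intro: measurable_completion)
  note [measurable] = m0 dm
  have f0': "AE x in lebesgue. \<phi>0 x = f0 x" and D': "AE x in lebesgue. d x = D x" and W': "AE x in lebesgue. \<phi>1 x = W x"
    using f0 D W by (auto intro: AE_completion)
  have tr: "integrable lborel (\<lambda>x. G x :: real)" if "integrable lebesgue g" "AE x in lebesgue. g x = G x" "G \<in> borel_measurable borel" for g G
  proof -
    have "integrable lebesgue G"
      by (rule Bochner_Integration.integrable_cong_AE_imp[OF that(1)]) (use that in \<open>auto intro: measurable_completion\<close>)
    then show ?thesis using that(3) by (simp add: integrable_completion)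
  qed
  have f0i: "set_integrable lborel {a..b} f0" for a b
    unfolding set_integrable_def
    by (rule tr[OF ai(1)[unfolded set_integrable_def]]) (use f0' in \<open>auto elim: eventually_mono\<close>)
  have Di: "set_integrable lborel {a..b} D" for a b
    unfolding set_integrable_def
    by (rule tr[OF ai(2)[unfolded set_integrable_def]]) (use D' in \<open>auto elim: eventually_mono\<close>)
  have fin: "integrable lebesgue g" if "g \<in> borel_measurable lebesgue" and "\<And>x. 0 \<le> g x"
    and "\<And>x. g x \<le> \<bar>d x\<bar>\<^sup>2 + \<bar>\<phi>1 x\<bar>\<^sup>2 + 2 / (p + 1) * \<bar>\<phi>0 x\<bar> powr (p + 1)" for g
  proof (rule integrableI_bounded)
    have "(\<integral>\<^sup>+x. ennreal (norm (g x)) \<partial>lebesgue) \<le> energy0 p \<phi>0 d \<phi>1"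
      unfolding energy0_def by (intro nn_integral_mono ennreal_leI) (use that in simp)
    also have "\<dots> < \<infinity>" by (rule en)
    finally show "(\<integral>\<^sup>+x. ennreal (norm (g x)) \<partial>lebesgue) < \<infinity>" .
  qed (rule that)
  have p0: "0 \<le> 2 / (p + 1) * \<bar>\<phi>0 x\<bar> powr (p + 1)" for x using p by simp
  have "integrable lebesgue (\<lambda>x. (d x)\<^sup>2)" by (rule fin) (use p0 in \<open>auto intro!: add_nonneg_nonneg\<close>)
  then have D2: "integrable lborel (\<lambda>x. (D x)\<^sup>2)" by (rule tr) (use D' in \<open>auto elim: eventually_mono\<close>)
  have "integrable lebesgue (\<lambda>x. (\<phi>1 x)\<^sup>2)" by (rule fin) (use p0 in \<open>auto intro!: add_nonneg_nonneg\<close>)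
  then have W2: "integrable lborel (\<lambda>x. (W x)\<^sup>2)" by (rule tr) (use W' in \<open>auto elim: eventually_mono\<close>)
  obtain G where G: "\<And>a b. a \<le> b \<Longrightarrow> G b - G a = (LBINT x:{a..b}. D x)" and Gc: "continuous_on UNIV G"
    using indefinite_integral_exists[OF Di] by metis
  have [measurable]: "G \<in> borel_measurable borel" using Gc by (rule borel_measurable_continuous_onI)
  have Gi: "set_integrable lborel {a..b} G" for a b
    by (intro borel_integrable_atLeastAtMost' continuous_on_subset[OF Gc]) auto
  have hi: "set_integrable lborel {a..b} (\<lambda>x. f0 x - G x)" for a b by (intro set_integral_diff f0i Gi)
  \<comment> \<open>\<open>f0\<close> and the primitive \<open>G\<close> have the same weak
    derivative, the former by the assumption on the data and the latter by partial
    integration.\<close>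
  have z: "(\<integral>x. (f0 x - G x) * deriv \<eta> x \<partial>lborel) = 0" if \<eta>: "test_function \<eta>" for \<eta>
  proof -
    note t = test_function_deriv[OF \<eta>]
    have c1: "continuous_on UNIV (deriv \<eta>)" and c0: "continuous_on UNIV \<eta>" using t(2) \<eta> by (auto intro: test_function_continuous)
    then have [measurable]: "deriv \<eta> \<in> borel_measurable borel" "\<eta> \<in> borel_measurable borel" by (auto intro: borel_measurable_continuous_onI)
    then have [measurable]: "deriv \<eta> \<in> borel_measurable lebesgue" "\<eta> \<in> borel_measurable lebesgue" by (auto intro: measurable_completion)
    have "(\<integral>x. f0 x * deriv \<eta> x \<partial>lborel) = (\<integral>x. f0 x * deriv \<eta> x \<partial>lebesgue)" by (rule integral_completion[symmetric]) measurable
    also have "\<dots> = (\<integral>x. \<phi>0 x * deriv \<eta> x \<partial>lebesgue)"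
      by (rule integral_cong_AE) (use f0' in \<open>auto elim: eventually_mono\<close>)
    also have "\<dots> = - (\<integral>x. d x * \<eta> x \<partial>lebesgue)" using wd \<eta> unfolding weak_deriv_def by blast
    also have "(\<integral>x. d x * \<eta> x \<partial>lebesgue) = (\<integral>x. D x * \<eta> x \<partial>lebesgue)"
      by (rule integral_cong_AE) (use D' in \<open>auto elim: eventually_mono\<close>)
    also have "\<dots> = (\<integral>x. D x * \<eta> x \<partial>lborel)" by (rule integral_completion) measurable
    finally have 1: "(\<integral>x. f0 x * deriv \<eta> x \<partial>lborel) = - (\<integral>x. D x * \<eta> x \<partial>lborel)" .
    obtain R where R: "\<And>x. R < \<bar>x\<bar> \<Longrightarrow> \<eta> x = 0" using test_function_support[OF \<eta>] by (metis real_norm_def)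
    have 2: "(\<integral>x. G x * deriv \<eta> x \<partial>lborel) = - (\<integral>x. D x * \<eta> x \<partial>lborel)"
      by (rule integration_by_parts_test[OF Di G t(1) c1 R])
    obtain R' where R': "\<And>x. R' < \<bar>x\<bar> \<Longrightarrow> deriv \<eta> x = 0" using test_function_support[OF t(2)] by (metis real_norm_def)
    have li: "integrable lborel (\<lambda>x. g x * deriv \<eta> x)" if "set_integrable lborel {-R'..R'} g" for g
    proof -
      have "set_integrable lborel {-R'..R'} (\<lambda>x. deriv \<eta> x * g x)"
        by (rule set_integrable_continuous_mult[OF that continuous_on_subset[OF c1]]) auto
      moreover have "indicator {-R'..R'} x *\<^sub>R (deriv \<eta> x * g x) = g x * deriv \<eta> x" for x
      proof (cases "x \<in> {-R'..R'}")
        case False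
        then have "R' < \<bar>x\<bar>" by (smt (verit) atLeastAtMost_iff)
        then show ?thesis by (simp add: R')
      qed simp
      ultimately show ?thesis unfolding set_integrable_def by (simp only:)
    qed
    show ?thesis
      using Bochner_Integration.integral_diff[OF li[OF f0i] li[OF Gi]] 1 2 by (simp add: left_diff_distrib)
  qed
  obtain c where c: "\<And>a b. a \<le> b \<Longrightarrow> (LBINT x:{a..b}. f0 x - G x) = c * (b - a)"
    by (rule du_Bois_Reymond[OF hi _ z]) (measurable, rule that)
  have ci: "set_integrable lborel {a..b} (\<lambda>x. c)" for a b :: real by (intro borel_integrable_atLeastAtMost' continuous_intros)
  have "AE x in lborel. (f0 x - G x) - c = 0"
  proof (rule AE_zero_if_interval_integrals_zero)
    show "set_integrable lborel {a..b} (\<lambda>x. (f0 x - G x) - c)" for a b by (intro set_integral_diff(1) hi ci)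
    show "(LBINT x:{a..b}. (f0 x - G x) - c) = 0" if "a \<le> b" for a b
      using set_integral_diff(2)[OF hi ci, of a b] c[OF that] that by (simp add: set_integral_const)
  qed
  then have "AE x in lebesgue. (f0 x - G x) - c = 0" by (rule AE_completion)
  with f0' have AE\<phi>: "AE x in lebesgue. G x + c = \<phi>0 x" by eventually_elim simp
  have "integrable lebesgue (\<lambda>x. npot p (\<phi>0 x))"
  proof (rule fin)
    show "(\<lambda>x. npot p (\<phi>0 x)) \<in> borel_measurable lebesgue" unfolding npot_def by measurable
    show "npot p (\<phi>0 x) \<le> \<bar>d x\<bar>\<^sup>2 + \<bar>\<phi>1 x\<bar>\<^sup>2 + 2 / (p + 1) * \<bar>\<phi>0 x\<bar> powr (p + 1)" for x
    proof -
      have "npot p (\<phi>0 x) \<le> 2 / (p + 1) * \<bar>\<phi>0 x\<bar> powr (p + 1)" using npot_nonneg[OF p, of "\<phi>0 x"] by (simp add: npot_def)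
      then show ?thesis by (simp add: add_increasing)
    qed
  qed (use npot_nonneg[OF p] in auto)
  then have pot: "integrable lborel (\<lambda>x. npot p (G x + c))"
  proof (rule tr)
    show "AE x in lebesgue. npot p (\<phi>0 x) = npot p (G x + c)" using AE\<phi> by eventually_elim simp
    show "(\<lambda>x. npot p (G x + c)) \<in> borel_measurable borel" unfolding npot_def by measurable
  qed
  show ?thesis
  proof (rule that[of D W "\<lambda>x. G x + c"])
    show "(G b + c) - (G a + c) = (LBINT x:{a..b}. D x)" if "a \<le> b" for a b using G[OF that] by simp
    show "AE x in lebesgue. W x = \<phi>1 x" using W' by eventually_elim simp
  qed (use D2 W2 pot AE\<phi> in auto)
qed

text \<open>One variable is changed at a time: \<open>u = 2 * t - v\<close> for fixed
  \<open>v\<close>, which gives the factor 2, then, after exchanging the order,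
  \<open>v = t + x\<close> for fixed \<open>t\<close>. The integrability needed for the exchange is
  inherited from the characteristic side.\<close>

lemma characteristic_change_of_variables:
  fixes g :: "real \<Rightarrow> real \<Rightarrow> real"
  assumes m: "(\<lambda>z. g (fst z) (snd z)) \<in> borel_measurable borel"
    and i: "integrable lborel (\<lambda>z. g ((fst z + snd z) / 2) ((snd z - fst z) / 2))"
  shows "(\<integral>t. (\<integral>x. g t x \<partial>lborel) \<partial>lborel) = (\<integral>z. g ((fst z + snd z) / 2) ((snd z - fst z) / 2) \<partial>lborel) / 2"
proof -
  define G where "G u v = g ((u + v) / 2) ((v - u) / 2)" for u v
  have Gi: "integrable (lborel \<Otimes>\<^sub>M lborel) (case_prod G)"
    using i by (simp add: lborel_prod G_def case_prod_unfold)
  have cv: "(\<integral>u. h u \<partial>lborel) = 2 * (\<integral>t. h (- v + 2 * t) \<partial>lborel)" for h :: "real \<Rightarrow> real" and v :: real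
    using lborel_integral_real_affine[of 2 h "- v"] by simp
  have ci: "integrable lborel (\<lambda>t. h (- v + 2 * t))" if "integrable lborel h" for h :: "real \<Rightarrow> real" and v :: real
    using lborel_integrable_real_affine[OF that, of 2 "- v"] by simp
  have GK: "G (- v + 2 * t) v = g t (v - t)" for t v by (simp add: G_def diff_divide_distrib)
  have mK: "(\<lambda>z::real \<times> real. g (snd z) (fst z - snd z)) \<in> borel_measurable borel"
  proof -
    have "(\<lambda>z::real \<times> real. (snd z, fst z - snd z)) \<in> borel_measurable borel"
      by (intro borel_measurable_continuous_onI continuous_intros)
    from measurable_compose[OF this m] show ?thesis by simp
  qed
  have Ki: "integrable (lborel \<Otimes>\<^sub>M lborel) (\<lambda>z::real \<times> real. g (snd z) (fst z - snd z))"
  proof (rule lborel_pair.Fubini_integrable)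
    show "(\<lambda>z::real \<times> real. g (snd z) (fst z - snd z)) \<in> borel_measurable (lborel \<Otimes>\<^sub>M lborel)"
      using mK by (simp add: lborel_prod)
    have "integrable (lborel \<Otimes>\<^sub>M lborel) (\<lambda>(u, v). \<bar>G u v\<bar>)"
      using integrable_abs[OF Gi] by (simp add: case_prod_unfold)
    from lborel_pair.integrable_snd[OF this]
    have "integrable lborel (\<lambda>v. \<integral>u. \<bar>G u v\<bar> \<partial>lborel)" by simp
    then have "integrable lborel (\<lambda>v. 2 * (\<integral>t. \<bar>g t (v - t)\<bar> \<partial>lborel))"
      unfolding cv[of "\<lambda>u. \<bar>G u v\<bar>" v for v] GK .
    then show "integrable lborel (\<lambda>x. \<integral>y. norm (g (snd (x, y)) (fst (x, y) - snd (x, y))) \<partial>lborel)" by simp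
    show "AE x in lborel. integrable lborel (\<lambda>y. g (snd (x, y)) (fst (x, y) - snd (x, y)))"
      using lborel_pair.AE_integrable_snd[OF Gi]
    proof eventually_elim
      case (elim v)
      then have "integrable lborel (\<lambda>u. G u v)" by simp
      from ci[OF this, of v] show ?case unfolding GK by simp
    qed
  qed
  have "(\<integral>z. g ((fst z + snd z) / 2) ((snd z - fst z) / 2) \<partial>lborel) = (\<integral>z. G (fst z) (snd z) \<partial>(lborel \<Otimes>\<^sub>M lborel))"
    by (simp add: lborel_prod G_def)
  also have "\<dots> = (\<integral>v. (\<integral>u. G u v \<partial>lborel) \<partial>lborel)"
    using lborel_pair.integral_snd[OF Gi] by (simp add: case_prod_unfold)
  also have "\<dots> = (\<integral>v. 2 * (\<integral>t. g t (v - t) \<partial>lborel) \<partial>lborel)"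
    unfolding cv[of "\<lambda>u. G u v" v for v] GK ..
  also have "\<dots> = 2 * (\<integral>v. (\<integral>t. g t (v - t) \<partial>lborel) \<partial>lborel)" by simp
  also have "(\<integral>v. (\<integral>t. g t (v - t) \<partial>lborel) \<partial>lborel) = (\<integral>t. (\<integral>v. g t (v - t) \<partial>lborel) \<partial>lborel)"
    using lborel_pair.Fubini_integral[of "\<lambda>v t. g t (v - t)"] Ki by (simp add: case_prod_unfold)
  also have "\<dots> = (\<integral>t. (\<integral>x. g t x \<partial>lborel) \<partial>lborel)"
  proof (rule Bochner_Integration.integral_cong[OF refl])
    fix t
    show "(\<integral>v. g t (v - t) \<partial>lborel) = (\<integral>x. g t x \<partial>lborel)"
      using lborel_integral_real_affine[of 1 "g t" "- t"] by (simp add: add.commute)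
  qed
  finally show ?thesis by simp
qed

definition tochar :: "(real \<times> real \<Rightarrow> real) \<Rightarrow> real \<Rightarrow> real \<Rightarrow> real" where
  "tochar \<psi> u v = \<psi> ((u + v) / 2, (v - u) / 2)"

lemma integrable_box_support:
  fixes U :: "real \<times> real \<Rightarrow> real"
  assumes i: "\<And>a. set_integrable lborel ({-a..a} \<times> {-a..a}) U" and c: "continuous_on UNIV k"
    and s: "\<And>z. z \<notin> {-R..R} \<times> {-R..R} \<Longrightarrow> k z = 0"
  shows "integrable lborel (\<lambda>z. U z * k z)"
proof -
  have "set_integrable lborel ({-R..R} \<times> {-R..R}) (\<lambda>z. k z * U z)"
    by (rule set_integrable_continuous_mult[OF i continuous_on_subset[OF c]]) (auto intro!: compact_Times)
  moreover have "indicator ({-R..R} \<times> {-R..R}) z *\<^sub>R (k z * U z) = U z * k z" for z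
    using s[of z] by (cases "z \<in> {-R..R} \<times> {-R..R}") auto
  ultimately show ?thesis unfolding set_integrable_def by (simp only:)
qed

lemma tochar_cont: "continuous_on UNIV \<psi> \<Longrightarrow> continuous_on UNIV (\<lambda>z. tochar \<psi> (fst z) (snd z))"
  unfolding tochar_def by (rule continuous_on_compose2[where g = \<psi>]) (auto intro!: continuous_intros)

lemma tochar_support:
  assumes \<psi>: "\<And>z. R < norm z \<Longrightarrow> \<psi> z = 0" and uv: "(u, v) \<notin> {-(2*R)..2*R} \<times> {-(2*R)..2*R}"
  shows "tochar \<psi> u v = 0"
proof -
  let ?t = "(u + v) / 2" let ?x = "(v - u) / 2"
  have "\<bar>?t\<bar> \<le> norm (?t, ?x)" "\<bar>?x\<bar> \<le> norm (?t, ?x)"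
    using norm_fst_le[of ?t ?x] norm_snd_le[of ?x ?t] by simp_all
  then have "R < norm (?t, ?x)" using uv by auto
  then show ?thesis by (simp add: tochar_def \<psi>)
qed

text \<open>\<open>pairing\<close> is an iterated integral over the completed measure. Joint Borel
  measurability of \<open>U\<close> allows it to become a plane integral in characteristic
  coordinates; this is why \<open>P\<close> and \<open>Q\<close> are built as functions rather than
  classes.\<close>

lemma pairing_characteristic:
  fixes U :: "real \<Rightarrow> real \<Rightarrow> real"
  assumes m: "(\<lambda>z. U (fst z) (snd z)) \<in> borel_measurable borel"
    and i: "\<And>a. set_integrable lborel ({-a..a} \<times> {-a..a}) (\<lambda>z. U (fst z) (snd z))"
    and c: "continuous_on UNIV \<psi>" and R: "\<And>z. R < norm z \<Longrightarrow> \<psi> z = 0"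
  shows "integrable lborel (\<lambda>z. U (fst z) (snd z) * tochar \<psi> (fst z) (snd z))"
    and "pairing (\<lambda>t x. U (t - x) (t + x)) \<psi> = (\<integral>z. U (fst z) (snd z) * tochar \<psi> (fst z) (snd z) \<partial>lborel) / 2"
proof -
  show i2: "integrable lborel (\<lambda>z. U (fst z) (snd z) * tochar \<psi> (fst z) (snd z))"
  proof (rule integrable_box_support[OF i tochar_cont[OF c], where R = "2 * R"])
    show "tochar \<psi> (fst z) (snd z) = 0" if "z \<notin> {-(2*R)..2*R} \<times> {-(2*R)..2*R}" for z
      by (rule tochar_support[OF R]) (use that in simp_all)
  qed
  define g where "g t x = U (t - x) (t + x) * \<psi> (t, x)" for t x
  have "(\<lambda>z::real \<times> real. (fst z - snd z, fst z + snd z)) \<in> borel_measurable borel"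
    by (intro borel_measurable_continuous_onI continuous_intros)
  from measurable_compose[OF this m] have "(\<lambda>z. U (fst z - snd z) (fst z + snd z)) \<in> borel_measurable borel" by simp
  moreover have "\<psi> \<in> borel_measurable borel" using c by (rule borel_measurable_continuous_onI)
  ultimately have gm: "(\<lambda>z. g (fst z) (snd z)) \<in> borel_measurable borel"
    unfolding g_def by (simp add: borel_measurable_times)
  have gt: "g t \<in> borel_measurable borel" for t
  proof -
    have "(\<lambda>x::real. (t, x)) \<in> borel_measurable borel"
      by (intro borel_measurable_continuous_onI continuous_intros)
    from measurable_compose[OF this gm] show ?thesis by (simp only: fst_conv snd_conv)
  qed
  have "(\<lambda>t. \<integral>x. g t x \<partial>lborel) \<in> borel_measurable lborel"
    by (rule sigma_finite_measure.borel_measurable_lebesgue_integral[OF sigma_finite_lborel])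
      (use gm in \<open>simp add: lborel_prod case_prod_unfold\<close>)
  then have "(\<integral>t. (\<integral>x. g t x \<partial>lborel) \<partial>lebesgue) = (\<integral>t. (\<integral>x. g t x \<partial>lborel) \<partial>lborel)"
    by (rule integral_completion)
  moreover have "(\<integral>x. g t x \<partial>lebesgue) = (\<integral>x. g t x \<partial>lborel)" for t
    by (rule integral_completion) (use gt in simp)
  moreover have gc: "g ((a + b) / 2) ((b - a) / 2) = U a b * tochar \<psi> a b" for a b
  proof -
    have "(a + b) / 2 - (b - a) / 2 = a" "(a + b) / 2 + (b - a) / 2 = b" by argo+
    then show ?thesis by (simp only: g_def tochar_def)
  qed
  have "(\<integral>t. (\<integral>x. g t x \<partial>lborel) \<partial>lborel) = (\<integral>z. U (fst z) (snd z) * tochar \<psi> (fst z) (snd z) \<partial>lborel) / 2"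
    using characteristic_change_of_variables[OF gm] i2 unfolding gc by simp
  ultimately show "pairing (\<lambda>t x. U (t - x) (t + x)) \<psi> = (\<integral>z. U (fst z) (snd z) * tochar \<psi> (fst z) (snd z) \<partial>lborel) / 2"
    by (simp add: pairing_def g_def)
qed

lemma tochar_deriv:
  assumes "test_function \<psi>"
  shows "((\<lambda>v. tochar \<psi> u v) has_real_derivative (tochar (partial_deriv (1, 0) \<psi>) u v + tochar (partial_deriv (0, 1) \<psi>) u v) / 2) (at v)"
    and "((\<lambda>u. tochar \<psi> u v) has_real_derivative (tochar (partial_deriv (1, 0) \<psi>) u v - tochar (partial_deriv (0, 1) \<psi>) u v) / 2) (at u)"
proof -
  let ?z = "((u + v) / 2, (v - u) / 2)"
  let ?F = "frechet_derivative \<psi> (at ?z)"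
  have d: "(\<psi> has_derivative ?F) (at ?z)"
    using test_function_differentiable[OF assms] by (rule partial_deriv_works)
  then have bl: "bounded_linear ?F" by (rule has_derivative_bounded_linear)
  have lin: "?F (a, b) = a * ?F (1, 0) + b * ?F (0, 1)" for a b
  proof -
    have "(a, b) = a *\<^sub>R (1, 0) + b *\<^sub>R (0, 1)" by simp
    then have "?F (a, b) = ?F (a *\<^sub>R (1, 0) + b *\<^sub>R (0, 1))" by simp
    also have "\<dots> = a *\<^sub>R ?F (1, 0) + b *\<^sub>R ?F (0, 1)"
      using bl by (simp only: linear_add[OF bounded_linear.linear] linear_scale[OF bounded_linear.linear])
    finally show ?thesis by simp
  qed
  have "((\<lambda>v. ((u + v) / 2, (v - u) / 2)) has_derivative (\<lambda>h. (h / 2, h / 2))) (at v)"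
    by (auto intro!: derivative_eq_intros)
  from has_derivative_compose[OF this d]
  have "((\<lambda>v. tochar \<psi> u v) has_derivative (\<lambda>h. ?F (h / 2, h / 2))) (at v)" by (simp add: tochar_def)
  moreover have "?F (h / 2, h / 2) = (?F (1, 0) + ?F (0, 1)) / 2 * h" for h by (subst lin) (simp add: field_simps)
  ultimately have "((\<lambda>v. tochar \<psi> u v) has_derivative (\<lambda>h. (?F (1, 0) + ?F (0, 1)) / 2 * h)) (at v)"
    by (simp only:)
  then show "((\<lambda>v. tochar \<psi> u v) has_real_derivative (tochar (partial_deriv (1, 0) \<psi>) u v + tochar (partial_deriv (0, 1) \<psi>) u v) / 2) (at v)"
    by (simp only: has_field_derivative_def tochar_def partial_deriv_def)
  have "((\<lambda>u. ((u + v) / 2, (v - u) / 2)) has_derivative (\<lambda>h. (h / 2, - h / 2))) (at u)"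
    by (auto intro!: derivative_eq_intros)
  from has_derivative_compose[OF this d]
  have "((\<lambda>u. tochar \<psi> u v) has_derivative (\<lambda>h. ?F (h / 2, - h / 2))) (at u)" by (simp add: tochar_def)
  moreover have "?F (h / 2, - h / 2) = (?F (1, 0) - ?F (0, 1)) / 2 * h" for h by (subst lin) (simp add: field_simps)
  ultimately have "((\<lambda>u. tochar \<psi> u v) has_derivative (\<lambda>h. (?F (1, 0) - ?F (0, 1)) / 2 * h)) (at u)"
    by (simp only:)
  then show "((\<lambda>u. tochar \<psi> u v) has_real_derivative (tochar (partial_deriv (1, 0) \<psi>) u v - tochar (partial_deriv (0, 1) \<psi>) u v) / 2) (at u)"
    by (simp only: has_field_derivative_def tochar_def partial_deriv_def)
qed

text \<open>The integration by parts takes place on each line \<open>u = const\<close>, where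
  \<open>U\<close> is absolutely continuous with density \<open>U'\<close>; Fubini then assembles
  the lines.\<close>

lemma by_parts_snd:
  fixes U U' k k' :: "real \<Rightarrow> real \<Rightarrow> real"
  assumes iU: "\<And>a. set_integrable lborel ({-a..a} \<times> {-a..a}) (\<lambda>z. U (fst z) (snd z))"
    and iU': "\<And>a. set_integrable lborel ({-a..a} \<times> {-a..a}) (\<lambda>z. U' (fst z) (snd z))"
    and li: "\<And>u a b. set_integrable lborel {a..b} (U' u)" and inc: "\<And>u a b. a \<le> b \<Longrightarrow> U u b - U u a = (LBINT v:{a..b}. U' u v)"
    and k: "\<And>u v. ((\<lambda>v. k u v) has_real_derivative k' u v) (at v)"
    and c: "continuous_on UNIV (\<lambda>z. k (fst z) (snd z))" and c': "continuous_on UNIV (\<lambda>z. k' (fst z) (snd z))"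
    and s: "\<And>u v. (u, v) \<notin> {-R..R} \<times> {-R..R} \<Longrightarrow> k u v = 0" and s': "\<And>u v. (u, v) \<notin> {-R..R} \<times> {-R..R} \<Longrightarrow> k' u v = 0"
  shows "(\<integral>z. U (fst z) (snd z) * k' (fst z) (snd z) \<partial>lborel) = - (\<integral>z. U' (fst z) (snd z) * k (fst z) (snd z) \<partial>lborel)"
proof -
  have i1: "integrable lborel (\<lambda>z. U (fst z) (snd z) * k' (fst z) (snd z))"
    by (rule integrable_box_support[OF iU c', where R = R], rule s', simp)
  have i2: "integrable lborel (\<lambda>z. U' (fst z) (snd z) * k (fst z) (snd z))"
    by (rule integrable_box_support[OF iU' c, where R = R], rule s, simp)
  have inner: "(\<integral>v. U u v * k' u v \<partial>lborel) = - (\<integral>v. U' u v * k u v \<partial>lborel)" for u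
  proof (rule integration_by_parts_test[OF li inc k])
    have "continuous_on UNIV (\<lambda>v. k' (fst (u, v)) (snd (u, v)))"
      by (rule continuous_on_compose2[OF c']) (auto intro!: continuous_intros)
    then show "continuous_on UNIV (k' u)" by simp
    show "k u v = 0" if "R < \<bar>v\<bar>" for v by (rule s) (use that in auto)
  qed
  have f: "(\<integral>z. W (fst z) (snd z) \<partial>lborel) = (\<integral>u. (\<integral>v. W u v \<partial>lborel) \<partial>lborel)"
    if "integrable lborel (\<lambda>z. W (fst z) (snd z))" for W :: "real \<Rightarrow> real \<Rightarrow> real"
  proof -
    have "integrable (lborel \<Otimes>\<^sub>M lborel) (case_prod W)" using that by (simp add: lborel_prod case_prod_unfold)
    from lborel_pair.integral_fst[OF this] show ?thesis by (simp add: lborel_prod case_prod_unfold)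
  qed
  show ?thesis unfolding f[OF i1] f[OF i2] inner by simp
qed

lemma by_parts_fst:
  fixes U U' k k' :: "real \<Rightarrow> real \<Rightarrow> real"
  assumes iU: "\<And>a. set_integrable lborel ({-a..a} \<times> {-a..a}) (\<lambda>z. U (fst z) (snd z))"
    and iU': "\<And>a. set_integrable lborel ({-a..a} \<times> {-a..a}) (\<lambda>z. U' (fst z) (snd z))"
    and li: "\<And>v a b. set_integrable lborel {a..b} (\<lambda>u. U' u v)" and inc: "\<And>v a b. a \<le> b \<Longrightarrow> U b v - U a v = (LBINT u:{a..b}. U' u v)"
    and k: "\<And>u v. ((\<lambda>u. k u v) has_real_derivative k' u v) (at u)"
    and c: "continuous_on UNIV (\<lambda>z. k (fst z) (snd z))" and c': "continuous_on UNIV (\<lambda>z. k' (fst z) (snd z))"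
    and s: "\<And>u v. (u, v) \<notin> {-R..R} \<times> {-R..R} \<Longrightarrow> k u v = 0" and s': "\<And>u v. (u, v) \<notin> {-R..R} \<times> {-R..R} \<Longrightarrow> k' u v = 0"
  shows "(\<integral>z. U (fst z) (snd z) * k' (fst z) (snd z) \<partial>lborel) = - (\<integral>z. U' (fst z) (snd z) * k (fst z) (snd z) \<partial>lborel)"
proof -
  have sw: "(\<integral>z. W (snd z) (fst z) \<partial>lborel) = (\<integral>z. W (fst z) (snd z) \<partial>lborel)"
    if "integrable lborel (\<lambda>z. W (fst z) (snd z))" for W :: "real \<Rightarrow> real \<Rightarrow> real"
    using set_integrable_prod_swap(2)[of UNIV UNIV "\<lambda>z. W (fst z) (snd z)"] that
    by (simp add: set_integrable_def set_lebesgue_integral_def)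
  have i1: "integrable lborel (\<lambda>z. U (fst z) (snd z) * k' (fst z) (snd z))"
    by (rule integrable_box_support[OF iU c', where R = R], rule s', simp)
  have i2: "integrable lborel (\<lambda>z. U' (fst z) (snd z) * k (fst z) (snd z))"
    by (rule integrable_box_support[OF iU' c, where R = R], rule s, simp)
  have cs: "continuous_on UNIV (\<lambda>z. g (snd z) (fst z))" if "continuous_on UNIV (\<lambda>z. g (fst z) (snd z))" for g :: "real \<Rightarrow> real \<Rightarrow> real"
  proof -
    have "continuous_on UNIV (\<lambda>z::real \<times> real. (snd z, fst z))" by (intro continuous_intros)
    from continuous_on_compose2[OF that this] show ?thesis by simp
  qed
  have "(\<integral>z. U (snd z) (fst z) * k' (snd z) (fst z) \<partial>lborel) = - (\<integral>z. U' (snd z) (fst z) * k (snd z) (fst z) \<partial>lborel)"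
  proof (rule by_parts_snd[where U = "\<lambda>v u. U u v" and U' = "\<lambda>v u. U' u v" and k = "\<lambda>v u. k u v" and k' = "\<lambda>v u. k' u v" and R = R])
    show "set_integrable lborel ({-a..a} \<times> {-a..a}) (\<lambda>z. U (snd z) (fst z))" for a
      using set_integrable_prod_swap(1)[OF iU[of a]] by simp
    show "set_integrable lborel ({-a..a} \<times> {-a..a}) (\<lambda>z. U' (snd z) (fst z))" for a
      using set_integrable_prod_swap(1)[OF iU'[of a]] by simp
  qed (use li inc k cs[OF c] cs[OF c'] s s' in auto)
  then show ?thesis
    using sw[of "\<lambda>u v. U u v * k' u v", OF i1] sw[of "\<lambda>u v. U' u v * k u v", OF i2] by simp
qed

context charsol
begin

lemma box_integrable_continuous:
  fixes g :: "real \<Rightarrow> real \<Rightarrow> real"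
  shows "continuous_on UNIV (\<lambda>z. g (fst z) (snd z)) \<Longrightarrow> set_integrable lborel ({a..b} \<times> {c..d}) (\<lambda>z. g (fst z) (snd z))"
  unfolding set_integrable_def
  by (intro borel_integrable_compact compact_Times compact_Icc) (auto intro: continuous_on_subset)

lemma Q_box: "set_integrable lborel ({a..b} \<times> {c..d}) (\<lambda>z. Q (fst z) (snd z))"
  by (rule set_integrable_from_square[OF Q_sq_box Q_meas]) (intro compact_Times compact_Icc)

text \<open>By the chain rule the characteristic derivatives of \<open>tochar \<psi>\<close> are
  half the sum and half the difference of those of \<open>\<psi>\<close>. Partial integration moves
  such a derivative onto \<open>\<Phi>\<close>, where it yields \<open>P\<close> or
  \<open>Q\<close>, or onto \<open>P\<close> or \<open>Q\<close> in the direction in which the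
  equation gives \<open>- f(\<Phi>) / 4\<close>.\<close>

lemma weak_forms:
  assumes \<psi>: "test_function \<psi>"
  defines "\<psi>t \<equiv> partial_deriv (1, 0) \<psi>" and "\<psi>x \<equiv> partial_deriv (0, 1) \<psi>"
  defines "I \<equiv> \<lambda>U k. \<integral>z. U (fst z) (snd z) * tochar k (fst z) (snd z) \<partial>(lborel :: (real \<times> real) measure)"
  shows "I \<Phi> \<psi>t + I \<Phi> \<psi>x = - 2 * I P \<psi>" "I \<Phi> \<psi>t - I \<Phi> \<psi>x = - 2 * I Q \<psi>"
    and "I P \<psi>t - I P \<psi>x = I (\<lambda>u v. f (\<Phi> u v)) \<psi> / 2" "I Q \<psi>t + I Q \<psi>x = I (\<lambda>u v. f (\<Phi> u v)) \<psi> / 2"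
proof -
  interpret sw: charsol f V "\<lambda>u v. \<Phi> v u" q p by (rule swap)
  have B: "(1, 0) \<in> (Basis :: (real \<times> real) set)" "(0, 1) \<in> (Basis :: (real \<times> real) set)" by (auto simp: Basis_prod_def)
  have tt: "test_function \<psi>t" and tx: "test_function \<psi>x"
    unfolding \<psi>t_def \<psi>x_def by (intro test_function_partial_deriv \<psi> B)+
  obtain R where R: "\<And>z. R < norm z \<Longrightarrow> \<psi> z = 0" using test_function_support[OF \<psi>] by blast
  have R': "\<psi>t z = 0" "\<psi>x z = 0" if "R < norm z" for z
    unfolding \<psi>t_def \<psi>x_def by (rule partial_deriv_zero_outside[OF R that], assumption)+
  note sup = tochar_support[OF R] tochar_support[OF R'(1)] tochar_support[OF R'(2)]
  note ct = tochar_cont[OF test_function_continuous[OF \<psi>]] tochar_cont[OF test_function_continuous[OF tt]] tochar_cont[OF test_function_continuous[OF tx]]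
  have int: "integrable lborel (\<lambda>z. U (fst z) (snd z) * tochar k (fst z) (snd z))"
    if sU: "\<And>a. set_integrable lborel ({-a..a} \<times> {-a..a}) (\<lambda>z. U (fst z) (snd z))" and tk: "test_function k" for U k
  proof -
    obtain R where R: "\<And>z. R < norm z \<Longrightarrow> k z = 0" using test_function_support[OF tk] by blast
    show ?thesis
    proof (rule integrable_box_support[OF sU tochar_cont[OF test_function_continuous[OF tk]], where R = "2 * R"])
      show "tochar k (fst z) (snd z) = 0" if "z \<notin> {-(2*R)..2*R} \<times> {-(2*R)..2*R}" for z
        by (rule tochar_support[OF R]) (use that in simp_all)
    qed
  qed
  have lincomb: "(\<integral>z. U (fst z) (snd z) * ((tochar \<psi>t (fst z) (snd z) + c * tochar \<psi>x (fst z) (snd z)) / 2) \<partial>lborel) = (I U \<psi>t + c * I U \<psi>x) / 2"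
    if "\<And>a. set_integrable lborel ({-a..a} \<times> {-a..a}) (\<lambda>z. U (fst z) (snd z))" for U c
  proof -
    have "(\<integral>z. U (fst z) (snd z) * ((tochar \<psi>t (fst z) (snd z) + c * tochar \<psi>x (fst z) (snd z)) / 2) \<partial>lborel)
       = (\<integral>z. (U (fst z) (snd z) * tochar \<psi>t (fst z) (snd z)) / 2 + (c * (U (fst z) (snd z) * tochar \<psi>x (fst z) (snd z))) / 2 \<partial>lborel)"
      by (rule Bochner_Integration.integral_cong) (auto simp: field_simps)
    also have "\<dots> = I U \<psi>t / 2 + c * I U \<psi>x / 2"
      using int[OF that tt] int[OF that tx] by (simp add: I_def)
    finally show ?thesis by (simp add: field_simps)
  qed
  have bf: "set_integrable lborel ({-a..a} \<times> {-a..a}) (\<lambda>z. \<Phi> (fst z) (snd z))" for a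
    by (intro box_integrable_continuous Phi_cont' continuous_intros)
  have cff: "continuous_on UNIV (\<lambda>z. - f (\<Phi> (fst z) (snd z)) / 4)"
    by (intro continuous_intros f_Phi_cont) simp
  have bff: "set_integrable lborel ({-a..a} \<times> {-a..a}) (\<lambda>z. - f (\<Phi> (fst z) (snd z)) / 4)" for a
    by (rule box_integrable_continuous[OF cff])
  have flv: "set_integrable lborel {a..b} (\<lambda>v. - f (\<Phi> u v) / 4)" and flu: "set_integrable lborel {a..b} (\<lambda>u. - f (\<Phi> u v) / 4)" for a b u v
    by (intro borel_integrable_atLeastAtMost' continuous_intros f_Phi_cont; simp)+
  have kv: "((\<lambda>v. tochar \<psi> u v) has_real_derivative (tochar \<psi>t u v + 1 * tochar \<psi>x u v) / 2) (at v)"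
    and ku: "((\<lambda>u. tochar \<psi> u v) has_real_derivative (tochar \<psi>t u v + (-1) * tochar \<psi>x u v) / 2) (at u)" for u v
    using tochar_deriv(1)[OF \<psi>, where u = u and v = v] tochar_deriv(2)[OF \<psi>, where u = u and v = v] by (simp_all add: \<psi>t_def \<psi>x_def)
  have ck: "continuous_on UNIV (\<lambda>z. (tochar \<psi>t (fst z) (snd z) + c * tochar \<psi>x (fst z) (snd z)) / 2)" for c
    by (intro continuous_intros ct) simp
  have sk: "(tochar \<psi>t u v + c * tochar \<psi>x u v) / 2 = 0" if "(u, v) \<notin> {-(2*R)..2*R} \<times> {-(2*R)..2*R}" for u v c
    using sup(2)[OF _ that] sup(3)[OF _ that] by simp
  have incP: "P b v - P a v = (LBINT u:{a..b}. - f (\<Phi> u v) / 4)" if "a \<le> b" for a b v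
    by (rule LBINT_FTC[symmetric, OF that P_deriv]) (intro continuous_intros f_Phi_cont, simp)
  have incQ: "Q u b - Q u a = (LBINT v:{a..b}. - f (\<Phi> u v) / 4)" if "a \<le> b" for a b u
    by (rule LBINT_FTC[symmetric, OF that Q_deriv]) (intro continuous_intros f_Phi_cont, simp)
  have i4: "(\<integral>z. - f (\<Phi> (fst z) (snd z)) / 4 * tochar \<psi> (fst z) (snd z) \<partial>lborel) = - I (\<lambda>u v. f (\<Phi> u v)) \<psi> / 4"
  proof -
    have "(\<integral>z. - f (\<Phi> (fst z) (snd z)) / 4 * tochar \<psi> (fst z) (snd z) \<partial>lborel)
       = (\<integral>z. (- 1 / 4) * (f (\<Phi> (fst z) (snd z)) * tochar \<psi> (fst z) (snd z)) \<partial>lborel)" by simp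
    also have "\<dots> = (- 1 / 4) * I (\<lambda>u v. f (\<Phi> u v)) \<psi>" unfolding I_def by (rule integral_mult_right_zero)
    finally show ?thesis by simp
  qed
  have "(I \<Phi> \<psi>t + 1 * I \<Phi> \<psi>x) / 2 = - I P \<psi>"
    unfolding lincomb[OF bf, symmetric] unfolding I_def
    by (rule by_parts_snd[where U' = P, OF bf P_box P_line Phi_v kv ct(1) ck sup(1) sk])
  then show "I \<Phi> \<psi>t + I \<Phi> \<psi>x = - 2 * I P \<psi>" by simp
  have "(I \<Phi> \<psi>t + (-1) * I \<Phi> \<psi>x) / 2 = - I Q \<psi>"
    unfolding lincomb[OF bf, symmetric] unfolding I_def
    by (rule by_parts_fst[where U' = Q, OF bf Q_box sw.P_line Phi_u ku ct(1) ck sup(1) sk])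
  then show "I \<Phi> \<psi>t - I \<Phi> \<psi>x = - 2 * I Q \<psi>" by simp
  have "(I P \<psi>t + (-1) * I P \<psi>x) / 2 = - (- I (\<lambda>u v. f (\<Phi> u v)) \<psi> / 4)"
    unfolding lincomb[OF P_box, symmetric] i4[symmetric]
    by (rule by_parts_fst[where U' = "\<lambda>u v. - f (\<Phi> u v) / 4", OF P_box bff flu incP ku ct(1) ck sup(1) sk])
  then show "I P \<psi>t - I P \<psi>x = I (\<lambda>u v. f (\<Phi> u v)) \<psi> / 2" by simp
  have "(I Q \<psi>t + 1 * I Q \<psi>x) / 2 = - (- I (\<lambda>u v. f (\<Phi> u v)) \<psi> / 4)"
    unfolding lincomb[OF Q_box, symmetric] i4[symmetric]
    by (rule by_parts_snd[where U' = "\<lambda>u v. - f (\<Phi> u v) / 4", OF Q_box bff flv incQ kv ct(1) ck sup(1) sk])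
  then show "I Q \<psi>t + I Q \<psi>x = I (\<lambda>u v. f (\<Phi> u v)) \<psi> / 2" by simp
qed

end

section \<open>Continuity in time\<close>

lemma Ct_LqI:
  fixes U :: "real \<Rightarrow> real \<Rightarrow> real"
  assumes q: "q > 0" and m [measurable]: "\<And>t. U t \<in> borel_measurable borel"
    and i: "\<And>t. integrable lborel (\<lambda>x. \<bar>U t x\<bar> powr q)"
    and l: "\<And>s. ((\<lambda>t. \<integral>x. \<bar>U t x - U s x\<bar> powr q \<partial>lborel) \<longlongrightarrow> 0) (at s)"
  shows "Ct_Lq q U"
proof -
  have "in_Lq q (U t)" for t
    unfolding in_Lq_def using i[of t] by (simp add: integrable_completion measurable_completion)
  moreover have "((\<lambda>t. Lq_norm q (\<lambda>x. U t x - U s x)) \<longlongrightarrow> 0) (at s)" for s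
  proof -
    have "((\<lambda>t. (\<integral>x. \<bar>U t x - U s x\<bar> powr q \<partial>lborel) powr (1 / q)) \<longlongrightarrow> 0 powr (1 / q)) (at s)"
      by (rule tendsto_powr'[OF l tendsto_const]) (use q in auto)
    then show ?thesis by (simp add: Lq_norm_def integral_completion)
  qed
  ultimately show ?thesis by (auto simp: Ct_Lq_def)
qed

lemma powr_2_abs: "\<bar>x :: real\<bar> powr 2 = x\<^sup>2"
  by (cases "x = 0") (simp_all)

text \<open>Integrates over \<open>x\<close> what Cauchy-Schwarz gives for an increment over
  \<open>[s, t]\<close> at each \<open>x\<close>; exchanging the integrals gains the second factor
  \<open>t - s\<close>. Nonnegative integrals are used because \<open>h\<close> may fail to be
  integrable in time for some \<open>x\<close>.\<close>

lemma slab_bound: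
  fixes h :: "real \<Rightarrow> real \<Rightarrow> real" and w :: "real \<Rightarrow> real"
  assumes hm: "(\<lambda>z. h (fst z) (snd z)) \<in> borel_measurable borel" and h0: "\<And>\<sigma> x. 0 \<le> h \<sigma> x"
    and hi: "\<And>\<sigma>. integrable lborel (\<lambda>x. h \<sigma> x)" and hC: "\<And>\<sigma>. (\<integral>x. h \<sigma> x \<partial>lborel) \<le> C"
    and st: "s \<le> t" and wm [measurable]: "w \<in> borel_measurable borel" and w0: "\<And>x. 0 \<le> w x"
    and wle: "\<And>x. w x \<le> (t - s) * (LBINT \<sigma>:{s..t}. h \<sigma> x)"
  shows "integrable lborel w" and "(\<integral>x. w x \<partial>lborel) \<le> (t - s)\<^sup>2 * C"
proof -
  have C0: "0 \<le> C" using order_trans[OF Bochner_Integration.integral_nonneg[of lborel "h 0", OF h0] hC] .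
  have hm' [measurable]: "(\<lambda>(\<sigma>, x). h \<sigma> x) \<in> borel_measurable (lborel \<Otimes>\<^sub>M lborel)"
    using hm by (simp add: lborel_prod case_prod_unfold)
  have slice [measurable]: "(\<lambda>\<sigma>. h \<sigma> x) \<in> borel_measurable borel" for x
  proof -
    have "(\<lambda>\<sigma>::real. (\<sigma>, x)) \<in> borel_measurable borel" by (intro borel_measurable_continuous_onI continuous_intros)
    from measurable_compose[OF this hm] show ?thesis by simp
  qed
  have slice' [measurable]: "(\<lambda>x. h \<sigma> x) \<in> borel_measurable borel" for \<sigma>
  proof -
    have "(\<lambda>x::real. (\<sigma>, x)) \<in> borel_measurable borel" by (intro borel_measurable_continuous_onI continuous_intros)
    from measurable_compose[OF this hm] show ?thesis by simp
  qed
  have le: "ennreal (LBINT \<sigma>:{s..t}. h \<sigma> x) \<le> (\<integral>\<^sup>+\<sigma>. ennreal (indicator {s..t} \<sigma> * h \<sigma> x) \<partial>lborel)" for x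
  proof (cases "set_integrable lborel {s..t} (\<lambda>\<sigma>. h \<sigma> x)")
    case True
    then show ?thesis
      unfolding set_integrable_def set_lebesgue_integral_def
      by (subst nn_integral_eq_integral) (auto simp: h0)
  next
    \<comment> \<open>Here the Bochner integral takes its default value 0 and the bound is
      trivial.\<close>
    case False
    then show ?thesis
      unfolding set_integrable_def set_lebesgue_integral_def by (simp add: not_integrable_integral_eq)
  qed
  have "(\<integral>\<^sup>+x. ennreal (w x) \<partial>lborel) \<le> (\<integral>\<^sup>+x. ennreal (t - s) * (\<integral>\<^sup>+\<sigma>. ennreal (indicator {s..t} \<sigma> * h \<sigma> x) \<partial>lborel) \<partial>lborel)"
  proof (rule nn_integral_mono)
    fix x
    have "ennreal (w x) \<le> ennreal (t - s) * ennreal (LBINT \<sigma>:{s..t}. h \<sigma> x)"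
      using wle[of x] st by (simp add: ennreal_mult'[symmetric] ennreal_leI)
    also have "\<dots> \<le> ennreal (t - s) * (\<integral>\<^sup>+\<sigma>. ennreal (indicator {s..t} \<sigma> * h \<sigma> x) \<partial>lborel)"
      by (rule mult_left_mono[OF le]) simp
    finally show "ennreal (w x) \<le> ennreal (t - s) * (\<integral>\<^sup>+\<sigma>. ennreal (indicator {s..t} \<sigma> * h \<sigma> x) \<partial>lborel)" .
  qed
  also have "\<dots> = ennreal (t - s) * (\<integral>\<^sup>+x. (\<integral>\<^sup>+\<sigma>. ennreal (indicator {s..t} \<sigma> * h \<sigma> x) \<partial>lborel) \<partial>lborel)"
    by (intro nn_integral_cmult) measurable
  also have "(\<integral>\<^sup>+x. (\<integral>\<^sup>+\<sigma>. ennreal (indicator {s..t} \<sigma> * h \<sigma> x) \<partial>lborel) \<partial>lborel)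
      = (\<integral>\<^sup>+\<sigma>. (\<integral>\<^sup>+x. ennreal (indicator {s..t} \<sigma> * h \<sigma> x) \<partial>lborel) \<partial>lborel)"
    by (rule lborel_pair.Fubini') measurable
  also have "\<dots> \<le> (\<integral>\<^sup>+\<sigma>. ennreal C * indicator {s..t} \<sigma> \<partial>lborel)"
  proof (rule nn_integral_mono)
    fix \<sigma> :: real
    have "(\<integral>\<^sup>+x. ennreal (h \<sigma> x) \<partial>lborel) \<le> ennreal C"
      by (subst nn_integral_eq_integral[OF hi]) (auto simp: h0 hC ennreal_leI)
    then show "(\<integral>\<^sup>+x. ennreal (indicator {s..t} \<sigma> * h \<sigma> x) \<partial>lborel) \<le> ennreal C * indicator {s..t} \<sigma>"
      by (auto simp: indicator_def)
  qed
  also have "\<dots> = ennreal C * ennreal (t - s)"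
    using st by (simp add: nn_integral_cmult_indicator)
  finally have "(\<integral>\<^sup>+x. ennreal (w x) \<partial>lborel) \<le> ennreal (t - s) * (ennreal C * ennreal (t - s))"
    by (simp add: mult_left_mono)
  also have "\<dots> = ennreal ((t - s)\<^sup>2 * C)"
    using st C0 by (simp add: ennreal_mult'[symmetric] power2_eq_square mult_ac)
  finally have b: "(\<integral>\<^sup>+x. ennreal (w x) \<partial>lborel) \<le> ennreal ((t - s)\<^sup>2 * C)" .
  show i: "integrable lborel w"
    by (rule integrableI_nonneg) (use w0 le_less_trans[OF b ennreal_less_top] in auto)
  show "(\<integral>x. w x \<partial>lborel) \<le> (t - s)\<^sup>2 * C"
    using b nn_integral_eq_integral[OF i] w0 C0 by simp
qed

text \<open>\<open>Ct_Lq 2\<close> for Borel representatives, with squares in place of real powers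
  and roots; sums and reflections are easier to handle in this form.\<close>

definition L2_curve :: "(real \<Rightarrow> real \<Rightarrow> real) \<Rightarrow> bool" where
  "L2_curve U \<longleftrightarrow> (\<forall>t. U t \<in> borel_measurable borel \<and> integrable lborel (\<lambda>x. (U t x)\<^sup>2)) \<and>
     (\<forall>s. ((\<lambda>t. \<integral>x. (U t x - U s x)\<^sup>2 \<partial>lborel) \<longlongrightarrow> 0) (at s))"

lemma integrable_square_add:
  fixes f g :: "real \<Rightarrow> real"
  assumes [measurable]: "f \<in> borel_measurable borel" "g \<in> borel_measurable borel"
    and f: "integrable lborel (\<lambda>x. (f x)\<^sup>2)" and g: "integrable lborel (\<lambda>x. (g x)\<^sup>2)"
  shows "integrable lborel (\<lambda>x. (f x + g x)\<^sup>2)"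
    and "(\<integral>x. (f x + g x)\<^sup>2 \<partial>lborel) \<le> 2 * (\<integral>x. (f x)\<^sup>2 \<partial>lborel) + 2 * (\<integral>x. (g x)\<^sup>2 \<partial>lborel)"
proof -
  have le: "(a + b)\<^sup>2 \<le> 2 * a\<^sup>2 + 2 * b\<^sup>2" for a b :: real
    using zero_le_power2[of "a - b"] by (simp add: power2_eq_square algebra_simps)
  have i: "integrable lborel (\<lambda>x. 2 * (f x)\<^sup>2 + 2 * (g x)\<^sup>2)" using f g by simp
  show i2: "integrable lborel (\<lambda>x. (f x + g x)\<^sup>2)"
    by (rule Bochner_Integration.integrable_bound[OF i]) (use le in auto)
  show "(\<integral>x. (f x + g x)\<^sup>2 \<partial>lborel) \<le> 2 * (\<integral>x. (f x)\<^sup>2 \<partial>lborel) + 2 * (\<integral>x. (g x)\<^sup>2 \<partial>lborel)"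
    using integral_mono[OF i2 i le] f g by simp
qed

lemma L2_curve_Ct: "L2_curve U \<Longrightarrow> Ct_Lq 2 U"
  by (rule Ct_LqI) (auto simp: L2_curve_def powr_2_abs)

lemma L2_curve_cmult: "L2_curve U \<Longrightarrow> L2_curve (\<lambda>t x. c * U t x)"
proof -
  assume a: "L2_curve U"
  have "((\<lambda>t. c\<^sup>2 * (\<integral>x. (U t x - U s x)\<^sup>2 \<partial>lborel)) \<longlongrightarrow> c\<^sup>2 * 0) (at s)" for s
    using a by (intro tendsto_intros) (auto simp: L2_curve_def)
  moreover have "(\<lambda>x. c * U t x) \<in> borel_measurable borel" for t
    using a by (intro borel_measurable_times borel_measurable_const) (auto simp: L2_curve_def)
  ultimately show ?thesis
    using a unfolding L2_curve_def
    by (auto simp: power_mult_distrib right_diff_distrib[symmetric])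
qed

lemma L2_curve_add:
  assumes U: "L2_curve U" and W: "L2_curve W"
  shows "L2_curve (\<lambda>t x. U t x + W t x)"
proof -
  have m [measurable]: "U t \<in> borel_measurable borel" "W t \<in> borel_measurable borel" for t using U W by (auto simp: L2_curve_def)
  have i: "integrable lborel (\<lambda>x. (U t x)\<^sup>2)" "integrable lborel (\<lambda>x. (W t x)\<^sup>2)" for t using U W by (auto simp: L2_curve_def)
  have d: "integrable lborel (\<lambda>x. (U t x - U s x)\<^sup>2)" "integrable lborel (\<lambda>x. (W t x - W s x)\<^sup>2)" for t s
    using integrable_square_add(1)[of "U t" "\<lambda>x. - U s x"] integrable_square_add(1)[of "W t" "\<lambda>x. - W s x"] i by auto
  have "((\<lambda>t. \<integral>x. ((U t x + W t x) - (U s x + W s x))\<^sup>2 \<partial>lborel) \<longlongrightarrow> 0) (at s)" for s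
  proof (rule tendsto_sandwich[OF _ _ tendsto_const])
    have "((\<lambda>t. 2 * (\<integral>x. (U t x - U s x)\<^sup>2 \<partial>lborel) + 2 * (\<integral>x. (W t x - W s x)\<^sup>2 \<partial>lborel)) \<longlongrightarrow> 2 * 0 + 2 * 0) (at s)"
      using U W by (intro tendsto_intros) (auto simp: L2_curve_def)
    then show "((\<lambda>t. 2 * (\<integral>x. (U t x - U s x)\<^sup>2 \<partial>lborel) + 2 * (\<integral>x. (W t x - W s x)\<^sup>2 \<partial>lborel)) \<longlongrightarrow> 0) (at s)" by simp
    have "(\<integral>x. ((U t x + W t x) - (U s x + W s x))\<^sup>2 \<partial>lborel) \<le> 2 * (\<integral>x. (U t x - U s x)\<^sup>2 \<partial>lborel) + 2 * (\<integral>x. (W t x - W s x)\<^sup>2 \<partial>lborel)" for t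
      using integrable_square_add(2)[OF _ _ d(1)[of t s] d(2)[of t s]] by (simp add: algebra_simps)
    then show "\<forall>\<^sub>F t in at s. (\<integral>x. ((U t x + W t x) - (U s x + W s x))\<^sup>2 \<partial>lborel) \<le> 2 * (\<integral>x. (U t x - U s x)\<^sup>2 \<partial>lborel) + 2 * (\<integral>x. (W t x - W s x)\<^sup>2 \<partial>lborel)"
      by simp
  qed (simp add: Bochner_Integration.integral_nonneg)
  moreover have "integrable lborel (\<lambda>x. (U t x + W t x)\<^sup>2)" for t
    by (rule integrable_square_add(1)) (use i in auto)
  ultimately show ?thesis by (auto simp: L2_curve_def)
qed

lemma L2_curve_reflect:
  assumes "L2_curve U"
  shows "L2_curve (\<lambda>t x. U t (- x))"
proof -
  have r: "(\<integral>x. g (- x) \<partial>lborel) = integral\<^sup>L lborel g" for g :: "real \<Rightarrow> real"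
    using lborel_integral_real_affine[of "-1" g 0] by simp
  have r': "integrable lborel (\<lambda>x. g (- x))" if "integrable lborel g" for g :: "real \<Rightarrow> real"
    using lborel_integrable_real_affine[OF that, of "-1" 0] by simp
  have [measurable]: "U t \<in> borel_measurable borel" for t using assms by (auto simp: L2_curve_def)
  have "(\<lambda>x. U t (- x)) \<in> borel_measurable borel" for t by measurable
  then show ?thesis
    using assms r'[of "\<lambda>x. (U t x)\<^sup>2" for t] r[of "\<lambda>x. (U t x - U s x)\<^sup>2" for s t]
    unfolding L2_curve_def by auto
qed

lemma quadratic_tendsto_0:
  fixes F :: "real \<Rightarrow> real"
  assumes "\<And>t. 0 \<le> F t" "\<And>t. F t \<le> C * (t - s)\<^sup>2"
  shows "(F \<longlongrightarrow> 0) (at s)"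
proof (rule tendsto_sandwich[OF _ _ tendsto_const])
  have "((\<lambda>t. C * (t - s)\<^sup>2) \<longlongrightarrow> C * (s - s)\<^sup>2) (at s)" by (intro tendsto_intros)
  then show "((\<lambda>t. C * (t - s)\<^sup>2) \<longlongrightarrow> 0) (at s)" by simp
qed (use assms in auto)

context finite_energy
begin

lemma P_slice_meas: "(\<lambda>v. P (2 * t - v) v) \<in> borel_measurable borel"
  by (rule P_meas') (auto intro!: borel_measurable_continuous_onI continuous_intros)

lemma P_slice_L2: "integrable lborel (\<lambda>v. (P (2 * t - v) v)\<^sup>2)" "(\<integral>v. (P (2 * t - v) v)\<^sup>2 \<partial>lborel) \<le> EP"
proof -
  note [measurable] = P_slice_meas
  have le: "(P (2 * t - v) v)\<^sup>2 \<le> eP t v" for v using V_nonneg by (simp add: eP_def)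
  show i: "integrable lborel (\<lambda>v. (P (2 * t - v) v)\<^sup>2)"
    by (rule Bochner_Integration.integrable_bound[OF energy_bound(1)[of t]]) (use le eP_nonneg in \<open>auto simp: abs_of_nonneg\<close>)
  show "(\<integral>v. (P (2 * t - v) v)\<^sup>2 \<partial>lborel) \<le> EP"
    using integral_mono[OF i energy_bound(1) le] energy_bound(2)[of t] by (simp add: EP_def)
qed

text \<open>For fixed \<open>v\<close> the map
  \<open>\<sigma> \<mapsto> P (2 * \<sigma> - v) v\<close> has derivative
  \<open>- f(\<Phi>) / 2\<close>, so in the coordinate \<open>v\<close> the profile changes only
  through the nonlinearity. The assumption on \<open>K\<close> bounds the square of this derivative
  by a multiple of \<open>eP\<close>, whose integral is at most \<open>EP\<close>.\<close>

lemma P_slice_increment: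
  assumes K: "\<And>u v. (f (\<Phi> u v))\<^sup>2 \<le> K * V (\<Phi> u v)" and K0: "0 \<le> K"
  shows "integrable lborel (\<lambda>v. (P (2 * t - v) v - P (2 * s - v) v)\<^sup>2)"
    and "(\<integral>v. (P (2 * t - v) v - P (2 * s - v) v)\<^sup>2 \<partial>lborel) \<le> (K * EP) * (t - s)\<^sup>2"
proof -
  note [measurable] = P_slice_meas
  have *: "integrable lborel (\<lambda>v. (P (2 * t - v) v - P (2 * s - v) v)\<^sup>2) \<and> (\<integral>v. (P (2 * t - v) v - P (2 * s - v) v)\<^sup>2 \<partial>lborel) \<le> (t - s)\<^sup>2 * (K * EP)"
    if st: "s \<le> t" for s t
  proof -
    define h where "h \<sigma> v = (f (\<Phi> (2 * \<sigma> - v) v) / 2)\<^sup>2" for \<sigma> v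
    have hc: "continuous_on UNIV (\<lambda>z. h (fst z) (snd z))"
      unfolding h_def by (intro continuous_intros f_Phi_cont) simp
    have hle: "h \<sigma> v \<le> K * eP \<sigma> v" for \<sigma> v
    proof -
      have "h \<sigma> v \<le> K * (V (\<Phi> (2 * \<sigma> - v) v) / 4)" using K[of "2 * \<sigma> - v" v] by (simp add: h_def power_divide)
      also have "\<dots> \<le> K * eP \<sigma> v"
        using V_nonneg[of "\<Phi> (2 * \<sigma> - v) v"] by (intro mult_left_mono[OF _ K0]) (simp add: eP_def add_increasing)
      finally show ?thesis .
    qed
    have hi: "integrable lborel (\<lambda>v. h \<sigma> v)" for \<sigma>
    proof (rule Bochner_Integration.integrable_bound)
      show "integrable lborel (\<lambda>v. K * eP \<sigma> v)" using energy_bound by simp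
      have "continuous_on UNIV (\<lambda>v. h \<sigma> v)" unfolding h_def by (intro continuous_intros f_Phi_cont) simp
      then show "(\<lambda>v. h \<sigma> v) \<in> borel_measurable lborel" by (simp add: borel_measurable_continuous_onI)
      show "AE x in lborel. norm (h \<sigma> x) \<le> norm (K * eP \<sigma> x)"
        using hle eP_nonneg K0 by (auto simp: h_def abs_of_nonneg intro!: AE_I2)
    qed
    have hC: "(\<integral>v. h \<sigma> v \<partial>lborel) \<le> K * EP" for \<sigma>
    proof -
      have "(\<integral>v. h \<sigma> v \<partial>lborel) \<le> (\<integral>v. K * eP \<sigma> v \<partial>lborel)"
        by (rule integral_mono[OF hi _ hle]) (use energy_bound in simp)
      also have "\<dots> = K * integral\<^sup>L lborel (eP \<sigma>)" by simp
      also have "\<dots> \<le> K * EP" using mult_left_mono[OF energy_bound(2)[of \<sigma>] K0] by (simp add: EP_def)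
      finally show ?thesis .
    qed
    have w: "(P (2 * t - v) v - P (2 * s - v) v)\<^sup>2 \<le> (t - s) * (LBINT \<sigma>:{s..t}. h \<sigma> v)" for v
    proof -
      let ?g = "\<lambda>\<sigma>. - f (\<Phi> (2 * \<sigma> - v) v) / 2"
      have gc: "continuous_on S ?g" for S by (intro continuous_intros f_Phi_cont) simp
      have "(LBINT \<sigma>:{s..t}. ?g \<sigma>) = P (2 * t - v) v - P (2 * s - v) v"
      proof (rule LBINT_FTC[OF st _ gc])
        fix \<sigma>
        have "((\<lambda>u. P u v) has_real_derivative - f (\<Phi> (2 * \<sigma> - v) v) / 4) (at (2 * \<sigma> - v))" by (rule P_deriv)
        then have "((\<lambda>\<sigma>. P (2 * \<sigma> - v) v) has_real_derivative (- f (\<Phi> (2 * \<sigma> - v) v) / 4) * 2) (at \<sigma> within {s..t})"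
          by (rule DERIV_chain2[where g = "\<lambda>\<sigma>. 2 * \<sigma> - v"]) (auto intro!: derivative_eq_intros)
        then show "((\<lambda>\<sigma>. P (2 * \<sigma> - v) v) has_real_derivative ?g \<sigma>) (at \<sigma> within {s..t})"
          by (simp add: field_simps)
      qed
      moreover have "(LBINT \<sigma>:{s..t}. ?g \<sigma>)\<^sup>2 \<le> (t - s) * (LBINT \<sigma>:{s..t}. (?g \<sigma>)\<^sup>2)"
      proof (rule LBINT_Cauchy_Schwarz[OF st])
        show "?g \<in> borel_measurable borel" by (rule borel_measurable_continuous_onI[OF gc])
        show "set_integrable lborel {s..t} (\<lambda>\<sigma>. (?g \<sigma>)\<^sup>2)"
          by (rule borel_integrable_atLeastAtMost'[OF continuous_on_power[OF gc]])
      qed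
      ultimately show ?thesis by (simp add: h_def)
    qed
    have "integrable lborel (\<lambda>v. (P (2 * t - v) v - P (2 * s - v) v)\<^sup>2)"
      by (rule slab_bound(1)[OF borel_measurable_continuous_onI[OF hc] _ hi hC st _ _ w]) (auto simp: h_def)
    moreover have "(\<integral>v. (P (2 * t - v) v - P (2 * s - v) v)\<^sup>2 \<partial>lborel) \<le> (t - s)\<^sup>2 * (K * EP)"
      by (rule slab_bound(2)[OF borel_measurable_continuous_onI[OF hc] _ hi hC st _ _ w]) (auto simp: h_def)
    ultimately show ?thesis by simp
  qed
  show "integrable lborel (\<lambda>v. (P (2 * t - v) v - P (2 * s - v) v)\<^sup>2)"
    "(\<integral>v. (P (2 * t - v) v - P (2 * s - v) v)\<^sup>2 \<partial>lborel) \<le> (K * EP) * (t - s)\<^sup>2"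
    using *[of s t] *[of t s] linear[of s t] by (auto simp: power2_commute mult.commute)
qed

text \<open>In the coordinate \<open>x\<close> the profile is also translated, as
  \<open>v = x + t\<close>. The increment splits into the change of the profile, of order
  \<open>t - s\<close> in norm, and a translation of the fixed profile at time \<open>s\<close>,
  which is merely continuous in the mean.\<close>

lemma P_L2_curve:
  assumes K: "\<And>u v. (f (\<Phi> u v))\<^sup>2 \<le> K * V (\<Phi> u v)" and K0: "0 \<le> K"
  shows "L2_curve (\<lambda>t x. P (t - x) (t + x))"
proof -
  define r where "r t v = P (2 * t - v) v" for t v
  have r: "P (t - x) (t + x) = r t (x + t)" for t x by (simp add: r_def algebra_simps)
  have m [measurable]: "r t \<in> borel_measurable borel" for t unfolding r_def by (rule P_slice_meas)
  have i: "integrable lborel (\<lambda>v. (r t v)\<^sup>2)" for t unfolding r_def by (rule P_slice_L2)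
  note inc = P_slice_increment[OF K K0, folded r_def]
  have sh: "integrable lborel (\<lambda>x. g (x + c))" if "integrable lborel g" for g :: "real \<Rightarrow> real" and c
    using lborel_integrable_real_affine[OF that, of 1 c] by (simp add: add.commute)
  have sh': "(\<integral>x. g (x + c) \<partial>lborel) = integral\<^sup>L lborel g" for g :: "real \<Rightarrow> real" and c
    using lborel_integral_real_affine[of 1 g c] by (simp add: add.commute)
  have lim: "((\<lambda>t. \<integral>x. (r t (x + t) - r s (x + s))\<^sup>2 \<partial>lborel) \<longlongrightarrow> 0) (at s)" for s
  proof (rule tendsto_sandwich[OF _ _ tendsto_const])
    let ?B = "\<lambda>t. 2 * ((K * EP) * (t - s)\<^sup>2) + 2 * (\<integral>x. (r s (x + (t - s)) - r s x)\<^sup>2 \<partial>lborel)"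
    have "((\<lambda>h. \<integral>x. \<bar>r s (x + h) - r s x\<bar> ^ 2 \<partial>lborel) \<longlongrightarrow> 0) (at 0)"
      by (rule L2_translation_continuous) (use i in auto)
    then have "((\<lambda>t. \<integral>x. (r s (x + (t - s)) - r s x)\<^sup>2 \<partial>lborel) \<longlongrightarrow> 0) (at s)"
      by (intro LIM_offset_zero_cancel[where a = s]) simp
    then have "(?B \<longlongrightarrow> 2 * ((K * EP) * (s - s)\<^sup>2) + 2 * 0) (at s)" by (intro tendsto_intros)
    then show "(?B \<longlongrightarrow> 0) (at s)" by simp
    have "(\<integral>x. (r t (x + t) - r s (x + s))\<^sup>2 \<partial>lborel) \<le> ?B t" for t
    proof -
      have i1: "integrable lborel (\<lambda>x. (r t (x + t) - r s (x + t))\<^sup>2)" by (rule sh[OF inc(1)])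
      have i2: "integrable lborel (\<lambda>x. (r s (x + t) - r s (x + s))\<^sup>2)"
        using integrable_square_add(1)[OF _ _ sh[OF i[of s], of t] , of "\<lambda>x. - r s (x + s)"] sh[OF i[of s], of s] by simp
      have "(\<integral>x. (r t (x + t) - r s (x + s))\<^sup>2 \<partial>lborel) \<le> 2 * (\<integral>x. (r t (x + t) - r s (x + t))\<^sup>2 \<partial>lborel) + 2 * (\<integral>x. (r s (x + t) - r s (x + s))\<^sup>2 \<partial>lborel)"
        using integrable_square_add(2)[OF _ _ i1 i2] by simp
      also have "(\<integral>x. (r t (x + t) - r s (x + t))\<^sup>2 \<partial>lborel) = (\<integral>x. (r t x - r s x)\<^sup>2 \<partial>lborel)"
        by (rule sh'[of "\<lambda>x. (r t x - r s x)\<^sup>2"])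
      also have "(\<integral>x. (r s (x + t) - r s (x + s))\<^sup>2 \<partial>lborel) = (\<integral>x. (r s (x + (t - s)) - r s x)\<^sup>2 \<partial>lborel)"
        using sh'[of "\<lambda>x. (r s (x + (t - s)) - r s x)\<^sup>2" s] by (simp add: algebra_simps)
      finally show ?thesis using inc(2)[of t s] by simp
    qed
    then show "\<forall>\<^sub>F t in at s. (\<integral>x. (r t (x + t) - r s (x + s))\<^sup>2 \<partial>lborel) \<le> ?B t" by simp
  qed (simp add: Bochner_Integration.integral_nonneg)
  show ?thesis unfolding L2_curve_def r using sh[OF i] lim by auto
qed

lemma Q_L2_curve:
  assumes K: "\<And>u v. (f (\<Phi> u v))\<^sup>2 \<le> K * V (\<Phi> u v)" and K0: "0 \<le> K"
  shows "L2_curve (\<lambda>t x. Q (t - x) (t + x))"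
  using L2_curve_reflect[OF finite_energy.P_L2_curve[OF swap' K K0]] by simp

text \<open>Only \<open>v\<close> moves while \<open>u = b - x\<close> is kept. The points
  \<open>(b - x, \<sigma> + x)\<close> form the slice of time \<open>(b + \<sigma>) / 2\<close>, on
  which the square of \<open>P\<close> has integral at most \<open>EP\<close>.\<close>

lemma Phi_increment_L2:
  assumes st: "s \<le> t"
  shows "integrable lborel (\<lambda>x. (\<Phi> (b - x) (t + x) - \<Phi> (b - x) (s + x))\<^sup>2)"
    and "(\<integral>x. (\<Phi> (b - x) (t + x) - \<Phi> (b - x) (s + x))\<^sup>2 \<partial>lborel) \<le> (t - s)\<^sup>2 * EP"
proof -
  define h where "h \<sigma> x = (P (b - x) (\<sigma> + x))\<^sup>2" for \<sigma> x
  have hm: "(\<lambda>z. h (fst z) (snd z)) \<in> borel_measurable borel"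
  proof -
    have "(\<lambda>z::real \<times> real. (b - snd z, fst z + snd z)) \<in> borel_measurable borel"
      by (intro borel_measurable_continuous_onI continuous_intros)
    from measurable_compose[OF this P_meas] have [measurable]: "(\<lambda>z::real \<times> real. P (b - snd z) (fst z + snd z)) \<in> borel_measurable borel" by simp
    show ?thesis unfolding h_def by measurable
  qed
  have he: "h \<sigma> x = (\<lambda>v. (P (2 * ((b + \<sigma>) / 2) - v) v)\<^sup>2) (x + \<sigma>)" for \<sigma> x
  proof -
    have "2 * ((b + \<sigma>) / 2) - (x + \<sigma>) = b - x" by argo
    then show ?thesis by (simp only: h_def add.commute[of \<sigma> x])
  qed
  have hi: "integrable lborel (\<lambda>x. h \<sigma> x)" for \<sigma>
    unfolding he using lborel_integrable_real_affine[OF P_slice_L2(1)[of "(b + \<sigma>) / 2"], of 1 \<sigma>] by (simp add: add.commute)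
  have hC: "(\<integral>x. h \<sigma> x \<partial>lborel) \<le> EP" for \<sigma>
    unfolding he using lborel_integral_real_affine[of 1 "\<lambda>v. (P (2 * ((b + \<sigma>) / 2) - v) v)\<^sup>2" \<sigma>] P_slice_L2(2)[of "(b + \<sigma>) / 2"] by (simp add: add.commute)
  have w: "(\<Phi> (b - x) (t + x) - \<Phi> (b - x) (s + x))\<^sup>2 \<le> (t - s) * (LBINT \<sigma>:{s..t}. h \<sigma> x)" for x
  proof -
    have "\<Phi> (b - x) (t + x) - \<Phi> (b - x) (s + x) = (LBINT y:{s + x..t + x}. P (b - x) y)"
      by (rule Phi_v) (use st in simp)
    also have "\<dots>\<^sup>2 \<le> ((t + x) - (s + x)) * (LBINT y:{s + x..t + x}. (P (b - x) y)\<^sup>2)"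
    proof (rule LBINT_Cauchy_Schwarz)
      show "P (b - x) \<in> borel_measurable borel" by (rule P_meas'[where k = "\<lambda>_. b - x" and m = "\<lambda>v. v"]) simp_all
      show "set_integrable lborel {s + x..t + x} (\<lambda>y. (P (b - x) y)\<^sup>2)" by (intro P_sq_line continuous_intros)
    qed (use st in simp)
    also have "(LBINT y:{s + x..t + x}. (P (b - x) y)\<^sup>2) = (LBINT \<sigma>:{s..t}. h \<sigma> x)"
    proof -
      have "(LBINT y:{s + x..t + x}. (P (b - x) y)\<^sup>2) = (\<integral>y. indicator {s + x..t + x} (x + y) *\<^sub>R (P (b - x) (x + y))\<^sup>2 \<partial>lborel)"
        unfolding set_lebesgue_integral_def
        by (subst lborel_integral_real_affine[where c = 1 and t = x]) simp_all
      also have "\<dots> = (LBINT \<sigma>:{s..t}. h \<sigma> x)"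
        unfolding set_lebesgue_integral_def h_def
        by (rule Bochner_Integration.integral_cong) (auto simp: indicator_def add.commute)
      finally show ?thesis .
    qed
    finally show ?thesis by simp
  qed
  have "continuous_on UNIV (\<lambda>x. \<Phi> (b - x) (y + x))" for y by (intro Phi_cont' continuous_intros)
  then have "continuous_on UNIV (\<lambda>x. (\<Phi> (b - x) (t + x) - \<Phi> (b - x) (s + x))\<^sup>2)"
    by (intro continuous_on_power continuous_on_diff)
  then have wm: "(\<lambda>x. (\<Phi> (b - x) (t + x) - \<Phi> (b - x) (s + x))\<^sup>2) \<in> borel_measurable borel"
    by (rule borel_measurable_continuous_onI)
  show "integrable lborel (\<lambda>x. (\<Phi> (b - x) (t + x) - \<Phi> (b - x) (s + x))\<^sup>2)"
    by (rule slab_bound(1)[OF hm _ hi hC st wm _ w]) (auto simp: h_def)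
  show "(\<integral>x. (\<Phi> (b - x) (t + x) - \<Phi> (b - x) (s + x))\<^sup>2 \<partial>lborel) \<le> (t - s)\<^sup>2 * EP"
    by (rule slab_bound(2)[OF hm _ hi hC st wm _ w]) (auto simp: h_def)
qed

text \<open>The path leads through \<open>(t - x, s + x)\<close>: one leg changes \<open>v\<close>,
  the other \<open>u\<close>, and the latter is the preceding estimate with exchanged
  coordinates.\<close>

lemma Phi_time_increment_L2:
  shows "integrable lborel (\<lambda>x. (\<Phi> (t - x) (t + x) - \<Phi> (s - x) (s + x))\<^sup>2)"
    and "(\<integral>x. (\<Phi> (t - x) (t + x) - \<Phi> (s - x) (s + x))\<^sup>2 \<partial>lborel) \<le> (2 * (EP + EQ)) * (t - s)\<^sup>2"
proof -
  have EQ: "finite_energy.EP f V (\<lambda>u v. \<Phi> v u) q = EQ"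
    by (simp only: finite_energy.EP_def[OF swap'] EQ_def)
  have *: "integrable lborel (\<lambda>x. (\<Phi> (t - x) (t + x) - \<Phi> (s - x) (s + x))\<^sup>2) \<and> (\<integral>x. (\<Phi> (t - x) (t + x) - \<Phi> (s - x) (s + x))\<^sup>2 \<partial>lborel) \<le> (2 * (EP + EQ)) * (t - s)\<^sup>2"
    if st: "s \<le> t" for s t
  proof -
    note 1 = Phi_increment_L2[OF st, of t]
    note 2 = finite_energy.Phi_increment_L2[OF swap' st, of s]
    have 3: "integrable lborel (\<lambda>x. (\<Phi> (t - x) (s + x) - \<Phi> (s - x) (s + x))\<^sup>2)"
      using lborel_integrable_real_affine[OF 2(1), of "-1" 0] by simp
    have 4: "(\<integral>x. (\<Phi> (t - x) (s + x) - \<Phi> (s - x) (s + x))\<^sup>2 \<partial>lborel) \<le> (t - s)\<^sup>2 * EQ"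
      using lborel_integral_real_affine[of "-1" "\<lambda>x. (\<Phi> (t + x) (s - x) - \<Phi> (s + x) (s - x))\<^sup>2" 0] 2(2) by (simp add: EQ)
    have c0: "continuous_on UNIV (\<lambda>x. \<Phi> (a - x) (b + x))" for a b by (intro Phi_cont' continuous_intros)
    have c: "continuous_on UNIV (\<lambda>x. \<Phi> (t - x) (t + x) - \<Phi> (t - x) (s + x))" "continuous_on UNIV (\<lambda>x. \<Phi> (t - x) (s + x) - \<Phi> (s - x) (s + x))"
      by (rule continuous_on_diff[OF c0 c0])+
    note 5 = integrable_square_add[OF c[THEN borel_measurable_continuous_onI] 1(1) 3]
    have e: "(\<Phi> (t - x) (t + x) - \<Phi> (t - x) (s + x)) + (\<Phi> (t - x) (s + x) - \<Phi> (s - x) (s + x)) = \<Phi> (t - x) (t + x) - \<Phi> (s - x) (s + x)" for x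
      by simp
    have "2 * (\<integral>x. (\<Phi> (t - x) (t + x) - \<Phi> (t - x) (s + x))\<^sup>2 \<partial>lborel) + 2 * (\<integral>x. (\<Phi> (t - x) (s + x) - \<Phi> (s - x) (s + x))\<^sup>2 \<partial>lborel) \<le> 2 * ((t - s)\<^sup>2 * EP) + 2 * ((t - s)\<^sup>2 * EQ)"
      by (intro add_mono mult_left_mono 1(2) 4) simp_all
    also have "\<dots> = (2 * (EP + EQ)) * (t - s)\<^sup>2" by (simp only: ring_distribs mult_ac)
    finally show ?thesis using 5(1) order_trans[OF 5(2)] unfolding e by blast
  qed
  have sym: "(\<lambda>x. (\<Phi> (s - x) (s + x) - \<Phi> (t - x) (t + x))\<^sup>2) = (\<lambda>x. (\<Phi> (t - x) (t + x) - \<Phi> (s - x) (s + x))\<^sup>2)"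
    by (rule ext) (rule power2_commute)
  have le: "s \<le> t \<or> t \<le> s" by linarith
  then show "integrable lborel (\<lambda>x. (\<Phi> (t - x) (t + x) - \<Phi> (s - x) (s + x))\<^sup>2)"
    using *[of s t] *[of t s] unfolding sym power2_commute[of s t] by satx
  from le show "(\<integral>x. (\<Phi> (t - x) (t + x) - \<Phi> (s - x) (s + x))\<^sup>2 \<partial>lborel) \<le> (2 * (EP + EQ)) * (t - s)\<^sup>2"
    using *[of s t] *[of t s] unfolding sym power2_commute[of s t] by satx
qed

end

section \<open>Weak derivatives and the equation in the original coordinates\<close>

context charsol
begin

lemma characteristic_weak_partials:
  shows "weak_partial (1, 0) (\<lambda>t x. \<Phi> (t - x) (t + x)) (\<lambda>t x. P (t - x) (t + x) + Q (t - x) (t + x))"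
    and "weak_partial (0, 1) (\<lambda>t x. \<Phi> (t - x) (t + x)) (\<lambda>t x. P (t - x) (t + x) - Q (t - x) (t + x))"
    and "test_function \<psi> \<Longrightarrow> pairing (\<lambda>t x. \<Phi> (t - x) (t + x)) (\<lambda>z. - partial_deriv (1, 0) (partial_deriv (1, 0) \<psi>) z
        + partial_deriv (0, 1) (partial_deriv (0, 1) \<psi>) z) = pairing (\<lambda>t x. f (\<Phi> (t - x) (t + x))) \<psi>"
proof -
  define I where "I = (\<lambda>U k. \<integral>z. U (fst z) (snd z) * tochar k (fst z) (snd z) \<partial>(lborel :: (real \<times> real) measure))"
  have B: "(1, 0) \<in> (Basis :: (real \<times> real) set)" "(0, 1) \<in> (Basis :: (real \<times> real) set)" by (auto simp: Basis_prod_def)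
  have td: "test_function (partial_deriv b k)" if "test_function k" "b \<in> Basis" for k :: "real \<times> real \<Rightarrow> real" and b
    by (rule test_function_partial_deriv[OF that])
  have good: "integrable lborel (\<lambda>z. U (fst z) (snd z) * tochar k (fst z) (snd z)) \<and> pairing (\<lambda>t x. U (t - x) (t + x)) k = I U k / 2"
    if k: "test_function k" and m: "(\<lambda>z. U (fst z) (snd z)) \<in> borel_measurable borel" and i: "\<And>a. set_integrable lborel ({-a..a} \<times> {-a..a}) (\<lambda>z. U (fst z) (snd z))" for U k
  proof -
    obtain R where R: "\<And>z. R < norm z \<Longrightarrow> k z = 0" using test_function_support[OF k] by blast
    show ?thesis using pairing_characteristic[OF m i test_function_continuous[OF k] R] by (simp add: I_def)
  qed
  have mF: "(\<lambda>z. \<Phi> (fst z) (snd z)) \<in> borel_measurable borel"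
    by (intro borel_measurable_continuous_onI Phi_cont' continuous_intros)
  have bF: "set_integrable lborel ({-a..a} \<times> {-a..a}) (\<lambda>z. \<Phi> (fst z) (snd z))" for a
    by (intro box_integrable_continuous Phi_cont' continuous_intros)
  have mf: "(\<lambda>z. f (\<Phi> (fst z) (snd z))) \<in> borel_measurable borel"
    by (intro borel_measurable_continuous_onI f_Phi_cont continuous_intros)
  have bf: "set_integrable lborel ({-a..a} \<times> {-a..a}) (\<lambda>z. f (\<Phi> (fst z) (snd z)))" for a
    by (rule box_integrable_continuous[of "\<lambda>u v. f (\<Phi> u v)"]) (intro f_Phi_cont continuous_intros)
  have PQ: "pairing (\<lambda>t x. P (t - x) (t + x) + c * Q (t - x) (t + x)) \<psi> = (I P \<psi> + c * I Q \<psi>) / 2" if \<psi>: "test_function \<psi>" for \<psi> c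
  proof -
    have m: "(\<lambda>z. P (fst z) (snd z) + c * Q (fst z) (snd z)) \<in> borel_measurable borel"
      using P_meas Q_meas by (intro borel_measurable_add borel_measurable_times borel_measurable_const)
    have b: "set_integrable lborel ({-a..a} \<times> {-a..a}) (\<lambda>z. P (fst z) (snd z) + c * Q (fst z) (snd z))" for a
      by (intro set_integral_add(1) set_integrable_mult_right P_box Q_box)
    have "pairing (\<lambda>t x. P (t - x) (t + x) + c * Q (t - x) (t + x)) \<psi> = I (\<lambda>u v. P u v + c * Q u v) \<psi> / 2"
      using good[OF \<psi>, of "\<lambda>u v. P u v + c * Q u v"] m b by simp
    also have "I (\<lambda>u v. P u v + c * Q u v) \<psi> = (\<integral>z. P (fst z) (snd z) * tochar \<psi> (fst z) (snd z) + c * (Q (fst z) (snd z) * tochar \<psi> (fst z) (snd z)) \<partial>lborel)"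
      unfolding I_def by (rule Bochner_Integration.integral_cong) (auto simp: algebra_simps)
    also have "\<dots> = I P \<psi> + c * I Q \<psi>"
      using good[OF \<psi> P_meas P_box] good[OF \<psi> Q_meas Q_box] by (simp add: I_def)
    finally show ?thesis .
  qed
  have gF: "pairing (\<lambda>t x. \<Phi> (t - x) (t + x)) k = I \<Phi> k / 2" if "test_function k" for k
    using good[OF that mF bF] by simp
  have wf: "I \<Phi> (partial_deriv (1, 0) k) + I \<Phi> (partial_deriv (0, 1) k) = - 2 * I P k"
      "I \<Phi> (partial_deriv (1, 0) k) - I \<Phi> (partial_deriv (0, 1) k) = - 2 * I Q k"
      "I P (partial_deriv (1, 0) k) - I P (partial_deriv (0, 1) k) = I (\<lambda>u v. f (\<Phi> u v)) k / 2"
      "I Q (partial_deriv (1, 0) k) + I Q (partial_deriv (0, 1) k) = I (\<lambda>u v. f (\<Phi> u v)) k / 2" if "test_function k" for k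
    using weak_forms[OF that] unfolding I_def by simp_all
  show "weak_partial (1, 0) (\<lambda>t x. \<Phi> (t - x) (t + x)) (\<lambda>t x. P (t - x) (t + x) + Q (t - x) (t + x))"
  proof -
    have "pairing (\<lambda>t x. \<Phi> (t - x) (t + x)) (partial_deriv (1, 0) \<psi>) = - pairing (\<lambda>t x. P (t - x) (t + x) + Q (t - x) (t + x)) \<psi>"
      if \<psi>: "test_function \<psi>" for \<psi>
      using gF[OF td[OF \<psi> B(1)]] PQ[OF \<psi>, where c = 1] wf(1,2)[OF \<psi>] by simp
    then show ?thesis by (simp add: weak_partial_def)
  qed
  show "weak_partial (0, 1) (\<lambda>t x. \<Phi> (t - x) (t + x)) (\<lambda>t x. P (t - x) (t + x) - Q (t - x) (t + x))"
  proof -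
    have "pairing (\<lambda>t x. \<Phi> (t - x) (t + x)) (partial_deriv (0, 1) \<psi>) = - pairing (\<lambda>t x. P (t - x) (t + x) - Q (t - x) (t + x)) \<psi>"
      if \<psi>: "test_function \<psi>" for \<psi>
      using gF[OF td[OF \<psi> B(2)]] PQ[OF \<psi>, where c = "-1"] wf(1,2)[OF \<psi>] by simp
    then show ?thesis by (simp add: weak_partial_def)
  qed
  assume \<psi>: "test_function \<psi>"
  let ?t = "partial_deriv (1, 0) \<psi>" and ?x = "partial_deriv (0, 1) \<psi>"
  let ?tt = "partial_deriv (1, 0) ?t" and ?xx = "partial_deriv (0, 1) ?x"
  have tt: "test_function ?tt" "test_function ?xx" "test_function ?t" "test_function ?x" by (intro td \<psi> B)+
  have "test_function (\<lambda>z. (-1) * ?tt z + 1 * ?xx z)" by (rule test_function_lincomb[OF tt(1,2)])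
  then have tk: "test_function (\<lambda>z. - ?tt z + ?xx z)" by simp
  have "I \<Phi> (\<lambda>z. - ?tt z + ?xx z) = (\<integral>z. - (\<Phi> (fst z) (snd z) * tochar ?tt (fst z) (snd z)) + \<Phi> (fst z) (snd z) * tochar ?xx (fst z) (snd z) \<partial>lborel)"
    unfolding I_def tochar_def by (simp only: ring_distribs mult_minus_right)
  also have "\<dots> = - I \<Phi> ?tt + I \<Phi> ?xx"
    using good[OF tt(1) mF bF] good[OF tt(2) mF bF] by (simp add: I_def)
  \<comment> \<open>The first two weak forms are taken with the derivatives of \<open>\<psi>\<close>
    as test functions, the last two with \<open>\<psi>\<close> itself. The mixed second derivatives
    cancel within each pair.\<close>
  finally have "I \<Phi> (\<lambda>z. - ?tt z + ?xx z) = I (\<lambda>u v. f (\<Phi> u v)) \<psi>"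
    using wf(1)[OF tt(3)] wf(2)[OF tt(3)] wf(1)[OF tt(4)] wf(2)[OF tt(4)] wf(3)[OF \<psi>] wf(4)[OF \<psi>] by linarith
  then show "pairing (\<lambda>t x. \<Phi> (t - x) (t + x)) (\<lambda>z. - ?tt z + ?xx z) = pairing (\<lambda>t x. f (\<Phi> (t - x) (t + x))) \<psi>"
    using gF[OF tk] good[OF \<psi> mf bf] by simp
qed

end

section \<open>Initial velocity of energy solutions\<close>

lemma partial_deriv_lincomb:
  assumes "f differentiable (at z)" "g differentiable (at z)"
  shows "partial_deriv b (\<lambda>z. c * f z + d * g z) z = c * partial_deriv b f z + d * partial_deriv b g z"
  using partial_deriv_eq[OF has_derivative_add[OF has_derivative_mult_right[OF partial_deriv_works[OF assms(1)], of c]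
        has_derivative_mult_right[OF partial_deriv_works[OF assms(2)], of d]]]
  by (simp add: partial_deriv_def)

text \<open>Each factor alone is constant along a line; the bound on the norm makes the support of
  the product bounded.\<close>

lemma test_function_product:
  fixes L1 L2 :: "real \<times> real \<Rightarrow> real"
  assumes a: "test_function a" and b: "test_function b" and L: "bounded_linear L1" "bounded_linear L2"
    and n: "\<And>z. norm z \<le> \<bar>L1 z\<bar> + \<bar>L2 z\<bar>"
  shows "test_function (\<lambda>z. a (L1 z) * b (L2 z))"
    and "partial_deriv c (\<lambda>z. a (L1 z) * b (L2 z)) = (\<lambda>z. L1 c * (deriv a (L1 z) * b (L2 z)) + L2 c * (a (L1 z) * deriv b (L2 z)))"
proof -
  have "Ck k (\<lambda>z. a (L1 z) * b (L2 z))" for k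
    using Ck_affine[OF L(1), of k a 0] Ck_affine[OF L(2), of k b 0] a b
    by (intro Ck_mult) (simp_all add: test_function_iff)
  moreover obtain R where R: "R > 0" "\<And>x. R < norm x \<Longrightarrow> a x = 0" using test_function_support[OF a] by blast
  moreover obtain S where S: "S > 0" "\<And>x. S < norm x \<Longrightarrow> b x = 0" using test_function_support[OF b] by blast
  have "bounded {z. a (L1 z) * b (L2 z) \<noteq> 0}"
  proof (rule boundedI)
    fix z assume "z \<in> {z. a (L1 z) * b (L2 z) \<noteq> 0}"
    then have "a (L1 z) \<noteq> 0" "b (L2 z) \<noteq> 0" by auto
    then have "\<bar>L1 z\<bar> \<le> R" "\<bar>L2 z\<bar> \<le> S" using R(2) S(2) by (metis not_less real_norm_def)+
    then show "norm z \<le> R + S" using n[of z] by linarith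
  qed
  ultimately show "test_function (\<lambda>z. a (L1 z) * b (L2 z))" by (simp add: test_function_iff)
  have d: "a differentiable (at x)" "b differentiable (at x)" for x
    using a b by (auto intro: test_function_differentiable)
  show "partial_deriv c (\<lambda>z. a (L1 z) * b (L2 z)) = (\<lambda>z. L1 c * (deriv a (L1 z) * b (L2 z)) + L2 c * (a (L1 z) * deriv b (L2 z)))"
  proof (rule ext)
    fix z
    have 1: "partial_deriv c (\<lambda>z. a (L1 z)) z = deriv a (L1 z) * L1 c" "(\<lambda>z. a (L1 z)) differentiable (at z)"
      using partial_deriv_affine(1)[OF L(1), where h = a and z = z and c = 0 and b = c] partial_deriv_affine(2)[OF L(1), where h = a and z = z and c = 0] d by (simp_all add: test_function_deriv(3)[OF a])
    have 2: "partial_deriv c (\<lambda>z. b (L2 z)) z = deriv b (L2 z) * L2 c" "(\<lambda>z. b (L2 z)) differentiable (at z)"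
      using partial_deriv_affine(1)[OF L(2), where h = b and z = z and c = 0 and b = c] partial_deriv_affine(2)[OF L(2), where h = b and z = z and c = 0] d by (simp_all add: test_function_deriv(3)[OF b])
    show "partial_deriv c (\<lambda>z. a (L1 z) * b (L2 z)) z = L1 c * (deriv a (L1 z) * b (L2 z)) + L2 c * (a (L1 z) * deriv b (L2 z))"
      unfolding partial_deriv_mult[OF 1(2) 2(2)] 1(1) 2(1) by (simp add: algebra_simps)
  qed
qed

text \<open>In characteristic coordinates the wave operator is \<open>- 4\<close> times the mixed
  derivative, so it maps products to products. Such test functions suffice to recover the mild
  form.\<close>

lemma characteristic_test_function:
  assumes a: "test_function a" and b: "test_function b"
  defines "\<psi> \<equiv> \<lambda>z. a (fst z - snd z) * b (fst z + snd z)"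
  shows "test_function \<psi>"
    and "- partial_deriv (1, 0) (partial_deriv (1, 0) \<psi>) z + partial_deriv (0, 1) (partial_deriv (0, 1) \<psi>) z
       = - 4 * (deriv a (fst z - snd z) * deriv b (fst z + snd z))"
proof -
  have L: "bounded_linear (\<lambda>z::real \<times> real. fst z - snd z)" "bounded_linear (\<lambda>z::real \<times> real. fst z + snd z)"
    by (intro bounded_linear_sub bounded_linear_add bounded_linear_fst bounded_linear_snd)+
  have n: "norm z \<le> \<bar>fst z - snd z\<bar> + \<bar>fst z + snd z\<bar>" for z :: "real \<times> real"
  proof -
    have "norm z \<le> \<bar>fst z\<bar> + \<bar>snd z\<bar>" using norm_Pair_le[of "fst z" "snd z"] by simp
    then show ?thesis by linarith
  qed
  note pr = test_function_product[OF _ _ L n, simplified]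
  show tf: "test_function \<psi>" unfolding \<psi>_def by (rule pr(1)[OF a b])
  note da = test_function_deriv(2)[OF a] and db = test_function_deriv(2)[OF b]
  have diff: "(\<lambda>z. f (fst z - snd z) * g (fst z + snd z)) differentiable (at z)"
    if "test_function f" "test_function g" for f g :: "real \<Rightarrow> real" and z :: "real \<times> real"
    by (rule test_function_differentiable[OF pr(1)[OF that]])
  have pt: "partial_deriv (1, 0) \<psi> = (\<lambda>z. 1 * (deriv a (fst z - snd z) * b (fst z + snd z)) + 1 * (a (fst z - snd z) * deriv b (fst z + snd z)))"
    unfolding \<psi>_def pr(2)[OF a b] by simp
  have px: "partial_deriv (0, 1) \<psi> = (\<lambda>z. (-1) * (deriv a (fst z - snd z) * b (fst z + snd z)) + 1 * (a (fst z - snd z) * deriv b (fst z + snd z)))"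
    unfolding \<psi>_def pr(2)[OF a b] by simp
  show "- partial_deriv (1, 0) (partial_deriv (1, 0) \<psi>) z + partial_deriv (0, 1) (partial_deriv (0, 1) \<psi>) z
       = - 4 * (deriv a (fst z - snd z) * deriv b (fst z + snd z))"
    unfolding pt px partial_deriv_lincomb[OF diff[OF da b] diff[OF a db]] pr(2)[OF da b] pr(2)[OF a db] by simp
qed

lemma integrable_continuous_support:
  fixes g :: "real \<Rightarrow> real"
  assumes "continuous_on UNIV g" "\<And>x. R < \<bar>x\<bar> \<Longrightarrow> g x = 0"
  shows "integrable lborel g"
proof -
  have "set_integrable lborel {-R..R} g"
    by (intro borel_integrable_atLeastAtMost' continuous_on_subset[OF assms(1)]) simp
  moreover have "(\<lambda>x. indicator {-R..R} x *\<^sub>R g x) = g"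
  proof (rule ext)
    show "indicator {-R..R} x *\<^sub>R g x = g x" for x
      using assms(2)[of x] by (cases "\<bar>x\<bar> \<le> R") (auto simp: indicator_def)
  qed
  ultimately show ?thesis by (simp add: set_integrable_def)
qed

lemma integral_continuous_support:
  fixes g :: "real \<Rightarrow> real"
  assumes c: "continuous_on UNIV g" and s: "\<And>x. R < \<bar>x\<bar> \<Longrightarrow> g x = 0"
  shows "(\<integral>x. g x \<partial>lborel) = oint (- R) R g"
proof -
  have e: "g x = 0" if "x \<notin> {- max R 0..max R 0}" for x using s that by (cases "0 \<le> x") auto
  show ?thesis
  proof (cases "0 \<le> R")
    case True
    then show ?thesis using integral_lborel_interval[of "-R" R g] e oint_eq_LBINT[OF c, of "-R" R] by simp
  next
    case False
    then have "g = (\<lambda>_. 0)" using s by (auto simp: fun_eq_iff)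
    then show ?thesis by (simp add: oint_def)
  qed
qed

lemma continuous_slice_integral:
  fixes h :: "real \<Rightarrow> real \<Rightarrow> real"
  assumes h: "continuous_on UNIV (\<lambda>(t, x). h t x)" and k: "continuous_on UNIV k" and s: "\<And>x. R < \<bar>x\<bar> \<Longrightarrow> k x = 0"
  shows "continuous_on UNIV (\<lambda>t. \<integral>x. h t x * k x \<partial>lborel)"
proof -
  have c: "continuous_on UNIV (\<lambda>x. h t x * k x)" for t
    by (intro continuous_intros continuous_on_curried[OF h] k)
  have "continuous_on UNIV (\<lambda>(t, x). h t x * k x)"
    unfolding case_prod_unfold
    by (intro continuous_intros continuous_on_curried[OF h] continuous_on_compose2[OF k]) simp
  then have "continuous_on UNIV (\<lambda>t. oint (- R) R (\<lambda>x. h t x * k x))"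
    by (intro continuous_oint continuous_on_const)
  moreover have "(\<integral>x. h t x * k x \<partial>lborel) = oint (- R) R (\<lambda>x. h t x * k x)" for t
    by (rule integral_continuous_support[OF c]) (simp add: s)
  ultimately show ?thesis by simp
qed

lemma pairing_product:
  "pairing U (\<lambda>z. \<theta> (fst z) * \<zeta> (snd z)) = (\<integral>t. (\<integral>x. U t x * \<zeta> x \<partial>lebesgue) * \<theta> t \<partial>lebesgue)"
proof -
  have "(\<integral>x. U t x * (\<theta> t * \<zeta> x) \<partial>lebesgue) = (\<integral>x. U t x * \<zeta> x \<partial>lebesgue) * \<theta> t" for t
  proof -
    have "(\<integral>x. U t x * (\<theta> t * \<zeta> x) \<partial>lebesgue) = (\<integral>x. \<theta> t * (U t x * \<zeta> x) \<partial>lebesgue)" by (simp add: mult_ac)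
    also have "\<dots> = \<theta> t * (\<integral>x. U t x * \<zeta> x \<partial>lebesgue)" by (rule integral_mult_right_zero)
    finally show ?thesis by (simp add: mult.commute)
  qed
  then show ?thesis by (simp add: pairing_def)
qed

lemma Ct_L2_slice_continuous:
  assumes U: "Ct_Lq 2 U" and z: "continuous_on UNIV \<zeta>" and R: "\<And>x. R < \<bar>x\<bar> \<Longrightarrow> \<zeta> x = 0"
  shows "continuous_on UNIV (\<lambda>t. \<integral>x. U t x * \<zeta> x \<partial>lebesgue)"
proof -
  define n where "n t = (\<integral>x. U t x * \<zeta> x \<partial>lebesgue)" for t
  have um [measurable]: "U t \<in> borel_measurable lebesgue" and u2: "integrable lebesgue (\<lambda>x. (U t x)\<^sup>2)" for t
    using U by (auto simp: Ct_Lq_def in_Lq_def powr_2_abs)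
  have [measurable]: "\<zeta> \<in> borel_measurable lebesgue"
    using borel_measurable_continuous_onI[OF z] by (simp add: measurable_completion)
  have "continuous_on UNIV (\<lambda>x. (\<zeta> x)\<^sup>2)" by (intro continuous_intros z)
  then have "integrable lborel (\<lambda>x. (\<zeta> x)\<^sup>2)" by (rule integrable_continuous_support) (use R in auto)
  then have z2: "integrable lebesgue (\<lambda>x. (\<zeta> x)\<^sup>2)" by (simp add: integrable_completion borel_measurable_integrable)
  define Z where "Z = (\<integral>x. (\<zeta> x)\<^sup>2 \<partial>lebesgue)"
  have d2: "integrable lebesgue (\<lambda>x. (U t x - U s x)\<^sup>2)" for t s
  proof (rule Bochner_Integration.integrable_bound)
    show "integrable lebesgue (\<lambda>x. 2 * (U t x)\<^sup>2 + 2 * (U s x)\<^sup>2)" using u2 by simp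
    have "(a - b)\<^sup>2 \<le> 2 * a\<^sup>2 + 2 * b\<^sup>2" for a b :: real
      using zero_le_power2[of "a + b"] by (simp add: power2_eq_square algebra_simps)
    then show "AE x in lebesgue. norm ((U t x - U s x)\<^sup>2) \<le> norm (2 * (U t x)\<^sup>2 + 2 * (U s x)\<^sup>2)" by simp
  qed measurable
  have ip: "integrable lebesgue (\<lambda>x. f x * \<zeta> x)"
    if "integrable lebesgue (\<lambda>x. (f x)\<^sup>2)" and [measurable]: "f \<in> borel_measurable lebesgue" for f
  proof (rule Bochner_Integration.integrable_bound)
    show "integrable lebesgue (\<lambda>x. (f x)\<^sup>2 + (\<zeta> x)\<^sup>2)" using that z2 by simp
    have "\<bar>a * b\<bar> \<le> a\<^sup>2 + b\<^sup>2" for a b :: real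
    proof -
      have "2 * (\<bar>a\<bar> * \<bar>b\<bar>) \<le> a\<^sup>2 + b\<^sup>2" using zero_le_power2[of "\<bar>a\<bar> - \<bar>b\<bar>"] by (simp add: power2_diff)
      moreover have "0 \<le> \<bar>a\<bar> * \<bar>b\<bar>" by simp
      ultimately show ?thesis unfolding abs_mult by linarith
    qed
    then show "AE x in lebesgue. norm (f x * \<zeta> x) \<le> norm ((f x)\<^sup>2 + (\<zeta> x)\<^sup>2)" by simp
  qed measurable
  have "isCont n s" for s
  proof -
    define L where "L t = Lq_norm 2 (\<lambda>x. U t x - U s x)" for t
    have Leq: "(L t)\<^sup>2 = (\<integral>x. (U t x - U s x)\<^sup>2 \<partial>lebesgue)" for t
    proof -
      have "0 \<le> (\<integral>x. (U t x - U s x)\<^sup>2 \<partial>lebesgue)" by simp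
      then show ?thesis by (simp add: L_def Lq_norm_def powr_2_abs powr_half_sqrt)
    qed
    have Llim: "(L \<longlongrightarrow> 0) (at s)" using U by (simp add: Ct_Lq_def L_def[abs_def])
    have L0: "0 \<le> L t" for t by (simp add: L_def Lq_norm_def)
    have b: "\<bar>n t - n s\<bar> \<le> L t + (L t + \<bar>t - s\<bar>) * Z" if "t \<noteq> s" for t
    proof -
      \<comment> \<open>Young's inequality with parameter \<open>e\<close> takes the place of
        Cauchy-Schwarz. The summand \<open>\<bar>t - s\<bar>\<close> keeps \<open>e\<close> positive
        when \<open>L t\<close> vanishes and still tends to 0.\<close>
      define e where "e = L t + \<bar>t - s\<bar>"
      have e: "e > 0" "L t \<le> e" using that L0[of t] by (auto simp: e_def)
      have y: "\<bar>a * b\<bar> \<le> a\<^sup>2 / e + e * b\<^sup>2" for a b :: real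
      proof -
        have "0 \<le> (\<bar>a\<bar> - e * \<bar>b\<bar>)\<^sup>2 + a\<^sup>2 + (e * b)\<^sup>2" by simp
        then have "\<bar>a * b\<bar> * e \<le> a\<^sup>2 + e * b\<^sup>2 * e"
          using e by (simp add: power2_diff power_mult_distrib abs_mult power2_eq_square algebra_simps)
        also have "\<dots> = (a\<^sup>2 / e + e * b\<^sup>2) * e" using e by (simp add: field_simps)
        finally show ?thesis using e by (simp only: mult_le_cancel_right_pos)
      qed
      have "n t - n s = (\<integral>x. (U t x - U s x) * \<zeta> x \<partial>lebesgue)"
        unfolding n_def using ip[OF u2 um, of t] ip[OF u2 um, of s] by (simp add: left_diff_distrib)
      then have "\<bar>n t - n s\<bar> \<le> (\<integral>x. \<bar>(U t x - U s x) * \<zeta> x\<bar> \<partial>lebesgue)" by simp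
      also have "\<dots> \<le> (\<integral>x. (U t x - U s x)\<^sup>2 / e + e * (\<zeta> x)\<^sup>2 \<partial>lebesgue)"
        by (rule integral_mono) (use ip[OF d2[of t s]] d2[of t s] z2 y in \<open>auto intro!: integrable_abs\<close>)
      also have "\<dots> = (L t)\<^sup>2 / e + e * Z" using d2[of t s] z2 by (simp add: Leq Z_def)
      also have "(L t)\<^sup>2 / e \<le> L t"
        using mult_left_mono[OF e(2) L0[of t]] e(1) by (simp add: power2_eq_square field_simps)
      finally show ?thesis by (simp add: e_def)
    qed
    have "((\<lambda>t. L t + (L t + \<bar>t - s\<bar>) * Z) \<longlongrightarrow> 0 + (0 + \<bar>s - s\<bar>) * Z) (at s)" by (intro tendsto_intros Llim)
    then have lim: "((\<lambda>t. L t + (L t + \<bar>t - s\<bar>) * Z) \<longlongrightarrow> 0) (at s)" by simp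
    have "((\<lambda>t. \<bar>n t - n s\<bar>) \<longlongrightarrow> 0) (at s)"
      by (rule tendsto_sandwich[OF _ _ tendsto_const lim]) (use b in \<open>auto simp: eventually_at_filter\<close>)
    then have "(n \<longlongrightarrow> n s) (at s)"
      using tendsto_rabs_zero_iff[of "\<lambda>t. n t - n s"] LIM_zero_iff[of n "n s"] by auto
    then show ?thesis by (simp add: isCont_def)
  qed
  then show ?thesis unfolding n_def[abs_def] by (simp add: continuous_on_eq_continuous_at)
qed

text \<open>The lemma of du Bois-Reymond applied to \<open>m\<close> minus an antiderivative of
  \<open>n\<close>.\<close>

lemma weak_derivative_continuous:
  fixes m n :: "real \<Rightarrow> real"
  assumes m: "continuous_on UNIV m" and n: "continuous_on UNIV n"
    and w: "\<And>\<theta>. test_function \<theta> \<Longrightarrow> (\<integral>t. m t * deriv \<theta> t \<partial>lborel) = - (\<integral>t. n t * \<theta> t \<partial>lborel)"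
  shows "(m has_real_derivative n t) (at t)"
proof -
  obtain N where N: "\<And>t. (N has_real_derivative n t) (at t)" using continuous_antiderivative[OF n] by blast
  have Nc: "continuous_on UNIV N" using N by (intro DERIV_continuous_on) (auto intro: has_field_derivative_at_within)
  have const: "m x - N x = m y - N y" for x y
  proof (rule du_Bois_Reymond_continuous[where h = "\<lambda>x. m x - N x"])
    show "continuous_on UNIV (\<lambda>x. m x - N x)" by (intro continuous_intros m Nc)
    fix \<eta> :: "real \<Rightarrow> real" assume \<eta>: "test_function \<eta>"
    obtain R where R: "\<And>x. R < norm x \<Longrightarrow> \<eta> x = 0" using test_function_support[OF \<eta>] by blast
    obtain R' where R': "\<And>x. R' < norm x \<Longrightarrow> deriv \<eta> x = 0" using test_function_support[OF test_function_deriv(2)[OF \<eta>]] by blast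
    have c: "continuous_on UNIV (deriv \<eta>)" by (rule test_function_continuous[OF test_function_deriv(2)[OF \<eta>]])
    have i: "integrable lborel (\<lambda>x. g x * deriv \<eta> x)" if "continuous_on UNIV g" for g
      by (rule integrable_continuous_support[of _ R']) (use R' in \<open>auto intro!: continuous_intros that c\<close>)
    have "(\<integral>x. N x * deriv \<eta> x \<partial>lborel) = - (\<integral>x. n x * \<eta> x \<partial>lborel)"
    proof (rule integration_by_parts_test)
      show "set_integrable lborel {a..b} n" for a b
        by (intro borel_integrable_atLeastAtMost' continuous_on_subset[OF n]) simp
      show "N b - N a = (LBINT x:{a..b}. n x)" if "a \<le> b" for a b
        by (rule LBINT_FTC[OF that, symmetric]) (use N continuous_on_subset[OF n] in \<open>auto intro: has_field_derivative_at_within\<close>)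
    qed (use test_function_deriv(1)[OF \<eta>] c R in auto)
    then show "(\<integral>x. (m x - N x) * deriv \<eta> x \<partial>lborel) = 0"
      using w[OF \<eta>] i[OF m] i[OF Nc] by (simp add: left_diff_distrib)
  qed
  have "m = (\<lambda>x. N x + (m 0 - N 0))"
  proof (rule ext)
    show "m x = N x + (m 0 - N 0)" for x using const[of x 0] by simp
  qed
  then show ?thesis using DERIV_add[OF N DERIV_const[of "m 0 - N 0"], of t] by simp
qed

text \<open>Gives the initial velocity a classical meaning: testing the weak time derivative with
  products \<open>\<theta> t * \<zeta> x\<close> shows that the pairing with \<open>\<zeta>\<close>
  is continuously differentiable in time. In the uniqueness proof this is how \<open>\<phi>1\<close>
  enters.\<close>

lemma energy_solution_initial_velocity:
  assumes sol: "global_energy_solution p \<phi>0 \<phi>1 \<phi>" and \<zeta>: "test_function \<zeta>"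
    and m1 [measurable]: "\<phi>1 \<in> borel_measurable lebesgue"
  shows "((\<lambda>t. \<integral>x. \<phi> t x * \<zeta> x \<partial>lborel) has_real_derivative (\<integral>x. \<phi>1 x * \<zeta> x \<partial>lebesgue)) (at 0)"
proof -
  obtain \<phi>t where wp: "weak_partial (1, 0) \<phi> \<phi>t" and C2: "Ct_Lq 2 \<phi>t" and ae: "AE x in lebesgue. \<phi>t 0 x = \<phi>1 x"
    using sol unfolding global_energy_solution_def by blast
  have c: "continuous_on UNIV (\<lambda>(t, x). \<phi> t x)" using sol by (simp add: global_energy_solution_def)
  obtain R where R: "\<And>x. R < norm x \<Longrightarrow> \<zeta> x = 0" using test_function_support[OF \<zeta>] by blast
  have zc: "continuous_on UNIV \<zeta>" by (rule test_function_continuous[OF \<zeta>])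
  define m where "m t = (\<integral>x. \<phi> t x * \<zeta> x \<partial>lborel)" for t
  define n where "n t = (\<integral>x. \<phi>t t x * \<zeta> x \<partial>lebesgue)" for t
  have mc: "continuous_on UNIV m" unfolding m_def by (rule continuous_slice_integral[OF c zc, of R]) (use R in auto)
  have nc: "continuous_on UNIV n" unfolding n_def by (rule Ct_L2_slice_continuous[OF C2 zc, of R]) (use R in auto)
  have ms: "(\<integral>x. \<phi> t x * \<zeta> x \<partial>lebesgue) = m t" for t
  proof -
    have "continuous_on UNIV (\<lambda>x. \<phi> t x * \<zeta> x)" by (intro continuous_intros continuous_on_curried[OF c] zc)
    then show ?thesis unfolding m_def by (simp add: integral_completion borel_measurable_continuous_onI)
  qed
  have lb: "(\<integral>t. g t * h t \<partial>lebesgue) = (\<integral>t. g t * h t \<partial>lborel)" if "continuous_on UNIV g" "continuous_on UNIV h" for g h :: "real \<Rightarrow> real"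
    using borel_measurable_continuous_onI[OF continuous_on_mult[OF that]] by (simp add: integral_completion)
  have "(m has_real_derivative n 0) (at 0)"
  proof (rule weak_derivative_continuous[OF mc nc])
    fix \<theta> :: "real \<Rightarrow> real" assume \<theta>: "test_function \<theta>"
    have L: "bounded_linear (fst :: real \<times> real \<Rightarrow> real)" "bounded_linear (snd :: real \<times> real \<Rightarrow> real)"
      by (rule bounded_linear_fst bounded_linear_snd)+
    have n: "norm z \<le> \<bar>fst z\<bar> + \<bar>snd z\<bar>" for z :: "real \<times> real" using norm_Pair_le[of "fst z" "snd z"] by simp
    note pr = test_function_product[OF \<theta> \<zeta> L n]
    have "pairing \<phi> (\<lambda>z. deriv \<theta> (fst z) * \<zeta> (snd z)) = - pairing \<phi>t (\<lambda>z. \<theta> (fst z) * \<zeta> (snd z))"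
      using wp pr(1) pr(2)[of "(1, 0)"] unfolding weak_partial_def by auto
    then have "(\<integral>t. m t * deriv \<theta> t \<partial>lebesgue) = - (\<integral>t. n t * \<theta> t \<partial>lebesgue)"
      unfolding pairing_product ms n_def .
    then show "(\<integral>t. m t * deriv \<theta> t \<partial>lborel) = - (\<integral>t. n t * \<theta> t \<partial>lborel)"
      using lb[OF mc test_function_continuous[OF test_function_deriv(2)[OF \<theta>]]] lb[OF nc test_function_continuous[OF \<theta>]] by simp
  qed
  moreover have "n 0 = (\<integral>x. \<phi>1 x * \<zeta> x \<partial>lebesgue)"
  proof -
    have "\<phi>t 0 \<in> borel_measurable lebesgue" using C2 by (simp add: Ct_Lq_def in_Lq_def)
    moreover have "\<zeta> \<in> borel_measurable lebesgue"
      using borel_measurable_continuous_onI[OF zc] by (simp add: measurable_completion)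
    ultimately have 1: "(\<lambda>x. \<phi>t 0 x * \<zeta> x) \<in> borel_measurable lebesgue" and 2: "(\<lambda>x. \<phi>1 x * \<zeta> x) \<in> borel_measurable lebesgue"
      using m1 by (auto intro: borel_measurable_times)
    show ?thesis unfolding n_def by (rule integral_cong_AE[OF 1 2]) (use ae in auto)
  qed
  ultimately show ?thesis unfolding m_def by simp
qed

text \<open>Adding a quarter of the Duhamel integral of \<open>k\<close> gives a continuous
  \<open>H\<close> whose mixed derivative vanishes when tested against products. The lemma of du
  Bois-Reymond, applied in \<open>u\<close> for each fixed test function of \<open>v\<close> and
  then in \<open>v\<close>, shows that \<open>H\<close> is a function of \<open>u\<close> plus a
  function of \<open>v\<close>.\<close>

lemma distributional_mild_form:
  fixes h k :: "real \<Rightarrow> real \<Rightarrow> real"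
  assumes h: "continuous_on UNIV (\<lambda>(u, v). h u v)" and k: "continuous_on UNIV (\<lambda>(u, v). k u v)"
    and eq: "\<And>\<psi>. test_function \<psi> \<Longrightarrow> pairing (\<lambda>t x. h (t - x) (t + x)) (\<lambda>z. - partial_deriv (1, 0) (partial_deriv (1, 0) \<psi>) z
        + partial_deriv (0, 1) (partial_deriv (0, 1) \<psi>) z) = pairing (\<lambda>t x. k (t - x) (t + x)) \<psi>"
  shows "h u v = (h u 0 + duh k u 0 / 4) + (h 0 v + duh k 0 v / 4) - (h 0 0 + duh k 0 0 / 4) - duh k u v / 4"
proof -
  define H where "H u v = h u v + duh k u v / 4" for u v
  have dc: "continuous_on UNIV (\<lambda>(u, v). duh k u v)" by (rule duh_cont[OF k])
  have Hc: "continuous_on UNIV (\<lambda>(u, v). H u v)"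
    unfolding H_def case_prod_unfold using h dc by (intro continuous_intros) (simp_all add: case_prod_unfold)
  have pc: "continuous_on UNIV (\<lambda>z. g (fst z) (snd z))" if "continuous_on UNIV (\<lambda>(u::real, v::real). g u v)" for g :: "real \<Rightarrow> real \<Rightarrow> real"
    using that by (simp add: case_prod_unfold)
  have box: "set_integrable lborel ({-a..a} \<times> {-a..a}) (\<lambda>z. g (fst z) (snd z))"
    if "continuous_on UNIV (\<lambda>(u, v). g u v)" for g :: "real \<Rightarrow> real \<Rightarrow> real" and a
    unfolding set_integrable_def
    by (intro borel_integrable_compact compact_Times compact_Icc continuous_on_subset[OF pc[OF that]]) simp
  have zero: "(\<integral>z. H (fst z) (snd z) * (deriv \<eta> (fst z) * deriv \<zeta> (snd z)) \<partial>lborel) = 0"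
    and fub: "(\<integral>z. H (fst z) (snd z) * (deriv \<eta> (fst z) * deriv \<zeta> (snd z)) \<partial>lborel) = (\<integral>u. (\<integral>v. H u v * deriv \<zeta> v \<partial>lborel) * deriv \<eta> u \<partial>lborel)"
    if \<eta>: "test_function \<eta>" and \<zeta>: "test_function \<zeta>" for \<eta> \<zeta>
  proof -
    obtain R1 where R1: "\<And>x. R1 < norm x \<Longrightarrow> \<eta> x = 0" using test_function_support[OF \<eta>] by blast
    obtain R2 where R2: "\<And>x. R2 < norm x \<Longrightarrow> \<zeta> x = 0" using test_function_support[OF \<zeta>] by blast
    have R1': "deriv \<eta> x = 0" if "R1 < norm x" for x
    proof -
      have "partial_deriv 1 \<eta> x = 0" by (rule partial_deriv_zero_outside[OF _ that]) (rule R1)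
      then show ?thesis by (simp add: test_function_deriv(3)[OF \<eta>])
    qed
    have R2': "deriv \<zeta> x = 0" if "R2 < norm x" for x
    proof -
      have "partial_deriv 1 \<zeta> x = 0" by (rule partial_deriv_zero_outside[OF _ that]) (rule R2)
      then show ?thesis by (simp add: test_function_deriv(3)[OF \<zeta>])
    qed
    define R where "R = max R1 R2"
    have out: "R1 < norm u \<or> R2 < norm v" if "(u, v) \<notin> {-R..R} \<times> {-R..R}" for u v
      using that by (auto simp: R_def)
    have c: "continuous_on UNIV \<eta>" "continuous_on UNIV \<zeta>" "continuous_on UNIV (deriv \<eta>)" "continuous_on UNIV (deriv \<zeta>)"
      using \<eta> \<zeta> by (auto intro: test_function_continuous test_function_deriv(2))
    have pr: "continuous_on UNIV (\<lambda>z::real \<times> real. a (fst z) * b (snd z))" if "continuous_on UNIV a" "continuous_on UNIV b" for a b :: "real \<Rightarrow> real"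
      by (intro continuous_intros continuous_on_compose2[OF that(1)] continuous_on_compose2[OF that(2)]) auto
    let ?I = "\<lambda>g a b. \<integral>z. g (fst z) (snd z) * (a (fst z) * b (snd z)) \<partial>(lborel :: (real \<times> real) measure)"
    have int: "integrable lborel (\<lambda>z. g (fst z) (snd z) * (deriv \<eta> (fst z) * deriv \<zeta> (snd z)))"
      if "continuous_on UNIV (\<lambda>(u, v). g u v)" for g :: "real \<Rightarrow> real \<Rightarrow> real"
    proof (rule integrable_box_support[OF box[OF that] pr[OF c(3,4)], where R = R])
      show "deriv \<eta> (fst z) * deriv \<zeta> (snd z) = 0" if "z \<notin> {-R..R} \<times> {-R..R}" for z
        using out[of "fst z" "snd z"] that R1' R2' by auto
    qed
    let ?w = "\<lambda>u v. oint (- v) u (\<lambda>u'. k u' v)"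
    have wc: "continuous_on UNIV (\<lambda>(u, v). ?w u v)"
      unfolding case_prod_unfold by (intro continuous_inner_oint[OF k] continuous_intros)
    have line: "set_integrable lborel {a..b} (g u)" if "continuous_on UNIV (\<lambda>(u, v). g u v)" for g :: "real \<Rightarrow> real \<Rightarrow> real" and u a b
      by (intro borel_integrable_atLeastAtMost' continuous_on_subset[OF slice_cont(2)[OF that]]) simp
    have line': "set_integrable lborel {a..b} (\<lambda>u. g u v)" if "continuous_on UNIV (\<lambda>(u, v). g u v)" for g :: "real \<Rightarrow> real \<Rightarrow> real" and v a b
      by (intro borel_integrable_atLeastAtMost' continuous_on_subset[OF slice_cont(1)[OF that]]) simp
    \<comment> \<open>Only the outer integral of \<open>duh\<close> is undone here, with
      \<open>deriv \<eta>\<close> as a factor constant in \<open>v\<close>; the inner integral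
      \<open>?w\<close> is differentiated in \<open>u\<close> next.\<close>
    have 1: "?I (duh k) (deriv \<eta>) (deriv \<zeta>) = - ?I ?w (deriv \<eta>) \<zeta>"
    proof (rule by_parts_snd[where U = "duh k" and U' = ?w and k = "\<lambda>u v. deriv \<eta> u * \<zeta> v" and k' = "\<lambda>u v. deriv \<eta> u * deriv \<zeta> v" and R = R])
      show "set_integrable lborel ({-a..a} \<times> {-a..a}) (\<lambda>z. duh k (fst z) (snd z))" for a by (rule box[OF dc])
      show "set_integrable lborel ({-a..a} \<times> {-a..a}) (\<lambda>z. ?w (fst z) (snd z))" for a by (rule box[OF wc])
      show "set_integrable lborel {a..b} (?w u)" for u a b by (rule line[OF wc])
      show "duh k u b - duh k u a = (LBINT v:{a..b}. ?w u v)" if "a \<le> b" for u a b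
        unfolding duh_diff_v[OF k] by (rule oint_eq_LBINT[OF duh_inner_cont[OF k] that, symmetric])
      show "((\<lambda>v. deriv \<eta> u * \<zeta> v) has_real_derivative deriv \<eta> u * deriv \<zeta> v) (at v)" for u v
        by (rule DERIV_cmult[OF test_function_deriv(1)[OF \<zeta>]])
      show "deriv \<eta> u * \<zeta> v = 0" "deriv \<eta> u * deriv \<zeta> v = 0" if "(u, v) \<notin> {-R..R} \<times> {-R..R}" for u v
        using out[OF that] R1' R2 R2' by auto
    qed (rule pr[OF c(3) c(2)] pr[OF c(3) c(4)])+
    have 2: "?I ?w (deriv \<eta>) \<zeta> = - ?I k \<eta> \<zeta>"
    proof (rule by_parts_fst[where U = ?w and U' = k and k = "\<lambda>u v. \<eta> u * \<zeta> v" and k' = "\<lambda>u v. deriv \<eta> u * \<zeta> v" and R = R])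
      show "set_integrable lborel ({-a..a} \<times> {-a..a}) (\<lambda>z. ?w (fst z) (snd z))" for a by (rule box[OF wc])
      show "set_integrable lborel ({-a..a} \<times> {-a..a}) (\<lambda>z. k (fst z) (snd z))" for a by (rule box[OF k])
      show "set_integrable lborel {a..b} (\<lambda>u. k u v)" for v a b by (rule line'[OF k])
      show "?w b v - ?w a v = (LBINT u:{a..b}. k u v)" if "a \<le> b" for v a b
        using oint_eq_LBINT[OF slice_cont(1)[OF k] that, of v] oint_combine[OF slice_cont(1)[OF k], of "- v" a v b] by simp
      show "((\<lambda>u. \<eta> u * \<zeta> v) has_real_derivative deriv \<eta> u * \<zeta> v) (at u)" for u v
        by (rule DERIV_cmult_right[OF test_function_deriv(1)[OF \<eta>]])
      show "\<eta> u * \<zeta> v = 0" "deriv \<eta> u * \<zeta> v = 0" if "(u, v) \<notin> {-R..R} \<times> {-R..R}" for u v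
        using out[OF that] R1 R1' R2 by auto
    qed (rule pr[OF c(1) c(2)] pr[OF c(3) c(2)])+
    \<comment> \<open>The factor from the change of coordinates occurs on both sides. What remains
      is the \<open>- 4\<close> of the wave operator, matched by the quarter in
      \<open>H\<close>.\<close>
    have 3: "- 4 * ?I h (deriv \<eta>) (deriv \<zeta>) = ?I k \<eta> \<zeta>"
    proof -
      let ?\<psi> = "\<lambda>z. \<eta> (fst z - snd z) * \<zeta> (fst z + snd z)"
      let ?\<psi>' = "\<lambda>z. - 4 * (deriv \<eta> (fst z - snd z) * deriv \<zeta> (fst z + snd z))"
      have tf: "test_function ?\<psi>" by (rule characteristic_test_function(1)[OF \<eta> \<zeta>])
      have "test_function (\<lambda>z. (- 4) * (deriv \<eta> (fst z - snd z) * deriv \<zeta> (fst z + snd z)) + 0 * ?\<psi> z)"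
        by (rule test_function_lincomb[OF characteristic_test_function(1)[OF test_function_deriv(2)[OF \<eta>] test_function_deriv(2)[OF \<zeta>]] tf])
      then have tf': "test_function ?\<psi>'" by simp
      have e: "pairing (\<lambda>t x. h (t - x) (t + x)) ?\<psi>' = pairing (\<lambda>t x. k (t - x) (t + x)) ?\<psi>"
        using eq[OF tf] unfolding characteristic_test_function(2)[OF \<eta> \<zeta>] .
      have pch: "pairing (\<lambda>t x. g (t - x) (t + x)) \<psi> = (\<integral>z. g (fst z) (snd z) * tochar \<psi> (fst z) (snd z) \<partial>lborel) / 2"
        if "continuous_on UNIV (\<lambda>(u, v). g u v)" and \<psi>: "test_function \<psi>" for g \<psi>
      proof -
        obtain R where R: "\<And>z. R < norm z \<Longrightarrow> \<psi> z = 0" using test_function_support[OF \<psi>] by blast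
        show ?thesis
          by (rule pairing_characteristic(2)[OF borel_measurable_continuous_onI[OF pc[OF that(1)]] box[OF that(1)] test_function_continuous[OF \<psi>] R])
      qed
      have ar: "(a + b) / 2 - (b - a) / 2 = a" "(a + b) / 2 + (b - a) / 2 = b" for a b :: real by argo+
      have t1: "tochar ?\<psi> a b = \<eta> a * \<zeta> b" "tochar ?\<psi>' a b = - 4 * (deriv \<eta> a * deriv \<zeta> b)" for a b
        by (simp_all only: tochar_def fst_conv snd_conv ar)
      have "(\<integral>z. h (fst z) (snd z) * (- 4 * (deriv \<eta> (fst z) * deriv \<zeta> (snd z))) \<partial>lborel) = ?I k \<eta> \<zeta>"
        using e unfolding pch[OF h tf'] pch[OF k tf] t1 by simp
      moreover have "(\<integral>z. h (fst z) (snd z) * (- 4 * (deriv \<eta> (fst z) * deriv \<zeta> (snd z))) \<partial>lborel)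
         = (\<integral>z. - 4 * (h (fst z) (snd z) * (deriv \<eta> (fst z) * deriv \<zeta> (snd z))) \<partial>lborel)"
        by (simp only: mult.left_commute)
      ultimately show ?thesis by simp
    qed
    have "?I H (deriv \<eta>) (deriv \<zeta>) = (\<integral>z. h (fst z) (snd z) * (deriv \<eta> (fst z) * deriv \<zeta> (snd z)) + (duh k (fst z) (snd z) * (deriv \<eta> (fst z) * deriv \<zeta> (snd z))) / 4 \<partial>lborel)"
      unfolding H_def by (simp only: ring_distribs times_divide_eq_left)
    also have "\<dots> = ?I h (deriv \<eta>) (deriv \<zeta>) + ?I (duh k) (deriv \<eta>) (deriv \<zeta>) / 4"
      using int[OF h] int[OF dc] by simp
    also have "\<dots> = 0" using 1 2 3 by linarith
    finally show "?I H (deriv \<eta>) (deriv \<zeta>) = 0" .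
    have "integrable (lborel \<Otimes>\<^sub>M lborel) (\<lambda>(u, v). H u v * (deriv \<eta> u * deriv \<zeta> v))"
      using int[OF Hc] by (simp add: lborel_prod case_prod_unfold)
    from lborel_pair.integral_fst[OF this]
    have "?I H (deriv \<eta>) (deriv \<zeta>) = (\<integral>u. (\<integral>v. H u v * (deriv \<eta> u * deriv \<zeta> v) \<partial>lborel) \<partial>lborel)"
      by (simp add: lborel_prod case_prod_unfold)
    also have "\<dots> = (\<integral>u. (\<integral>v. (H u v * deriv \<zeta> v) * deriv \<eta> u \<partial>lborel) \<partial>lborel)"
      by (simp only: mult_ac)
    also have "\<dots> = (\<integral>u. (\<integral>v. H u v * deriv \<zeta> v \<partial>lborel) * deriv \<eta> u \<partial>lborel)"
      by (simp only: integral_mult_left_zero)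
    finally show "?I H (deriv \<eta>) (deriv \<zeta>) = (\<integral>u. (\<integral>v. H u v * deriv \<zeta> v \<partial>lborel) * deriv \<eta> u \<partial>lborel)" .
  qed
  have "H u v - H 0 v = H u 0 - H 0 0"
  proof (rule du_Bois_Reymond_continuous[where h = "\<lambda>v. H u v - H 0 v"])
    show "continuous_on UNIV (\<lambda>v. H u v - H 0 v)"
      by (intro continuous_intros slice_cont(2)[OF Hc])
    fix \<zeta> :: "real \<Rightarrow> real" assume \<zeta>: "test_function \<zeta>"
    obtain R where R: "\<And>x. R < norm x \<Longrightarrow> deriv \<zeta> x = 0"
      using test_function_support[OF test_function_deriv(2)[OF \<zeta>]] by blast
    have zc: "continuous_on UNIV (deriv \<zeta>)" by (rule test_function_continuous[OF test_function_deriv(2)[OF \<zeta>]])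
    have i: "integrable lborel (\<lambda>v. H u v * deriv \<zeta> v)" for u
      by (rule integrable_continuous_support[of _ R]) (use R in \<open>auto intro!: continuous_intros slice_cont(2)[OF Hc] zc\<close>)
    have "(\<integral>v. H u v * deriv \<zeta> v \<partial>lborel) = (\<integral>v. H 0 v * deriv \<zeta> v \<partial>lborel)"
    proof (rule du_Bois_Reymond_continuous[where h = "\<lambda>u. \<integral>v. H u v * deriv \<zeta> v \<partial>lborel"])
      show "continuous_on UNIV (\<lambda>u. \<integral>v. H u v * deriv \<zeta> v \<partial>lborel)"
        by (rule continuous_slice_integral[OF Hc zc, of R]) (use R in auto)
      fix \<eta> :: "real \<Rightarrow> real" assume \<eta>: "test_function \<eta>"
      show "(\<integral>u. (\<integral>v. H u v * deriv \<zeta> v \<partial>lborel) * deriv \<eta> u \<partial>lborel) = 0"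
        using zero[OF \<eta> \<zeta>] fub[OF \<eta> \<zeta>] by simp
    qed
    then show "(\<integral>v. (H u v - H 0 v) * deriv \<zeta> v \<partial>lborel) = 0"
      using i[of u] i[of 0] by (simp add: left_diff_distrib)
  qed
  then show ?thesis by (simp add: H_def)
qed

section \<open>Uniqueness and the main theorem\<close>

lemma continuous_AE_eq:
  fixes f g :: "real \<Rightarrow> real"
  assumes "continuous_on UNIV f" "continuous_on UNIV g" and ae: "AE x in lebesgue. f x = g x"
  shows "f x = g x"
proof (rule ccontr)
  define S where "S = {x. f x \<noteq> g x}"
  have o: "open S" unfolding S_def using assms(1,2) by (intro open_Collect_neq)
  then have "S \<in> sets lebesgue" by simp
  then have "S \<in> null_sets lebesgue" using ae by (subst AE_iff_null_sets) (auto simp: S_def)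
  then have "negligible S" by (simp add: negligible_iff_null_sets)
  moreover assume "f x \<noteq> g x"
  then have "S \<noteq> {}" by (auto simp: S_def)
  ultimately show False using open_not_negligible[OF o] by blast
qed

lemma derivative_zero_of_quadratic_bound:
  fixes E :: "real \<Rightarrow> real"
  assumes d: "(E has_real_derivative e) (at 0)" and b: "\<And>t. \<bar>t\<bar> \<le> 1 \<Longrightarrow> \<bar>E t\<bar> \<le> C * t\<^sup>2"
  shows "e = 0"
proof -
  have E0: "E 0 = 0" using b[of 0] by simp
  have "((\<lambda>h. E h / h) \<longlongrightarrow> e) (at 0)" using d by (simp add: has_field_derivative_iff E0)
  moreover have "((\<lambda>h. E h / h) \<longlongrightarrow> 0) (at 0)"
  proof (rule tendsto_rabs_zero_cancel, rule tendsto_sandwich[OF _ _ tendsto_const])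
    have "((\<lambda>h. C * \<bar>h\<bar>) \<longlongrightarrow> C * \<bar>0\<bar>) (at 0)" by (intro tendsto_intros)
    then show "((\<lambda>h. C * \<bar>h\<bar>) \<longlongrightarrow> 0) (at 0)" by simp
    have "\<bar>E h / h\<bar> \<le> C * \<bar>h\<bar>" if "h \<noteq> 0" "\<bar>h\<bar> \<le> 1" for h
    proof -
      have "\<bar>E h\<bar> \<le> (C * \<bar>h\<bar>) * \<bar>h\<bar>" using b[OF that(2)] by (simp add: power2_eq_square mult.assoc)
      then show ?thesis using that(1) by (simp add: divide_le_eq)
    qed
    moreover have "\<forall>\<^sub>F h in at 0. h \<noteq> 0 \<and> \<bar>h\<bar> \<le> (1::real)"
      unfolding eventually_at by (rule exI[of _ 1]) (auto simp: dist_real_def)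
    ultimately show "\<forall>\<^sub>F h in at 0. \<bar>E h / h\<bar> \<le> C * \<bar>h\<bar>" by (auto elim: eventually_mono)
  qed simp
  ultimately show ?thesis by (rule tendsto_unique[rotated]) simp
qed

text \<open>\<open>\<beta>\<close> is only continuous, so the translations are moved onto
  \<open>\<zeta>\<close> and the derivative is taken under the integral. The interval of integration
  reaches one unit beyond the support, which keeps the shifted test functions inside it for
  \<open>\<bar>t\<bar> \<le> 1\<close>.\<close>

lemma translation_difference_derivative:
  fixes \<beta> \<zeta> :: "real \<Rightarrow> real"
  assumes \<beta>: "continuous_on UNIV \<beta>" and \<zeta>: "test_function \<zeta>"
  obtains J where "(J has_real_derivative - 2 * (\<integral>y. \<beta> y * deriv \<zeta> y \<partial>lborel)) (at 0)"
    "\<And>t. \<bar>t\<bar> \<le> 1 \<Longrightarrow> J t = (\<integral>x. (\<beta> (t + x) - \<beta> (x - t)) * \<zeta> x \<partial>lborel)"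
proof -
  obtain R where R0: "R > 0" and R: "\<And>x. R < norm x \<Longrightarrow> \<zeta> x = 0" using test_function_support[OF \<zeta>] by blast
  have R': "deriv \<zeta> x = 0" if "R < norm x" for x
  proof -
    have "partial_deriv 1 \<zeta> x = 0" by (rule partial_deriv_zero_outside[OF _ that]) (rule R)
    then show ?thesis by (simp add: test_function_deriv(3)[OF \<zeta>])
  qed
  have c: "continuous_on S (\<lambda>z. \<zeta> (k z))" "continuous_on S (\<lambda>z. deriv \<zeta> (k z))" "continuous_on S (\<lambda>z. \<beta> (k z))"
    if "continuous_on S k" for S :: "'z::topological_space set" and k
    using continuous_on_compose2[OF test_function_continuous[OF \<zeta>] that] continuous_on_compose2[OF \<beta> that]
      continuous_on_compose2[OF test_function_continuous[OF test_function_deriv(2)[OF \<zeta>]] that] by auto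
  define r where "r = R + 1"
  let ?g = "\<lambda>t y. \<beta> y * (\<zeta> (y - t) - \<zeta> (y + t))"
  let ?g' = "\<lambda>t y. \<beta> y * (- deriv \<zeta> (y - t) - deriv \<zeta> (y + t))"
  have gc: "continuous_on S (?g t)" for S t by (intro continuous_intros c)
  have conv: "(\<integral>y. k y \<partial>lborel) = integral (cbox (- r) r) k"
    if "continuous_on UNIV k" "\<And>y. r < \<bar>y\<bar> \<Longrightarrow> k y = 0" for k :: "real \<Rightarrow> real"
  proof -
    have "(\<integral>y. k y \<partial>lborel) = (LBINT y:{-r..r}. k y)"
      by (rule integral_lborel_interval) (use that(2) in force)
    also have "\<dots> = integral {-r..r} k"
      by (intro set_borel_integral_eq_integral borel_integrable_atLeastAtMost' continuous_on_subset[OF that(1)]) simp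
    finally show ?thesis by simp
  qed
  have "((\<lambda>t. integral (cbox (- r) r) (?g t)) has_real_derivative integral (cbox (- r) r) (?g' 0)) (at 0 within UNIV)"
  proof (rule leibniz_rule_field_derivative)
    fix t y
    have "((\<lambda>t. \<zeta> (y - t)) has_real_derivative deriv \<zeta> (y - t) * (- 1)) (at t)"
      by (rule DERIV_chain2[OF test_function_deriv(1)[OF \<zeta>]]) (auto intro!: derivative_eq_intros)
    moreover have "((\<lambda>t. \<zeta> (y + t)) has_real_derivative deriv \<zeta> (y + t) * 1) (at t)"
      by (rule DERIV_chain2[OF test_function_deriv(1)[OF \<zeta>]]) (auto intro!: derivative_eq_intros)
    ultimately have "((\<lambda>t. ?g t y) has_real_derivative \<beta> y * (deriv \<zeta> (y - t) * (- 1) - deriv \<zeta> (y + t) * 1)) (at t)"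
      by (intro DERIV_cmult DERIV_diff)
    then show "((\<lambda>t. ?g t y) has_real_derivative ?g' t y) (at t within UNIV)" by simp
    show "?g t integrable_on cbox (- r) r" by (intro integrable_continuous gc)
    show "continuous_on (UNIV \<times> cbox (- r) r) (\<lambda>(t, y). ?g' t y)"
      unfolding case_prod_unfold by (intro continuous_intros c)
  qed simp_all
  moreover have "integral (cbox (- r) r) (?g' 0) = - 2 * (\<integral>y. \<beta> y * deriv \<zeta> y \<partial>lborel)"
  proof -
    have "(\<integral>y. \<beta> y * deriv \<zeta> y \<partial>lborel) = integral (cbox (- r) r) (\<lambda>y. \<beta> y * deriv \<zeta> y)"
      by (rule conv) (use R' in \<open>auto simp: r_def intro!: continuous_intros c\<close>)
    moreover have "?g' 0 = (\<lambda>y. - 2 * (\<beta> y * deriv \<zeta> y))" by (auto simp: fun_eq_iff)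
    ultimately show ?thesis by simp
  qed
  ultimately have "((\<lambda>t. integral (cbox (- r) r) (?g t)) has_real_derivative - 2 * (\<integral>y. \<beta> y * deriv \<zeta> y \<partial>lborel)) (at 0)"
    by simp
  moreover have "integral (cbox (- r) r) (?g t) = (\<integral>x. (\<beta> (t + x) - \<beta> (x - t)) * \<zeta> x \<partial>lborel)" if t: "\<bar>t\<bar> \<le> 1" for t
  proof -
    have i: "integrable lborel (\<lambda>y. \<beta> (y + s) * \<zeta> y)" for s
      by (rule integrable_continuous_support[of _ R]) (use R in \<open>auto intro!: continuous_intros c\<close>)
    have sh: "(\<integral>y. \<beta> y * \<zeta> (y - s) \<partial>lborel) = (\<integral>y. \<beta> (y + s) * \<zeta> y \<partial>lborel)"
      and shi: "integrable lborel (\<lambda>y. \<beta> y * \<zeta> (y - s))" for s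
      using lborel_integral_real_affine[of 1 "\<lambda>y. \<beta> y * \<zeta> (y - s)" s] lborel_integrable_real_affine[OF i[of s], of 1 "- s"]
      by (simp_all add: add.commute)
    have "integral (cbox (- r) r) (?g t) = (\<integral>y. ?g t y \<partial>lborel)"
      by (rule conv[OF gc, symmetric]) (use R t in \<open>auto simp: r_def\<close>)
    also have "\<dots> = (\<integral>y. \<beta> y * \<zeta> (y - t) - \<beta> y * \<zeta> (y - (- t)) \<partial>lborel)" by (simp add: right_diff_distrib)
    also have "\<dots> = (\<integral>y. \<beta> y * \<zeta> (y - t) \<partial>lborel) - (\<integral>y. \<beta> y * \<zeta> (y - (- t)) \<partial>lborel)"
      by (rule Bochner_Integration.integral_diff[OF shi shi])
    also have "\<dots> = (\<integral>y. \<beta> (y + t) * \<zeta> y \<partial>lborel) - (\<integral>y. \<beta> (y + - t) * \<zeta> y \<partial>lborel)" by (simp only: sh)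
    also have "\<dots> = (\<integral>y. \<beta> (y + t) * \<zeta> y - \<beta> (y + - t) * \<zeta> y \<partial>lborel)"
      by (rule Bochner_Integration.integral_diff[OF i i, symmetric])
    finally show ?thesis by (simp add: left_diff_distrib add.commute)
  qed
  ultimately show ?thesis by (rule that)
qed

text \<open>By \<open>distributional_mild_form\<close> the difference of two solutions is \<open>\<beta> (t + x) - \<beta> (x - t)\<close> up to
  a Duhamel term of order \<open>t\<^sup>2\<close>. Its pairing with a test function \<open>\<zeta>\<close> has derivative \<open>- 2 \<integral> \<beta> \<zeta>'\<close> at
  \<open>t = 0\<close>, which must vanish because the initial velocities agree; hence \<open>\<beta>\<close> is constant.\<close>

lemma energy_solution_unique:
  assumes p: "p > 1" and m1: "\<phi>1 \<in> borel_measurable lebesgue"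
    and sa: "global_energy_solution p \<phi>0 \<phi>1 a" and sb: "global_energy_solution p \<phi>0 \<phi>1 b"
  shows "a = b"
proof -
  define ch where "ch g = (\<lambda>u v. g ((u + v) / 2) ((v - u) / 2))" for g :: "real \<Rightarrow> real \<Rightarrow> real"
  have ch: "g t x = ch g (t - x) (t + x)" for g t x
  proof -
    have "(t - x + (t + x)) / 2 = t" "(t + x - (t - x)) / 2 = x" by argo+
    then show ?thesis by (simp only: ch_def)
  qed
  define k where "k g = (\<lambda>u v. nlin p (ch g u v))" for g
  define H where "H g = (\<lambda>u v. ch g u v + duh (k g) u v / 4)" for g
  have chc: "continuous_on UNIV (\<lambda>(u, v). ch g u v)" and kc: "continuous_on UNIV (\<lambda>(u, v). k g u v)" and Hc: "continuous_on UNIV (\<lambda>(u, v). H g u v)"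
    if "continuous_on UNIV (\<lambda>(t, x). g t x)" for g
  proof -
    show 1: "continuous_on UNIV (\<lambda>(u, v). ch g u v)"
      unfolding ch_def case_prod_unfold by (intro continuous_on_curried[OF that] continuous_intros) simp_all
    show 2: "continuous_on UNIV (\<lambda>(u, v). k g u v)"
      using continuous_on_compose2[OF nlin_cont[OF p, of UNIV] 1] by (simp add: k_def case_prod_unfold)
    show "continuous_on UNIV (\<lambda>(u, v). H g u v)"
      using continuous_on_add[OF 1 continuous_on_divide[OF duh_cont[OF 2] continuous_on_const[of UNIV 4]]]
      by (simp add: H_def case_prod_unfold)
  qed
  have mild: "ch g u v = (H g u 0 + (H g 0 v - H g 0 0)) - duh (k g) u v / 4"
    if "global_energy_solution p \<phi>0 \<phi>1 g" for g u v
  proof -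
    have c: "continuous_on UNIV (\<lambda>(t, x). g t x)" and d: "nlw_distributional p g"
      using that by (auto simp: global_energy_solution_def)
    have "ch g u v = (ch g u 0 + duh (k g) u 0 / 4) + (ch g 0 v + duh (k g) 0 v / 4) - (ch g 0 0 + duh (k g) 0 0 / 4) - duh (k g) u v / 4"
    proof (rule distributional_mild_form[OF chc[OF c] kc[OF c]])
      fix \<psi> :: "real \<times> real \<Rightarrow> real" assume "test_function \<psi>"
      then show "pairing (\<lambda>t x. ch g (t - x) (t + x)) (\<lambda>z. - partial_deriv (1, 0) (partial_deriv (1, 0) \<psi>) z
        + partial_deriv (0, 1) (partial_deriv (0, 1) \<psi>) z) = pairing (\<lambda>t x. k g (t - x) (t + x)) \<psi>"
        using d unfolding nlw_distributional_def k_def nlin_def ch[symmetric] by blast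
    qed
    then show ?thesis by (simp add: H_def)
  qed
  have ca: "continuous_on UNIV (\<lambda>(t, x). a t x)" and cb: "continuous_on UNIV (\<lambda>(t, x). b t x)"
    and a0: "AE x in lebesgue. a 0 x = \<phi>0 x" and b0: "AE x in lebesgue. b 0 x = \<phi>0 x"
    using sa sb by (auto simp: global_energy_solution_def)
  define \<alpha> where "\<alpha> u = H a u 0 - H b u 0" for u
  define \<beta> where "\<beta> v = (H a 0 v - H a 0 0) - (H b 0 v - H b 0 0)" for v
  define d where "d u v = duh (\<lambda>u v. k a u v - k b u v) u v / 4" for u v
  have kdc: "continuous_on UNIV (\<lambda>(u, v). k a u v - k b u v)"
    using continuous_on_diff[OF kc[OF ca] kc[OF cb]] by (simp add: case_prod_unfold)
  have dc: "continuous_on UNIV (\<lambda>(u, v). d u v)"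
    using continuous_on_divide[OF duh_cont[OF kdc] continuous_on_const[of UNIV 4]] by (simp add: d_def case_prod_unfold)
  have \<beta>c: "continuous_on UNIV \<beta>"
    unfolding \<beta>_def by (intro continuous_intros slice_cont(2)[OF Hc[OF ca]] slice_cont(2)[OF Hc[OF cb]])
  have w: "a t x - b t x = \<alpha> (t - x) + \<beta> (t + x) - d (t - x) (t + x)" for t x
  proof -
    have "duh (k a) (t - x) (t + x) - duh (k b) (t - x) (t + x) = 4 * d (t - x) (t + x)"
      using duh_minus[OF kc[OF ca] kc[OF cb]] by (simp add: d_def)
    then show ?thesis
      using mild[OF sa, of "t - x" "t + x"] mild[OF sb, of "t - x" "t + x"] ch[of a t x] ch[of b t x]
      unfolding \<alpha>_def \<beta>_def by linarith
  qed
  have ab0: "a 0 x = b 0 x" for x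
  proof (rule continuous_AE_eq[where f = "a 0" and g = "b 0"])
    show "continuous_on UNIV (a 0)" "continuous_on UNIV (b 0)" by (rule slice_cont(2)[OF ca] slice_cont(2)[OF cb])+
    show "AE x in lebesgue. a 0 x = b 0 x" using a0 b0 by eventually_elim simp
  qed
  \<comment> \<open>At time 0 the Duhamel term vanishes and the two solutions agree, so the profiles
    of their difference cancel there.\<close>
  have \<alpha>: "\<alpha> u = - \<beta> (- u)" for u
    using w[of 0 "- u"] ab0[of "- u"] by (simp add: d_def)
  have wave: "(\<integral>y. \<beta> y * deriv \<zeta> y \<partial>lborel) = 0" if \<zeta>: "test_function \<zeta>" for \<zeta>
  proof -
    obtain R where R0: "R > 0" and R: "\<And>x. R < norm x \<Longrightarrow> \<zeta> x = 0" using test_function_support[OF \<zeta>] by blast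
    have zc: "continuous_on UNIV \<zeta>" by (rule test_function_continuous[OF \<zeta>])
    have i: "integrable lborel (\<lambda>x. g x * \<zeta> x)" if "continuous_on UNIV g" for g
      by (rule integrable_continuous_support[of _ R]) (use R in \<open>auto intro!: continuous_intros that zc\<close>)
    obtain J where J: "(J has_real_derivative - 2 * (\<integral>y. \<beta> y * deriv \<zeta> y \<partial>lborel)) (at 0)"
      and Jt: "\<And>t. \<bar>t\<bar> \<le> 1 \<Longrightarrow> J t = (\<integral>x. (\<beta> (t + x) - \<beta> (x - t)) * \<zeta> x \<partial>lborel)"
      using translation_difference_derivative[OF \<beta>c \<zeta>] by blast
    define D where "D t = (\<integral>x. a t x * \<zeta> x \<partial>lborel) - (\<integral>x. b t x * \<zeta> x \<partial>lborel)" for t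
    have D: "(D has_real_derivative 0) (at 0)"
      using DERIV_diff[OF energy_solution_initial_velocity[OF sa \<zeta> m1] energy_solution_initial_velocity[OF sb \<zeta> m1]]
      by (simp add: D_def[abs_def])
    obtain K where K0: "K \<ge> 0" and K: "\<And>u v. \<bar>u\<bar> \<le> R + 1 \<Longrightarrow> \<bar>v\<bar> \<le> R + 1 \<Longrightarrow> \<bar>k a u v - k b u v\<bar> \<le> K"
    proof -
      have "continuous_on ({-(R+1)..R+1} \<times> {-(R+1)..R+1}) (\<lambda>(u, v). k a u v - k b u v)"
        by (rule continuous_on_subset[OF kdc]) simp
      from compact_bounded_values[OF this compact_Times[OF compact_Icc compact_Icc]]
      obtain K where "K \<ge> 0" "\<forall>z\<in>{-(R+1)..R+1} \<times> {-(R+1)..R+1}. \<bar>(\<lambda>(u, v). k a u v - k b u v) z\<bar> \<le> K" by blast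
      then show ?thesis by (intro that[of K]) force+
    qed
    define Z where "Z = (\<integral>x. \<bar>\<zeta> x\<bar> \<partial>lborel)"
    \<comment> \<open>The Duhamel difference is integrated over triangles with
      \<open>(u + v)\<^sup>2 = 4 * t\<^sup>2\<close>; it is of second order and invisible to the
      derivative at \<open>t = 0\<close>.\<close>
    have "\<bar>D t - J t\<bar> \<le> (K * Z) * t\<^sup>2" if t: "\<bar>t\<bar> \<le> 1" for t
    proof -
      have c1: "continuous_on UNIV (\<lambda>x. \<beta> (t + x) - \<beta> (x - t))"
        by (intro continuous_intros continuous_on_compose2[OF \<beta>c]) simp_all
      have c2: "continuous_on UNIV (\<lambda>x. d (t - x) (t + x))" by (intro continuous_on_curried[OF dc] continuous_intros)
      have "D t = (\<integral>x. a t x * \<zeta> x - b t x * \<zeta> x \<partial>lborel)"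
        unfolding D_def using i[OF slice_cont(2)[OF ca]] i[OF slice_cont(2)[OF cb]] by simp
      also have "\<dots> = (\<integral>x. (\<beta> (t + x) - \<beta> (x - t)) * \<zeta> x - d (t - x) (t + x) * \<zeta> x \<partial>lborel)"
      proof (rule Bochner_Integration.integral_cong)
        fix x
        have "a t x * \<zeta> x - b t x * \<zeta> x = (\<alpha> (t - x) + \<beta> (t + x) - d (t - x) (t + x)) * \<zeta> x"
          using w[of t x] by (simp only: left_diff_distrib[symmetric])
        then show "a t x * \<zeta> x - b t x * \<zeta> x = (\<beta> (t + x) - \<beta> (x - t)) * \<zeta> x - d (t - x) (t + x) * \<zeta> x"
          by (simp add: \<alpha> algebra_simps)
      qed simp
      also have "\<dots> = J t - (\<integral>x. d (t - x) (t + x) * \<zeta> x \<partial>lborel)"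
        unfolding Jt[OF t] by (rule Bochner_Integration.integral_diff[OF i[OF c1] i[OF c2]])
      finally have "\<bar>D t - J t\<bar> = \<bar>\<integral>x. d (t - x) (t + x) * \<zeta> x \<partial>lborel\<bar>" by simp
      also have "\<dots> \<le> (\<integral>x. \<bar>d (t - x) (t + x) * \<zeta> x\<bar> \<partial>lborel)" by (rule integral_abs_bound)
      also have "\<dots> \<le> (\<integral>x. (K * t\<^sup>2) * \<bar>\<zeta> x\<bar> \<partial>lborel)"
      proof (rule integral_mono)
        show "integrable lborel (\<lambda>x. \<bar>d (t - x) (t + x) * \<zeta> x\<bar>)" using i[OF c2] by (rule integrable_abs)
        show "integrable lborel (\<lambda>x. (K * t\<^sup>2) * \<bar>\<zeta> x\<bar>)"
          using integrable_abs[OF i[OF continuous_on_const[of _ "K * t\<^sup>2"]]] K0 by (simp add: abs_mult)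
        fix x
        show "\<bar>d (t - x) (t + x) * \<zeta> x\<bar> \<le> (K * t\<^sup>2) * \<bar>\<zeta> x\<bar>"
        proof (cases "R < norm x")
          case False
          have "\<bar>duh (\<lambda>u v. k a u v - k b u v) (t - x) (t + x)\<bar> \<le> K * ((t - x) + (t + x))\<^sup>2"
            by (rule duh_quadratic_bound[OF kdc, where R = "R + 1"]) (use False t K in \<open>auto simp: abs_le_iff\<close>)
          also have "((t - x) + (t + x))\<^sup>2 = 4 * t\<^sup>2" by (simp add: power2_eq_square)
          finally have "\<bar>d (t - x) (t + x)\<bar> \<le> K * t\<^sup>2" unfolding d_def abs_divide by simp
          then show ?thesis unfolding abs_mult by (rule mult_right_mono) simp
        qed (use R in simp)
      qed
      also have "\<dots> = (K * Z) * t\<^sup>2" by (simp add: Z_def)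
      finally show ?thesis .
    qed
    then have "0 - (- 2 * (\<integral>y. \<beta> y * deriv \<zeta> y \<partial>lborel)) = 0"
      by (rule derivative_zero_of_quadratic_bound[OF DERIV_diff[OF D J]])
    then show ?thesis by simp
  qed
  have const: "\<beta> x = \<beta> y" for x y by (rule du_Bois_Reymond_continuous[OF \<beta>c wave])
  \<comment> \<open>With \<open>\<beta>\<close> constant,
    \<open>\<alpha> u = - \<beta> (- u)\<close> cancels \<open>\<beta> v\<close>: both solutions
    satisfy the mild equation with the same free part.\<close>
  have same: "H a u 0 + (H a 0 v - H a 0 0) = H b u 0 + (H b 0 v - H b 0 0)" for u v
    using \<alpha>[of u] const[of "- u" v] unfolding \<alpha>_def \<beta>_def[of v] by (simp add: \<beta>_def)
  have "ch a u v = ch b u v" for u v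
  proof (rule mild_solution_unique[OF _ nlin_cont[OF p] chc[OF ca] chc[OF cb], where A = "\<lambda>u v. H a u 0 + (H a 0 v - H a 0 0)"])
    show "\<exists>L. \<forall>x y. \<bar>x\<bar> \<le> R \<longrightarrow> \<bar>y\<bar> \<le> R \<longrightarrow> \<bar>nlin p x - nlin p y\<bar> \<le> L * \<bar>x - y\<bar>" for R
      using nlin_lipschitz[OF p] by blast
    show "ch a u v = H a u 0 + (H a 0 v - H a 0 0) - duh (\<lambda>a' b'. nlin p (ch a a' b')) u v / 4" for u v
      using mild[OF sa, of u v] by (simp only: k_def)
    show "ch b u v = H a u 0 + (H a 0 v - H a 0 0) - duh (\<lambda>a' b'. nlin p (ch b a' b')) u v / 4" for u v
      unfolding same using mild[OF sb, of u v] by (simp only: k_def)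
  qed
  then show ?thesis by (intro ext) (simp only: ch[of a] ch[of b])
qed

text \<open>For bounded arguments this controls the square of the nonlinearity by a multiple of the
  potential, as the continuity in time of \<open>P\<close> and \<open>Q\<close> demands.\<close>

lemma nlin_square: "p > 1 \<Longrightarrow> (nlin p y)\<^sup>2 = (\<bar>y\<bar> powr (p - 1) * (p + 1)) * npot p y"
proof -
  assume p: "p > 1"
  have "(nlin p y)\<^sup>2 = \<bar>y\<bar> powr (p - 1) * (y * nlin p y)" by (simp add: nlin_def power2_eq_square)
  then show ?thesis by (simp add: npot_hom[OF p])
qed

lemma abs_powr_split: "p > 1 \<Longrightarrow> \<bar>y :: real\<bar> powr (p + 1) = \<bar>y\<bar> powr (p - 1) * y\<^sup>2"
  using npot_eq[of p y] by (simp add: npot_def nlin_def power2_eq_square mult.assoc)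

lemma characteristic_energy_solution:
  assumes p: "p > 1" and fe: "finite_energy (nlin p) (npot p) \<Phi> pp qq" and M: "\<And>u v. \<bar>\<Phi> u v\<bar> \<le> M"
    and \<phi>: "\<And>x. \<Phi> (- x) x = \<phi> x" and P0: "\<And>x. Pd (nlin p) \<Phi> pp (- x) x = (D x + W x) / 2"
    and Q0: "\<And>x. Pd (nlin p) (\<lambda>u v. \<Phi> v u) qq x (- x) = (W x - D x) / 2"
    and ae: "AE x in lebesgue. \<phi> x = \<phi>0 x" "AE x in lebesgue. W x = \<phi>1 x"
  shows "global_energy_solution p \<phi>0 \<phi>1 (\<lambda>t x. \<Phi> (t - x) (t + x))"
proof -
  interpret finite_energy "nlin p" "npot p" \<Phi> pp qq by (rule fe)
  have M0: "0 \<le> M" using M[of 0 0] by simp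
  define K where "K = M powr (p - 1) * (p + 1)"
  have K0: "0 \<le> K" using p by (simp add: K_def)
  have K: "(nlin p (\<Phi> u v))\<^sup>2 \<le> K * npot p (\<Phi> u v)" for u v
    unfolding nlin_square[OF p] K_def
    by (intro mult_right_mono powr_mono2 M npot_nonneg[OF p]) (use p in auto)
  note PL = P_L2_curve[OF K K0] and QL = Q_L2_curve[OF K K0]
  have tL: "L2_curve (\<lambda>t x. P (t - x) (t + x) + Q (t - x) (t + x))" by (rule L2_curve_add[OF PL QL])
  have xL: "L2_curve (\<lambda>t x. P (t - x) (t + x) - Q (t - x) (t + x))"
    using L2_curve_add[OF PL L2_curve_cmult[OF QL, of "- 1"]] by simp
  have sc: "continuous_on UNIV (\<lambda>x. \<Phi> (t - x) (t + x))" for t by (intro Phi_cont' continuous_intros)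
  have "Ct_Lq (p + 1) (\<lambda>t x. \<Phi> (t - x) (t + x))"
  proof (rule Ct_LqI)
    show "(\<lambda>x. \<Phi> (t - x) (t + x)) \<in> borel_measurable borel" for t by (rule borel_measurable_continuous_onI[OF sc])
    have "integrable lborel (\<lambda>x. (p + 1) * npot p (\<Phi> (t - x) (t + x)))" for t
      using potential_integrable by (rule integrable_mult_right)
    then show "integrable lborel (\<lambda>x. \<bar>\<Phi> (t - x) (t + x)\<bar> powr (p + 1))" for t
      using p by (simp add: npot_def)
    show "((\<lambda>t. \<integral>x. \<bar>\<Phi> (t - x) (t + x) - \<Phi> (s - x) (s + x)\<bar> powr (p + 1) \<partial>lborel) \<longlongrightarrow> 0) (at s)" for s
    proof (rule quadratic_tendsto_0)
      fix t
      let ?d = "\<lambda>x. \<Phi> (t - x) (t + x) - \<Phi> (s - x) (s + x)"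
      let ?c = "(2 * M) powr (p - 1)"
      \<comment> \<open>Interpolation with the supremum bound: \<open>p - 1\<close> powers of the
        increment are estimated by \<open>2 * M\<close>, and the remaining square has an integral of
        order \<open>(t - s)\<^sup>2\<close>.\<close>
      have le: "\<bar>?d x\<bar> powr (p + 1) \<le> ?c * (?d x)\<^sup>2" for x
      proof -
        have "\<bar>?d x\<bar> \<le> 2 * M" using M[of "t - x" "t + x"] M[of "s - x" "s + x"] by linarith
        then show ?thesis unfolding abs_powr_split[OF p] using p by (intro mult_right_mono powr_mono2) auto
      qed
      have i: "integrable lborel (\<lambda>x. ?c * (?d x)\<^sup>2)"
        using Phi_time_increment_L2(1) by (rule integrable_mult_right)
      have "continuous_on UNIV ?d" by (rule continuous_on_diff[OF sc sc])
      then have [measurable]: "?d \<in> borel_measurable borel" by (rule borel_measurable_continuous_onI)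
      have i2: "integrable lborel (\<lambda>x. \<bar>?d x\<bar> powr (p + 1))"
        by (rule Bochner_Integration.integrable_bound[OF i]) (use le in \<open>auto simp: abs_of_nonneg\<close>)
      have "(\<integral>x. \<bar>?d x\<bar> powr (p + 1) \<partial>lborel) \<le> (\<integral>x. ?c * (?d x)\<^sup>2 \<partial>lborel)" by (rule integral_mono[OF i2 i le])
      also have "\<dots> = ?c * (\<integral>x. (?d x)\<^sup>2 \<partial>lborel)" by (rule integral_mult_right_zero)
      also have "\<dots> \<le> ?c * ((2 * (EP + EQ)) * (t - s)\<^sup>2)"
        by (intro mult_left_mono Phi_time_increment_L2(2)) simp
      finally show "(\<integral>x. \<bar>?d x\<bar> powr (p + 1) \<partial>lborel) \<le> (?c * (2 * (EP + EQ))) * (t - s)\<^sup>2" by (simp only: mult.assoc)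
    qed simp
  qed (use p in simp)
  moreover have "AE x in lebesgue. \<Phi> (0 - x) (0 + x) = \<phi>0 x" using ae(1) by (simp add: \<phi>)
  moreover have "AE x in lebesgue. P (0 - x) (0 + x) + Q (0 - x) (0 + x) = \<phi>1 x"
  proof -
    have "P (0 - x) (0 + x) + Q (0 - x) (0 + x) = W x" for x using P0[of x] Q0[of x] by simp
    then show ?thesis using ae(2) by simp
  qed
  moreover have "nlw_distributional p (\<lambda>t x. \<Phi> (t - x) (t + x))"
    using characteristic_weak_partials(3) unfolding nlw_distributional_def nlin_def by blast
  moreover have "continuous_on UNIV (\<lambda>(t, x). \<Phi> (t - x) (t + x))"
    unfolding case_prod_unfold by (intro Phi_cont' continuous_intros)
  ultimately show ?thesis
    unfolding global_energy_solution_def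
    using characteristic_weak_partials(1,2) L2_curve_Ct[OF tL] L2_curve_Ct[OF xL] by blast
qed

lemma Linf_norm_tendsto_0:
  assumes m: "\<And>t. U t \<in> borel_measurable lebesgue" and l: "\<And>e. e > 0 \<Longrightarrow> \<forall>\<^sub>F t in F. \<forall>x. \<bar>U t x\<bar> \<le> e"
  shows "((\<lambda>t. Linf_norm (U t)) \<longlongrightarrow> 0) F"
proof (rule order_tendstoI)
  have nn: "0 \<le> Linf_norm (U t)" for t
  proof -
    have "AE x in lebesgue. ereal \<bar>U t x\<bar> \<le> Linf_norm (U t)"
      unfolding Linf_norm_def by (rule esssup_AE)
    \<comment> \<open>The line is not a null set, so the essential bound holds at some point, which
      makes the norm nonnegative.\<close>
    moreover have "ae_filter lebesgue \<noteq> (bot :: real filter)" by (simp add: ae_filter_eq_bot_iff)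
    ultimately obtain x where "ereal \<bar>U t x\<bar> \<le> Linf_norm (U t)" using eventually_happens' by blast
    then show ?thesis by (rule order_trans[rotated]) simp
  qed
  show "\<forall>\<^sub>F t in F. c < Linf_norm (U t)" if "c < 0" for c
    by (intro always_eventually allI) (rule less_le_trans[OF that nn])
  show "\<forall>\<^sub>F t in F. Linf_norm (U t) < c" if c: "0 < c" for c
  proof -
    obtain e where e: "0 < e" "ereal e < c" using ereal_dense2[OF c] by auto
    have le: "Linf_norm (U t) \<le> ereal e" if "\<forall>x. \<bar>U t x\<bar> \<le> e" for t
      unfolding Linf_norm_def by (rule esssup_I) (use m that in auto)
    show ?thesis
      by (rule eventually_mono[OF l[OF e(1)]]) (rule le_less_trans[OF le e(2)])
  qed
qed

lemma characteristic_decay: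
  assumes p: "p > 1" and fe: "finite_energy (nlin p) (npot p) \<Phi> pp qq" and M: "\<And>u v. \<bar>\<Phi> u v\<bar> \<le> M"
  shows "((\<lambda>t. Lq_norm (p + 1) (\<lambda>x. \<Phi> (t - x) (t + x))) \<longlongrightarrow> 0) at_top"
    and "((\<lambda>t. Linf_norm (\<lambda>x. \<Phi> (t - x) (t + x))) \<longlongrightarrow> 0) at_top"
proof -
  interpret finite_energy "nlin p" "npot p" \<Phi> pp qq by (rule fe)
  have lim: "((\<lambda>T. \<integral>x. npot p (\<Phi> (T - x) (T + x)) \<partial>lborel) \<longlongrightarrow> 0) at_top"
    by (rule potential_decay[OF M npot_hom[OF p]]) (use p in simp)
  have "continuous_on UNIV (\<lambda>x. \<Phi> (t - x) (t + x))" for t by (intro Phi_cont' continuous_intros)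
  then have m [measurable]: "(\<lambda>x. \<Phi> (t - x) (t + x)) \<in> borel_measurable borel" for t by (rule borel_measurable_continuous_onI)
  have e: "Lq_norm (p + 1) (\<lambda>x. \<Phi> (t - x) (t + x)) = ((p + 1) * (\<integral>x. npot p (\<Phi> (t - x) (t + x)) \<partial>lborel)) powr (1 / (p + 1))" for t
  proof -
    have "(\<integral>x. \<bar>\<Phi> (t - x) (t + x)\<bar> powr (p + 1) \<partial>lborel) = (\<integral>x. (p + 1) * npot p (\<Phi> (t - x) (t + x)) \<partial>lborel)"
      using p by (simp add: npot_def)
    also have "\<dots> = (p + 1) * (\<integral>x. npot p (\<Phi> (t - x) (t + x)) \<partial>lborel)" by (rule integral_mult_right_zero)
    finally show ?thesis by (simp add: Lq_norm_def integral_completion)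
  qed
  have "((\<lambda>t. ((p + 1) * (\<integral>x. npot p (\<Phi> (t - x) (t + x)) \<partial>lborel)) powr (1 / (p + 1))) \<longlongrightarrow> ((p + 1) * 0) powr (1 / (p + 1))) at_top"
  proof (rule tendsto_powr'[OF tendsto_mult[OF tendsto_const lim] tendsto_const])
    have "0 \<le> (p + 1) * (\<integral>x. npot p (\<Phi> (t - x) (t + x)) \<partial>lborel)" for t
      using p by (intro mult_nonneg_nonneg Bochner_Integration.integral_nonneg npot_nonneg) auto
    then show "(p + 1) * 0 \<noteq> 0 \<or> 0 < 1 / (p + 1) \<and> (\<forall>\<^sub>F t in at_top. 0 \<le> (p + 1) * (\<integral>x. npot p (\<Phi> (t - x) (t + x)) \<partial>lborel))"
      using p by simp
  qed
  then show "((\<lambda>t. Lq_norm (p + 1) (\<lambda>x. \<Phi> (t - x) (t + x))) \<longlongrightarrow> 0) at_top" unfolding e by simp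
  show "((\<lambda>t. Linf_norm (\<lambda>x. \<Phi> (t - x) (t + x))) \<longlongrightarrow> 0) at_top"
  proof (rule Linf_norm_tendsto_0)
    show "(\<lambda>x. \<Phi> (t - x) (t + x)) \<in> borel_measurable lebesgue" for t using m by (simp add: measurable_completion)
    fix \<eta> :: real assume \<eta>: "\<eta> > 0"
    have H: "0 < sqrt EP + sqrt EQ + 1" using EP_nonneg by (simp add: add_nonneg_pos)
    \<comment> \<open>A value above \<open>\<eta>\<close> forces at least this much potential energy
      at any time, so the decay of the latter excludes such values eventually.\<close>
    define c where "c = (\<eta> / (2 * (sqrt EP + sqrt EQ + 1)))\<^sup>2 * npot p (\<eta> / 2)"
    have "npot p (\<eta> / 2) > 0" using p \<eta> by (simp add: npot_def)
    then have c: "c > 0" unfolding c_def using \<eta> H by (intro mult_pos_pos zero_less_power divide_pos_pos) auto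
    have "\<bar>\<Phi> (t - x) (t + x)\<bar> \<le> \<eta>" if "(\<integral>x. npot p (\<Phi> (t - x) (t + x)) \<partial>lborel) < c" for t x
    proof (rule ccontr)
      assume "\<not> ?thesis"
      then have "c \<le> (\<integral>x. npot p (\<Phi> (t - x) (t + x)) \<partial>lborel)"
        unfolding c_def by (intro potential_lower_bound[where x = x]) (use \<eta> npot_mono[OF p] in auto)
      with that show False by simp
    qed
    then show "\<forall>\<^sub>F t in at_top. \<forall>x. \<bar>\<Phi> (t - x) (t + x)\<bar> \<le> \<eta>"
      using order_tendstoD(2)[OF lim c] by (auto elim: eventually_mono)
  qed
qed

theorem theorem1:
  fixes p :: real and \<phi>0 \<phi>1 :: "real \<Rightarrow> real"
  assumes "p > 1"
    and "finite_energy_data p \<phi>0 \<phi>1"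
  shows "(\<exists>!\<phi>. global_energy_solution p \<phi>0 \<phi>1 \<phi>) \<and>
    (\<forall>\<phi>. global_energy_solution p \<phi>0 \<phi>1 \<phi> \<longrightarrow>
       ((\<lambda>t. Lq_norm (p + 1) (\<phi> t)) \<longlongrightarrow> 0) at_top \<and>
       ((\<lambda>t. Linf_norm (\<phi> t)) \<longlongrightarrow> 0) at_top)"
proof -
  have m1: "\<phi>1 \<in> borel_measurable lebesgue" using assms(2) by (simp add: finite_energy_data_def)
  show ?thesis
  proof (rule finite_energy_data_AC[OF assms])
    fix \<phi> D W
    assume data: "D \<in> borel_measurable borel" "W \<in> borel_measurable borel"
        "integrable lborel (\<lambda>x. (D x)\<^sup>2)" "integrable lborel (\<lambda>x. (W x)\<^sup>2)"
        "\<And>a b. a \<le> b \<Longrightarrow> \<phi> b - \<phi> a = (LBINT x:{a..b}. D x)" "integrable lborel (\<lambda>x. npot p (\<phi> x))"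
      and ae: "AE x in lebesgue. \<phi> x = \<phi>0 x" "AE x in lebesgue. W x = \<phi>1 x"
    show ?thesis
    proof (rule characteristic_solution_exists[OF assms(1) data])
      fix \<Phi> pp qq M
      assume fe: "finite_energy (nlin p) (npot p) \<Phi> pp qq" and M: "\<And>u v. \<bar>\<Phi> u v\<bar> \<le> M"
        and init: "\<And>x. \<Phi> (- x) x = \<phi> x" "\<And>x. Pd (nlin p) \<Phi> pp (- x) x = (D x + W x) / 2"
          "\<And>x. Pd (nlin p) (\<lambda>u v. \<Phi> v u) qq x (- x) = (W x - D x) / 2"
      let ?\<phi> = "\<lambda>t x. \<Phi> (t - x) (t + x)"
      have sol: "global_energy_solution p \<phi>0 \<phi>1 ?\<phi>"
        by (rule characteristic_energy_solution[OF assms(1) fe M init ae])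
      have uniq: "g = ?\<phi>" if "global_energy_solution p \<phi>0 \<phi>1 g" for g
        by (rule energy_solution_unique[OF assms(1) m1 that sol])
      show ?thesis
      proof (intro conjI allI impI)
        show "\<exists>!\<phi>. global_energy_solution p \<phi>0 \<phi>1 \<phi>"
          by (rule ex1I[where a = ?\<phi>]) (rule sol, rule uniq)
        \<comment> \<open>Decay is established for the constructed solution; uniqueness passes it on
          to an arbitrary one.\<close>
        fix g assume g: "global_energy_solution p \<phi>0 \<phi>1 g"
        show "((\<lambda>t. Lq_norm (p + 1) (g t)) \<longlongrightarrow> 0) at_top"
          unfolding uniq[OF g] by (rule characteristic_decay(1)[OF assms(1) fe M])
        show "((\<lambda>t. Linf_norm (g t)) \<longlongrightarrow> 0) at_top"
          unfolding uniq[OF g] by (rule characteristic_decay(2)[OF assms(1) fe M])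
      qed
    qed
  qed
qed

end
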